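(* Let $n\ge1$, let $\mu_0,\mu_1$ be $1$-strongly log-concave probability measures on $\mathbb{R}^n$, and let $(\mu_t)_{0\le t\le1}$ be their constant-speed quadratic Wasserstein geodesic. Let $b_\mu=\int x\,\mathrm d\mu$ denote the barycenter of $\mu$, set $$W_{\rm c}^2=W_2^2(\mu_0,\mu_1)-|b_{\mu_1}-b_{\mu_0}|^2,\qquad \mathcal D_t=\operatorname{Ent}_\gamma(\mu_t)-\tfrac12|b_{\mu_t}|^2 .$$ Then $0\le W_{\rm c}^2\le 2n$ and, with $W_{\rm c}\ge 0$ and $\omega=\sqrt{2/n}\,W_{\rm c}$, for every $t\in[0,1]$, $$e^{-\mathcal D_t/n}\ \ge\ \frac{\sin((1-t)\omega)}{\sin\omega}\,e^{-\mathcal D_0/n}+\frac{\sin(t\omega)}{\sin\omega}\,e^{-\mathcal D_1/n},\qquad ( * )$$ where the sine quotients are understood by continuity when $\omega=0$ (equal to $1-t$ and $t$, respectively). Moreover, equality in $( * )$ at some $t\in(0,1)$ holds if and only if $\mu_1$ is a translate of $\mu_0$; in this case equality holds for every $t\in[0,1]$. In particular, if $b_{\mu_0}=b_{\mu_1}$, then the same statements hold with $\operatorname{Ent}_\gamma(\mu_t)$ in place of $\mathcal D_t$ (for every $t\in[0,1]$) and $W_2(\mu_0,\mu_1)$ in place of $W_{\rm c}$; in this case, equality at an interior time $t\in(0,1)$ holds if and only if $\mu_0=\mu_1$.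
   Context: A probability measure $\mu$ on $\mathbb{R}^n$ is $1$-strongly log-concave if $\mathrm d\mu=e^{-V}\,\mathrm dx$ with $V:\mathbb{R}^n\to(-\infty,+\infty]$ proper and lower semicontinuous and $V-|x|^2/2$ convex. $W_2$ is the quadratic Wasserstein distance. Geodesic: let $T$ be the Brenier map, i.e. the ($\mu_0$-a.e. unique) optimal transport map from $\mu_0$ to $\mu_1$ for the cost $|x-y|^2$; then $\mu_t=((1-t)I+tT)_\#\mu_0$, $t\in[0,1]$, $I$ the identity map. $\gamma$ is the standard Gaussian measure on $\mathbb{R}^n$. Relative entropy: $\operatorname{Ent}_\gamma(\mu)=\int\rho\log\rho\,\mathrm d\gamma$ if $\mathrm d\mu=\rho\,\mathrm d\gamma$ (with $0\log0=0$), and $+\infty$ otherwise. *)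

theory Defs
  imports "HOL-Probability.Probability"
begin

definition eexp :: "ereal \<Rightarrow> ereal" where
  "eexp x = (case x of ereal r \<Rightarrow> ereal (exp r) | PInfty \<Rightarrow> \<infinity> | MInfty \<Rightarrow> 0)"

definition proper_fun :: "('a \<Rightarrow> ereal) \<Rightarrow> bool" where
  "proper_fun V \<longleftrightarrow> (\<forall>x. V x \<noteq> -\<infinity>) \<and> (\<exists>x. V x \<noteq> \<infinity>)"

definition lower_semicont :: "('a::topological_space \<Rightarrow> ereal) \<Rightarrow> bool" where
  "lower_semicont V \<longleftrightarrow> (\<forall>a. open {x. a < V x})"

text \<open>Only used for functions that never take the value \<open>-\<infinity>\<close>, so that no sum
  \<open>\<infinity> + (-\<infinity>)\<close> occurs; \<open>0 * \<infinity> = 0\<close> makes the endpoints \<open>u = 0, 1\<close> harmless.\<close>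

definition ereal_convex :: "('a::real_vector \<Rightarrow> ereal) \<Rightarrow> bool" where
  "ereal_convex f \<longleftrightarrow> (\<forall>x y. \<forall>u\<in>{0..1::real}.
     f ((1 - u) *\<^sub>R x + u *\<^sub>R y) \<le> ereal (1 - u) * f x + ereal u * f y)"

definition strongly_log_concave :: "'a::euclidean_space measure \<Rightarrow> bool" where
  "strongly_log_concave \<mu> \<longleftrightarrow> prob_space \<mu> \<and>
     (\<exists>V. proper_fun V \<and> lower_semicont V \<and>
          ereal_convex (\<lambda>x. V x - ereal ((norm x)\<^sup>2 / 2)) \<and>
          \<mu> = density lborel (\<lambda>x. e2ennreal (eexp (- V x))))"

definition barycenter :: "'a::euclidean_space measure \<Rightarrow> 'a" where
  "barycenter \<mu> = (\<integral>x. x \<partial>\<mu>)"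

definition couplings :: "'a::euclidean_space measure \<Rightarrow> 'a measure \<Rightarrow> ('a \<times> 'a) measure set" where
  "couplings \<mu> \<nu> = {\<pi>. sets \<pi> = sets borel \<and> distr \<pi> borel fst = \<mu> \<and> distr \<pi> borel snd = \<nu>}"

definition W2_sq :: "'a::euclidean_space measure \<Rightarrow> 'a measure \<Rightarrow> ennreal" where
  "W2_sq \<mu> \<nu> = (INF \<pi>\<in>couplings \<mu> \<nu>. \<integral>\<^sup>+z. ennreal ((dist (fst z) (snd z))\<^sup>2) \<partial>\<pi>)"

text \<open>Meaningful only when \<^term>\<open>W2_sq \<mu> \<nu>\<close> is finite.\<close>

definition W2 :: "'a::euclidean_space measure \<Rightarrow> 'a measure \<Rightarrow> real" where
  "W2 \<mu> \<nu> = sqrt (enn2real (W2_sq \<mu> \<nu>))"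

definition optimal_map :: "'a::euclidean_space measure \<Rightarrow> 'a measure \<Rightarrow> ('a \<Rightarrow> 'a) \<Rightarrow> bool" where
  "optimal_map \<mu> \<nu> T \<longleftrightarrow> T \<in> borel_measurable borel \<and> distr \<mu> borel T = \<nu> \<and>
     (\<integral>\<^sup>+x. ennreal ((dist x (T x))\<^sup>2) \<partial>\<mu>) = W2_sq \<mu> \<nu>"

definition W2_geodesic ::
  "'a::euclidean_space measure \<Rightarrow> 'a measure \<Rightarrow> (real \<Rightarrow> 'a measure) \<Rightarrow> bool" where
  "W2_geodesic \<mu>\<^sub>0 \<mu>\<^sub>1 \<mu> \<longleftrightarrow> (\<exists>T. optimal_map \<mu>\<^sub>0 \<mu>\<^sub>1 T \<and>
     (\<forall>t\<in>{0..1}. \<mu> t = distr \<mu>\<^sub>0 borel (\<lambda>x. (1 - t) *\<^sub>R x + t *\<^sub>R T x)))"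

definition std_gaussian :: "'a::euclidean_space measure" where
  "std_gaussian = density lborel
     (\<lambda>x. ennreal ((2 * pi) powr (- real DIM('a) / 2) * exp (- (norm x)\<^sup>2 / 2)))"

text \<open>The integral of \<open>\<rho> log \<rho>\<close> is taken as the difference of the integrals of its positive and
  negative parts, hence is \<open>\<infinity>\<close> when the positive part is not integrable. The negative part is
  bounded by \<open>1/e\<close>, so no difference \<open>\<infinity> - \<infinity>\<close> arises for a finite reference measure.
  Note \<open>ln 0 = 0\<close>.\<close>

definition rel_entropy :: "'a measure \<Rightarrow> 'a measure \<Rightarrow> ereal" where
  "rel_entropy \<gamma> \<mu> =
     (if \<exists>\<rho>\<in>borel_measurable \<gamma>. \<mu> = density \<gamma> \<rho> then
        let \<rho> = (\<lambda>x. enn2real (RN_deriv \<gamma> \<mu> x)) in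
          enn2ereal (\<integral>\<^sup>+x. ennreal (\<rho> x * ln (\<rho> x)) \<partial>\<gamma>)
        - enn2ereal (\<integral>\<^sup>+x. ennreal (- (\<rho> x * ln (\<rho> x))) \<partial>\<gamma>)
      else \<infinity>)"

abbreviation Ent :: "'a::euclidean_space measure \<Rightarrow> ereal" where
  "Ent \<equiv> rel_entropy std_gaussian"

definition centered_W2_sq :: "'a::euclidean_space measure \<Rightarrow> 'a measure \<Rightarrow> ereal" where
  "centered_W2_sq \<mu> \<nu> = enn2ereal (W2_sq \<mu> \<nu>) - ereal ((norm (barycenter \<nu> - barycenter \<mu>))\<^sup>2)"

definition centered_Ent :: "'a::euclidean_space measure \<Rightarrow> ereal" where
  "centered_Ent \<mu> = Ent \<mu> - ereal ((norm (barycenter \<mu>))\<^sup>2 / 2)"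

definition sin_quotient :: "real \<Rightarrow> real \<Rightarrow> real" where
  "sin_quotient \<omega> s = (if \<omega> = 0 then s else sin (s * \<omega>) / sin \<omega>)"

definition sin_interp :: "real \<Rightarrow> real \<Rightarrow> ereal \<Rightarrow> ereal \<Rightarrow> ereal" where
  "sin_interp \<omega> t a b = ereal (sin_quotient \<omega> (1 - t)) * a + ereal (sin_quotient \<omega> t) * b"

definition translate_of :: "'a::euclidean_space measure \<Rightarrow> 'a measure \<Rightarrow> bool" where
  "translate_of \<nu> \<mu> \<longleftrightarrow> (\<exists>v. \<nu> = distr \<mu> borel (\<lambda>x. x + v))"

end

theory Submission imports Defs "HOL-Complex_Analysis.Great_Picard" begin

text \<open>
 Fix an interior time \<open>t\<close>, let \<open>v\<close> be the velocity of the geodesic at time \<open>t\<close> and \<open>A\<close> its derivative, which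
 exists almost everywhere by Rademacher's theorem. With respect to \<open>mu\<^sub>t\<close> put \<open>W = Var v\<close> (the squared centered
 distance), \<open>Z = Var z\<close>, \<open>C = Cov (z, v)\<close>, \<open>Q = \<integral> norm A ^ 2\<close> and \<open>S = \<integral> tr A\<close>. The Jacobian of \<open>z + d v(z)\<close> gives
 \<open>D' = C - S\<close> and \<open>D'' \<ge> Q + W\<close> for the centered entropy \<open>D\<close>.

 The maps \<open>X\<close>, \<open>Y\<close> from \<open>mu\<^sub>t\<close> to the two endpoints have \<open>1\<close>-strongly log-concave images. Transporting between two
 perturbations of \<open>mu\<^sub>t\<close> so that both endpoint costs are controlled gives a transport-entropy inequality with cost
 \<open>(1 - t) \<bar>X - X'\<bar>^2 + t \<bar>Y - Y'\<bar>^2 = \<bar>z - z'\<bar>^2 + t (1 - t) \<bar>v - v'\<bar>^2\<close>; its linearisation is the Poincare inequality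
 for \<open>mu\<^sub>t\<close>, strict for the components of \<open>v\<close>. Applied to \<open>v \<bullet> e + l (z \<bullet> e)\<close>, summed over the basis vectors \<open>e\<close> and
 optimised over \<open>l\<close>, it yields \<open>(S - C)^2 <= (Q - W) (n - Z)\<close> and \<open>W < Q\<close> if \<open>W > 0\<close>. Since \<open>Z > 0\<close>, this makes
 \<open>exp (- D / n)\<close> a strict supersolution of \<open>y'' + (2 W / n) y = 0\<close>, and the comparison with sines is strict. If
 \<open>W = 0\<close>, then \<open>v\<close> is constant and the geodesic consists of translates of \<open>mu\<^sub>0\<close>, along which \<open>D\<close> is constant.\<close>

text \<open>Strong log-concavity is at hand only at the endpoints; nothing of the kind is claimed
  for the interpolants, so their Poincare inequality has to be pulled back through \<open>X\<close>
  and \<open>Y\<close>. A plan that is cheap for one endpoint says nothing about the other. The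
  remedy is to match the \<open>Y\<close>-image of one perturbation with the \<open>X\<close>-image
  of the other: the gradient that does this bounds the first endpoint cost, its inverse the second,
  and both belong to one transport map. The surplus \<open>t (1 - t)\<close> times the squared
  velocity difference in the cost is what makes the inequality strict for the components of the
  velocity. The second obstacle is regularity. Densities may vanish, supports may be unbounded and
  the transport map is only measurable. Hence Brenier maps are built on balls, the potentials are
  glued by a lower limit, derivatives live on a Borel set \<open>G\<close> of full measure, and the
  entropy is never differentiated twice: first-order bounds and symmetric second differences at a
  maximum suffice for the comparison with sines.\<close>

abbreviation BM :: "('a::topological_space => 'b::topological_space) set" where "BM \<equiv> borel_measurable borel"

abbreviation dens :: "('a::euclidean_space => real) => 'a measure" where "dens f \<equiv> density lborel (\<lambda>x. ennreal (f x))"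

subsection \<open>Rademacher and Alexandrov theorems\<close>

abbreviation straddle :: "real => real => real => real => bool" where
 "straddle d x u v \<equiv> u < v & u <= x & x <= v & v - u < d"

text \<open>A closed interval is a closed ball of the real line, so the Vitali covering theorem for
  balls applies; the intervals around a point of \<open>E\<close> can be taken short enough to stay
  inside \<open>U\<close>.\<close>

lemma vitali_intervals:
 fixes E :: "real set"
 assumes U: "open U" "E \<subseteq> U"
  and fine: "!!x d. x \<in> E ==> 0 < d ==> \<exists>u v. straddle d x u v & P u v"
 obtains \<I> where "countable \<I>" "!!u v. (u, v) \<in> \<I> ==> u < v & P u v & {u..v} \<subseteq> U"
  "disjoint_family_on (\<lambda>(u, v). {u..v}) \<I>" "negligible (E - (\<Union>(u,v)\<in>\<I>. {u..v}))"
proof -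
 define K where "K = {(u, v). u < v & P u v & {u..v} \<subseteq> U}"
 define a where "a = (\<lambda>(u, v). (u + v) / 2 :: real)"
 define r where "r = (\<lambda>(u, v). (v - u) / 2 :: real)"
 have cb: "cball (a i) (r i) = (case i of (u, v) => {u..v})" for i
  by (cases i) (auto simp: a_def r_def cball_eq_atLeastAtMost field_simps)
 obtain C where C: "countable C" "C \<subseteq> K"
   "pairwise (\<lambda>i j. disjnt (cball (a i) (r i)) (cball (a j) (r j))) C"
   "negligible (E - (\<Union>i \<in> C. cball (a i) (r i)))"
 proof (rule Vitali_covering_theorem_cballs[of K r E a])
  show "0 < r i" if "i \<in> K" for i using that by (auto simp: K_def r_def)
  fix x d :: real assume x: "x \<in> E" "0 < d"
  obtain e where e: "e > 0" "ball x e \<subseteq> U" using U x by (meson openE subsetD)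
  obtain u v where uv: "u < v" "u <= x" "x <= v" "v - u < min d e" "P u v"
   using fine[OF x(1), of "min d e"] e x by auto
  have "{u..v} \<subseteq> ball x e" using uv by (auto simp: dist_real_def)
  then have "(u, v) \<in> K" using uv e by (auto simp: K_def)
  moreover have "x \<in> cball (a (u,v)) (r (u,v))" using uv by (auto simp: cb)
  moreover have "r (u,v) < d" using uv by (auto simp: r_def)
  ultimately show "\<exists>i. i \<in> K & x \<in> cball (a i) (r i) & r i < d" by blast
 qed blast
 show ?thesis
 proof (rule that[of C])
  show "countable C" by fact
  show "u < v & P u v & {u..v} \<subseteq> U" if "(u, v) \<in> C" for u v
   using that C(2) by (auto simp: K_def)
  show "disjoint_family_on (\<lambda>(u, v). {u..v}) C"
   using C(3) unfolding disjoint_family_on_def pairwise_def cb disjnt_def by auto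
  show "negligible (E - (\<Union>(u, v)\<in>C. {u..v}))" using C(4) unfolding cb .
 qed
qed

lemma null_sets_lebesgue_cover:
 assumes "negligible N"
 obtains N' where "N' \<in> null_sets lborel" "N \<subseteq> N'"
 using assms unfolding negligible_iff_null_sets
 by (metis null_sets_completion_iff2)

text \<open>Compare the Stieltjes measure \<open>nu\<close> of \<open>f\<close> with Lebesgue
  measure. Disjoint intervals of slope at most \<open>a\<close> cover almost all of
  \<open>E\<close>, and inside them intervals of slope at least \<open>b\<close> do so again. The
  total length of the second family is at most \<open>a / b\<close> times the measure of the
  surrounding open set, and iteration makes the outer measure of \<open>E\<close> arbitrarily
  small.\<close>

lemma negligible_slope_gap:
 fixes f :: "real => real" and a b :: real
 assumes mono: "!!x y. x <= y ==> f x <= f y" and cont: "continuous_on UNIV f"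
  and ab: "0 < a" "a < b" and bE: "bounded E"
  and lo: "!!x d. x \<in> E ==> 0 < d ==> \<exists>u v. straddle d x u v & f v - f u <= a * (v - u)"
  and hi: "!!x d. x \<in> E ==> 0 < d ==> \<exists>u v. straddle d x u v & b * (v - u) <= f v - f u"
 shows "negligible E"
proof -
 define nu where "nu = interval_measure f"
 have sets_nu[simp, measurable_cong]: "sets nu = sets borel" by (simp add: nu_def)
 have nuIcc: "emeasure nu {u..v} = ennreal (f v - f u)" if "u <= v" for u v
  unfolding nu_def using that mono cont
  by (intro emeasure_interval_measure_Icc) (auto simp: continuous_on_eq_continuous_within)
 have nusum: "emeasure nu (\<Union>(u,v)\<in>\<I>. {u..v}) = (\<integral>\<^sup>+(u,v). emeasure nu {u..v} \<partial>count_space \<I>)"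
  and lsum: "emeasure lborel (\<Union>(u,v)\<in>\<I>. {u..v}) = (\<integral>\<^sup>+(u,v). emeasure lborel {u..v} \<partial>count_space \<I>)"
  and bor: "(\<Union>(u,v)\<in>\<I>. {u..v}) \<in> sets borel"
  if "countable \<I>" "disjoint_family_on (\<lambda>(u, v). {u..v}) \<I>" for \<I> :: "(real \<times> real) set"
 proof -
  show "emeasure nu (\<Union>(u,v)\<in>\<I>. {u..v}) = (\<integral>\<^sup>+(u,v). emeasure nu {u..v} \<partial>count_space \<I>)"
   using that by (subst emeasure_UN_countable) (auto simp: case_prod_unfold)
  show "emeasure lborel (\<Union>(u,v)\<in>\<I>. {u..v}) = (\<integral>\<^sup>+(u,v). emeasure lborel {u..v} \<partial>count_space \<I>)"
   using that by (subst emeasure_UN_countable) (auto simp: case_prod_unfold)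
  show "(\<Union>(u,v)\<in>\<I>. {u..v}) \<in> sets borel" using that(1) by (auto simp: split_beta)
 qed
 \<comment> \<open>\<open>th\<close> is the midpoint of \<open>a / b\<close> and \<open>1\<close>;
   the gap \<open>th - a / b\<close> pays for enlarging the second covering to an open set.\<close>
 define th where "th = (a + b) / (2 * b)"
 have th: "0 < th" "th < 1" "a / b < th" using ab by (auto simp: th_def field_simps)
 have step: "\<exists>T. open T & E \<subseteq> T & emeasure lborel T <= ennreal (th * m)"
  if T: "open U" "E \<subseteq> U" "emeasure lborel U <= ennreal m" and m: "m > 0" for U m
 proof -
  obtain \<I> where I: "countable \<I>" "!!u v. (u, v) \<in> \<I> ==> u < v & f v - f u <= a * (v - u) & {u..v} \<subseteq> U"
    "disjoint_family_on (\<lambda>(u, v). {u..v}) \<I>" "negligible (E - (\<Union>(u,v)\<in>\<I>. {u..v}))"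
   using vitali_intervals[OF T(1,2), of "\<lambda>u v. f v - f u <= a * (v - u)"] lo by metis
  define G where "G = (\<Union>(u,v)\<in>\<I>. {u..v})"
  define W where "W = (\<Union>(u,v)\<in>\<I>. {u<..<v})"
  have WG: "W \<subseteq> G" unfolding W_def G_def by (intro UN_mono) auto
  have oW: "open W" by (auto simp: W_def split_beta)
  \<comment> \<open>The second family needs an open set to live in, so the closed intervals are
    replaced by their interiors; only countably many endpoints are lost.\<close>
  have GW: "negligible (G - W)"
  proof (rule negligible_subset)
   show "negligible (fst ` \<I> \<union> snd ` \<I>)" using I(1) by (auto intro!: null_sets_completionI countable_imp_null_set_lborel simp: negligible_iff_null_sets simp del: null_sets.Un)
   show "G - W \<subseteq> fst ` \<I> \<union> snd ` \<I>" unfolding G_def W_def by force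
  qed
  obtain \<J> where J: "countable \<J>" "!!u v. (u, v) \<in> \<J> ==> u < v & b * (v - u) <= f v - f u & {u..v} \<subseteq> W"
    "disjoint_family_on (\<lambda>(u, v). {u..v}) \<J>" "negligible ((E \<inter> W) - (\<Union>(u,v)\<in>\<J>. {u..v}))"
   using vitali_intervals[OF oW, of "E \<inter> W" "\<lambda>u v. b * (v - u) <= f v - f u"] hi by (metis Int_iff inf_le2)
  define H where "H = (\<Union>(u,v)\<in>\<J>. {u..v})"
  have HB: "H \<in> sets borel" and GB: "G \<in> sets borel" using bor I(1,3) J(1,3) by (auto simp: H_def G_def)
  have HW: "H \<subseteq> W" using J(2) by (auto simp: H_def)
  have "b * emeasure lborel H = (\<integral>\<^sup>+(u,v). b * emeasure lborel {u..v} \<partial>count_space \<J>)"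
   unfolding H_def lsum[OF J(1,3)] by (simp add: case_prod_unfold nn_integral_cmult)
  also have "... <= (\<integral>\<^sup>+(u,v). emeasure nu {u..v} \<partial>count_space \<J>)"
  proof (rule nn_integral_mono, clarsimp)
   fix u v assume "(u, v) \<in> \<J>"
   from J(2)[OF this] show "ennreal b * emeasure lborel {u..v} <= emeasure nu {u..v}"
    using ab by (auto simp: nuIcc ennreal_mult[symmetric] intro!: ennreal_leI)
  qed
  also have "... = emeasure nu H" unfolding H_def nusum[OF J(1,3)] ..
  also have "... <= emeasure nu G" using HW WG GB by (intro emeasure_mono) auto
  also have "... = (\<integral>\<^sup>+(u,v). emeasure nu {u..v} \<partial>count_space \<I>)" unfolding G_def nusum[OF I(1,3)] ..
  also have "... <= (\<integral>\<^sup>+(u,v). a * emeasure lborel {u..v} \<partial>count_space \<I>)"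
  proof (rule nn_integral_mono, clarsimp)
   fix u v assume "(u, v) \<in> \<I>"
   from I(2)[OF this] show "emeasure nu {u..v} <= ennreal a * emeasure lborel {u..v}"
    using ab by (auto simp: nuIcc ennreal_mult[symmetric] intro!: ennreal_leI)
  qed
  also have "... = a * emeasure lborel G"
   unfolding G_def lsum[OF I(1,3)] by (simp add: case_prod_unfold nn_integral_cmult)
  also have "... <= a * emeasure lborel U"
   using I(2) T(1) by (intro mult_left_mono emeasure_mono) (auto simp: G_def)
  also have "... <= ennreal (a * m)" using T(3) ab m by (simp add: ennreal_mult mult_left_mono)
  finally have bH: "b * emeasure lborel H <= ennreal (a * m)" .
  have Hm: "emeasure lborel H <= ennreal (a / b * m)"
  proof (cases "emeasure lborel H")
   case (real r)
   then have "ennreal (b * r) <= ennreal (a * m)" using bH ab by (simp add: ennreal_mult)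
   then have "b * r <= a * m" using ab m real by (subst (asm) ennreal_le_iff) auto
   then show ?thesis using ab real by (simp add: field_simps ennreal_leI)
  qed (use bH ab in \<open>simp add: ennreal_mult_top top_unique\<close>)
  have "negligible (E - H)"
  proof (rule negligible_subset)
   show "negligible ((E - G) \<union> (G - W) \<union> ((E \<inter> W) - H))"
    using I(4) GW J(4) by (auto simp: G_def H_def)
  qed auto
  then obtain N where N: "N \<in> null_sets lborel" "E - H \<subseteq> N" by (rule null_sets_lebesgue_cover)
  have "0 < ennreal ((th - a / b) * m)" using th m by simp
  then obtain T where T': "open T" "H \<union> N \<subseteq> T" "emeasure lborel (T - (H \<union> N)) < ennreal ((th - a / b) * m)"
   using outer_regular_lborel[of "H \<union> N" "(th - a / b) * m"] HB N th m by (auto simp: null_sets_def)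
  have "emeasure lborel T <= emeasure lborel (H \<union> N) + emeasure lborel (T - (H \<union> N))"
   using T' HB N by (subst plus_emeasure) (auto simp: null_sets_def intro!: emeasure_mono)
  also have "emeasure lborel (H \<union> N) = emeasure lborel H" using N HB by (intro emeasure_Un_null_set) auto
  also have "emeasure lborel H + emeasure lborel (T - (H \<union> N)) <= ennreal (a / b * m) + ennreal ((th - a / b) * m)"
   using Hm T'(3) by (intro add_mono) auto
  also have "... = ennreal (th * m)" proof -
   have "0 <= a / b * m" "0 <= (th - a / b) * m" using th m ab by auto
   then show ?thesis by (subst ennreal_plus[symmetric]) (auto simp: algebra_simps)
  qed
  finally show ?thesis using T' N by (intro exI[of _ T]) auto
 qed
 obtain R where R: "R > 0" "E \<subseteq> ball 0 R" using bE by (metis bounded_subset_ballD)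
 define m0 where "m0 = measure lborel (ball (0::real) R)"
 have m0: "emeasure lborel (ball (0::real) R) = ennreal m0" "m0 > 0"
  using R by (auto simp: m0_def emeasure_eq_measure2 ball_eq_greaterThanLessThan)
 have iter: "\<exists>T. open T & E \<subseteq> T & emeasure lborel T <= ennreal (th ^ k * m0)" for k
 proof (induction k)
  case 0 then show ?case using R m0 by (intro exI[of _ "ball 0 R"]) auto
 next
  case (Suc k) then show ?case using step[of _ "th ^ k * m0"] m0 th by (auto simp: mult.assoc)
 qed
 show ?thesis unfolding negligible_outer
 proof (intro allI impI)
  fix e :: real assume e: "e > 0"
  have "(\<lambda>k. th ^ k * m0) \<longlonglongrightarrow> 0 * m0" using th by (intro tendsto_intros LIMSEQ_realpow_zero) auto
  then have "eventually (\<lambda>k. th ^ k * m0 < e) sequentially" using e by (simp add: order_tendstoD(2))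
  then obtain k where k: "th ^ k * m0 < e" by (auto simp: eventually_sequentially)
  obtain T where T: "open T" "E \<subseteq> T" "emeasure lborel T <= ennreal (th ^ k * m0)" using iter by blast
  then have fin: "emeasure lborel T < \<infinity>" by (simp add: le_less_trans)
  have "T \<in> lmeasurable" using T(1) fin by (simp add: fmeasurable_def)
  moreover have "measure lebesgue T < e"
  proof -
   have "0 <= th ^ k * m0" using m0 th by simp
   then have "measure lborel T <= th ^ k * m0" using T(3) by (simp add: measure_def enn2real_leI)
   then show ?thesis using k T(1) by simp
  qed
  ultimately show "\<exists>T. E \<subseteq> T & T \<in> lmeasurable & measure lebesgue T < e" using T by blast
 qed
qed

text \<open>The bounds keep the lower and upper limits of the difference quotient finite, so without
  a derivative they differ and two rationals fit between them. Rational slopes keep the exceptional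
  family countable.\<close>

lemma nondifferentiable_slope_gap:
 fixes f :: "real => real"
 assumes nd: "\<not> f differentiable (at x)" and bnd: "!!h. h ~= 0 ==> c <= (f (x + h) - f x) / h & (f (x + h) - f x) / h <= C"
 obtains a b where "a \<in> \<rat>" "b \<in> \<rat>" "a < b" "c < a" "\<exists>\<^sub>F h in at 0. (f (x + h) - f x) / h < a" "\<exists>\<^sub>F h in at 0. b < (f (x + h) - f x) / h"
proof -
 define q where "q h = (f (x + h) - f x) / h" for h
 let ?I = "Liminf (at 0) (\<lambda>h. ereal (q h))" and ?S = "Limsup (at 0) (\<lambda>h. ereal (q h))"
 have ev: "eventually (\<lambda>h. c <= q h & q h <= C) (at 0)" unfolding q_def using bnd by (auto simp: eventually_at intro: exI[of _ 1])
 have I: "c <= ?I" "?S <= C" by (auto intro!: Liminf_bounded Limsup_bounded eventually_mono[OF ev])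
 have le: "?I <= ?S" by (rule Liminf_le_Limsup) simp
 have "?I ~= ?S"
 proof
  assume eq: "?I = ?S"
  obtain D where "?S = ereal D" using I unfolding eq by (cases ?S) auto
  then have "((\<lambda>h. ereal (q h)) \<longlongrightarrow> ereal D) (at 0)" using eq by (intro Liminf_eq_Limsup) auto
  then have "(f has_real_derivative D) (at x)" by (simp add: DERIV_def q_def)
  then show False using nd real_differentiable_def by blast
 qed
 then have "?I < ?S" using le by simp
 then obtain a :: rat where a: "?I < real_of_rat a" "real_of_rat a < ?S" using ereal_dense3 by blast
 then obtain b :: rat where b: "real_of_rat a < real_of_rat b" "real_of_rat b < ?S" using ereal_dense3 by (metis ereal_less_le less_ereal.simps(1))
 have fr: "\<exists>\<^sub>F h in at 0. q h < real_of_rat a"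
  unfolding frequently_def not_less using Liminf_bounded[of "ereal (real_of_rat a)" "\<lambda>h. ereal (q h)" "at 0"] a(1) by (auto simp: not_less[symmetric])
 have fr': "\<exists>\<^sub>F h in at 0. real_of_rat b < q h"
  unfolding frequently_def not_less using Limsup_bounded[of "\<lambda>h. ereal (q h)" "ereal (real_of_rat b)" "at 0"] b(2) by (auto simp: not_less[symmetric])
 show thesis
  by (rule that[OF Rats_of_rat Rats_of_rat b(1)[unfolded less_ereal.simps] _ fr[unfolded q_def] fr'[unfolded q_def]])
    (use le_less_trans[OF I(1) a(1)] in simp)
qed

proposition lipschitz_real_differentiable_ae:
 fixes f :: "real => real"
 assumes lip: "!!x y. abs (f x - f y) <= L * abs (x - y)"
 shows "negligible {x. \<not> f differentiable (at x)}"
proof -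
 \<comment> \<open>The linear term does not affect differentiability and moves all difference
   quotients into the interval from \<open>1\<close> to \<open>2 * L + 1\<close>:
   \<open>negligible_slope_gap\<close> asks for an increasing function and positive slopes.\<close>
 define g where "g x = f x + (L + 1) * x" for x
 have bnd: "1 <= (g (x + h) - g x) / h & (g (x + h) - g x) / h <= 2 * L + 1" if "h ~= 0" for x h
 proof -
  have e: "(g (x + h) - g x) / h = (f (x + h) - f x) / h + (L + 1)" using that by (simp add: g_def field_simps)
  have "abs ((f (x + h) - f x) / h) <= L" using lip[of "x + h" x] that by (simp add: pos_divide_le_eq)
  then show ?thesis unfolding e by linarith
 qed
 have mono: "g u <= g v" if "u <= v" for u v using lip[of v u] that unfolding g_def by (auto simp: algebra_simps abs_le_iff)
 have L0: "0 <= L" using lip[of 0 1] by auto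
 then have "L-lipschitz_on UNIV f" using lip by (auto simp: lipschitz_on_def dist_real_def)
 then have cont: "continuous_on UNIV g" unfolding g_def by (intro continuous_intros lipschitz_on_continuous_on)
 define E where "E a b n = {x. abs x <= real n &
  (\<forall>d>0. \<exists>u v. straddle d x u v & g v - g u <= a * (v - u)) &
  (\<forall>d>0. \<exists>u v. straddle d x u v & b * (v - u) <= g v - g u)}" for a b n
 let ?I = "{(a, b, n::nat). a \<in> \<rat> & b \<in> \<rat> & 0 < a & a < b}"
 have negE: "negligible (E a b n)" if "0 < a" "a < b" for a b n
 proof (rule negligible_slope_gap[OF mono cont that])
  show "bounded (E a b n)" by (rule boundedI[of _ "real n"]) (auto simp: E_def)
 qed (auto simp: E_def)
 have "countable ?I" by (rule countable_subset[of _ "\<rat> \<times> \<rat> \<times> UNIV"]) (auto simp: countable_rat)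
 then have "negligible (\<Union>(a,b,n)\<in>?I. E a b n)"
  unfolding negligible_iff_null_sets
  by (rule null_sets_UN') (use negE in \<open>auto simp: negligible_iff_null_sets\<close>)
 moreover have "{x. \<not> f differentiable (at x)} \<subseteq> (\<Union>(a,b,n)\<in>?I. E a b n)"
 proof
  fix x assume "x \<in> {x. \<not> f differentiable (at x)}"
  moreover have "f differentiable (at x)" if "g differentiable (at x)"
  proof -
   have "(\<lambda>x. g x - (L+1) * x) differentiable (at x)" using that by (intro derivative_intros)
   then show ?thesis by (simp add: g_def)
  qed
  ultimately have nd: "\<not> g differentiable (at x)" by blast
  obtain a b where ab: "a \<in> \<rat>" "b \<in> \<rat>" "a < b" "1 < a" and lo: "\<exists>\<^sub>F h in at 0. (g (x + h) - g x) / h < a"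
   and hi: "\<exists>\<^sub>F h in at 0. b < (g (x + h) - g x) / h"
   by (rule nondifferentiable_slope_gap[OF nd bnd])
  have st: "\<exists>u v. straddle d x u v & (g v - g u) / (v - u) = (g (x + h) - g x) / h" if "h ~= 0" "abs h < d" for h d
   using that by (cases "0 < h") (force intro: exI[of _ x] exI[of _ "x + h"] simp: minus_divide_right[symmetric] minus_divide_left)+
  have small: "\<exists>h. h ~= 0 & abs h < d & P h" if "\<exists>\<^sub>F h in at (0::real). P h" "0 < d" for P d
   using that by (auto simp: frequently_def eventually_at dist_real_def)
  have "\<exists>u v. straddle d x u v & g v - g u <= a * (v - u)" if "0 < d" for d
   using small[OF lo that] st[of _ d] by (metis diff_gt_0_iff_gt less_imp_le pos_divide_le_eq)
  moreover have "\<exists>u v. straddle d x u v & b * (v - u) <= g v - g u" if "0 < d" for d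
   using small[OF hi that] st[of _ d] by (metis diff_gt_0_iff_gt less_imp_le pos_le_divide_eq)
  moreover obtain n where "abs x <= real n" using real_arch_simple by blast
  ultimately have "x \<in> E a b n" by (simp add: E_def)
  then show "x \<in> (\<Union>(a,b,n)\<in>?I. E a b n)" using ab by force
 qed
 ultimately show ?thesis by (rule negligible_subset)
qed

definition cutoff :: "'a::metric_space set => nat => 'a => real" where
 "cutoff C k x = max 0 (1 - real k * infdist x C)"

lemma cutoff_bounds: "0 <= cutoff C k x" "cutoff C k x <= 1"
 by (auto simp: cutoff_def infdist_nonneg)

lemma cutoff_continuous: "continuous_on UNIV (cutoff C k)"
 unfolding cutoff_def by (intro continuous_intros)

lemma cutoff_tendsto_indicator:
 assumes "closed C" "C ~= {}"
 shows "(\<lambda>k. cutoff C k x) \<longlonglongrightarrow> indicator C x"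
proof (cases "x \<in> C")
 case True then show ?thesis by (simp add: cutoff_def)
next
 case False
 then have d: "infdist x C > 0" using assms by (simp add: infdist_pos_not_in_closed)
 obtain N where N: "1 < real N * infdist x C" using reals_Archimedean3[OF d] by blast
 have "cutoff C k x = 0" if "k \<ge> N" for k
 proof -
  have "real N * infdist x C <= real k * infdist x C" using that d by (intro mult_right_mono) auto
  then show ?thesis using N by (simp add: cutoff_def)
 qed
 then have "eventually (\<lambda>k. cutoff C k x = indicator C x) sequentially"
  using False by (auto simp: eventually_sequentially)
 then show ?thesis by (rule tendsto_eventually)
qed

text \<open>Cauchy criterion for the difference quotient. The value of the derivative disappears,
  and the outer quantifiers become countable, which is what measurability needs.\<close>

lemma real_derivative_exists_iff:
 fixes g :: "real => real"
 shows "(\<exists>D. (g has_real_derivative D) (at 0)) \<longleftrightarrow> (\<forall>n. \<exists>m. \<forall>s t. 0 < abs s & abs s < 1 / Suc m & 0 < abs t & abs t < 1 / Suc m -->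
   abs ((g s - g 0) / s - (g t - g 0) / t) <= 1 / Suc n)"
proof -
 define q where "q s = (g s - g 0) / s" for s
 have "(\<exists>D. (g has_real_derivative D) (at 0)) \<longleftrightarrow> cauchy_filter (filtermap q (at 0))"
  unfolding DERIV_def q_def[abs_def] filterlim_def
  using complete_UNIV[unfolded complete_uniform, THEN spec, of "filtermap (\<lambda>h. (g h - g 0) / h) (at 0)"]
  by (auto intro: nhds_imp_cauchy_filter simp: filtermap_bot_iff)
 also have "... \<longleftrightarrow> (\<forall>n. \<exists>m. \<forall>s t. 0 < abs s & abs s < 1 / Suc m & 0 < abs t & abs t < 1 / Suc m --> abs (q s - q t) <= 1 / Suc n)"
  unfolding cauchy_filter_metric_filtermap
 proof (intro iffI allI impI)
  fix n assume "\<forall>e>0. \<exists>P. eventually P (at 0) & (\<forall>x y. P x & P y --> dist (q x) (q y) < e)"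
  then obtain P where P: "eventually P (at 0)" "!!x y. P x ==> P y ==> dist (q x) (q y) < 1 / Suc n"
   by (metis of_nat_0_less_iff zero_less_Suc zero_less_divide_1_iff)
  then obtain d where d: "d > 0" "!!s. s ~= 0 ==> abs s < d ==> P s" by (auto simp: eventually_at)
  obtain m where m: "1 / Suc m < d" using nat_approx_posE[OF d(1)] by blast
  show "\<exists>m. \<forall>s t. 0 < abs s & abs s < 1 / Suc m & 0 < abs t & abs t < 1 / Suc m --> abs (q s - q t) <= 1 / Suc n"
   using m P(2)[OF d(2) d(2)] by (intro exI[of _ m]) (auto simp: dist_real_def intro!: less_imp_le)
 next
  fix e :: real
  assume *: "\<forall>n. \<exists>m. \<forall>s t. 0 < abs s & abs s < 1 / Suc m & 0 < abs t & abs t < 1 / Suc m --> abs (q s - q t) <= 1 / Suc n" and "0 < e"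
  then obtain n where n: "1 / Suc n < e" using nat_approx_posE by blast
  obtain m :: nat where M: "!!s t. 0 < abs s & abs s < 1 / Suc m & 0 < abs t & abs t < 1 / Suc m ==> abs (q s - q t) <= 1 / Suc n" using * by blast
  have "eventually (\<lambda>s. 0 < abs s & abs s < 1 / Suc m) (at (0::real))"
   unfolding eventually_at by (intro exI[of _ "1 / Suc m"]) (auto simp: dist_real_def)
  moreover have "dist (q s) (q t) < e" if "0 < abs s & abs s < 1 / Suc m" "0 < abs t & abs t < 1 / Suc m" for s t
   using M[of s t] that n unfolding dist_real_def by linarith
  ultimately show "\<exists>P. eventually P (at 0) & (\<forall>x y. P x & P y --> dist (q x) (q y) < e)" by blast
 qed
 finally show ?thesis by (simp only: q_def)
qed

text \<open>For fixed \<open>s\<close> and \<open>t\<close> the Cauchy condition is closed in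
  \<open>x\<close>, and arbitrary intersections of closed sets are closed. The uncountable
  quantifiers are therefore harmless.\<close>

lemma dir_differentiable_borel:
 fixes f :: "'a::euclidean_space => real"
 assumes cont: "continuous_on UNIV f"
 shows "{x. \<exists>D. ((\<lambda>t. f (x + t *\<^sub>R e)) has_real_derivative D) (at 0)} \<in> sets borel"
proof -
 have [continuous_intros]: "continuous_on UNIV (\<lambda>x. f (x + s *\<^sub>R e))" for s
  by (rule continuous_on_compose2[OF cont]) (auto intro!: continuous_intros)
 have "closed {x. 0 < abs s & abs s < r & 0 < abs t & abs t < r -->
   abs ((f (x + s *\<^sub>R e) - f (x + 0 *\<^sub>R e)) / s - (f (x + t *\<^sub>R e) - f (x + 0 *\<^sub>R e)) / t) <= c}" for s t r c :: real
  unfolding divide_inverse by (intro closed_Collect_imp closed_Collect_le open_Collect_const continuous_intros)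
 then have cl: "{x. \<forall>s t. 0 < abs s & abs s < r & 0 < abs t & abs t < r -->
   abs ((f (x + s *\<^sub>R e) - f (x + 0 *\<^sub>R e)) / s - (f (x + t *\<^sub>R e) - f (x + 0 *\<^sub>R e)) / t) <= c} \<in> sets borel" for r c :: real
  by (intro borel_closed closed_Collect_all)
 have "{x. \<exists>D. ((\<lambda>t. f (x + t *\<^sub>R e)) has_real_derivative D) (at 0)} = (\<Inter>n. \<Union>m. {x. \<forall>s t. 0 < abs s & abs s < 1 / real (Suc m) & 0 < abs t & abs t < 1 / real (Suc m) -->
   abs ((f (x + s *\<^sub>R e) - f (x + 0 *\<^sub>R e)) / s - (f (x + t *\<^sub>R e) - f (x + 0 *\<^sub>R e)) / t) <= 1 / real (Suc n)})"
  unfolding real_derivative_exists_iff by blast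
 also have "... \<in> sets borel" by (intro sets.countable_INT'' sets.countable_UN image_subsetI cl) auto
 finally show ?thesis .
qed

text \<open>By the one-dimensional theorem the exceptional set meets every line in direction
  \<open>e\<close> in a null set of parameters; Fubini does the rest.\<close>

lemma lipschitz_dir_derivative_ae:
 fixes f :: "'a::euclidean_space => real"
 assumes lip: "!!x y. abs (f x - f y) <= L * norm (x - y)" and cont: "continuous_on UNIV f"
 shows "AE x in lborel. \<exists>D. ((\<lambda>t. f (x + t *\<^sub>R e)) has_real_derivative D) (at 0)"
proof -
 define N where "N = - {x. \<exists>D. ((\<lambda>t. f (x + t *\<^sub>R e)) has_real_derivative D) (at 0)}"
 have N[measurable]: "N \<in> sets borel" unfolding N_def using dir_differentiable_borel[OF cont] by auto
 have line: "(\<integral>\<^sup>+s. indicator N (x + s *\<^sub>R e) * indicator {0..1::real} s \<partial>lborel) = 0" for x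
 proof -
  have sub: "{s. x + s *\<^sub>R e \<in> N} \<subseteq> {s. \<not> (\<lambda>t. f (x + t *\<^sub>R e)) differentiable (at s)}"
  proof (clarsimp simp: N_def)
   fix s assume nc: "\<forall>D. \<not> ((\<lambda>t. f (x + s *\<^sub>R e + t *\<^sub>R e)) has_real_derivative D) (at 0)" and "(\<lambda>t. f (x + t *\<^sub>R e)) differentiable at s"
   then obtain D where "((\<lambda>t. f (x + t *\<^sub>R e)) has_real_derivative D) (at s)" using real_differentiableE by blast
   then have "((\<lambda>t. f (x + (t + s) *\<^sub>R e)) has_real_derivative D) (at 0)"
    using DERIV_shift[of "\<lambda>t. f (x + t *\<^sub>R e)" D 0 s] by (simp add: add.commute)
   then have "((\<lambda>t. f ((x + s *\<^sub>R e) + t *\<^sub>R e)) has_real_derivative D) (at 0)" by (simp add: algebra_simps)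
   then show False using nc by blast
  qed
  have "negligible {s. \<not> (\<lambda>t. f (x + t *\<^sub>R e)) differentiable (at s)}"
  proof (rule lipschitz_real_differentiable_ae)
   fix s t :: real
   have "abs (f (x + s *\<^sub>R e) - f (x + t *\<^sub>R e)) <= L * norm ((x + s *\<^sub>R e) - (x + t *\<^sub>R e))" by (rule lip)
   also have "(x + s *\<^sub>R e) - (x + t *\<^sub>R e) = (s - t) *\<^sub>R e" by (simp add: algebra_simps)
   finally show "abs (f (x + s *\<^sub>R e) - f (x + t *\<^sub>R e)) <= (L * norm e) * abs (s - t)" by (simp add: mult_ac)
  qed
  then have "negligible {s. x + s *\<^sub>R e \<in> N}" using sub by (rule negligible_subset)
  then have "{s. x + s *\<^sub>R e \<in> N} \<in> null_sets lborel"
   by (simp add: negligible_iff_null_sets null_sets_completion_iff)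
  then have "AE s in lborel. \<not> (x + s *\<^sub>R e \<in> N)" by (auto dest: AE_not_in)
  then have "AE s in lborel. indicator N (x + s *\<^sub>R e) * indicator {0..1::real} s = (0::ennreal)" by eventually_elim auto
  then show ?thesis by (subst nn_integral_0_iff_AE) auto
 qed
 \<comment> \<open>Instead of splitting off a coordinate, the set is averaged over its translates
   along \<open>e\<close>. Translation invariance makes the average constant, and no basis adapted
   to \<open>e\<close> is needed.\<close>
 have "emeasure lborel N = (\<integral>\<^sup>+s. emeasure lborel N * indicator {0..1::real} s \<partial>lborel)"
  by (simp add: nn_integral_cmult)
 also have "... = (\<integral>\<^sup>+s. (\<integral>\<^sup>+x. indicator N (x + s *\<^sub>R e) * indicator {0..1::real} s \<partial>lborel) \<partial>lborel)"
 proof (rule nn_integral_cong)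
  fix s :: real
  have "emeasure lborel N = (\<integral>\<^sup>+x. indicator N x \<partial>distr lborel borel ((+) (s *\<^sub>R e)))" by (simp add: lborel_distr_plus)
  also have "... = (\<integral>\<^sup>+x. indicator N (s *\<^sub>R e + x) \<partial>lborel)" by (subst nn_integral_distr) auto
  finally show "emeasure lborel N * indicator {0..1::real} s = (\<integral>\<^sup>+x. indicator N (x + s *\<^sub>R e) * indicator {0..1::real} s \<partial>lborel)"
   by (simp add: nn_integral_multc add.commute)
 qed
 also have "... = (\<integral>\<^sup>+x. (\<integral>\<^sup>+s. indicator N (x + s *\<^sub>R e) * indicator {0..1::real} s \<partial>lborel) \<partial>lborel)"
  by (rule lborel_pair.Fubini') measurable
 also have "... = 0" by (simp add: line)
 finally have "N \<in> null_sets lborel" by (auto simp: null_sets_def)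
 then have "AE x in lborel. x \<notin> N" by (rule AE_not_in)
 then show ?thesis by eventually_elim (auto simp: N_def)
qed

text \<open>Where the distance to \<open>B\<close> is differentiable in a direction at a point of \<open>B\<close>, the derivative
 vanishes because the distance has a minimum there.\<close>

lemma infdist_small_ae:
 fixes B :: "'a::euclidean_space set"
 shows "AE x in lborel. x \<in> B --> (\<forall>e>0. \<exists>d>0. \<forall>h. norm h < d --> infdist (x + h) B <= e * norm h)"
proof -
 let ?d = "\<lambda>x. infdist x B"
 obtain C :: "'a set" where C: "countable C" "!!U. open U ==> U ~= {} ==> \<exists>u\<in>C. u \<in> U"
  using countable_dense_setE by metis
 have lip: "abs (?d x - ?d y) <= norm (x - y)" for x y
  using infdist_triangle_abs[of x B y] by (simp add: dist_norm)
 have "AE x in lborel. \<forall>u\<in>C. \<exists>D. ((\<lambda>t. ?d (x + t *\<^sub>R u)) has_real_derivative D) (at 0)"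
  unfolding AE_ball_countable[OF C(1)]
  by (intro ballI lipschitz_dir_derivative_ae[of _ 1] continuous_on_infdist continuous_on_id) (use lip in auto)
 then show ?thesis
 proof (eventually_elim, intro impI allI)
  fix e :: real and x :: 'a
  assume ex: "\<forall>u\<in>C. \<exists>D. ((\<lambda>t. ?d (x + t *\<^sub>R u)) has_real_derivative D) (at 0)" and x: "x \<in> B" and e: "e > (0::real)"
  have dir: "\<exists>r>0. \<forall>t. 0 < t & t < r --> ?d (x + t *\<^sub>R u) <= e / 2 * t" if "u \<in> C" for u
  proof -
   obtain D where D: "((\<lambda>t. ?d (x + t *\<^sub>R u)) has_real_derivative D) (at 0)" using bspec[OF ex \<open>u \<in> C\<close>] by (rule exE)
   have "D = 0" by (rule DERIV_local_min[OF D, of 1]) (simp_all add: x infdist_nonneg)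
   then have "((\<lambda>t. ?d (x + t *\<^sub>R u) / t) \<longlongrightarrow> 0) (at 0)" using D[unfolded DERIV_def] x by simp
   then have "eventually (\<lambda>t. ?d (x + t *\<^sub>R u) / t < e / 2) (at 0)" using e by (intro order_tendstoD) auto
   then obtain r where "r > 0" "!!t. t ~= 0 ==> abs t < r ==> ?d (x + t *\<^sub>R u) / t < e / 2" by (auto simp: eventually_at)
   then show ?thesis by (intro exI[of _ r]) (simp add: pos_divide_less_eq[symmetric] pos_divide_le_eq[symmetric] less_imp_le)
  qed
  \<comment> \<open>Smallness is known only along the countable set \<open>C\<close> of directions.
    By compactness finitely many of them suffice; half of \<open>e\<close> is spent along the
    direction, half on rounding \<open>h\<close> to it.\<close>
  have "sphere (0::'a) 1 \<subseteq> (\<Union>u\<in>C. ball u (e / 2))"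
  proof
   fix y :: 'a
   obtain u where "u \<in> C" "u \<in> ball y (e / 2)" using C(2)[of "ball y (e / 2)"] e by auto
   then show "y \<in> (\<Union>u\<in>C. ball u (e / 2))" by (auto simp: dist_commute)
  qed
  then obtain F where F: "F \<subseteq> C" "finite F" "sphere (0::'a) 1 \<subseteq> (\<Union>u\<in>F. ball u (e / 2))"
   using compactE_image[of "sphere (0::'a) 1" C "\<lambda>u. ball u (e / 2)"] by auto
  obtain r where r: "!!u. u \<in> F ==> 0 < r u" "!!u t. u \<in> F ==> 0 < t ==> t < r u ==> ?d (x + t *\<^sub>R u) <= e / 2 * t"
   using dir F(1) by (metis subsetD)
  have "?d (x + h) <= e * norm h" if h: "norm h < Min (insert 1 (r ` F))" for h
  proof (cases "h = 0")
   case False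
   define t where "t = norm h"
   have t: "0 < t" using False by (simp add: t_def)
   have "h /\<^sub>R t \<in> sphere 0 1" using t by (simp add: t_def)
   then obtain u where u: "u \<in> F" "norm (h /\<^sub>R t - u) < e / 2" using F(3) by (fastforce simp: dist_norm norm_minus_commute)
   have "?d (x + h) <= ?d (x + t *\<^sub>R u) + norm (h - t *\<^sub>R u)"
    using lip[of "x + h" "x + t *\<^sub>R u"] by (simp add: algebra_simps)
   also have "h - t *\<^sub>R u = t *\<^sub>R (h /\<^sub>R t - u)" using t by (simp add: algebra_simps)
   also have "norm ... <= t * (e / 2)" using t u(2) by (simp add: less_imp_le)
   also have "?d (x + t *\<^sub>R u) <= e / 2 * t" using r(2)[OF u(1) t] h F(2) u(1) by (simp add: t_def)
   finally show ?thesis by (simp add: t_def algebra_simps)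
  qed (use x in simp)
  moreover have "0 < Min (insert 1 (r ` F))" using F(2) r(1) by auto
  ultimately show "\<exists>d>0. \<forall>h. norm h < d --> ?d (x + h) <= e * norm h" by blast
 qed
qed

text \<open>On the closed set \<open>B\<close> the increments in the basis directions are uniformly close to linear.
 As \<open>B\<close> fills the neighbourhood of almost each of its points up to distance \<open>o(norm h)\<close>, these
 increments can be added up.\<close>

lemma lipschitz_almost_linear:
 fixes f r :: "'a::euclidean_space => real" and e m :: real
 assumes lip: "!!x y. abs (f x - f y) <= L * norm (x - y)" and L: "0 <= L" and cont: "continuous_on UNIV f"
  and e: "0 < e" and m: "0 < m"
  and B: "B = {x. \<forall>t b. abs t < m & b \<in> Basis --> abs (f (x + t *\<^sub>R b) - f x - t * r b) <= e * abs t}"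
 shows "AE x in lborel. x \<in> B --> (\<exists>d>0. \<forall>h. norm h < d -->
  abs (f (x + h) - f x - (\<Sum>b\<in>Basis. (h \<bullet> b) * r b)) <= 3 * DIM('a) * e * norm h)"
 using infdist_small_ae[of B]
proof (eventually_elim, intro impI)
 fix x assume small: "x \<in> B --> (\<forall>e>0. \<exists>d>0. \<forall>h. norm h < d --> infdist (x + h) B <= e * norm h)" and x: "x \<in> B"
 \<comment> \<open>Chosen so that moving a base point by \<open>c * DIM('a) * norm h\<close> changes
   \<open>f\<close> by at most \<open>e * norm h\<close>.\<close>
 define c where "c = e / (DIM('a) * (L + 1))"
 have c: "0 < c" "L * (c * DIM('a)) <= e" using e L by (auto simp: c_def divide_simps add_nonneg_pos mult_nonneg_nonneg)
 obtain d where d: "d > 0" "!!h. norm h < d ==> infdist (x + h) B <= c * norm h" using small x c(1) by blast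
 have [continuous_intros]: "continuous_on UNIV (\<lambda>x. f (x + v))" for v
  by (rule continuous_on_compose2[OF cont]) (auto intro!: continuous_intros)
 have clB: "closed B" unfolding B
  by (intro closed_Collect_all closed_Collect_imp closed_Collect_le open_Collect_const continuous_intros cont) 
 let ?p = "\<lambda>h A. \<Sum>b\<in>A. (h \<bullet> b) *\<^sub>R b"
 \<comment> \<open>The coordinates of \<open>h\<close> are added one at a time. Each costs three
   errors \<open>e * norm h\<close>: two for exchanging \<open>y\<close> with a nearby point
   \<open>z\<close> of \<open>B\<close>, one for the increment at \<open>z\<close>.\<close>
 have tele: "abs (f (x + ?p h A) - f x - (\<Sum>b\<in>A. (h \<bullet> b) * r b)) <= 3 * card A * e * norm h"
  if h: "norm h < min (d / DIM('a)) m" and A: "A \<subseteq> Basis" for h A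
  using finite_subset[OF A finite_Basis] A
 proof induction
  case (insert b A)
  define y where "y = x + ?p h A"
  have "A \<subseteq> Basis" using insert(4) by simp
  note IH = insert.IH[OF this]
  have hb: "abs (h \<bullet> b) <= norm h" if "b \<in> Basis" for b :: 'a
   using that by (rule Basis_le_norm)
  have "norm (?p h A) <= (\<Sum>b\<in>A. norm h)" using insert(4) hb by (intro sum_norm_le) auto
  also have "... <= DIM('a) * norm h" using insert(4) by (auto intro!: mult_right_mono card_mono)
  finally have p: "norm (?p h A) <= DIM('a) * norm h" .
  obtain z where z: "z \<in> B" "infdist y B = dist y z" using infdist_attains_inf[OF clB] x by blast
  have "dist y z <= c * norm (?p h A)" using d(2)[of "?p h A"] p h z(2) by (simp add: y_def field_simps)
  also have "... <= c * (DIM('a) * norm h)" using p c(1) by simp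
  finally have "L * dist y z <= L * (c * (DIM('a) * norm h))" using L by (rule mult_left_mono)
  also have "... <= e * norm h" using mult_right_mono[OF c(2), of "norm h"] by (simp add: mult_ac)
  finally have Ld: "L * norm (y - z) <= e * norm h" by (simp add: dist_norm)
  have "abs (f (y + (h \<bullet> b) *\<^sub>R b) - f (z + (h \<bullet> b) *\<^sub>R b)) <= e * norm h" "abs (f y - f z) <= e * norm h"
   using lip[of "y + (h \<bullet> b) *\<^sub>R b" "z + (h \<bullet> b) *\<^sub>R b"] lip[of y z] Ld by auto
  moreover have "abs (f (z + (h \<bullet> b) *\<^sub>R b) - f z - (h \<bullet> b) * r b) <= e * norm h"
  proof (rule order_trans)
   show "abs (f (z + (h \<bullet> b) *\<^sub>R b) - f z - (h \<bullet> b) * r b) <= e * abs (h \<bullet> b)" using z(1) hb[of b] h insert(4) unfolding B by auto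
  qed (use hb[of b] insert(4) e in auto)
  ultimately have "abs (f (y + (h \<bullet> b) *\<^sub>R b) - f x - ((h \<bullet> b) * r b + (\<Sum>b\<in>A. (h \<bullet> b) * r b))) <= 3 * card A * e * norm h + 3 * (e * norm h)"
   using IH unfolding y_def by linarith
  then show ?case using insert by (simp add: y_def algebra_simps)
 qed simp
 show "\<exists>d>0. \<forall>h. norm h < d --> abs (f (x + h) - f x - (\<Sum>b\<in>Basis. (h \<bullet> b) * r b)) <= 3 * DIM('a) * e * norm h"
  using tele[of _ Basis] d(1) m by (intro exI[of _ "min (d / DIM('a)) m"]) (simp add: euclidean_representation)
qed

text \<open>Partial derivatives exist almost everywhere and are approximated by rational vectors
  \<open>r\<close>. With reciprocals of integers for \<open>e\<close> and \<open>m\<close>,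
  countably many sets \<open>B e m r\<close> suffice, so almost every point is good for all of them
  at once.\<close>

theorem rademacher_real:
 fixes f :: "'a::euclidean_space => real"
 assumes lip: "!!x y. abs (f x - f y) <= L * norm (x - y)"
 shows "AE x in lborel. f differentiable (at x)"
proof -
 obtain b :: 'a where "b \<in> Basis" using nonempty_Basis by blast
 then have L: "0 <= L" using lip[of b 0] by auto
 then have "L-lipschitz_on UNIV f" using lip by (auto simp: lipschitz_on_def dist_norm)
 then have cont: "continuous_on UNIV f" by (rule lipschitz_on_continuous_on)
 define B where "B e m r = {x. \<forall>t b. abs t < m & b \<in> Basis --> abs (f (x + t *\<^sub>R b) - f x - t * r b) <= e * abs t}"
  for e m and r :: "'a => real"
 define lin where "lin x e r \<longleftrightarrow> (\<exists>d>0. \<forall>h. norm h < d --> abs (f (x + h) - f x - (\<Sum>b\<in>Basis. (h \<bullet> b) * r b)) <= e * norm h)" for x e r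
 let ?S = "Basis \<rightarrow>\<^sub>E \<rat> :: ('a => real) set"
 have cnt: "countable ?S" by (intro countable_PiE) (auto simp: countable_rat)
 have "AE x in lborel. x \<in> B (1 / Suc k) (1 / Suc m) r --> lin x (3 * DIM('a) * (1 / Suc k)) r" for k m r
  unfolding lin_def by (rule lipschitz_almost_linear[OF lip L cont _ _ B_def]) auto
 then have "AE x in lborel. \<forall>k m. \<forall>r\<in>?S. x \<in> B (1 / Suc k) (1 / Suc m) r --> lin x (3 * DIM('a) * (1 / Suc k)) r"
  by (simp only: AE_all_countable AE_ball_countable[OF cnt]) blast
 moreover have "AE x in lborel. \<forall>b\<in>Basis. \<exists>D. ((\<lambda>t. f (x + t *\<^sub>R b)) has_real_derivative D) (at 0)"
  by (intro AE_finite_allI finite_Basis lipschitz_dir_derivative_ae[OF lip cont])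
 ultimately show ?thesis
 proof eventually_elim
  case (elim x)
  obtain g where g: "!!b. b \<in> Basis ==> ((\<lambda>t. f (x + t *\<^sub>R b)) has_real_derivative g b) (at 0)" using elim(2) by metis
  have "(f has_derivative (\<lambda>h. \<Sum>b\<in>Basis. (h \<bullet> b) * g b)) (at x)"
   unfolding has_derivative_at_alt
  proof (intro conjI allI impI)
   show "bounded_linear (\<lambda>h. \<Sum>b\<in>Basis. (h \<bullet> b) * g b)"
    by (intro bounded_linear_sum bounded_linear_mult_const bounded_linear_inner_left)
   fix e :: real assume "e > 0"
   \<comment> \<open>The factor \<open>4\<close>: three units come from
     \<open>lipschitz_almost_linear\<close>, one from replacing \<open>r\<close> by the true partial
     derivatives \<open>g\<close>.\<close>
   then obtain k where k: "1 / Suc k < e / (4 * DIM('a))" using nat_approx_posE[of "e / (4 * DIM('a))"] by auto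
   define c where "c = 1 / real (Suc k)"
   have c: "0 < c" "c < e / (4 * DIM('a))" using k by (simp_all add: c_def)
   have "\<exists>r. r \<in> \<rat> & abs (g b - r) < c / 2" for b
    using Rats_dense_in_real[of "g b" "g b + c / 2"] c(1) by force
   then obtain r' where r': "!!b. r' b \<in> \<rat>" "!!b. abs (g b - r' b) < c / 2" by metis
   define r where "r = restrict r' Basis"
   have r: "r \<in> ?S" "!!b. b \<in> Basis ==> abs (g b - r b) < c / 2" using r' by (auto simp: r_def)
   have "\<exists>d>0. \<forall>t. abs t < d --> abs (f (x + t *\<^sub>R b) - f x - t * r b) <= c * abs t" if b: "b \<in> Basis" for b
   proof -
    obtain d where d: "d > 0" "!!t. abs t < d ==> abs (f (x + t *\<^sub>R b) - f x - g b * t) <= c / 2 * abs t"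
     using g[OF b, unfolded has_field_derivative_def has_derivative_at_alt, THEN conjunct2, rule_format, of "c / 2"]
      c(1) by auto
    have "abs (f (x + t *\<^sub>R b) - f x - t * r b) <= c * abs t" if "abs t < d" for t
    proof -
     have "abs ((g b - r b) * t) <= c / 2 * abs t"
      unfolding abs_mult using r(2)[OF b] by (intro mult_right_mono) auto
     moreover have "c * abs t = c / 2 * abs t + c / 2 * abs t" by simp
     ultimately show ?thesis using d(2)[OF that] by (simp only: left_diff_distrib mult.commute[of t]) linarith
    qed
    then show ?thesis using d(1) by blast
   qed
   then obtain d where d: "!!b. b \<in> Basis ==> 0 < d b"
    "!!b t. b \<in> Basis ==> abs t < d b ==> abs (f (x + t *\<^sub>R b) - f x - t * r b) <= c * abs t" by metis
   obtain m where m: "1 / Suc m < Min (d ` Basis)" using nat_approx_posE[of "Min (d ` Basis)"] d(1) by auto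
   have "x \<in> B (1 / Suc k) (1 / Suc m) r" unfolding c_def[symmetric] B_def using d(2) m by fastforce
   then obtain de where de: "de > 0" "!!h. norm h < de ==> abs (f (x + h) - f x - (\<Sum>b\<in>Basis. (h \<bullet> b) * r b)) <= 3 * DIM('a) * c * norm h"
    using elim(1) r(1) unfolding lin_def c_def by blast
   show "\<exists>d>0. \<forall>y. norm (y - x) < d --> norm (f y - f x - (\<Sum>b\<in>Basis. ((y - x) \<bullet> b) * g b)) <= e * norm (y - x)"
   proof (intro exI[of _ de] conjI allI impI de)
    fix y assume y: "norm (y - x) < de"
    have 1: "abs ((\<Sum>b\<in>Basis. ((y - x) \<bullet> b) * r b) - (\<Sum>b\<in>Basis. ((y - x) \<bullet> b) * g b)) <= (\<Sum>b\<in>(Basis::'a set). norm (y - x) * c)"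
     unfolding sum_subtractf[symmetric] right_diff_distrib[symmetric]
    proof (rule order_trans[OF sum_abs sum_mono])
     fix b :: 'a assume b: "b \<in> Basis"
     have "abs (r b - g b) <= c" using r(2)[OF b] by linarith
     then show "abs ((y - x) \<bullet> b * (r b - g b)) <= norm (y - x) * c"
      unfolding abs_mult using Basis_le_norm[OF b] by (intro mult_mono) auto
    qed
    have "abs (f y - f x - (\<Sum>b\<in>Basis. ((y - x) \<bullet> b) * r b)) <= 3 * DIM('a) * c * norm (y - x)" using de(2)[OF y] by simp
    then have "abs (f y - f x - (\<Sum>b\<in>Basis. ((y - x) \<bullet> b) * g b)) <= 3 * DIM('a) * c * norm (y - x) + DIM('a) * (norm (y - x) * c)"
     using 1 unfolding sum_constant by linarith
    also have "... = 4 * DIM('a) * c * norm (y - x)" by (simp add: algebra_simps)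
    also have "... <= e * norm (y - x)" using c by (intro mult_right_mono) (auto simp: field_simps)
    finally show "norm (f y - f x - (\<Sum>b\<in>Basis. ((y - x) \<bullet> b) * g b)) <= e * norm (y - x)" by simp
   qed
  qed
  then show ?case by (auto simp: differentiable_def)
 qed
qed

theorem rademacher:
 fixes f :: "'a::euclidean_space => 'b::euclidean_space"
 assumes lip: "!!x y. norm (f x - f y) <= L * norm (x - y)"
 shows "AE x in lborel. f differentiable (at x)"
proof -
 have "AE x in lborel. (\<lambda>x. f x \<bullet> b) differentiable (at x)" if "b \<in> Basis" for b
 proof (rule rademacher_real[of _ L])
  fix x y
  have "abs (f x \<bullet> b - f y \<bullet> b) <= norm (f x - f y)" using that by (simp add: inner_diff_left[symmetric] Basis_le_norm)
  also have "... <= L * norm (x - y)" by (rule lip)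
  finally show "abs (f x \<bullet> b - f y \<bullet> b) <= L * norm (x - y)" .
 qed
 then have "AE x in lborel. \<forall>b\<in>Basis. (\<lambda>x. f x \<bullet> b) differentiable (at x)"
  by (intro AE_finite_allI) auto
 then show ?thesis by eventually_elim (subst differentiable_componentwise_within, blast)
qed

section \<open>Sard's theorem and the area formula over arbitrary finite index types\<close>

text \<open>The change-of-variables theorems of the library need a well-ordered index type; \<open>enum_idx\<close> is a
 well-ordered copy of an arbitrary finite type.\<close>

typedef (overloaded) ('n::finite) enum_idx = "{..<CARD('n)}"
 by (rule exI[of _ 0]) auto

instantiation enum_idx :: (finite) linorder
begin
definition less_eq_enum_idx :: "'a enum_idx => 'a enum_idx => bool" where
 "less_eq_enum_idx i j \<longleftrightarrow> Rep_enum_idx i <= Rep_enum_idx j"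
definition less_enum_idx :: "'a enum_idx => 'a enum_idx => bool" where
 "less_enum_idx i j \<longleftrightarrow> Rep_enum_idx i < Rep_enum_idx j"
instance
proof
 fix x y z :: "'a enum_idx"
 show "x < y \<longleftrightarrow> x <= y & \<not> y <= x" unfolding less_eq_enum_idx_def less_enum_idx_def by (rule less_le_not_le)
 show "x <= x" unfolding less_eq_enum_idx_def by simp
 show "x <= y \<or> y <= x" unfolding less_eq_enum_idx_def by linarith
 show "x <= z" if "x <= y" "y <= z" using that unfolding less_eq_enum_idx_def by linarith
 show "x = y" if "x <= y" "y <= x"
  using that unfolding less_eq_enum_idx_def by (intro Rep_enum_idx_inject[THEN iffD1] order_antisym)
qed
end

instance enum_idx :: (finite) finite
proof
 have "(UNIV :: 'a::finite enum_idx set) = Abs_enum_idx ` {..<CARD('a)}"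
  by (rule type_definition.univ[OF type_definition_enum_idx])
 then show "finite (UNIV :: 'a enum_idx set)" by (metis finite_imageI finite_lessThan)
qed

instance enum_idx :: (finite) wellorder
proof
 fix P :: "'a enum_idx => bool" and a
 assume step: "!!x. (!!y. y < x ==> P y) ==> P x"
 show "P a"
 proof (induction "Rep_enum_idx a" arbitrary: a rule: less_induct)
  case less
  show ?case by (rule step) (rule less, simp add: less_enum_idx_def)
 qed
qed

lemma card_enum_idx: "CARD('n::finite enum_idx) = CARD('n)"
proof -
 have "CARD('n enum_idx) = card {..<CARD('n)}" by (rule type_definition.card[OF type_definition_enum_idx])
 then show ?thesis by simp
qed

text \<open>Conjugation with \<open>h\<close> is a sign-preserving bijection between the
  permutations of the two index types, so the Leibniz sums agree term by term.\<close>

lemma det_reindex: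
 fixes h :: "'a::finite => 'b::finite" and A :: "real^'b^'b"
 assumes h: "bij h"
 shows "det (\<chi> i j. A $ h i $ h j) = det A"
 unfolding det_def
proof (rule sum.reindex_bij_witness[where j="map_permutation UNIV h" and i="map_permutation UNIV (inv h)"])
 have bi: "bij (inv h)" using h by (rule bij_imp_bij_inv)
 fix p :: "'a => 'a" assume "p \<in> {p. p permutes UNIV}"
 then have p: "p permutes UNIV" by simp
 show "map_permutation UNIV (inv h) (map_permutation UNIV h p) = p"
  by (rule map_permutation_compose_inv[OF h p]) (simp add: h bij_is_inj)
 show "map_permutation UNIV h p \<in> {p. p permutes UNIV}" using map_permutation_permutes[OF h p] by simp
 have "(\<Prod>i\<in>UNIV. A $ i $ map_permutation UNIV h p i) = (\<Prod>i\<in>UNIV. A $ h i $ h (p i))"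
  using prod.reindex_bij_betw[OF h, of "\<lambda>i. A $ i $ map_permutation UNIV h p i"] h
  by (simp add: map_permutation_apply bij_is_inj)
 then show "of_int (sign (map_permutation UNIV h p)) * (\<Prod>i\<in>UNIV. A $ i $ map_permutation UNIV h p i) =
   of_int (sign p) * (\<Prod>i\<in>UNIV. (\<chi> i j. A $ h i $ h j) $ i $ p i)"
  using sign_map_permutation[of h UNIV p] p h by (simp add: bij_is_inj)
next
 fix q :: "'b => 'b" assume "q \<in> {p. p permutes UNIV}"
 then have q: "q permutes UNIV" by simp
 show "map_permutation UNIV h (map_permutation UNIV (inv h) q) = q"
  by (rule map_permutation_compose_inv[OF bij_imp_bij_inv[OF h] q]) (simp add: h bij_is_surj surj_f_inv_f)
 show "map_permutation UNIV (inv h) q \<in> {p. p permutes UNIV}" using map_permutation_permutes[OF bij_imp_bij_inv[OF h] q] by simp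
qed

definition idx_bij :: "'n::finite enum_idx => 'n" where
 "idx_bij = (SOME h. bij h)"

lemma bij_idx_bij: "bij (idx_bij :: 'n::finite enum_idx => 'n)"
proof -
 have "\<exists>h :: 'n enum_idx => 'n. bij h"
  using finite_same_card_bij[of "UNIV :: 'n enum_idx set" "UNIV :: 'n set"] by (simp add: card_enum_idx)
 then show ?thesis unfolding idx_bij_def by (rule someI_ex)
qed

definition to_idx :: "real^'n => real^('n enum_idx)" where
 "to_idx x = (\<chi> i. x $ idx_bij i)"

definition of_idx :: "real^('n enum_idx) => real^'n" where
 "of_idx y = (\<chi> j. y $ inv idx_bij j)"

lemma idx_inv [simp]: "inv idx_bij (idx_bij i) = i" "idx_bij (inv idx_bij j) = j"
 by (simp_all add: bij_idx_bij bij_is_inj bij_is_surj surj_f_inv_f)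

lemma of_to_idx [simp]: "of_idx (to_idx x) = x" "to_idx (of_idx y) = y"
 by (simp_all add: to_idx_def of_idx_def vec_eq_iff)

lemma linear_idx: "linear to_idx" "linear of_idx"
 by (auto intro!: linearI simp: to_idx_def of_idx_def vec_eq_iff)

lemma lborel_to_idx: "distr lborel borel to_idx = (lborel :: (real^('n::finite enum_idx)) measure)"
proof (rule lborel_eqI[symmetric])
 have [measurable]: "to_idx \<in> BM"
  by (rule borel_measurable_continuous_onI) (simp add: linear_continuous_on linear_conv_bounded_linear[symmetric] linear_idx)
 fix l u :: "real^('n enum_idx)" assume lu: "!!b. b \<in> Basis ==> l \<bullet> b <= u \<bullet> b"
 have lu': "l $ i <= u $ i" for i using lu[of "axis i 1"] by (simp add: inner_axis)
 have pre: "to_idx -` box l u = box (of_idx l) (of_idx u)"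
  by (auto simp: mem_box_cart to_idx_def of_idx_def) (metis idx_inv)+
 have "emeasure (distr lborel borel to_idx) (box l u) = emeasure lborel (box (of_idx l) (of_idx u))"
  by (subst emeasure_distr) (auto simp: pre)
 also have "... = ennreal (\<Prod>b\<in>Basis. (of_idx u - of_idx l) \<bullet> b)"
  by (rule emeasure_lborel_box) (use lu' in \<open>auto simp: Basis_vec_def inner_axis of_idx_def\<close>)
 also have "(\<Prod>b\<in>Basis. (of_idx u - of_idx l) \<bullet> b) = (\<Prod>j\<in>UNIV. (of_idx u - of_idx l) $ j)"
  by (simp add: Basis_vec_def inner_axis) (subst prod.UNION_disjoint; simp add: axis_eq_axis inner_axis)
 also have "... = (\<Prod>i\<in>UNIV. (u - l) $ i)"
  using prod.reindex_bij_betw[OF bij_idx_bij, of "\<lambda>j. (of_idx u - of_idx l) $ j"] by (simp add: of_idx_def)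
 also have "... = (\<Prod>b\<in>Basis. (u - l) \<bullet> b)"
  by (simp add: Basis_vec_def inner_axis) (subst prod.UNION_disjoint; simp add: axis_eq_axis inner_axis)
 finally show "emeasure (distr lborel borel to_idx) (box l u) = (\<Prod>b\<in>Basis. (u - l) \<bullet> b)" .
qed simp

lemma lebesgue_to_idx: "distr lebesgue lebesgue to_idx = (lebesgue :: (real^('n::finite enum_idx)) measure)"
 and measurable_to_idx: "(to_idx :: real^'n => _) \<in> lebesgue \<rightarrow>\<^sub>M lebesgue"
proof -
 have m[measurable]: "to_idx \<in> BM"
  by (rule borel_measurable_continuous_onI) (simp add: linear_continuous_on linear_conv_bounded_linear[symmetric] linear_idx)
 have 1: "distr lebesgue lborel (to_idx :: real^'n => _) = lborel"
 proof -
  have "distr lebesgue lborel (to_idx :: real^'n => _) = distr lborel lborel to_idx" by (rule distr_completion) simp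
  also have "... = distr lborel borel to_idx" by (rule distr_cong) auto
  finally show ?thesis using lborel_to_idx by simp
 qed
 show "distr lebesgue lebesgue to_idx = (lebesgue :: (real^('n::finite enum_idx)) measure)"
  using completion.completion_distr_eq[of "to_idx :: real^'n => _" lborel lborel] 1
  by (simp add: measurable_completion)
 show "(to_idx :: real^'n => _) \<in> lebesgue \<rightarrow>\<^sub>M lebesgue"
  using completion.measurable_completion2[of "to_idx :: real^'n => _" lborel lborel] 1 
  by (simp add: measurable_completion)
qed

lemma to_idx_vimage: "to_idx -` A = of_idx ` A" "of_idx -` B = to_idx ` B"
 by (auto simp: image_iff) (metis of_to_idx)+

lemma negligible_of_idx: "negligible A ==> negligible (of_idx ` (A :: (real^('n::finite enum_idx)) set))"
proof -
 assume "negligible A"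
 then have "A \<in> null_sets lebesgue" by (simp add: negligible_iff_null_sets)
 then have "A \<in> null_sets (distr lebesgue lebesgue (to_idx :: real^'n => _))" by (simp add: lebesgue_to_idx)
 then have "to_idx -` A \<in> null_sets (lebesgue :: (real^'n) measure)"
  using null_sets_distr_iff[OF measurable_to_idx] by auto
 then show ?thesis by (simp add: negligible_iff_null_sets to_idx_vimage)
qed

lemma of_idx_derivative: "(of_idx has_derivative of_idx) F" "(to_idx has_derivative to_idx) G"
 using linear_idx by (auto simp: linear_conv_bounded_linear intro!: bounded_linear_imp_has_derivative)

lemma conj_derivative:
 assumes "(g has_derivative L) (at x within S)"
 shows "((to_idx \<circ> g \<circ> of_idx) has_derivative (to_idx \<circ> L \<circ> of_idx)) (at (to_idx x) within to_idx ` S)"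
proof -
 have 1: "(of_idx has_derivative of_idx) (at (to_idx x) within to_idx ` S)" by (rule of_idx_derivative)
 have "(g has_derivative L) (at (of_idx (to_idx x)) within of_idx ` to_idx ` S)" using assms by (simp add: image_image)
 from diff_chain_within[OF 1 this] have "(g \<circ> of_idx has_derivative L \<circ> of_idx) (at (to_idx x) within to_idx ` S)" .
 from diff_chain_within[OF this of_idx_derivative(2)] show ?thesis by (simp add: comp_assoc)
qed

lemma det_conj:
 fixes L :: "real^'n => real^'n"
 shows "det (matrix (to_idx \<circ> L \<circ> of_idx)) = det (matrix L)"
proof -
 have "of_idx (axis j 1) = (axis (idx_bij j) 1 :: real^'n)" for j :: "'n enum_idx"
  by (auto simp: of_idx_def axis_def vec_eq_iff) 
 then have "matrix (to_idx \<circ> L \<circ> of_idx) = (\<chi> i j. matrix L $ idx_bij i $ idx_bij j)"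
  by (auto simp: matrix_def to_idx_def)
 then show ?thesis using det_reindex[OF bij_idx_bij, of "matrix L"] by simp
qed

theorem sard_negligible:
 fixes f :: "real^'n => real^'n"
 assumes der: "!!x. x \<in> S ==> (f has_derivative f' x) (at x within S)"
  and sing: "!!x. x \<in> S ==> det (matrix (f' x)) = 0"
 shows "negligible (f ` S)"
proof -
 have "negligible ((to_idx \<circ> f \<circ> of_idx) ` (to_idx ` S))"
 proof (rule baby_Sard[where f'="\<lambda>y. to_idx \<circ> f' (of_idx y) \<circ> of_idx"])
  fix y assume "y \<in> to_idx ` S"
  then obtain x where x: "x \<in> S" "y = to_idx x" by auto
  show "((to_idx \<circ> f \<circ> of_idx) has_derivative (to_idx \<circ> f' (of_idx y) \<circ> of_idx)) (at y within to_idx ` S)"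
   using conj_derivative[OF der[OF x(1)]] x by simp
  show "rank (matrix (to_idx \<circ> f' (of_idx y) \<circ> of_idx)) < CARD('n enum_idx)"
   using sing[OF x(1)] x(2) det_conj[of "f' x"] by (simp add: det_eq_0_rank[symmetric])
 qed simp
 then have "negligible (of_idx ` ((to_idx \<circ> f \<circ> of_idx) ` (to_idx ` S)))" by (rule negligible_of_idx)
 then show ?thesis by (simp add: image_image)
qed

text \<open>The equivalence used here ties a finite measure of the image to a finite integral of the
  Jacobian. As the integrand is nonnegative, this settles the infinite case too: neither side can be
  finite alone.\<close>

lemma emeasure_differentiable_image_wellorder:
 fixes g :: "real^'n::{finite,wellorder} => real^'n::_"
 assumes S: "S \<in> sets lebesgue"
  and der: "!!x. x \<in> S ==> (g has_derivative g' x) (at x within S)"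
  and inj: "inj_on g S"
 shows "g ` S \<in> sets lebesgue" (is ?A)
  and "(\<lambda>x. abs (det (matrix (g' x)))) \<in> borel_measurable (lebesgue_on S)" (is ?B)
  and "emeasure lebesgue (g ` S) = (\<integral>\<^sup>+x. ennreal (abs (det (matrix (g' x)))) \<partial>lebesgue_on S)" (is ?C)
proof -
 show A: ?A
  by (rule differentiable_image_in_sets_lebesgue) (use S der in \<open>auto simp: differentiable_on_def differentiable_def\<close>)
 show B: ?B by (intro borel_measurable_abs borel_measurable_det_Jacobian[OF S der])
 define d where "d x = (if x \<in> S then abs (det (matrix (g' x))) else 0)" for x
 have dm: "d \<in> borel_measurable lebesgue"
  unfolding d_def using B S by (simp add: borel_measurable_if)
 have nn: "(\<integral>\<^sup>+x. ennreal (abs (det (matrix (g' x)))) \<partial>lebesgue_on S) = (\<integral>\<^sup>+x. ennreal (d x) \<partial>lebesgue)"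
  using S by (subst nn_integral_restrict_space) (auto intro!: nn_integral_cong simp: d_def)
 have hi: "((\<lambda>x. abs (det (matrix (g' x)))) has_integral r) S \<longleftrightarrow> (\<integral>\<^sup>+x. ennreal (d x) \<partial>lebesgue) = ennreal r & 0 <= r" for r
 proof -
  have "((\<lambda>x. abs (det (matrix (g' x)))) has_integral r) S \<longleftrightarrow> (d has_integral r) UNIV"
   unfolding d_def by (simp add: has_integral_restrict_UNIV)
  then show ?thesis using has_integral_iff_nn_integral_lebesgue[of d r] dm by (auto simp: d_def)
 qed
 note key = has_measure_differentiable_image[OF S der inj, unfolded hi]
 show ?C
 proof (cases "g ` S \<in> lmeasurable")
  case True
  then show ?thesis using key[of "measure lebesgue (g ` S)"] by (simp add: nn emeasure_eq_measure2)
 next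
  case False
  then have "emeasure lebesgue (g ` S) = \<infinity>" using A unfolding fmeasurable_def by (auto simp del: emeasure_completion simp: less_top[symmetric])
  moreover have "(\<integral>\<^sup>+x. ennreal (d x) \<partial>lebesgue) = \<infinity>"
  proof (cases "\<integral>\<^sup>+x. ennreal (d x) \<partial>lebesgue")
   case (real r) then show ?thesis using key[of r] False by auto
  qed simp
  ultimately show ?thesis by (simp add: nn)
 qed
qed

theorem emeasure_differentiable_image:
 fixes g :: "real^'n => real^'n"
 assumes S: "S \<in> sets lebesgue"
  and der: "!!x. x \<in> S ==> (g has_derivative g' x) (at x within S)"
  and inj: "inj_on g S"
 shows "g ` S \<in> sets lebesgue" (is ?A)
  and "(\<lambda>x. abs (det (matrix (g' x)))) \<in> borel_measurable (lebesgue_on S)" (is ?B)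
  and "emeasure lebesgue (g ` S) = (\<integral>\<^sup>+x. ennreal (abs (det (matrix (g' x)))) \<partial>lebesgue_on S)" (is ?C)
proof -
 define S' where "S' = to_idx ` S"
 define h where "h = to_idx \<circ> g \<circ> of_idx"
 define h' where "h' y = to_idx \<circ> g' (of_idx y) \<circ> of_idx" for y
 have S': "S' \<in> sets lebesgue" unfolding S'_def
 proof (rule differentiable_image_in_sets_lebesgue[OF S])
  show "DIM(real^'n) <= DIM(real^'n enum_idx)" by (simp add: card_enum_idx)
  show "to_idx differentiable_on S" unfolding differentiable_on_def differentiable_def using of_idx_derivative(2) by blast
 qed
 have der': "(h has_derivative h' y) (at y within S')" if "y \<in> S'" for y
 proof -
  obtain x where x: "x \<in> S" "y = to_idx x" using \<open>y \<in> S'\<close> unfolding S'_def by blast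
  then show ?thesis using conj_derivative[OF der[OF x(1)]] by (simp add: h_def h'_def S'_def)
 qed
 have inj': "inj_on h S'"
  unfolding h_def S'_def using inj by (auto simp: inj_on_def) (metis of_to_idx(1))
 note E = emeasure_differentiable_image_wellorder[OF S' der' inj']
 have det': "det (matrix (h' y)) = det (matrix (g' (of_idx y)))" for y unfolding h'_def by (rule det_conj)
 have gS: "g ` S = to_idx -` (h ` S')" unfolding to_idx_vimage h_def S'_def by (simp add: image_image)
 show ?A unfolding gS using measurable_sets[OF measurable_to_idx E(1)] by simp
 define d where "d x = (if x \<in> S then abs (det (matrix (g' x))) else 0)" for x
 define d' where "d' y = (if y \<in> S' then abs (det (matrix (h' y))) else 0)" for y
 have d'm: "d' \<in> borel_measurable lebesgue" unfolding d'_def using E(2) S' by (simp add: borel_measurable_if)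
 have dd: "d' (to_idx x) = d x" for x
  by (auto simp: d'_def d_def det' S'_def) (metis image_eqI imageE of_to_idx(1))+
 have "(\<lambda>x. d' (to_idx x)) \<in> borel_measurable lebesgue" using measurable_compose[OF measurable_to_idx d'm] .
 then have dm: "d \<in> borel_measurable lebesgue" by (simp add: dd)
 then show ?B unfolding d_def using S by (simp add: borel_measurable_if)
 have "emeasure lebesgue (g ` S) = emeasure (distr lebesgue lebesgue to_idx) (h ` S')"
  unfolding gS using E(1) measurable_to_idx by (subst emeasure_distr) auto
 also have "... = (\<integral>\<^sup>+y. ennreal (abs (det (matrix (h' y)))) \<partial>lebesgue_on S')" by (simp add: lebesgue_to_idx E(3))
 also have "... = (\<integral>\<^sup>+y. ennreal (d' y) \<partial>lebesgue)"
  using S' by (subst nn_integral_restrict_space) (auto intro!: nn_integral_cong simp: d'_def)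
 also have "... = (\<integral>\<^sup>+y. ennreal (d' y) \<partial>distr lebesgue lebesgue to_idx)" by (simp add: lebesgue_to_idx)
 also have "... = (\<integral>\<^sup>+x. ennreal (d' (to_idx x)) \<partial>lebesgue)"
  using d'm measurable_to_idx by (subst nn_integral_distr) auto
 also have "... = (\<integral>\<^sup>+x. ennreal (abs (det (matrix (g' x)))) \<partial>lebesgue_on S)"
  using S by (subst nn_integral_restrict_space) (auto intro!: nn_integral_cong simp: dd d_def)
 finally show ?C .
qed

text \<open>Both sides integrate \<open>f\<close> against Borel measures: the image under
  \<open>g\<close> of the Jacobian density, and Lebesgue measure on the image of \<open>S\<close>.
  They agree on a Borel set \<open>A\<close> by the area formula for the part of \<open>S\<close>
  that \<open>g\<close> maps into \<open>A\<close>.\<close>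

theorem nn_integral_differentiable_image:
 fixes g :: "real^'n => real^'n" and f :: "real^'n => ennreal"
 assumes S: "S \<in> sets lebesgue"
  and der: "!!x. x \<in> S ==> (g has_derivative g' x) (at x within S)"
  and inj: "inj_on g S" and f[measurable]: "f \<in> BM"
 shows "(\<integral>\<^sup>+y. f y * indicator (g ` S) y \<partial>lebesgue) = (\<integral>\<^sup>+x. ennreal (abs (det (matrix (g' x)))) * f (g x) \<partial>lebesgue_on S)"
proof -
 note E = emeasure_differentiable_image[OF S der inj]
 have gm[measurable]: "g \<in> borel_measurable (lebesgue_on S)"
  by (rule continuous_imp_measurable_on_sets_lebesgue[OF _ S])
    (metis continuous_on_eq_continuous_within der has_derivative_continuous)
 have dm[measurable]: "(\<lambda>x. ennreal (abs (det (matrix (g' x))))) \<in> borel_measurable (lebesgue_on S)" using E(2) by measurable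
 define M where "M = distr (density (lebesgue_on S) (\<lambda>x. ennreal (abs (det (matrix (g' x)))))) borel g"
 define N where "N = distr (lebesgue_on (g ` S)) borel (\<lambda>y. y)"
 have idm[measurable]: "(\<lambda>y. y) \<in> borel_measurable (lebesgue_on (g ` S))"
  by (rule continuous_imp_measurable_on_sets_lebesgue[OF _ E(1)]) (intro continuous_intros)
 have "M = N"
 proof (rule measure_eqI)
  show "sets M = sets N" by (simp add: M_def N_def)
  fix A assume "A \<in> sets M"
  then have A[measurable]: "A \<in> sets borel" by (simp add: M_def)
  define T where "T = S \<inter> g -` A"
  have T0: "g -` A \<inter> S \<in> sets (lebesgue_on S)" using measurable_sets[OF gm A] by simp
  have T: "T \<in> sets lebesgue" using T0 S unfolding T_def by (metis Int_commute sets_restrict_space_iff Int_iff sets.Int space_lebesgue_on inf_le1 sets_lebesgue_on_refl subset_eq measurable_sets sets_restrict_space_subset)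
  have derT: "(g has_derivative g' x) (at x within T)" if "x \<in> T" for x
   using der[of x] that by (auto simp: T_def intro: has_derivative_subset)
  have injT: "inj_on g T" using inj by (rule inj_on_subset) (auto simp: T_def)
  have "emeasure M A = (\<integral>\<^sup>+x. ennreal (abs (det (matrix (g' x)))) * indicator (g -` A \<inter> S) x \<partial>lebesgue_on S)"
   unfolding M_def using T0 S by (subst emeasure_distr) (auto simp: emeasure_density[OF dm])
  also have "... = (\<integral>\<^sup>+x. ennreal (abs (det (matrix (g' x)))) \<partial>lebesgue_on T)"
   using S T by (subst (1 2) nn_integral_restrict_space) (auto intro!: nn_integral_cong simp: T_def indicator_def)
  also have "... = emeasure lebesgue (g ` T)" using emeasure_differentiable_image(3)[OF T derT injT] by simp
  also have "g ` T = A \<inter> g ` S" by (auto simp: T_def)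
  also have "emeasure lebesgue (A \<inter> g ` S) = emeasure N A"
   unfolding N_def using E(1) by (subst emeasure_distr) (auto simp: emeasure_restrict_space)
  finally show "emeasure M A = emeasure N A" .
 qed
 then have "(\<integral>\<^sup>+y. f y \<partial>M) = (\<integral>\<^sup>+y. f y \<partial>N)" by simp
 moreover have "(\<integral>\<^sup>+y. f y \<partial>M) = (\<integral>\<^sup>+x. ennreal (abs (det (matrix (g' x)))) * f (g x) \<partial>lebesgue_on S)"
  unfolding M_def by (subst nn_integral_distr) (auto intro!: nn_integral_density dm)
 moreover have "(\<integral>\<^sup>+y. f y \<partial>N) = (\<integral>\<^sup>+y. f y * indicator (g ` S) y \<partial>lebesgue)"
  unfolding N_def using E(1) by (subst nn_integral_distr) (auto simp: nn_integral_restrict_space)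
 ultimately show ?thesis by simp
qed

lemma negligible_if_AE:
 assumes "AE x in lborel. P x"
 shows "negligible {x. \<not> P x}"
proof -
 obtain N where N: "{x \<in> space lborel. \<not> P x} \<subseteq> N" "emeasure lborel N = 0" "N \<in> sets lborel"
  using assms by (rule AE_E)
 then have "N \<in> null_sets lebesgue" by (intro null_sets_completionI null_setsI)
 then have "negligible N" by (simp only: negligible_iff_null_sets)
 moreover have "{x. \<not> P x} \<subseteq> N" using N(1) by simp
 ultimately show ?thesis by (rule negligible_subset)
qed

section \<open>Subgradients and second derivatives of convex functions\<close>

definition subgrad :: "('a::euclidean_space => real) => 'a => 'a set" where
 "subgrad w y = {p. \<forall>y'. w y + p \<bullet> (y' - y) <= w y'}"

lemma subgradD: "p \<in> subgrad w y ==> w y + p \<bullet> (y' - y) <= w y'"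
 by (auto simp: subgrad_def)

lemma subgrad_monotone:
 assumes "p \<in> subgrad w y" "q \<in> subgrad w z"
 shows "0 <= (p - q) \<bullet> (y - z)"
 using subgradD[OF assms(1), of z] subgradD[OF assms(2), of y]
 by (simp add: inner_diff_left inner_diff_right)

text \<open>Separate the point \<open>(y, w y)\<close> from the strict epigraph. The hyperplane
  cannot be vertical because \<open>w\<close> is finite on the whole space, and its slope is a
  subgradient.\<close>

lemma subgrad_nonempty:
 fixes w :: "'a::euclidean_space => real"
 assumes "convex_on UNIV w"
 shows "subgrad w y ~= {}"
proof -
 let ?S = "{(y, w y)}" and ?T = "{(x, r). w x < r}"
 have "convex ?T"
 proof (rule convexI, clarsimp)
  fix x r x' r' and u v :: real assume h: "w x < r" "w x' < r'" "0 <= u" "0 <= v" "u + v = 1"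
  have "w (u *\<^sub>R x + v *\<^sub>R x') <= u * w x + v * w x'"
   using assms h by (auto simp: convex_on_def)
  also have "... < u * r + v * r'"
  proof (cases "u = 0")
   case True then show ?thesis using h by auto
  next
   case False
   then have "u * w x < u * r" using h by auto
   moreover have "v * w x' <= v * r'" using h by (intro mult_left_mono) auto
   ultimately show ?thesis by simp
  qed
  finally show "w (u *\<^sub>R x + v *\<^sub>R x') < u * r + v * r'" .
 qed
 moreover have "(y, w y + 1) \<in> ?T" by simp
 then have "?T ~= {}" by blast
 ultimately obtain a b where ab: "a ~= 0" "\<forall>s\<in>?S. inner a s <= b" "\<forall>t\<in>?T. inner a t \<ge> b"
  using separating_hyperplane_sets[of ?S ?T] by auto
 obtain a1 a2 where a: "a = (a1, a2)" by (cases a)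
 have le: "a1 \<bullet> y + a2 * w y <= a1 \<bullet> x + a2 * r" if "w x < r" for x r
  using ab(2,3) that by (auto simp: a) (meson order_trans)
 have a2: "a2 > 0"
 proof (rule ccontr)
  assume "\<not> a2 > 0"
  moreover have "a2 \<ge> 0" using le[of y "w y + 1"] by (simp add: algebra_simps)
  ultimately have "a2 = 0" by simp
  then have "a1 \<bullet> y <= a1 \<bullet> (y - a1)" using le[of "y - a1" "w (y - a1) + 1"] by simp
  then have "a1 \<bullet> a1 <= 0" by (simp add: inner_diff_right)
  then have "a1 = 0" by (metis inner_eq_zero_iff inner_ge_zero order_antisym)
  then show False using ab(1) \<open>a2 = 0\<close> by (simp add: a zero_prod_def)
 qed
 have "w y + (- (1 / a2) *\<^sub>R a1) \<bullet> (x - y) <= w x" for x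
 proof (rule field_le_epsilon)
  fix e :: real assume "e > 0"
  then have "a1 \<bullet> y + a2 * w y <= a1 \<bullet> x + a2 * (w x + e)" by (intro le) simp
  then show "w y + (- (1 / a2) *\<^sub>R a1) \<bullet> (x - y) <= w x + e"
   using a2 by (simp add: inner_diff_right field_simps)
 qed
 then have "- (1 / a2) *\<^sub>R a1 \<in> subgrad w y" by (simp add: subgrad_def)
 then show ?thesis by blast
qed

text \<open>The point is the minimiser of \<open>w\<close> plus half the squared distance to
  \<open>ze\<close>; the first-order condition at the minimum says that \<open>ze - y\<close> is a
  subgradient.\<close>

lemma subgrad_resolvent_exists:
 fixes w :: "'a::euclidean_space => real"
 assumes cv: "convex_on UNIV w"
 shows "\<exists>y. ze - y \<in> subgrad w y"
proof -
 have cont: "continuous_on UNIV w" using convex_on_continuous[OF open_UNIV cv] .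
 define F where "F y = w y + (norm (y - ze))^2 / 2" for y
 have Fc: "continuous_on UNIV F" unfolding F_def by (intro continuous_intros cont) auto
 obtain p where p: "p \<in> subgrad w ze" using subgrad_nonempty[OF cv] by blast
 \<comment> \<open>Beyond this radius the affine minorant with slope \<open>p\<close> drops by no
   more than the quadratic term rises, so the minimum over the ball is global.\<close>
 define R where "R = 2 * norm p + 1"
 have R: "R > 0" unfolding R_def using norm_ge_zero[of p] by linarith
 obtain y where y: "y \<in> cball ze R" "!!x. x \<in> cball ze R ==> F y <= F x"
  using continuous_attains_inf[of "cball ze R" F] R continuous_on_subset[OF Fc] by auto
 have out: "F ze <= F x" if "x \<notin> cball ze R" for x
 proof -
  define d where "d = norm (x - ze)"
  have d: "d > 2 * norm p + 1" using that by (simp add: d_def R_def dist_norm norm_minus_commute)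
  have "w ze - norm p * d <= w x"
   using subgradD[OF p, of x] norm_cauchy_schwarz[of "-p" "x - ze"] by (simp add: d_def)
  moreover have "norm p * d <= d^2 / 2"
  proof -
   have "norm p * d <= (d / 2) * d" using d norm_ge_zero[of p] by (intro mult_right_mono) linarith+
   then show ?thesis by (simp add: power2_eq_square)
  qed
  ultimately show ?thesis by (simp add: F_def d_def)
 qed
 have min: "F y <= F x" for x
  using y(2)[of x] y(2)[of ze] out[of x] R by (cases "x \<in> cball ze R") auto
 have "w y + (ze - y) \<bullet> (x - y) <= w x" for x
 proof -
  define d where "d = x - y"
  have ineq: "0 <= (w x - w y) + (y - ze) \<bullet> d + t * ((norm d)^2 / 2)" if t: "0 < t" "t < 1" for t
  proof -
   have "w (y + t *\<^sub>R d) <= (1 - t) * w y + t * w x"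
   proof -
    have "w ((1 - t) *\<^sub>R y + t *\<^sub>R x) <= (1 - t) * w y + t * w x"
     using cv t unfolding convex_on_def by auto
    moreover have "(1 - t) *\<^sub>R y + t *\<^sub>R x = y + t *\<^sub>R d" by (simp add: d_def algebra_simps)
    ultimately show ?thesis by simp
   qed
   moreover have "(norm (y + t *\<^sub>R d - ze))^2 = (norm (y - ze))^2 + 2 * t * ((y - ze) \<bullet> d) + t^2 * (norm d)^2"
    unfolding power2_norm_eq_inner by (simp add: inner_simps inner_commute power2_eq_square algebra_simps)
   moreover have "F y <= F (y + t *\<^sub>R d)" by (rule min)
   ultimately have "0 <= t * (w x - w y) + t * ((y - ze) \<bullet> d) + t^2 * (norm d)^2 / 2"
    unfolding F_def by (simp add: algebra_simps) 
   also have "... = t * ((w x - w y) + (y - ze) \<bullet> d + t * ((norm d)^2 / 2))"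
    by (simp add: power2_eq_square algebra_simps)
   finally show ?thesis using t by (simp add: zero_le_mult_iff)
  qed
  have "0 <= (w x - w y) + (y - ze) \<bullet> d"
  proof (rule tendsto_lowerbound)
   have "((\<lambda>t. (w x - w y) + (y - ze) \<bullet> d + t * ((norm d)^2 / 2)) \<longlongrightarrow> (w x - w y) + (y - ze) \<bullet> d + 0 * ((norm d)^2 / 2)) (at_right 0)"
    by (intro tendsto_intros)
   then show "((\<lambda>t. (w x - w y) + (y - ze) \<bullet> d + t * ((norm d)^2 / 2)) \<longlongrightarrow> (w x - w y) + (y - ze) \<bullet> d) (at_right 0)" by simp
   show "eventually (\<lambda>t. 0 <= (w x - w y) + (y - ze) \<bullet> d + t * ((norm d)^2 / 2)) (at_right 0)"
    using ineq by (auto simp: eventually_at_right_field intro!: exI[of _ 1])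
  qed simp
  then show ?thesis by (simp add: d_def inner_diff_left)
 qed
 then show ?thesis by (auto simp: subgrad_def)
qed

text \<open>Second-order differentiability in the sense of Alexandrov: every selection of the
 subdifferential is differentiable at \<open>y\<close> with derivative \<open>sg\<close>.\<close>

definition alexandrov_at :: "('a::euclidean_space => real) => 'a => 'a => ('a => 'a) => bool" where
 "alexandrov_at w y p sg \<longleftrightarrow> p \<in> subgrad w y & linear sg &
   (\<forall>e>0. \<exists>d>0. \<forall>y' p'. norm (y' - y) < d & p' \<in> subgrad w y' -->
    norm (p' - p - sg (y' - y)) <= e * norm (y' - y))"

text \<open>For \<open>y' = y\<close> the definition leaves no error at all, so the subdifferential
  at \<open>y\<close> is a singleton.\<close>

lemma alexandrov_unique:
 assumes "alexandrov_at w y p sg" "q \<in> subgrad w y"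
 shows "q = p"
proof -
 have l: "linear sg" using assms(1) by (simp add: alexandrov_at_def)
 obtain d where "d > 0" "!!y' p'. norm (y' - y) < d & p' \<in> subgrad w y' ==> norm (p' - p - sg (y' - y)) <= 1 * norm (y' - y)"
  using assms(1) unfolding alexandrov_at_def by (metis zero_less_one)
 from this(2)[of y q] this(1) assms(2) show ?thesis using linear_0[OF l] by simp
qed

lemma alexandrov_has_derivative:
 assumes "alexandrov_at w y p sg" "!!y. y \<in> S ==> s y \<in> subgrad w y" "y \<in> S"
 shows "(s has_derivative sg) (at y within S)"
 unfolding has_derivative_within_alt
proof (intro conjI allI impI)
 have l: "linear sg" using assms(1) by (simp add: alexandrov_at_def)
 show "bounded_linear sg" using l by (simp add: linear_conv_bounded_linear)
 fix e :: real assume "e > 0"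
 then obtain d where d: "d > 0" "!!y' p'. norm (y' - y) < d & p' \<in> subgrad w y' ==> norm (p' - p - sg (y' - y)) <= e * norm (y' - y)"
  using assms(1) unfolding alexandrov_at_def by metis
 have "s y = p" using alexandrov_unique[OF assms(1)] assms(2,3) by blast
 then show "\<exists>d>0. \<forall>y'\<in>S. norm (y' - y) < d --> norm (s y' - s y - sg (y' - y)) <= e * norm (y' - y)"
  using d assms(2) by blast
qed

text \<open>Rescaling \<open>w\<close> around \<open>y\<close>: in the limit \<open>sg\<close> is a subgradient selection.\<close>

lemma alexandrov_blowup:
 fixes w :: "'a::euclidean_space => real"
 assumes al: "alexandrov_at w y p sg" and cv: "convex_on UNIV w" and e: "0 < e"
 obtains F :: "'a => real" where "F 0 = 0" "!!a b. norm a <= R ==> F a + sg a \<bullet> (b - a) - e * norm (b - a) <= F b"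
proof -
 have l: "linear sg" using al by (simp add: alexandrov_at_def)
 define R' where "R' = abs R + 1"
 have R': "0 < R'" "R <= R'" by (auto simp: R'_def)
 obtain d where d: "d > 0" "!!y' p'. norm (y' - y) < d & p' \<in> subgrad w y' ==> norm (p' - p - sg (y' - y)) <= e / R' * norm (y' - y)"
  using al e R'(1) unfolding alexandrov_at_def by (metis divide_pos_pos)
 define eps where "eps = d / (2 * R')"
 have eps: "0 < eps" "eps * R' < d" using d(1) R'(1) by (auto simp: eps_def)
 define F where "F a = (w (y + eps *\<^sub>R a) - w y - eps * (p \<bullet> a)) / eps^2" for a
 have F': "eps^2 * F a = w (y + eps *\<^sub>R a) - w y - eps * (p \<bullet> a)" for a using eps(1) by (simp add: F_def)
 show thesis
 proof
  show "F 0 = 0" by (simp add: F_def)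
  fix a b :: 'a assume a: "norm a <= R"
  obtain p' where p': "p' \<in> subgrad w (y + eps *\<^sub>R a)" using subgrad_nonempty[OF cv] by blast
  have "eps * norm a < d" using mult_left_mono[of "norm a" R' eps] a R'(2) eps by linarith
  then have "norm (p' - p - eps *\<^sub>R sg a) <= e / R' * (eps * norm a)"
   using d(2)[of "y + eps *\<^sub>R a" p'] p' eps by (simp add: linear_scale[OF l])
  also have "... <= e / R' * (eps * R')" using a R' eps(1) e by (intro mult_left_mono) auto
  finally have "norm (p' - p - eps *\<^sub>R sg a) * norm (b - a) <= eps * e * norm (b - a)" using R'(1) by (intro mult_right_mono) (auto simp: mult.commute)
  then have "- (eps * e * norm (b - a)) <= (p' - p - eps *\<^sub>R sg a) \<bullet> (b - a)"
   using Cauchy_Schwarz_ineq2[of "p' - p - eps *\<^sub>R sg a" "b - a"] by linarith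
  then have "eps * (- (eps * e * norm (b - a))) <= eps * ((p' - p - eps *\<^sub>R sg a) \<bullet> (b - a))" using eps(1) by (intro mult_left_mono) auto
  moreover have "w (y + eps *\<^sub>R a) + eps * (p' \<bullet> (b - a)) <= w (y + eps *\<^sub>R b)"
   using subgradD[OF p', of "y + eps *\<^sub>R b"] by (simp add: scaleR_diff_right[symmetric])
  ultimately have "0 <= (w (y + eps *\<^sub>R b) - w y - eps * (p \<bullet> b)) - (w (y + eps *\<^sub>R a) - w y - eps * (p \<bullet> a)) - eps^2 * (sg a \<bullet> (b - a) - e * norm (b - a))"
   by (simp add: inner_diff_left inner_diff_right power2_eq_square algebra_simps)
  also have "... = eps^2 * (F b - F a - (sg a \<bullet> (b - a) - e * norm (b - a)))" by (simp add: F' right_diff_distrib)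
  finally show "F a + sg a \<bullet> (b - a) - e * norm (b - a) <= F b" using eps(1) by (simp add: zero_le_mult_iff)
 qed
qed

text \<open>Adding the blow-up inequalities from \<open>0\<close> to \<open>h\<close> and back
  cancels \<open>F\<close> and leaves \<open>sg h \<bullet> h\<close> up to the error.\<close>

lemma alexandrov_nonneg:
 assumes al: "alexandrov_at w y p sg" and cv: "convex_on UNIV w"
 shows "0 <= sg h \<bullet> h"
proof (rule field_le_epsilon)
 fix e :: real assume "e > 0"
 define c where "c = e / (2 * (norm h + 1))"
 have c: "0 < c" "2 * (c * norm h) <= e" using \<open>e > 0\<close> by (simp_all add: c_def pos_divide_le_eq add_nonneg_pos)
 obtain F where F: "F 0 = 0" "!!a b. norm a <= norm h ==> F a + sg a \<bullet> (b - a) - c * norm (b - a) <= F b"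
  using alexandrov_blowup[OF al cv c(1)] by metis
 have "sg 0 = 0" using al by (simp add: alexandrov_at_def linear_0)
 then show "0 <= sg h \<bullet> h + e" using F(2)[of 0 h] F(2)[of h 0] c(2) by (simp add: F(1))
qed

text \<open>Summing the subgradient inequality over fine subdivisions of the sides of the triangle with
 vertices \<open>0, h, k\<close> bounds the circulation of \<open>sg\<close> around it.\<close>

lemma alexandrov_symmetric:
 assumes al: "alexandrov_at w y p sg" and cv: "convex_on UNIV w"
 shows "sg h \<bullet> k = h \<bullet> sg k"
proof -
 have l: "linear sg" using al by (simp add: alexandrov_at_def)
 have "sg h \<bullet> k <= sg k \<bullet> h" for h k
 proof (rule field_le_epsilon)
  fix e0 :: real assume e0: "e0 > 0"
  define C where "C = 2 * (norm h + norm (k - h) + norm k) + 1"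
  define e where "e = e0 / C"
  have "0 < C" by (simp add: C_def add_nonneg_pos)
  then have e: "0 < e" "e * C = e0" using e0 by (auto simp: e_def)
  define R where "R = norm h + norm k"
  obtain F where F: "F 0 = 0" "!!a b. norm a <= R ==> F a + sg a \<bullet> (b - a) - e * norm (b - a) <= F b"
   using alexandrov_blowup[OF al cv e(1), of R] by metis
  \<comment> \<open>Halving a segment \<open>n\<close> times gathers the fraction
    \<open>1 - (1/2) ^ n\<close> of the quadratic term, while the error depends on the total length
    only and does not grow.\<close>
  have dyadic: "F a + sg a \<bullet> v + (1 - (1/2) ^ n) / 2 * (sg v \<bullet> v) - e * norm v <= F (a + v)" if "norm a <= R" "norm (a + v) <= R" for a v n
   using that
  proof (induction n arbitrary: a v)
   case 0
   then show ?case using F(2)[of a "a + v"] by simp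
  next
   case (Suc n)
   let ?v = "(1/2) *\<^sub>R v"
   have "norm ((1/2) *\<^sub>R a + (1/2) *\<^sub>R (a + v)) <= 1/2 * norm a + 1/2 * norm (a + v)"
    by (rule order_trans[OF norm_triangle_ineq]) simp
   also have "(1/2) *\<^sub>R a + (1/2) *\<^sub>R (a + v) = a + ?v" by (simp add: scaleR_add_right scaleR_left_distrib[symmetric] add.assoc[symmetric])
   finally have m: "norm (a + ?v) <= R" using Suc.prems by simp
   have "a + ?v + ?v = a + v" by (simp add: add.assoc scaleR_left_distrib[symmetric])
   then show ?case using Suc.IH[OF Suc.prems(1) m] Suc.IH[OF m, of ?v] Suc.prems(2)
    by (simp add: linear_add[OF l] linear_scale[OF l] inner_add_left field_simps)
  qed
  have edge: "F a + sg a \<bullet> v + 1 / 2 * (sg v \<bullet> v) - e * norm v <= F (a + v)" if "norm a <= R" "norm (a + v) <= R" for a v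
  proof (rule LIMSEQ_le_const2)
   have "(\<lambda>n. F a + sg a \<bullet> v + (1 - (1/2) ^ n) / 2 * (sg v \<bullet> v) - e * norm v) \<longlonglongrightarrow> F a + sg a \<bullet> v + (1 - 0) / 2 * (sg v \<bullet> v) - e * norm v"
    by (intro tendsto_intros LIMSEQ_realpow_zero) auto
   then show "(\<lambda>n. F a + sg a \<bullet> v + (1 - (1/2) ^ n) / 2 * (sg v \<bullet> v) - e * norm v) \<longlonglongrightarrow> F a + sg a \<bullet> v + 1 / 2 * (sg v \<bullet> v) - e * norm v" by simp
  qed (use dyadic[OF that] in blast)
  have "F 0 + 1 / 2 * (sg h \<bullet> h) - e * norm h <= F h"
   "F h + sg h \<bullet> (k - h) + 1 / 2 * (sg (k - h) \<bullet> (k - h)) - e * norm (k - h) <= F k"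
   "F k - sg k \<bullet> k + 1 / 2 * (sg k \<bullet> k) - e * norm k <= F 0"
   using edge[of 0 h] edge[of h "k - h"] edge[of k "-k"] by (simp_all add: R_def linear_0[OF l] linear_neg[OF l])
  then have "sg h \<bullet> k - sg k \<bullet> h <= e * (C - 1)"
   by (simp add: C_def linear_diff[OF l] inner_diff_left inner_diff_right algebra_simps)
  also have "... <= e0" using e by (simp add: right_diff_distrib)
  finally show "sg h \<bullet> k <= sg k \<bullet> h + e0" by simp
 qed
 from this[of h k] this[of k h] show ?thesis by (simp add: inner_commute)
qed

text \<open>Resolvent proof: \<open>J = (I + \<partial>w)\<^sup>-\<^sup>1\<close> is nonexpansive, hence differentiable a.e. by Rademacher, and
 the set where its derivative is singular has null image by Sard; elsewhere \<open>\<partial>w = J\<^sup>-\<^sup>1 - I\<close> is differentiable.\<close>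

theorem alexandrov_ae:
 fixes w :: "real^'n => real"
 assumes cv: "convex_on UNIV w"
 shows "AE y in lborel. \<exists>p sg. alexandrov_at w y p sg"
proof -
 obtain J where J: "!!ze. ze - J ze \<in> subgrad w (J ze)" using subgrad_resolvent_exists[OF cv] by metis
 have firm: "(norm (J a - J b))^2 <= (J a - J b) \<bullet> (a - b)" for a b
 proof -
  have "0 <= ((a - J a) - (b - J b)) \<bullet> (J a - J b)" by (rule subgrad_monotone[OF J J])
  then show ?thesis by (simp add: power2_norm_eq_inner inner_simps inner_commute)
 qed
 have nonexp: "norm (J a - J b) <= 1 * norm (a - b)" for a b
 proof (cases "J a = J b")
  case False
  have "norm (J a - J b) * norm (J a - J b) <= norm (J a - J b) * norm (a - b)"
   using firm[of a b] norm_cauchy_schwarz[of "J a - J b" "a - b"] by (simp add: power2_eq_square)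
  then show ?thesis using False by simp
 qed simp
 have Juniq: "J (y + p) = y" if "p \<in> subgrad w y" for y p
 proof -
  have "0 <= (((y + p) - J (y + p)) - p) \<bullet> (J (y + p) - y)" by (rule subgrad_monotone[OF J that])
  then have "(J (y + p) - y) \<bullet> (J (y + p) - y) <= 0" by (simp add: inner_simps inner_commute)
  then show ?thesis by (metis eq_iff_diff_eq_0 inner_eq_zero_iff inner_ge_zero order_antisym)
 qed
 define N1 where "N1 = {ze. \<not> J differentiable (at ze)}"
 define N2 where "N2 = {ze. J differentiable (at ze) & det (matrix (frechet_derivative J (at ze))) = 0}"
 have "AE ze in lborel. J differentiable (at ze)" by (rule rademacher[OF nonexp])
 then have "negligible N1" unfolding N1_def by (rule negligible_if_AE)
 then have n1: "negligible (J ` N1)"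
 proof (rule negligible_locally_Lipschitz_image[OF order_refl])
  fix x show "\<exists>T B. open T & x \<in> T & (\<forall>y \<in> N1 \<inter> T. norm (J y - J x) <= B * norm (y - x))"
   using nonexp by (intro exI[of _ UNIV] exI[of _ 1]) auto
 qed
 have n2: "negligible (J ` N2)"
 proof (rule sard_negligible)
  fix ze assume "ze \<in> N2"
  then show "(J has_derivative frechet_derivative J (at ze)) (at ze within N2)"
   by (auto simp: N2_def frechet_derivative_works intro: has_derivative_at_withinI)
 qed (auto simp: N2_def)
 have "negligible (J ` N1 \<union> J ` N2)" using n1 n2 by simp
 then obtain N where N: "N \<in> null_sets lborel" "J ` N1 \<union> J ` N2 \<subseteq> N" by (rule null_sets_lebesgue_cover)
 have "AE y in lborel. y \<notin> N" using N(1) by (rule AE_not_in)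
 then show ?thesis
 proof eventually_elim
  case (elim y)
  obtain p where p: "p \<in> subgrad w y" using subgrad_nonempty[OF cv] by blast
  define ze where "ze = y + p"
  have Jze: "J ze = y" using Juniq[OF p] by (simp add: ze_def)
  have "ze \<notin> N1" "ze \<notin> N2" using elim N(2) Jze by auto
  then have dJ: "J differentiable (at ze)" and det: "det (matrix (frechet_derivative J (at ze))) ~= 0"
   by (auto simp: N1_def N2_def)
  define La where "La = frechet_derivative J (at ze)"
  have der: "(J has_derivative La) (at ze)" using dJ by (simp add: La_def frechet_derivative_works)
  have lin: "linear La" using der by (simp add: has_derivative_linear)
  have "inj La" using det det_nz_iff_inj[OF lin] by (simp add: La_def)
  then obtain M where M: "linear M" "M \<circ> La = id" using linear_injective_left_inverse[OF lin] by blast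
  have MLam: "M (La u) = u" for u using M(2) by (simp add: fun_eq_iff)
  have inv2: "La (M v) = v" for v
   using linear_injective_isomorphism[OF lin \<open>inj La\<close>] MLam by metis
  obtain B where B: "B > 0" "!!v. norm (M v) <= B * norm v" using linear_bounded_pos[OF M(1)] by blast
  \<comment> \<open>\<open>2 * c\<close> is a lower bound for \<open>La\<close>; half of it survives
    the linearisation error in \<open>near\<close>.\<close>
  define c where "c = 1 / (2 * B)"
  have c: "c > 0" using B(1) by (simp add: c_def)
  have lower: "2 * c * norm u <= norm (La u)" for u
   using B(2)[of "La u"] B(1) by (simp add: c_def MLam field_simps)
  define sg where "sg v = M v - v" for v
  have "linear sg" unfolding sg_def using M(1) by (intro linear_compose_sub linear_id[unfolded id_def]) auto
  moreover have "\<exists>d>0. \<forall>y' p'. norm (y' - y) < d & p' \<in> subgrad w y' --> norm (p' - p - sg (y' - y)) <= e * norm (y' - y)" if e: "e > 0" for e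
  proof -
   define eta where "eta = min c (e * c / B)"
   have eta: "eta > 0" "eta <= c" "B * eta <= e * c" using c e B(1) by (auto simp: eta_def min_def field_simps)
   obtain r where r: "r > 0" "!!ze'. norm (ze' - ze) < r ==> norm (J ze' - J ze - La (ze' - ze)) <= eta * norm (ze' - ze)"
    using der eta(1) unfolding has_derivative_at_alt by blast
   have near: "c * norm (ze' - ze) <= norm (J ze' - y)" if "norm (ze' - ze) < r" for ze'
   proof -
    have "norm (La (ze' - ze)) <= norm (J ze' - J ze) + norm (J ze' - J ze - La (ze' - ze))"
     by (metis norm_minus_commute norm_triangle_sub add.commute diff_add_cancel)
    moreover have "norm (J ze' - J ze - La (ze' - ze)) <= c * norm (ze' - ze)"
     using r(2)[OF that] mult_right_mono[OF eta(2), of "norm (ze' - ze)"] by simp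
    ultimately show ?thesis using lower[of "ze' - ze"] Jze by simp
   qed
   define r1 where "r1 = r / 2"
   have r1: "r1 > 0" "r1 < r" using r(1) by (auto simp: r1_def)
   \<comment> \<open>A point \<open>ze'\<close> at distance at least \<open>r1\<close> is compared
     with the point \<open>ze''\<close> of the same ray at distance \<open>r1\<close>: monotonicity
     of \<open>J\<close> along the ray keeps its image away from \<open>y\<close>. Subgradients at
     points near \<open>y\<close> are thereby confined to the ball where the linearisation
     holds.\<close>
   have far: "c^2 * r1 <= norm (J ze' - y)" if "norm (ze' - ze) \<ge> r1" for ze'
   proof -
    define R where "R = norm (ze' - ze)"
    have R: "R \<ge> r1" "R > 0" using that r1 by (auto simp: R_def)
    define u where "u = (1 / R) *\<^sub>R (ze' - ze)"
    have u: "norm u = 1" "ze' = ze + R *\<^sub>R u" using R by (auto simp: u_def R_def)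
    define ze'' where "ze'' = ze + r1 *\<^sub>R u"
    have n2: "norm (ze'' - ze) = r1" using r1 u(1) by (simp add: ze''_def)
    have a: "0 <= (J ze' - J ze'') \<bullet> u"
    proof (cases "R = r1")
     case True then show ?thesis by (simp add: ze''_def u(2))
    next
     case False
     have "0 <= (J ze' - J ze'') \<bullet> (ze' - ze'')" using firm[of ze' ze''] by (meson order_trans zero_le_power2)
     also have "ze' - ze'' = (R - r1) *\<^sub>R u" by (simp add: ze''_def u(2) algebra_simps)
     finally show ?thesis using R(1) False by (simp add: zero_le_mult_iff)
    qed
    have b: "c^2 * r1 <= (J ze'' - y) \<bullet> u"
    proof -
     have "c * r1 <= norm (J ze'' - y)" using near[of ze''] n2 r1 by simp
     then have "(c * r1)^2 <= (norm (J ze'' - y))^2" using c r1 by (intro power_mono) auto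
     also have "... <= (J ze'' - y) \<bullet> (ze'' - ze)" using firm[of ze'' ze] Jze by simp
     also have "... = r1 * ((J ze'' - y) \<bullet> u)" by (simp add: ze''_def)
     finally have "r1 * (c^2 * r1) <= r1 * ((J ze'' - y) \<bullet> u)" by (simp add: power2_eq_square mult_ac)
     then show ?thesis using r1 by simp
    qed
    have "c^2 * r1 <= (J ze' - y) \<bullet> u" using a b by (simp add: inner_diff_left)
    also have "... <= norm (J ze' - y)" using norm_cauchy_schwarz[of "J ze' - y" u] u(1) by simp
    finally show ?thesis .
   qed
   show ?thesis
   proof (intro exI[of _ "c^2 * r1"] conjI allI impI)
    show "0 < c^2 * r1" using c r1 by simp
    fix y' p' assume h: "norm (y' - y) < c^2 * r1 & p' \<in> subgrad w y'"
    define ze' where "ze' = y' + p'"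
    have J': "J ze' = y'" using Juniq h by (simp add: ze'_def)
    have "norm (ze' - ze) < r1" using far[of ze'] h J' by force
    then have lr: "norm (ze' - ze) < r" using r1 by simp
    have 1: "norm (y' - y - La (ze' - ze)) <= eta * norm (ze' - ze)" using r(2)[OF lr] J' Jze by simp
    have 2: "c * norm (ze' - ze) <= norm (y' - y)" using near[OF lr] J' by simp
    have "p' - p - sg (y' - y) = - M (y' - y - La (ze' - ze))"
    proof -
     have "M (y' - y - La (ze' - ze)) = M (y' - y) - (ze' - ze)"
      using linear_diff[OF M(1), of "y' - y" "La (ze' - ze)"] MLam by simp
     then show ?thesis by (simp add: sg_def ze'_def ze_def)
    qed
    then have "norm (p' - p - sg (y' - y)) = norm (M (y' - y - La (ze' - ze)))" by simp
    also have "... <= B * norm (y' - y - La (ze' - ze))" by (rule B(2))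
    also have "... <= B * (eta * norm (ze' - ze))" using mult_left_mono[OF 1, of B] B(1) by simp
    also have "... <= (e * c) * norm (ze' - ze)"
     using mult_right_mono[OF eta(3), of "norm (ze' - ze)"] by simp
    also have "... <= e * norm (y' - y)" using mult_left_mono[OF 2, of e] e by simp
    finally show "norm (p' - p - sg (y' - y)) <= e * norm (y' - y)" .
   qed
  qed
  ultimately have "alexandrov_at w y p sg" using p by (simp add: alexandrov_at_def)
  then show ?case by blast
 qed
qed

subsection \<open>Optimal transport maps\<close>

text \<open>A Borel version of the gradient, with junk values where the limits do not exist.\<close>

definition cgrad :: "('a::euclidean_space => real) => 'a => 'a" where
 "cgrad w y = (\<Sum>b\<in>Basis. lim (\<lambda>k. (w (y + (1 / Suc k) *\<^sub>R b) - w y) * real (Suc k)) *\<^sub>R b)"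

lemma cgrad_measurable [measurable]:
 assumes "convex_on UNIV w"
 shows "cgrad w \<in> BM"
proof -
 have [measurable]: "w \<in> BM"
  using convex_on_continuous[OF open_UNIV assms] by (rule borel_measurable_continuous_onI)
 show ?thesis unfolding cgrad_def by measurable
qed

text \<open>Each difference quotient lies between \<open>p \<bullet> b\<close> and the component of
  a subgradient at the shifted point, and the latter converges because selections are continuous at
  \<open>y\<close>.\<close>

lemma cgrad_eq:
 assumes al: "alexandrov_at w y p sg" and cv: "convex_on UNIV w"
 shows "cgrad w y = p"
proof -
 have l: "linear sg" and p: "p \<in> subgrad w y" using al by (auto simp: alexandrov_at_def)
 have "\<forall>y. \<exists>q. q \<in> subgrad w y" using subgrad_nonempty[OF cv] by blast
 then obtain s where s: "!!y. s y \<in> subgrad w y" by metis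
 have sp: "s y = p" using alexandrov_unique[OF al s] .
 have "(s has_derivative sg) (at y)" by (rule alexandrov_has_derivative[OF al]) (auto simp: s)
 then have "isCont s y" by (rule has_derivative_continuous)
 then have sc: "(s \<longlongrightarrow> p) (at y)" by (simp add: isCont_def sp)
 have "lim (\<lambda>k. (w (y + (1 / Suc k) *\<^sub>R b) - w y) * real (Suc k)) = p \<bullet> b" if b: "b \<in> Basis" for b
 proof (rule limI)
  let ?z = "\<lambda>k. y + (1 / real (Suc k)) *\<^sub>R b"
  have "?z \<longlonglongrightarrow> y + 0 *\<^sub>R b" by (intro tendsto_intros LIMSEQ_Suc[OF lim_1_over_n])
  then have "(\<lambda>k. s (?z k)) \<longlonglongrightarrow> s y" 
   by (intro isCont_tendsto_compose[OF \<open>isCont s y\<close>]) simp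
  then have hi: "(\<lambda>k. s (?z k) \<bullet> b) \<longlonglongrightarrow> p \<bullet> b" by (intro tendsto_intros) (simp add: sp)
  show "(\<lambda>k. (w (y + (1 / Suc k) *\<^sub>R b) - w y) * real (Suc k)) \<longlonglongrightarrow> p \<bullet> b"
  proof (rule tendsto_sandwich[OF _ _ tendsto_const hi])
   have "p \<bullet> b <= (w (?z k) - w y) * real (Suc k)" for k
   proof -
    have "p \<bullet> b / real (Suc k) <= w (?z k) - w y" using subgradD[OF p, of "?z k"] by simp
    then show ?thesis by (simp add: pos_divide_le_eq)
   qed
   then show "\<forall>\<^sub>F k in sequentially. p \<bullet> b <= (w (?z k) - w y) * real (Suc k)" by (rule eventuallyI)
   have "(w (?z k) - w y) * real (Suc k) <= s (?z k) \<bullet> b" for k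
   proof -
    have "w (?z k) - w y <= s (?z k) \<bullet> b / real (Suc k)" using subgradD[OF s[of "?z k"], of y] by simp
    then show ?thesis by (simp add: pos_le_divide_eq)
   qed
   then show "\<forall>\<^sub>F k in sequentially. (w (?z k) - w y) * real (Suc k) <= s (?z k) \<bullet> b" by (rule eventuallyI)
  qed
 qed
 then show ?thesis unfolding cgrad_def by (simp add: euclidean_representation)
qed

lemma cgrad_ae:
 fixes w :: "real^'n => real"
 assumes "convex_on UNIV w"
 shows "AE y in lborel. subgrad w y = {cgrad w y}"
 using alexandrov_ae[OF assms]
proof eventually_elim
 case (elim y)
 then obtain p sg where al: "alexandrov_at w y p sg" by blast
 then have "p \<in> subgrad w y" by (simp add: alexandrov_at_def)
 moreover have "q = p" if "q \<in> subgrad w y" for q using alexandrov_unique[OF al that] .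
 ultimately show ?case using cgrad_eq[OF al assms] by blast
qed

text \<open>The Legendre transform of \<open>u\<close> set to infinity off \<open>K\<close>. For
  compact \<open>K\<close> and continuous \<open>u\<close> the supremum is attained, and the
  transform is finite, convex and Lipschitz.\<close>

definition conj_on :: "'a::euclidean_space set => ('a => real) => 'a => real" where
 "conj_on K u y = (SUP x\<in>K. x \<bullet> y - u x)"

context
 fixes K :: "'a::euclidean_space set" and u :: "'a => real"
 assumes K: "compact K" "K ~= {}" and u: "continuous_on K u"
begin

lemma conj_on_attained: "\<exists>x\<in>K. conj_on K u y = x \<bullet> y - u x & (\<forall>x'\<in>K. x' \<bullet> y - u x' <= x \<bullet> y - u x)"
proof -
 have "continuous_on K (\<lambda>x. x \<bullet> y - u x)" by (intro continuous_intros u)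
 then obtain x where x: "x \<in> K" "!!x'. x' \<in> K ==> x' \<bullet> y - u x' <= x \<bullet> y - u x"
  using continuous_attains_sup[OF K] by blast
 have "conj_on K u y = x \<bullet> y - u x" unfolding conj_on_def
 proof (rule cSup_eq_maximum)
  show "x \<bullet> y - u x \<in> (\<lambda>x. x \<bullet> y - u x) ` K" using x(1) by (rule imageI)
  fix z assume "z \<in> (\<lambda>x. x \<bullet> y - u x) ` K"
  then show "z <= x \<bullet> y - u x" using x(2) by (elim imageE) simp
 qed
 then show ?thesis using x by blast
qed

lemma conj_on_ge: "x \<in> K ==> x \<bullet> y - u x <= conj_on K u y"
 using conj_on_attained[of y] by auto

lemma conj_on_le: "(!!x. x \<in> K ==> x \<bullet> y - u x <= c) ==> conj_on K u y <= c"
 using conj_on_attained[of y] by auto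

lemma conj_on_convex: "convex_on UNIV (conj_on K u)"
proof (rule convex_onI)
 fix t :: real and y y' assume t: "0 < t" "t < 1"
 show "conj_on K u ((1 - t) *\<^sub>R y + t *\<^sub>R y') <= (1 - t) * conj_on K u y + t * conj_on K u y'"
 proof (rule conj_on_le)
  fix x assume x: "x \<in> K"
  have "x \<bullet> ((1 - t) *\<^sub>R y + t *\<^sub>R y') - u x = (1 - t) * (x \<bullet> y - u x) + t * (x \<bullet> y' - u x)"
   by (simp add: inner_simps algebra_simps)
  also have "... <= (1 - t) * conj_on K u y + t * conj_on K u y'"
   using t x by (intro add_mono mult_left_mono conj_on_ge) auto
  finally show "x \<bullet> ((1 - t) *\<^sub>R y + t *\<^sub>R y') - u x <= (1 - t) * conj_on K u y + t * conj_on K u y'" .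
 qed
qed simp

lemma conj_on_lipschitz:
 assumes "K \<subseteq> cball 0 rho"
 shows "abs (conj_on K u y - conj_on K u y') <= rho * norm (y - y')"
proof -
 have "conj_on K u y <= conj_on K u y' + rho * norm (y - y')" for y y'
 proof (rule conj_on_le)
  fix x assume x: "x \<in> K"
  have "x \<bullet> (y - y') <= norm x * norm (y - y')" by (rule norm_cauchy_schwarz)
  also have "... <= rho * norm (y - y')" using assms x by (intro mult_right_mono) auto
  finally show "x \<bullet> y - u x <= conj_on K u y' + rho * norm (y - y')"
   using conj_on_ge[OF x, of y'] by (simp add: inner_diff_right)
 qed
 from this[of y y'] this[of y' y] show ?thesis by (simp add: norm_minus_commute abs_le_iff)
qed

lemma conj_on_maximizer_subgrad:
 assumes "x \<in> K" "conj_on K u y = x \<bullet> y - u x"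
 shows "x \<in> subgrad (conj_on K u) y"
 using conj_on_ge[OF assms(1)] assms(2) by (simp add: subgrad_def inner_diff_right)

end

lemma conj_on_perturb:
 assumes K: "compact K" "K ~= {}" and u: "continuous_on K u" and v: "continuous_on K v"
  and e: "!!x. x \<in> K ==> abs (u x - v x) <= e"
 shows "abs (conj_on K u y - conj_on K v y) <= e"
proof -
 have "conj_on K u y <= conj_on K v y + e"
 proof (rule conj_on_le[OF K u])
  fix x assume x: "x \<in> K"
  show "x \<bullet> y - u x <= conj_on K v y + e" using conj_on_ge[OF K v x, of y] e[OF x] by linarith
 qed
 moreover have "conj_on K v y <= conj_on K u y + e"
 proof (rule conj_on_le[OF K v])
  fix x assume x: "x \<in> K"
  show "x \<bullet> y - v x <= conj_on K u y + e" using conj_on_ge[OF K u x, of y] e[OF x] by linarith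
 qed
 ultimately show ?thesis by simp
qed

text \<open>Closed sets form an intersection-stable generator, and \<open>cutoff\<close>
  approximates the indicator of a closed set by bounded continuous functions.\<close>

lemma finite_borel_measure_eqI:
 fixes M N :: "'a::euclidean_space measure"
 assumes M: "finite_measure M" "sets M = sets borel" and N: "finite_measure N" "sets N = sets borel"
  and eq: "!!f B. continuous_on UNIV f ==> (!!x. abs (f x) <= B) ==> (LINT x|M. (f x :: real)) = (LINT x|N. f x)"
 shows "M = N"
proof -
 interpret M: finite_measure M by fact
 interpret N: finite_measure N by fact
 have [measurable_cong]: "sets M = sets borel" "sets N = sets borel" by fact+
 have closed_eq: "measure M C = measure N C" if C: "closed C" for C
 proof (cases "C = {}")
  case False
  have lim: "(\<lambda>k. \<integral>x. cutoff C k x \<partial>L) \<longlonglongrightarrow> measure L C" if L: "finite_measure L" "sets L = sets borel" for L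
  proof -
   interpret L: finite_measure L by fact
   have [measurable_cong]: "sets L = sets borel" by fact
   have sp: "space L = UNIV" using L(2) by (metis sets_eq_imp_space_eq space_borel)
   have [measurable]: "cutoff C k \<in> BM" for k
    by (rule borel_measurable_continuous_onI[OF cutoff_continuous])
   have [measurable]: "C \<in> sets borel" using C by simp
   have "(\<lambda>k. \<integral>x. cutoff C k x \<partial>L) \<longlonglongrightarrow> (LINT x|L. indicator C x)"
   proof (rule integral_dominated_convergence[where w="\<lambda>_. 1"])
    show "AE x in L. (\<lambda>k. cutoff C k x) \<longlonglongrightarrow> indicator C x"
     using cutoff_tendsto_indicator[OF C False] by auto
    show "AE x in L. norm (cutoff C k x) <= 1" for k using cutoff_bounds[of C k] by auto
   qed auto
   then show ?thesis by (simp add: sp)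
  qed
  have "(LINT x|M. cutoff C k x) = (LINT x|N. cutoff C k x)" for k
   by (rule eq[of "cutoff C k" 1]) (use cutoff_bounds[of C k] cutoff_continuous[of C k] in auto)
  then show ?thesis using lim[OF M] lim[OF N] LIMSEQ_unique by auto
 qed simp
 show ?thesis
 proof (rule measure_eqI_generator_eq[where E="Collect closed" and \<Omega>=UNIV and A="\<lambda>_. UNIV"])
  show "Int_stable (Collect closed)" by (auto simp: Int_stable_def)
  show "sets M = sigma_sets UNIV (Collect closed)" "sets N = sigma_sets UNIV (Collect closed)"
   using M N by (simp_all add: borel_eq_closed)
  show "emeasure M X = emeasure N X" if "X \<in> Collect closed" for X
   using closed_eq[of X] that by (simp add: M.emeasure_eq_measure N.emeasure_eq_measure)
 qed (auto simp: M.emeasure_eq_measure)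
qed

text \<open>Existence of the Brenier map by minimising the dual functional
 \<open>u \<mapsto> \<integral> u \<partial>be + \<integral> u\<^sup>* \<partial>al\<close> over Lipschitz functions on a ball; the first variation in \<open>u\<close>
 says that the gradient of \<open>u\<^sup>*\<close> pushes \<open>al\<close> to \<open>be\<close>.\<close>

theorem brenier_exists:
 fixes al be :: "(real^'n) measure"
 assumes al: "finite_measure al" "sets al = sets borel" and be: "finite_measure be" "sets be = sets borel"
  and mass: "measure al UNIV = measure be UNIV"
  and ac: "null_sets lborel \<subseteq> null_sets al" and rho: "0 < rho"
  and alK: "AE y in al. y \<in> cball 0 rho" and beK: "AE x in be. x \<in> cball 0 rho"
 obtains w u where "convex_on UNIV w" "convex_on UNIV u"
  "distr al borel (cgrad w) = be"
  "!!x y. x \<in> cball 0 rho ==> y \<in> cball 0 rho ==> x \<bullet> y <= w y + u x"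
  "AE y in al. subgrad w y = {cgrad w y} & cgrad w y \<in> cball 0 rho & y \<in> subgrad u (cgrad w y) & w y + u (cgrad w y) = cgrad w y \<bullet> y"
proof -
 interpret al: finite_measure al by fact
 interpret be: finite_measure be by fact
 have [measurable_cong]: "sets al = sets borel" "sets be = sets borel" by fact+
 have sp: "space al = UNIV" "space be = UNIV" using al(2) be(2) by (metis sets_eq_imp_space_eq space_borel)+
 define K where "K = cball (0::real^'n) rho"
 have K: "compact K" "K ~= {}" "K \<subseteq> cball 0 rho" "0 \<in> K" using rho by (auto simp: K_def)
 have Kn: "norm x <= rho" if "x \<in> K" for x using that by (simp add: K_def)
 have KAE: "AE y in al. y \<in> K" "AE x in be. x \<in> K" using alK beK by (simp_all add: K_def)
 \<comment> \<open>Both measures are concentrated on \<open>K\<close>; cutting off outside makes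
   every function that is continuous on \<open>K\<close> measurable and bounded on the whole
   space.\<close>
 define uK where "uK u x = (if x \<in> K then u x else (0::real))" for u x
 have intK: "integrable M (uK u)" "AE x in M. abs (uK u x) <= B" if "continuous_on K u" "M = al \<or> M = be" "!!x. x \<in> K ==> abs (u x) <= B" for u M B
 proof -
  have fm: "finite_measure M" "sets M = sets borel" using that(2) al be by auto
  interpret M: finite_measure M by fact
  have m: "uK u \<in> borel_measurable M"
  proof -
   have "uK u \<in> BM"
    unfolding uK_def using that(1) K(1)
    by (intro borel_measurable_continuous_on_if) (auto intro: borel_closed compact_imp_closed continuous_on_const)
   then show ?thesis using fm(2) by (simp cong: measurable_cong_sets)
  qed
  have B: "0 <= B" using that(3)[OF K(4)] by simp
  have b: "abs (uK u x) <= B" for x using that(3) B by (auto simp: uK_def)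
  show "integrable M (uK u)" by (rule M.integrable_const_bound[where B=B]) (use b m in auto)
  show "AE x in M. abs (uK u x) <= B" using b by simp
 qed
 have bddK: "\<exists>B. \<forall>x\<in>K. abs (u x) <= B" if "continuous_on K u" for u :: "real^'n => real"
 proof -
  have "bounded (u ` K)" using compact_continuous_image[OF that K(1)] by (rule compact_imp_bounded)
  then show ?thesis by (auto simp: bounded_iff)
 qed
 have intK': "integrable M (uK u)" if "continuous_on K u" "M = al \<or> M = be" for u M
  using bddK[OF that(1)] intK(1)[OF that] by blast
 define \<J> where "\<J> u = (LINT x|be. uK u x) + (LINT y|al. uK (conj_on K u) y)" for u
 have conjc: "continuous_on S (conj_on K u)" if "continuous_on K u" for u S
  using convex_on_continuous[OF open_UNIV conj_on_convex[OF K(1,2) that]] continuous_on_subset by blast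
 have uKeq: "AE x in M. uK u x = u x" if "M = al \<or> M = be" for u M using that KAE by (auto simp: uK_def elim: eventually_mono)
 \<comment> \<open>A class that is compact by Arzela-Ascoli. The normalisation at \<open>0\<close>
   is free because equal masses make the functional invariant under constants, and the Lipschitz
   bound is the one that every conjugate over a ball of radius \<open>rho\<close> satisfies.\<close>
 define C where "C = {u. rho-lipschitz_on K u & u 0 = (0::real)}"
 have Cc: "continuous_on K u" if "u \<in> C" for u using that by (auto simp: C_def intro: lipschitz_on_continuous_on)
 have Cb: "abs (u x) <= rho^2" if "u \<in> C" "x \<in> K" for u x
 proof -
  have "abs (u x - u 0) <= rho * norm (x - 0)"
   using that K(4) by (auto simp: C_def lipschitz_on_def dist_norm)
  also have "... <= rho * rho" using Kn[OF that(2)] rho by (intro mult_left_mono) auto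
  finally show ?thesis using that by (simp add: C_def power2_eq_square)
 qed
 have lower: "- rho\<^sup>2 * measure be UNIV <= \<J> u" if u: "u \<in> C" for u
 proof -
  have "- rho\<^sup>2 * measure be UNIV = (LINT x|be. - rho\<^sup>2)" by (simp add: sp)
  also have "... <= (LINT x|be. uK u x)"
   by (rule integral_mono[OF _ intK'[OF Cc[OF u]]]) (use Cb[OF u] in \<open>force simp: uK_def abs_le_iff\<close>)+
  finally have 1: "- rho\<^sup>2 * measure be UNIV <= (LINT x|be. uK u x)" .
  have "0 <= conj_on K u y" for y using conj_on_ge[OF K(1,2) Cc[OF u] K(4), of y] u by (simp add: C_def)
  then have "0 <= (LINT y|al. uK (conj_on K u) y)" by (intro integral_nonneg_AE) (auto simp: uK_def)
  then show ?thesis using 1 by (simp add: \<J>_def)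
 qed
 have C0: "(\<lambda>x. 0) \<in> C" using rho by (auto simp: C_def lipschitz_on_def)
 define m where "m = Inf (\<J> ` C)"
 have bdd: "bdd_below (\<J> ` C)" using lower by (auto intro!: bdd_belowI[of _ "- rho\<^sup>2 * measure be UNIV"])
 have mle: "m <= \<J> u" if "u \<in> C" for u unfolding m_def using that bdd by (intro cInf_lower) auto
 have "\<exists>u\<in>C. \<J> u < m + 1 / Suc k" for k
 proof -
  have "\<exists>z\<in>\<J> ` C. z < m + 1 / Suc k" unfolding m_def
   using C0 by (intro cInf_lessD) auto
  then show ?thesis by auto
 qed
 then obtain U where U: "!!k. U k \<in> C" "!!k. \<J> (U k) < m + 1 / Suc k" by metis
 obtain u r where ur: "continuous_on K u" "strict_mono (r :: nat => nat)"
   "!!e. 0 < e ==> \<exists>N. \<forall>n x. n \<ge> N & x \<in> K --> norm (U (r n) x - u x) < e"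
 proof (rule Arzela_Ascoli[OF K(1), of U "rho^2"])
  show "norm (U n x) <= rho^2" if "x \<in> K" for n x using Cb[OF U(1) that] by simp
  fix x e assume x: "x \<in> K" "0 < (e::real)"
  show "\<exists>d. 0 < d & (\<forall>n y. y \<in> K & norm (x - y) < d --> norm (U n x - U n y) < e)"
  proof (intro exI[of _ "e / rho"] conjI allI impI)
   fix n y assume y: "y \<in> K & norm (x - y) < e / rho"
   have "norm (U n x - U n y) <= rho * norm (x - y)" using U(1)[of n] x y by (auto simp: C_def lipschitz_on_def dist_norm)
   also have "... < e" using y rho by (simp add: field_simps)
   finally show "norm (U n x - U n y) < e" .
  qed (use x rho in auto)
 qed blast
 have pw: "(\<lambda>n. U (r n) x) \<longlonglongrightarrow> u x" if "x \<in> K" for x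
  unfolding LIMSEQ_iff using ur(3) that by meson
 have uC: "u \<in> C"
 proof -
  have "abs (u x - u y) <= rho * norm (x - y)" if "x \<in> K" "y \<in> K" for x y
  proof (rule LIMSEQ_le_const2)
   show "(\<lambda>n. abs (U (r n) x - U (r n) y)) \<longlonglongrightarrow> abs (u x - u y)" using that by (intro tendsto_intros pw)
   show "\<exists>N. \<forall>n\<ge>N. abs (U (r n) x - U (r n) y) <= rho * norm (x - y)"
    using U(1) that by (auto simp: C_def lipschitz_on_def dist_norm)
  qed
  moreover have "u 0 = 0"
  proof -
   have "(\<lambda>n. U (r n) 0) = (\<lambda>n. 0)" using U(1) by (auto simp: C_def)
   then show ?thesis using pw[OF K(4)] by (simp add: LIMSEQ_const_iff)
  qed
  ultimately show ?thesis using rho by (auto simp: C_def lipschitz_on_def dist_norm)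
 qed
 have close: "abs (\<J> v - \<J> v') <= e * (2 * measure be UNIV)"
  if v: "continuous_on K v" "continuous_on K v'" and e: "!!x. x \<in> K ==> abs (v x - v' x) <= e" for v v' e
 proof -
  have e0: "0 <= e" using e[OF K(4)] by simp
  have one: "abs ((LINT x|M. uK f x) - (LINT x|M. uK g x)) <= e * measure M UNIV"
   if M: "M = al \<or> M = be" and fg: "continuous_on K f" "continuous_on K g" and b: "!!x. x \<in> K ==> abs (f x - g x) <= e" for f g M
  proof -
   have fm: "finite_measure M" "space M = UNIV" using M al be sp by auto
   interpret M: finite_measure M by fact
   have "abs ((LINT x|M. uK f x) - (LINT x|M. uK g x)) = abs (\<integral>x. uK f x - uK g x \<partial>M)"
    by (simp add: Bochner_Integration.integral_diff intK'[OF fg(1) M] intK'[OF fg(2) M])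
   also have "... <= (LINT x|M. abs (uK f x - uK g x))" by (rule integral_abs_bound)
   also have "... <= (LINT x|M. e)"
    by (intro integral_mono integrable_abs Bochner_Integration.integrable_diff intK'[OF fg(1) M] intK'[OF fg(2) M])
      (use b e0 in \<open>auto simp: uK_def\<close>)
   also have "... = e * measure M UNIV" by (simp add: fm)
   finally show ?thesis .
  qed
  have a: "abs ((LINT x|be. uK v x) - (LINT x|be. uK v' x)) <= e * measure be UNIV"
   by (rule one) (use v e in auto)
  have b: "abs ((LINT x|al. uK (conj_on K v) x) - (LINT x|al. uK (conj_on K v') x)) <= e * measure al UNIV"
   by (rule one[OF _ conjc[OF v(1)] conjc[OF v(2)]]) (use conj_on_perturb[OF K(1,2) v e] in auto)
  show ?thesis using a b unfolding \<J>_def mass[symmetric] by linarith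
 qed
 have Ju: "\<J> u <= m"
 proof (rule field_le_epsilon)
  fix e :: real assume e: "e > 0"
  define e' where "e' = e / 2 / (2 * measure be UNIV + 1)"
  have den: "2 * measure be UNIV + 1 > 0" using measure_nonneg[of be UNIV] by linarith
  have e': "e' > 0" using e den by (simp add: e'_def)
  obtain N where N: "!!n x. n \<ge> N ==> x \<in> K ==> norm (U (r n) x - u x) < e'" using ur(3)[OF e'] by blast
  obtain k where k: "1 / Suc k < e / 2" using nat_approx_posE[of "e/2"] e by auto
  define n where "n = max N k"
  have "abs (\<J> u - \<J> (U (r n))) <= e' * (2 * measure be UNIV)"
  proof (rule close[OF Cc[OF uC] Cc[OF U(1)]])
   fix x assume "x \<in> K"
   then show "abs (u x - U (r n) x) <= e'" using N[of n x] by (simp add: n_def abs_minus_commute)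
  qed
  also have "... <= e' * (2 * measure be UNIV + 1)" using e' by simp
  also have "... = e / 2" using den unfolding e'_def by (simp only: nonzero_divide_eq_eq less_imp_neq[THEN not_sym] times_divide_eq_left nonzero_mult_div_cancel_right not_False_eq_True)
  finally have "\<J> u <= \<J> (U (r n)) + e / 2" by linarith
  also have "... <= m + 1 / Suc (r n) + e / 2" using U(2)[of "r n"] by simp
  also have "1 / Suc (r n) <= 1 / Suc k"
   using seq_suble[OF ur(2), of n] by (intro divide_left_mono) (auto simp: n_def)
  finally show "\<J> u <= m + e" using k by linarith
 qed
 \<comment> \<open>The minimiser within \<open>C\<close> is a minimiser among all continuous
   functions: the double conjugate of \<open>v\<close> lies below \<open>v\<close> on
   \<open>K\<close>, its conjugate does not exceed that of \<open>v\<close> there, and the shift by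
   \<open>v2 0\<close> is neutral.\<close>
 have opt: "\<J> u <= \<J> v" if v: "continuous_on K v" for v
 proof -
  define v2 where "v2 = conj_on K (conj_on K v)"
  define v3 where "v3 x = v2 x - v2 0" for x
  have cv: "continuous_on K (conj_on K v)" by (rule conjc[OF v])
  have lip: "abs (v2 x - v2 y) <= rho * norm (x - y)" for x y unfolding v2_def by (rule conj_on_lipschitz[OF K(1,2) cv K(3)])
  have v3C: "v3 \<in> C" using lip rho by (auto simp: C_def v3_def lipschitz_on_def dist_norm)
  have v2c: "continuous_on K v2" unfolding v2_def by (rule conjc[OF cv])
  have v2le: "v2 x <= v x" if x: "x \<in> K" for x
   unfolding v2_def
  proof (rule conj_on_le[OF K(1,2) cv])
   fix y assume "y \<in> K"
   show "y \<bullet> x - conj_on K v y <= v x" using conj_on_ge[OF K(1,2) v x, of y] by (simp add: inner_commute)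
  qed
  have cle: "conj_on K v3 y <= conj_on K v y + v2 0" if y: "y \<in> K" for y
  proof (rule conj_on_le[OF K(1,2) Cc[OF v3C]])
   fix x assume "x \<in> K"
   have "y \<bullet> x - conj_on K v y <= v2 x" unfolding v2_def by (rule conj_on_ge[OF K(1,2) cv y])
   then show "x \<bullet> y - v3 x <= conj_on K v y + v2 0" by (simp add: v3_def inner_commute)
  qed
  have "\<J> u <= \<J> v3" using Ju mle[OF v3C] by simp
  also have "\<J> v3 <= ((LINT x|be. uK v x) - v2 0 * measure be UNIV) + ((LINT y|al. uK (conj_on K v) y) + v2 0 * measure al UNIV)"
   unfolding \<J>_def
  proof (rule add_mono)
   have "(LINT x|be. uK v3 x) <= (LINT x|be. uK v x - v2 0)"
    by (intro integral_mono_AE Bochner_Integration.integrable_diff intK' v Cc[OF v3C] be.integrable_const eventually_mono[OF KAE(2)])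
      (use v2le in \<open>auto simp: uK_def v3_def\<close>)
   also have "... = (LINT x|be. uK v x) - v2 0 * measure be UNIV"
    by (subst Bochner_Integration.integral_diff) (auto intro: intK' v simp: sp)
   finally show "(LINT x|be. uK v3 x) <= (LINT x|be. uK v x) - v2 0 * measure be UNIV" .
   have "(LINT y|al. uK (conj_on K v3) y) <= (LINT y|al. uK (conj_on K v) y + v2 0)"
    by (intro integral_mono_AE Bochner_Integration.integrable_add intK' conjc v Cc[OF v3C] al.integrable_const eventually_mono[OF KAE(1)])
      (use cle in \<open>auto simp: uK_def\<close>)
   also have "... = (LINT y|al. uK (conj_on K v) y) + v2 0 * measure al UNIV"
    by (subst Bochner_Integration.integral_add) (auto intro: intK' conjc v simp: sp)
   finally show "(LINT y|al. uK (conj_on K v3) y) <= (LINT y|al. uK (conj_on K v) y) + v2 0 * measure al UNIV" .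
  qed
  also have "... = \<J> v" by (simp add: \<J>_def mass)
  finally show ?thesis .
 qed
 have uc: "continuous_on K u" by fact
 define w where "w = conj_on K u"
 define u2 where "u2 = conj_on K w"
 have wc: "convex_on UNIV w" unfolding w_def by (rule conj_on_convex[OF K(1,2) uc])
 have wcont: "continuous_on S w" for S unfolding w_def by (rule conjc[OF uc])
 have u2c: "convex_on UNIV u2" unfolding u2_def by (rule conj_on_convex[OF K(1,2) wcont])
 have AEl: "AE y in al. P y" if "AE y in lborel. P y" for P
 proof -
  obtain N where "{y \<in> space lborel. \<not> P y} \<subseteq> N" "emeasure lborel N = 0" "N \<in> sets lborel"
   using \<open>AE y in lborel. P y\<close> by (rule AE_E)
  then have "N \<in> null_sets al" using ac by (auto simp: null_sets_def)
  then show ?thesis by (rule AE_I') (use \<open>{y \<in> space lborel. \<not> P y} \<subseteq> N\<close> in \<open>auto simp: sp\<close>)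
 qed
 have gw: "AE y in al. subgrad w y = {cgrad w y}" by (rule AEl[OF cgrad_ae[OF wc]])
 have maxi: "x = cgrad w y" if "subgrad w y = {cgrad w y}" "x \<in> K" "w y = x \<bullet> y - u x" for x y
  using conj_on_maximizer_subgrad[OF K(1,2) uc that(2), of y] that by (auto simp: w_def)
 have att: "cgrad w y \<in> K & w y = cgrad w y \<bullet> y - u (cgrad w y)" if "subgrad w y = {cgrad w y}" for y
  using conj_on_attained[OF K(1,2) uc, of y] maxi[OF that] by (fold w_def) blast
 have good: "AE y in al. subgrad w y = {cgrad w y} & cgrad w y \<in> cball 0 rho & y \<in> subgrad u2 (cgrad w y) & w y + u2 (cgrad w y) = cgrad w y \<bullet> y"
  using gw KAE(1)
 proof eventually_elim
  case (elim y)
  let ?x = "cgrad w y"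
  have x: "?x \<in> K" "w y = ?x \<bullet> y - u ?x" using att[OF elim(1)] by auto
  have 1: "y \<bullet> ?x - w y <= u2 ?x" unfolding u2_def by (rule conj_on_ge[OF K(1,2) wcont elim(2)])
  have 2: "u2 ?x <= u ?x" unfolding u2_def
  proof (rule conj_on_le[OF K(1,2) wcont])
   fix y' assume "y' \<in> K"
   show "y' \<bullet> ?x - w y' <= u ?x" using conj_on_ge[OF K(1,2) uc x(1), of y'] by (simp add: w_def inner_commute)
  qed
  have eq: "w y + u2 ?x = ?x \<bullet> y" using 1 2 x(2) by (simp add: inner_commute)
  have "y \<in> subgrad u2 ?x" unfolding u2_def
   by (rule conj_on_maximizer_subgrad[OF K(1,2) wcont elim(2)]) (use eq in \<open>simp add: u2_def inner_commute\<close>)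
  then show ?case using elim(1) x(1) eq by (simp add: K_def)
 qed
 have [measurable]: "cgrad w \<in> BM" by (rule cgrad_measurable[OF wc])
 \<comment> \<open>First variation in the direction \<open>phi\<close>. For almost every
   \<open>y\<close> the maximiser in the conjugate is unique, so the maximisers of the perturbed
   problems converge to it and the conjugate changes at the rate
   \<open>- phi (cgrad w y)\<close>.\<close>
 have var: "0 <= (LINT x|be. phi x) - (LINT y|al. phi (cgrad w y))" if phi: "continuous_on UNIV phi" "!!x. abs (phi x) <= B" for phi :: "real^'n => real" and B
 proof -
  have [measurable]: "phi \<in> BM" using phi(1) by (rule borel_measurable_continuous_onI)
  have phiK: "continuous_on K phi" using phi(1) continuous_on_subset by blast
  define eps where "eps k = 1 / real (Suc k)" for k
  have eps: "eps k > 0" for k by (simp add: eps_def)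
  have eps0: "eps \<longlonglongrightarrow> 0" unfolding eps_def by (rule LIMSEQ_Suc[OF lim_1_over_n])
  define v where "v k x = u x + eps k * phi x" for k x
  have vc: "continuous_on K (v k)" for k unfolding v_def by (intro continuous_intros uc phiK)
  define W where "W k = conj_on K (v k)" for k
  define Q where "Q k y = (uK (W k) y - uK w y) / eps k" for k y
  have Qb: "abs (Q k y) <= B" for k y
  proof (cases "y \<in> K")
   case True
   have "abs (W k y - w y) <= eps k * B" unfolding W_def w_def
    by (rule conj_on_perturb[OF K(1,2) vc uc]) (use phi(2) eps[of k] in \<open>auto simp: v_def abs_mult\<close>)
   then show ?thesis using True eps[of k] by (simp add: Q_def uK_def field_simps)
  next
   case False
   have "0 <= B" using phi(2)[of 0] by simp
   then show ?thesis using False by (simp add: Q_def uK_def)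
  qed
  have Qm: "Q k \<in> borel_measurable al" for k unfolding Q_def W_def w_def
   using intK'[OF conjc[OF vc[of k]], of al] intK'[OF conjc[OF uc], of al]
   by (intro borel_measurable_divide borel_measurable_diff) (auto dest: borel_measurable_integrable)
  have Qlim: "AE y in al. (\<lambda>k. Q k y) \<longlonglongrightarrow> - phi (cgrad w y)"
   using gw KAE(1)
  proof eventually_elim
   case (elim y)
   let ?p = "cgrad w y"
   have p: "?p \<in> K" "w y = ?p \<bullet> y - u ?p" using att[OF elim(1)] by auto
   have "\<forall>k. \<exists>x\<in>K. W k y = x \<bullet> y - v k x" unfolding W_def using conj_on_attained[OF K(1,2) vc] by blast
   then obtain x where x: "!!k. x k \<in> K" "!!k. W k y = x k \<bullet> y - v k (x k)" by metis
   \<comment> \<open>The deficit of \<open>z\<close> as a maximiser. On \<open>K\<close> it is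
     nonnegative and vanishes only at \<open>?p\<close>, so by compactness it is bounded below away
     from \<open>?p\<close>.\<close>
   define h where "h z = w y - (z \<bullet> y - u z)" for z
   have hc: "continuous_on K h" unfolding h_def by (intro continuous_intros uc)
   have h0: "0 <= h z" if "z \<in> K" for z using conj_on_ge[OF K(1,2) uc that, of y] by (simp add: h_def w_def)
   have low: "w y - eps k * phi ?p <= W k y" for k
    using conj_on_ge[OF K(1,2) vc p(1), of y k] p(2) by (simp add: W_def v_def)
   have up: "W k y <= w y - eps k * phi (x k)" for k using x(2)[of k] h0[OF x(1)[of k]] by (simp add: v_def h_def)
   have hx: "h (x k) <= 2 * B * eps k" for k
   proof -
    have "h (x k) = w y - W k y - eps k * phi (x k)" using x(2)[of k] by (simp add: h_def v_def)
    also have "... <= eps k * (phi ?p - phi (x k))" using low[of k] by (simp add: algebra_simps)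
    also have "... <= eps k * (2 * B)" using eps[of k] phi(2)[of ?p] phi(2)[of "x k"] by (intro mult_left_mono) (auto simp: abs_le_iff)
    finally show ?thesis by (simp add: mult_ac)
   qed
   have hx0: "(\<lambda>k. 2 * B * eps k) \<longlonglongrightarrow> 2 * B * 0" by (intro tendsto_intros eps0)
   have "x \<longlonglongrightarrow> ?p"
   proof (rule ccontr)
    assume "\<not> x \<longlonglongrightarrow> ?p"
    then obtain d where d: "d > 0" "\<exists>\<^sub>F k in sequentially. d <= dist (x k) ?p"
     by (auto simp: tendsto_iff frequently_def not_le)
    have "\<exists>c>0. \<forall>z\<in>K - ball ?p d. c <= h z"
    proof (cases "K - ball ?p d = {}")
     case False
     have "compact (K - ball ?p d)" using K(1) by (simp add: compact_diff)
     then obtain z0 where z0: "z0 \<in> K - ball ?p d" "!!z. z \<in> K - ball ?p d ==> h z0 <= h z"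
      using continuous_attains_inf[OF _ False continuous_on_subset[OF hc]] by (metis Diff_subset)
     have "h z0 ~= 0"
     proof
      assume "h z0 = 0"
      then have "z0 = ?p" using maxi[OF elim(1), of z0] z0(1) by (simp add: h_def)
      then show False using z0(1) d(1) by simp
     qed
     then have "h z0 > 0" using h0 z0(1) by (simp add: order_less_le)
     then show ?thesis using z0(2) by blast
    qed (auto intro: exI[of _ 1])
    then obtain c where c: "c > 0" "!!z. z \<in> K - ball ?p d ==> c <= h z" by blast
    have "\<forall>\<^sub>F k in sequentially. 2 * B * eps k < c" using hx0 c(1) by (intro order_tendstoD) auto
    with d(2) obtain k where k: "d <= dist (x k) ?p" "2 * B * eps k < c"
     by (metis (mono_tags, lifting) eventually_frequently_simps(1) frequently_ex frequently_eventually_frequently)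
    have "c <= h (x k)" using k(1) x(1)[of k] by (intro c(2)) (auto simp: dist_commute)
    then show False using hx[of k] k(2) by simp
   qed
   then have "(\<lambda>k. phi (x k)) \<longlonglongrightarrow> phi ?p" by (rule continuous_on_tendsto_compose[OF phi(1)]) auto
   then have lim: "(\<lambda>k. - phi (x k)) \<longlonglongrightarrow> - phi ?p" by (intro tendsto_intros)
   have Qy: "Q k y = (W k y - w y) / eps k" for k using elim(2) by (simp add: Q_def uK_def)
   show "(\<lambda>k. Q k y) \<longlonglongrightarrow> - phi ?p"
   proof (rule tendsto_sandwich[OF _ _ tendsto_const lim])
    have "- phi ?p <= Q k y" for k using low[of k] eps[of k] by (simp add: Qy pos_le_divide_eq algebra_simps)
    then show "\<forall>\<^sub>F k in sequentially. - phi ?p <= Q k y" by (rule eventuallyI)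
    have "Q k y <= - phi (x k)" for k using up[of k] eps[of k] by (simp add: Qy pos_divide_le_eq algebra_simps)
    then show "\<forall>\<^sub>F k in sequentially. Q k y <= - phi (x k)" by (rule eventuallyI)
   qed
  qed
  have "(\<lambda>k. \<integral>y. Q k y \<partial>al) \<longlonglongrightarrow> (LINT y|al. - phi (cgrad w y))"
   by (rule integral_dominated_convergence[where w="\<lambda>_. B"]) (use Qlim Qb Qm in auto)
  then have lim: "(\<lambda>k. (LINT x|be. phi x) + (LINT y|al. Q k y)) \<longlonglongrightarrow> (LINT x|be. phi x) + (LINT y|al. - phi (cgrad w y))"
   by (intro tendsto_intros)
  have "0 <= (LINT x|be. phi x) + (LINT y|al. Q k y)" for k
  proof -
   have "0 <= \<J> (v k) - \<J> u" using opt[OF vc[of k]] by simp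
   also have "\<J> (v k) - \<J> u = ((LINT x|be. uK (v k) x) - (LINT x|be. uK u x)) + ((LINT y|al. uK (W k) y) - (LINT y|al. uK w y))"
    by (simp add: \<J>_def W_def w_def)
   also have "(LINT x|be. uK (v k) x) - (LINT x|be. uK u x) = (LINT x|be. uK (v k) x - uK u x)"
    by (intro Bochner_Integration.integral_diff[symmetric] intK' vc uc) auto
   also have "... = (LINT x|be. eps k * phi x)"
   proof (rule integral_cong_AE)
    show "(\<lambda>x. uK (v k) x - uK u x) \<in> borel_measurable be"
     using intK'[OF vc[of k], of be] intK'[OF uc, of be] by (intro borel_measurable_diff borel_measurable_integrable) auto
    show "AE x in be. uK (v k) x - uK u x = eps k * phi x" using KAE(2) by eventually_elim (simp add: uK_def v_def)
   qed measurable
   also have "... = eps k * (LINT x|be. phi x)" by simp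
   also have "(LINT y|al. uK (W k) y) - (LINT y|al. uK w y) = (LINT y|al. uK (W k) y - uK w y)"
    unfolding W_def w_def by (intro Bochner_Integration.integral_diff[symmetric] intK' conjc vc uc) auto
   also have "... = (LINT y|al. eps k * Q k y)" using eps[of k] by (simp add: Q_def)
   also have "... = eps k * (LINT y|al. Q k y)" by simp
   finally have "0 <= eps k * ((LINT x|be. phi x) + (LINT y|al. Q k y))" by (simp add: algebra_simps)
   then show ?thesis using eps[of k] by (simp add: zero_le_mult_iff)
  qed
  then have "0 <= (LINT x|be. phi x) + (LINT y|al. - phi (cgrad w y))" using lim by (intro LIMSEQ_le_const[OF lim]) auto
  then show ?thesis by simp
 qed
 have "distr al borel (cgrad w) = be"
 proof (rule finite_borel_measure_eqI)
  show "finite_measure (distr al borel (cgrad w))" by (rule al.finite_measure_distr) simp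
  fix f :: "real^'n => real" and B assume f: "continuous_on UNIV f" "!!x. abs (f x) <= B"
  have [measurable]: "f \<in> BM" using f(1) by (rule borel_measurable_continuous_onI)
  have "(LINT x|be. f x) = (LINT y|al. f (cgrad w y))"
   using var[OF f] var[of "\<lambda>x. - f x" B] f by (auto intro!: continuous_intros)
  then show "(\<integral>x. f x \<partial>distr al borel (cgrad w)) = (LINT x|be. f x)" by (simp add: integral_distr)
 qed (use be in auto)
 moreover have "x \<bullet> y <= w y + u2 x" if "x \<in> cball 0 rho" "y \<in> cball 0 rho" for x y
  using conj_on_ge[OF K(1,2) wcont, of y x] that by (simp add: u2_def K_def inner_commute)
 ultimately show ?thesis using that wc u2c good by blast
qed

section \<open>Symmetric maps, determinants and square-integrable functions\<close>

definition sym_map :: "('a::euclidean_space => 'a) => bool" where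
 "sym_map L \<longleftrightarrow> linear L & (\<forall>h k. L h \<bullet> k = h \<bullet> L k)"

lemma quadratic_discriminant_le:
 fixes A B C :: real
 assumes q: "!!x. 0 <= A + 2 * x * B + x^2 * C"
 shows "B^2 <= A * C" and "0 <= C"
proof -
 have A: "0 <= A" using q[of 0] by simp
 show C: "0 <= C"
 proof (rule ccontr)
  assume "\<not> 0 <= C"
  then have C: "C < 0" by simp
  define x where "x = sqrt ((A + 1) / - C)"
  have "x^2 = (A + 1) / - C" using A C unfolding x_def by (intro real_sqrt_pow2) (simp add: divide_nonneg_neg)
  then have "x^2 * C = - (A + 1)" using C by simp
  then show False using q[of x] q[of "- x"] by simp
 qed
 show "B^2 <= A * C"
 proof (cases "C = 0")
  case True
  have "B = 0"
  proof (rule ccontr)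
   assume "B ~= 0"
   then show False using q[of "- (A + 1) / (2 * B)"] True by (simp add: field_simps)
  qed
  then show ?thesis using True by simp
 next
  case False
  then have "0 < C" using C by simp
  then show ?thesis using q[of "- B / C"] by (simp add: power2_eq_square field_simps)
 qed
qed

lemma integral_Cauchy_Schwarz:
 fixes f g :: "'a => real"
 assumes [measurable]: "f \<in> borel_measurable M" "g \<in> borel_measurable M"
  and f: "integrable M (\<lambda>x. (f x)^2)" and g: "integrable M (\<lambda>x. (g x)^2)"
 shows "integrable M (\<lambda>x. f x * g x)"
  and "(LINT x|M. f x * g x)^2 <= (LINT x|M. (f x)^2) * (LINT x|M. (g x)^2)"
proof -
 show fg: "integrable M (\<lambda>x. f x * g x)"
 proof (rule Bochner_Integration.integrable_bound)
  show "integrable M (\<lambda>x. (f x)^2 + (g x)^2)" using f g by simp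
  have "abs (a * b) <= a^2 + b^2" for a b :: real
  proof -
   have "0 <= abs a * abs b" by simp
   then show ?thesis using sum_squares_bound[of "abs a" "abs b"] unfolding abs_mult power2_abs by linarith
  qed
  then show "AE x in M. norm (f x * g x) <= norm ((f x)^2 + (g x)^2)" by simp
 qed measurable
 define A where "A = (LINT x|M. (f x)^2)"
 define B where "B = (LINT x|M. f x * g x)"
 define C where "C = (LINT x|M. (g x)^2)"
 have "0 <= A + 2 * x * B + x^2 * C" for x
 proof -
  have "0 <= (LINT y|M. (f y + x * g y)^2)" by (rule Bochner_Integration.integral_nonneg) simp
  also have "(\<lambda>y. (f y + x * g y)^2) = (\<lambda>y. (f y)^2 + 2 * x * (f y * g y) + x^2 * (g y)^2)"
   by (simp add: power2_eq_square algebra_simps)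
  also have "(LINT y|M. (f y)^2 + 2 * x * (f y * g y) + x^2 * (g y)^2) = A + 2 * x * B + x^2 * C"
   using f g fg by (simp add: A_def B_def C_def)
  finally show ?thesis .
 qed
 from quadratic_discriminant_le(1)[OF this]
 show "(LINT x|M. f x * g x)^2 <= (LINT x|M. (f x)^2) * (LINT x|M. (g x)^2)" by (simp add: A_def B_def C_def)
qed

lemma integrable_square_imp:
 fixes g :: "'b => 'a::euclidean_space"
 assumes mu: "prob_space mu" and [measurable]: "g \<in> borel_measurable mu" and "integrable mu (\<lambda>x. (norm (g x))^2)"
 shows "integrable mu g" "(norm (LINT x|mu. g x))^2 <= (LINT x|mu. (norm (g x))^2)"
proof -
 interpret prob_space mu by fact
 have n: "integrable mu (\<lambda>x. norm (g x))" using square_integrable_imp_integrable[of "\<lambda>x. norm (g x)"] assms(3) by simp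
 then show "integrable mu g" by (subst (asm) integrable_norm_iff) auto
 have "(LINT x|mu. 1 * norm (g x))^2 <= (LINT x|mu. 1^2) * (LINT x|mu. (norm (g x))^2)"
  by (rule integral_Cauchy_Schwarz(2)) (use assms(3) in auto)
 then have "(LINT x|mu. norm (g x))^2 <= (LINT x|mu. (norm (g x))^2)" using prob_space by simp
 moreover have "(norm (LINT x|mu. g x))^2 <= (LINT x|mu. norm (g x))^2" by (intro power_mono integral_norm_bound) auto
 ultimately show "(norm (LINT x|mu. g x))^2 <= (LINT x|mu. (norm (g x))^2)" by linarith
qed

lemma variance_zero_AE:
 fixes g :: "'b => 'a::euclidean_space"
 assumes mu: "prob_space mu" and [measurable]: "g \<in> borel_measurable mu" and g2: "integrable mu (\<lambda>x. (norm (g x))^2)"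
  and eq: "(LINT x|mu. (norm (g x))^2) = (norm (LINT x|mu. g x))^2"
 shows "AE x in mu. g x = (LINT x|mu. g x)"
proof -
 interpret prob_space mu by fact
 define m where "m = (LINT x|mu. g x)"
 have i: "integrable mu g" by (rule integrable_square_imp(1)[OF mu _ g2]) simp
 have n: "(norm (g x - m))^2 = (norm (g x))^2 - 2 * (g x \<bullet> m) + (norm m)^2" for x
  by (simp add: power2_norm_eq_inner inner_diff_left inner_diff_right inner_commute)
 have ii: "integrable mu (\<lambda>x. (norm (g x - m))^2)" unfolding n using g2 i by simp
 have "(LINT x|mu. (norm (g x - m))^2) = 0"
  unfolding n using g2 i eq by (simp add: m_def[symmetric] prob_space power2_norm_eq_inner)
 then show ?thesis using integral_nonneg_eq_0_iff_AE[OF ii] by (simp add: m_def)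
qed

lemma integrable_norm_add_sq:
 fixes f g :: "'b => 'a::euclidean_space"
 assumes [measurable]: "f \<in> borel_measurable M" "g \<in> borel_measurable M"
  and "integrable M (\<lambda>x. (norm (f x))^2)" "integrable M (\<lambda>x. (norm (g x))^2)"
 shows "integrable M (\<lambda>x. (norm (f x + g x))^2)" "integrable M (\<lambda>x. (norm (f x - g x))^2)" "integrable M (\<lambda>x. f x \<bullet> g x)"
proof -
 have p: "(norm (x + y))^2 + (norm (x - y))^2 = 2 * ((norm x)^2 + (norm y)^2)" for x y :: 'a
  by (simp add: power2_norm_eq_inner inner_add_left inner_add_right inner_diff_left inner_diff_right)
 have i: "integrable M (\<lambda>x. 2 * ((norm (f x))^2 + (norm (g x))^2))" using assms(3,4) by simp
 have le: "(norm (x + y))^2 <= 2 * ((norm x)^2 + (norm y)^2)" "(norm (x - y))^2 <= 2 * ((norm x)^2 + (norm y)^2)" for x y :: 'a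
  unfolding p[symmetric] by simp_all
 show a: "integrable M (\<lambda>x. (norm (f x + g x))^2)" "integrable M (\<lambda>x. (norm (f x - g x))^2)"
  by (rule Bochner_Integration.integrable_bound[OF i]; use le in simp)+
 have e: "x \<bullet> y = ((norm (x + y))^2 - (norm (x - y))^2) / 4" for x y :: 'a
  by (simp add: power2_norm_eq_inner inner_add_left inner_add_right inner_diff_left inner_diff_right inner_commute)
 show "integrable M (\<lambda>x. f x \<bullet> g x)" unfolding e using a by simp
qed

text \<open>A nonnegative quadratic polynomial without constant term has no linear term.\<close>

lemma psd_form_kernel:
 fixes N :: "'a::euclidean_space => 'a"
 assumes "linear N" "!!h k. N h \<bullet> k = h \<bullet> N k" "subspace S" "!!h. h \<in> S ==> 0 <= N h \<bullet> h"
  and x: "x \<in> S" "N x \<bullet> x = 0" and h: "h \<in> S"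
 shows "N x \<bullet> h = 0"
proof -
 have "0 <= 0 + 2 * t * (N x \<bullet> h) + t^2 * (N h \<bullet> h)" for t
 proof -
  have "x + t *\<^sub>R h \<in> S" using x h assms(3) by (simp add: subspace_add subspace_scale)
  then have "0 <= N (x + t *\<^sub>R h) \<bullet> (x + t *\<^sub>R h)" by (rule assms(4))
  also have "... = 0 + 2 * t * (N x \<bullet> h) + t^2 * (N h \<bullet> h)"
   using assms(2)[of h x] x(2) by (simp add: linear_add[OF assms(1)] linear_scale[OF assms(1)] inner_simps inner_commute power2_eq_square algebra_simps)
  finally show ?thesis .
 qed
 from quadratic_discriminant_le(1)[OF this] show ?thesis by simp
qed

text \<open>A maximiser \<open>x\<close> of the Rayleigh quotient on the unit sphere of
  \<open>S\<close> is a zero of the nonnegative form of \<open>mu\<close> minus \<open>L\<close>,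
  hence an eigenvector by \<open>psd_form_kernel\<close>. Its orthogonal complement in
  \<open>S\<close> is invariant, and induction on the dimension does the rest.\<close>

lemma spectral_subspace:
 fixes L :: "'a::euclidean_space => 'a"
 assumes "sym_map L" "subspace S" "L ` S \<subseteq> S"
 shows "\<exists>B. B \<subseteq> S & finite B & pairwise orthogonal B & (\<forall>b\<in>B. norm b = 1) & (\<forall>b\<in>B. \<exists>mu. L b = mu *\<^sub>R b) & S \<subseteq> span B"
 using assms(2,3)
proof (induction "dim S" arbitrary: S rule: less_induct)
 case less
 have lin: "linear L" and sym: "!!h k. L h \<bullet> k = h \<bullet> L k" using assms(1) by (auto simp: sym_map_def)
 show ?case
 proof (cases "S = {0}")
  case True
  then show ?thesis by (intro exI[of _ "{}"]) auto
 next
  case False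
  then obtain y where y: "y \<in> S" "y ~= 0" using less.prems(1) subspace_0 by blast
  let ?K = "S \<inter> sphere 0 1"
  have c1: "compact ?K" using closed_subspace[OF less.prems(1)] by (intro closed_Int_compact) auto
  have "(1 / norm y) *\<^sub>R y \<in> ?K" using y less.prems(1) by (auto simp: subspace_scale)
  then have c2: "?K ~= {}" by blast
  have c3: "continuous_on ?K (\<lambda>x. L x \<bullet> x)"
   using linear_continuous_on[of L] lin by (intro continuous_intros) (auto simp: linear_conv_bounded_linear)
  obtain x where x: "x \<in> ?K" "!!z. z \<in> ?K ==> L z \<bullet> z <= L x \<bullet> x"
   using continuous_attains_sup[OF c1 c2 c3] by blast
  define mu where "mu = L x \<bullet> x"
  have x': "x \<in> S" "norm x = 1" using x(1) by auto
  have le: "L h \<bullet> h <= mu * (h \<bullet> h)" if "h \<in> S" for h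
  proof (cases "h = 0")
   case False
   have "(1 / norm h) *\<^sub>R h \<in> ?K" using False that less.prems(1) by (auto simp: subspace_scale)
   then have "L ((1 / norm h) *\<^sub>R h) \<bullet> ((1 / norm h) *\<^sub>R h) <= mu" unfolding mu_def by (rule x(2))
   then have "(L h \<bullet> h) / (norm h)^2 <= mu" by (simp add: linear_scale[OF lin] power2_eq_square)
   then show ?thesis using False by (simp add: power2_norm_eq_inner divide_le_eq)
  qed (simp add: linear_0[OF lin])
  define N where "N h = mu *\<^sub>R h - L h" for h
  have Nl: "linear N" unfolding N_def using lin by (intro linear_compose_sub linear_compose_scale_right linear_id[unfolded id_def]) 
  have NS: "N x \<in> S" unfolding N_def using x'(1) less.prems by (auto intro!: subspace_diff subspace_scale)
  have "N x \<bullet> N x = 0"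
  proof (rule psd_form_kernel[OF Nl _ less.prems(1) _ x'(1) _ NS])
   show "N h \<bullet> k = h \<bullet> N k" for h k by (simp add: N_def inner_simps sym)
   show "0 <= N h \<bullet> h" if "h \<in> S" for h using le[OF that] by (simp add: N_def inner_simps)
   show "N x \<bullet> x = 0" using x'(2) by (simp add: N_def inner_simps mu_def norm_eq_1)
  qed
  then have eig: "L x = mu *\<^sub>R x" by (simp add: N_def)
  define S' where "S' = {h \<in> S. h \<bullet> x = 0}"
  have S': "subspace S'" using less.prems(1) unfolding S'_def subspace_def by (auto simp: inner_simps)
  have LS': "L ` S' \<subseteq> S'" using less.prems(2) by (auto simp: S'_def sym eig)
  have "x \<notin> S'" using x'(2) by (auto simp: S'_def norm_eq_1)
  then have "S' \<subset> S" using x'(1) unfolding S'_def by blast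
  moreover have "span S' = S'" "span S = S" using S' less.prems(1) by (simp_all only: span_eq_iff)
  ultimately have "dim S' < dim S" by (metis dim_psubset)
  from less.hyps[OF this S' LS'] obtain B where B: "B \<subseteq> S'" "finite B" "pairwise orthogonal B" "\<forall>b\<in>B. norm b = 1"
   "\<forall>b\<in>B. \<exists>mu. L b = mu *\<^sub>R b" "S' \<subseteq> span B" by blast
  have "S \<subseteq> span (insert x B)"
  proof
   fix h assume h: "h \<in> S"
   have "h - (h \<bullet> x) *\<^sub>R x \<in> S'" using h x' less.prems(1)
    by (auto simp: S'_def inner_simps norm_eq_1 intro!: subspace_diff subspace_scale)
   then have "h - (h \<bullet> x) *\<^sub>R x \<in> span (insert x B)" using B(6) by (meson span_mono subset_insertI subsetD)
   moreover have "(h \<bullet> x) *\<^sub>R x \<in> span (insert x B)" by (intro span_scale span_base) simp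
   ultimately have "(h - (h \<bullet> x) *\<^sub>R x) + (h \<bullet> x) *\<^sub>R x \<in> span (insert x B)" by (rule span_add)
   then show "h \<in> span (insert x B)" by simp
  qed
  moreover have "pairwise orthogonal (insert x B)"
   using B(1,3) by (auto simp: pairwise_insert S'_def orthogonal_def inner_commute)
  ultimately show ?thesis using B x' eig S'_def by (intro exI[of _ "insert x B"]) auto
 qed
qed

theorem spectral_theorem:
 fixes L :: "real^'n => real^'n"
 assumes "sym_map L"
 obtains e :: "'n => real^'n" and mu :: "'n => real"
 where "!!i j. e i \<bullet> e j = (if i = j then 1 else 0)" "!!i. L (e i) = mu i *\<^sub>R e i"
proof -
 obtain B where B: "finite B" "pairwise orthogonal B" "\<forall>b\<in>B. norm b = 1" "\<forall>b\<in>B. \<exists>mu. L b = mu *\<^sub>R b" "UNIV \<subseteq> span B"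
  using spectral_subspace[OF assms subspace_UNIV] by blast
 have "0 \<notin> B" using B(3) by auto
 then have "independent B" using B(2) pairwise_orthogonal_independent by blast
 then have "card B = dim (span B)" by (simp add: dim_eq_card_independent)
 then have "card B = CARD('n)" using B(5) by (metis UNIV_I dim_UNIV DIM_cart DIM_real mult.right_neutral top.extremum_uniqueI)
 then obtain e where e: "bij_betw e (UNIV :: 'n set) B" using finite_same_card_bij[of "UNIV :: 'n set" B] B(1) by auto
 then have eB: "e i \<in> B" for i by (auto simp: bij_betw_def)
 have "\<forall>i. \<exists>mu. L (e i) = mu *\<^sub>R e i" using eB B(4) by blast
 then obtain mu where mu: "!!i. L (e i) = mu i *\<^sub>R e i" by metis
 have "e i \<bullet> e j = (if i = j then 1 else 0)" for i j
 proof (cases "i = j")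
  case True then show ?thesis using eB[of i] B(3) by (simp add: norm_eq_1)
 next
  case False
  then have "e i ~= e j" using e by (auto simp: bij_betw_def inj_on_def)
  then show ?thesis using B(2) eB False by (auto simp: pairwise_def orthogonal_def)
 qed
 then show ?thesis using that mu by blast
qed

lemma orthonormal_expand:
 fixes e :: "'n => real^'n"
 assumes e: "!!i j. e i \<bullet> e j = (if i = j then 1 else 0)"
 shows "x = (\<Sum>i\<in>UNIV. (x \<bullet> e i) *\<^sub>R e i)"
proof -
 have inj: "inj e"
 proof (rule injI)
  fix i j assume "e i = e j"
  then show "i = j" using e[of i j] e[of i i] by (auto split: if_splits)
 qed
 have "pairwise orthogonal (range e)" using e by (auto simp: pairwise_def orthogonal_def split: if_splits)
 moreover have "0 \<notin> range e" using e by (metis imageE inner_zero_left zero_neq_one)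
 ultimately have ind: "independent (range e)" by (rule pairwise_orthogonal_independent)
 have "card (range e) = CARD('n)" using inj by (simp add: card_image)
 then have "span (range e) = UNIV"
  using ind dim_eq_full[of "range e"] by (simp add: dim_eq_card_independent)
 define y where "y = x - (\<Sum>i\<in>UNIV. (x \<bullet> e i) *\<^sub>R e i)"
 have "y \<bullet> e j = 0" for j by (simp add: y_def inner_diff_left inner_sum_left e if_distrib cong: if_cong)
 then have "orthogonal y z" if "z \<in> range e" for z using that by (auto simp: orthogonal_def)
 then have "orthogonal y y" using orthogonal_to_span[of y "range e" y] \<open>span (range e) = UNIV\<close> by (metis UNIV_I orthogonal_commute)
 then show ?thesis by (simp add: y_def orthogonal_def)
qed

text \<open>Expanding the standard vectors in the basis \<open>e\<close>, exchanging the sums and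
  contracting back moves the trace to the basis \<open>e\<close>; with eigenvectors it becomes a sum
  of eigenvalues.\<close>

lemma trace_orthonormal:
 fixes e :: "'n => real^'n"
 assumes e: "!!i j. e i \<bullet> e j = (if i = j then 1 else 0)" and M: "linear M"
 shows "(\<Sum>b\<in>Basis. M b \<bullet> b) = (\<Sum>i\<in>UNIV. M (e i) \<bullet> e i)"
proof -
 have "(\<Sum>b\<in>Basis. M b \<bullet> b) = (\<Sum>b\<in>Basis. \<Sum>i\<in>UNIV. (M b \<bullet> e i) * (b \<bullet> e i))"
 proof (rule sum.cong[OF refl])
  fix b :: "real^'n" assume "b \<in> Basis"
  have "M b \<bullet> b = M b \<bullet> (\<Sum>i\<in>UNIV. (b \<bullet> e i) *\<^sub>R e i)" using orthonormal_expand[OF e, of b] by simp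
  then show "M b \<bullet> b = (\<Sum>i\<in>UNIV. (M b \<bullet> e i) * (b \<bullet> e i))" by (simp add: inner_sum_right mult.commute)
 qed
 also have "... = (\<Sum>i\<in>UNIV. \<Sum>b\<in>Basis. (b \<bullet> e i) * (M b \<bullet> e i))" by (subst sum.swap) (simp add: mult.commute)
 also have "... = (\<Sum>i\<in>UNIV. M (e i) \<bullet> e i)"
 proof (rule sum.cong[OF refl])
  fix i
  have "M (e i) = M (\<Sum>b\<in>Basis. (e i \<bullet> b) *\<^sub>R b)" by (simp add: euclidean_representation)
  also have "... = (\<Sum>b\<in>Basis. (e i \<bullet> b) *\<^sub>R M b)" by (simp add: linear_sum[OF M] linear_scale[OF M])
  finally show "(\<Sum>b\<in>Basis. (b \<bullet> e i) * (M b \<bullet> e i)) = M (e i) \<bullet> e i"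
   by (simp add: inner_sum_right inner_commute)
 qed
 finally show ?thesis .
qed

abbreviation ldet :: "(real^'n => real^'n) => real" where
 "ldet L \<equiv> det (matrix L)"

lemma ldet_compose: "linear L ==> linear M ==> ldet (\<lambda>x. L (M x)) = ldet L * ldet M"
 using matrix_compose[of M L] by (simp add: det_mul comp_def)

lemma ldet_eigen:
 fixes e :: "'n => real^'n"
 assumes e: "!!i j. e i \<bullet> e j = (if i = j then 1 else 0)" and L: "linear L" "!!i. L (e i) = mu i *\<^sub>R e i"
 shows "ldet L = (\<Prod>i\<in>UNIV. mu i)"
proof -
 define Q where "Q = (\<chi> a b. e b $ a)"
 define D where "D = (\<chi> a b. if a = b then mu a else 0)"
 have QQ: "transpose Q ** Q = mat 1"
  using e by (simp add: Q_def transpose_def matrix_matrix_mult_def mat_def vec_eq_iff inner_vec_def)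
 then have "det Q * det Q = 1" by (metis det_I det_mul det_transpose)
 then have dQ: "det Q ~= 0" by auto
 have LQ: "matrix L ** Q = Q ** D"
 proof -
  have "column b (matrix L ** Q) = column b (Q ** D)" for b
  proof -
   have "column b (matrix L ** Q) = matrix L *v (column b Q)"
    by (simp add: column_def matrix_matrix_mult_def matrix_vector_mult_def vec_eq_iff)
   also have "column b Q = e b" by (simp add: column_def Q_def vec_eq_iff)
   also have "matrix L *v e b = mu b *\<^sub>R e b" using matrix_vector_mul(2)[OF L(1)] L(2) by (metis)
   also have "... = column b (Q ** D)"
    by (simp add: column_def Q_def D_def matrix_matrix_mult_def vec_eq_iff if_distrib cong: if_cong)
   finally show ?thesis .
  qed
  then show ?thesis by (simp add: vec_eq_iff column_def)
 qed
 have "det D = (\<Prod>i\<in>UNIV. mu i)" by (subst det_diagonal) (auto simp: D_def)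
 moreover have "det (matrix L) * det Q = det Q * det D" using LQ by (metis det_mul)
 ultimately show ?thesis using dQ by simp
qed

definition diag_map :: "('n => real^'n) => ('n => real) => real^'n => real^'n" where
 "diag_map e c x = (\<Sum>i\<in>UNIV. (c i * (x \<bullet> e i)) *\<^sub>R e i)"

lemma linear_diag_map: "linear (diag_map e c)"
 by (rule linearI) (simp_all add: diag_map_def inner_simps sum.distrib algebra_simps scaleR_sum_right)

lemma diag_map_eigen:
 assumes e: "!!i j. e i \<bullet> e j = (if i = j then 1 else 0)"
 shows "diag_map e c (e i) = c i *\<^sub>R e i"
 by (simp add: diag_map_def e if_distrib if_distribR cong: if_cong)

lemma sym_diag_map: "sym_map (diag_map e c)"
 unfolding sym_map_def
 by (auto simp: linear_diag_map) (simp add: diag_map_def inner_sum_left inner_sum_right inner_commute mult_ac)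

lemma linear_eq_orthonormal:
 fixes e :: "'n => real^'n"
 assumes e: "!!i j. e i \<bullet> e j = (if i = j then 1 else 0)" and "linear f" "linear g" "!!i. f (e i) = g (e i)"
 shows "f = g"
proof
 fix x
 have "f x = f (\<Sum>i\<in>UNIV. (x \<bullet> e i) *\<^sub>R e i)" using orthonormal_expand[OF e, of x] by simp
 also have "... = g (\<Sum>i\<in>UNIV. (x \<bullet> e i) *\<^sub>R e i)" by (simp add: linear_sum linear_scale assms)
 finally show "f x = g x" using orthonormal_expand[OF e, of x] by simp
qed

text \<open>Conjugation with \<open>R\<close>, the inverse square root of \<open>P\<close>, turns
  \<open>P\<close> into the identity and \<open>Q\<close> into a symmetric map with eigenvalues
  \<open>nu i\<close>. What remains is \<open>nu i <= ((1 + nu i) / 2)^2\<close> for each of them,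
  the arithmetic-geometric mean inequality.\<close>

lemma ldet_midpoint_ge:
 fixes P Q :: "real^'n => real^'n"
 assumes P: "sym_map P" "!!h. h ~= 0 ==> 0 < P h \<bullet> h" and Q: "sym_map Q" "!!h. 0 <= Q h \<bullet> h"
 shows "ldet P * ldet Q <= (ldet (\<lambda>x. (1/2) *\<^sub>R (P x + Q x)))^2" "0 < ldet P" "0 <= ldet Q" "0 < ldet (\<lambda>x. (1/2) *\<^sub>R (P x + Q x))"
proof -
 obtain e :: "'n => real^'n" and mu :: "'n => real"
  where e: "!!i j. e i \<bullet> e j = (if i = j then 1 else 0)" and mu: "!!i. P (e i) = mu i *\<^sub>R e i"
  using spectral_theorem[OF P(1)] by blast
 have lin: "linear P" "linear Q" using P Q by (auto simp: sym_map_def)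
 have e0: "e i ~= 0" for i using e[of i i] by auto
 have mu0: "mu i > 0" for i using P(2)[OF e0, of i] mu[of i] e[of i i] by simp
 define R where "R = diag_map e (\<lambda>i. 1 / sqrt (mu i))"
 have R: "linear R" "!!i. R (e i) = (1 / sqrt (mu i)) *\<^sub>R e i" unfolding R_def by (auto simp: linear_diag_map diag_map_eigen[OF e])
 have Rs: "R h \<bullet> k = h \<bullet> R k" for h k using sym_diag_map[of e] unfolding R_def sym_map_def by blast
 have "(\<lambda>x. R (P (R x))) = (\<lambda>x. x)"
 proof (rule linear_eq_orthonormal[OF e])
  show "linear (\<lambda>x. R (P (R x)))" using linear_compose[OF linear_compose[OF R(1) lin(1)] R(1)] by (simp add: comp_def)
  show "linear (\<lambda>x. x)" by (rule linear_id[unfolded id_def])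
  show "R (P (R (e i))) = e i" for i
   using mu0[of i] by (simp add: R mu linear_scale[OF lin(1)] linear_scale[OF R(1)])
 qed
 then have RPR: "R (P (R x)) = x" for x by (rule fun_cong)
 have lRQR: "linear (\<lambda>x. R (Q (R x)))" using linear_compose[OF linear_compose[OF R(1) lin(2)] R(1)] by (simp add: comp_def)
 have "sym_map (\<lambda>x. R (Q (R x)))"
  unfolding sym_map_def using lRQR Rs Q(1) by (auto simp: sym_map_def)
 then obtain f :: "'n => real^'n" and nu :: "'n => real"
  where f: "!!i j. f i \<bullet> f j = (if i = j then 1 else 0)" and nu: "!!i. R (Q (R (f i))) = nu i *\<^sub>R f i"
  using spectral_theorem[of "\<lambda>x. R (Q (R x))"] by blast
 have nu0: "0 <= nu i" for i
 proof -
  have "nu i = R (Q (R (f i))) \<bullet> f i" using f[of i i] by (simp add: nu)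
  also have "... = Q (R (f i)) \<bullet> R (f i)" by (rule Rs)
  finally show ?thesis using Q(2) by simp
 qed
 define d where "d = ldet R"
 have dR: "ldet (\<lambda>x. R (M (R x))) = d * ldet M * d" if "linear M" for M
 proof -
  have "linear (\<lambda>x. M (R x))" using linear_compose[OF R(1) that] by (simp add: comp_def)
  then show ?thesis using ldet_compose[OF R(1), of "\<lambda>x. M (R x)"] ldet_compose[OF that R(1)] by (simp add: d_def)
 qed
 have "ldet (\<lambda>x :: real^'n. x) = 1" using matrix_id by (simp add: id_def)
 then have dP: "d^2 * ldet P = 1" using dR[OF lin(1)] by (simp add: RPR power2_eq_square mult_ac)
 have dQ: "d^2 * ldet Q = (\<Prod>i\<in>UNIV. nu i)"
  using dR[OF lin(2)] ldet_eigen[OF f lRQR nu] by (simp add: power2_eq_square mult_ac)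
 have lPQ: "linear (\<lambda>x. (1/2) *\<^sub>R (P x + Q x))" using lin by (intro linear_compose_scale_right linear_compose_add)
 have dPQ: "d^2 * ldet (\<lambda>x. (1/2) *\<^sub>R (P x + Q x)) = (\<Prod>i\<in>UNIV. (1 + nu i) / 2)"
 proof -
  have "linear (\<lambda>x. R ((1/2) *\<^sub>R (P (R x) + Q (R x))))"
   using linear_compose[OF linear_compose[OF R(1) lPQ] R(1)] by (simp add: comp_def)
  moreover have "R ((1/2) *\<^sub>R (P (R (f i)) + Q (R (f i)))) = ((1 + nu i) / 2) *\<^sub>R f i" for i
   by (simp add: linear_scale[OF R(1)] linear_add[OF R(1)] RPR nu scaleR_add_left[symmetric] scaleR_add_right)
  ultimately show ?thesis using ldet_eigen[OF f, of "\<lambda>x. R ((1/2) *\<^sub>R (P (R x) + Q (R x)))"] dR[OF lPQ]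
   by (simp add: power2_eq_square mult_ac)
 qed
 have "d ~= 0" using dP by auto
 then have d2: "d^2 > 0" by simp
 have "0 < d^2 * ldet P" using dP by simp
 then show P0: "0 < ldet P" using d2 by (rule zero_less_mult_pos)
 have "0 <= d^2 * ldet Q" unfolding dQ using nu0 by (intro prod_nonneg) auto
 then show Q0: "0 <= ldet Q" using d2 by (simp add: zero_le_mult_iff)
 have "0 < (\<Prod>i\<in>UNIV. (1 + nu i) / 2)" using nu0 by (intro prod_pos) (simp add: add_pos_nonneg)
 then have "0 < d^2 * ldet (\<lambda>x. (1/2) *\<^sub>R (P x + Q x))" using dPQ by simp
 then show "0 < ldet (\<lambda>x. (1/2) *\<^sub>R (P x + Q x))" using d2 by (rule zero_less_mult_pos)
 have "(\<Prod>i\<in>UNIV. nu i) <= (\<Prod>i\<in>UNIV. ((1 + nu i) / 2)^2)"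
 proof (rule prod_mono, intro conjI nu0)
  fix i
  have "0 <= (1 - nu i)^2" by simp
  then show "nu i <= ((1 + nu i) / 2)^2" by (simp add: power2_eq_square field_simps)
 qed
 then have "(d^2 * ldet P) * (d^2 * ldet Q) <= (d^2 * ldet (\<lambda>x. (1/2) *\<^sub>R (P x + Q x)))^2"
  unfolding dP dQ dPQ by (simp add: prod_power_distrib)
 then have "(d^2)^2 * (ldet P * ldet Q) <= (d^2)^2 * (ldet (\<lambda>x. (1/2) *\<^sub>R (P x + Q x)))^2"
  by (simp add: power_mult_distrib power2_eq_square mult_ac)
 then show "ldet P * ldet Q <= (ldet (\<lambda>x. (1/2) *\<^sub>R (P x + Q x)))^2" using d2 by simp
qed

lemma real_density_exists:
 fixes M :: "'a::euclidean_space measure"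
 assumes M: "finite_measure M" "sets M = sets borel" and ac: "null_sets lborel \<subseteq> null_sets M"
 obtains f :: "'a => real" where "f \<in> BM" "!!x. 0 <= f x" "M = dens f"
proof -
 interpret M: finite_measure M by fact
 have ac': "absolutely_continuous lborel M" using ac by (simp add: absolutely_continuous_def)
 have 1: "density lborel (RN_deriv lborel M) = M"
  by (rule sigma_finite_measure.density_RN_deriv[OF sigma_finite_lborel ac']) (simp add: M)
 have fin: "AE x in lborel. RN_deriv lborel M x ~= \<infinity>"
  by (rule sigma_finite_measure.RN_deriv_finite[OF sigma_finite_lborel _ ac']) (simp_all add: M M.sigma_finite_measure_axioms)
 define f where "f x = enn2real (RN_deriv lborel M x)" for x
 have "dens f = density lborel (RN_deriv lborel M)"
 proof (rule density_cong)
  show "AE x in lborel. ennreal (f x) = RN_deriv lborel M x"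
   using fin by eventually_elim (simp add: f_def less_top)
 qed (auto simp: f_def)
 moreover have "f \<in> BM" unfolding f_def by measurable
 moreover have "0 <= f x" for x by (simp add: f_def)
 ultimately show ?thesis using that 1 by metis
qed

text \<open>The Monge-Ampere equation of an injective differentiable map: the area formula is tested
  on all Borel subsets of \<open>G\<close>, and densities with equal integrals agree almost
  everywhere.\<close>

lemma density_relation:
 fixes f f' :: "real^'n => real" and phi :: "real^'n => real^'n"
 assumes [measurable]: "f \<in> BM" "f' \<in> BM" "G \<in> sets borel" "phi \<in> BM"
  and nonneg: "!!z. 0 <= f z" "!!z. 0 <= f' z"
  and push: "distr (dens f) borel phi = dens f'"
  and full: "AE z in dens f. z \<in> G"
  and der: "!!z. z \<in> G ==> (phi has_derivative phi' z) (at z within G)"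
  and inj: "inj_on phi G"
 shows "AE z in lborel. z \<in> G --> f' (phi z) * abs (det (matrix (phi' z))) = f z"
proof -
 define M where "M = dens f"
 define M' where "M' = dens f'"
 have [simp, measurable_cong]: "sets M = sets borel" "sets M' = sets borel" by (simp_all add: M_def M'_def)
 have spM: "space M = UNIV" "space M' = UNIV" by (simp_all add: M_def M'_def)
 have push': "distr M borel phi = M'" using push by (simp add: M_def M'_def)
 have GL: "G \<in> sets lebesgue" by simp
 define d0 where "d0 z = (if z \<in> G then abs (det (matrix (phi' z))) else 0)" for z
 have "d0 \<in> borel_measurable lebesgue" unfolding d0_def
  using emeasure_differentiable_image(2)[OF GL der inj] by (simp add: borel_measurable_if)
 then obtain d where d[measurable]: "d \<in> BM" and dAE: "AE z in lborel. d0 z = d z"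
  using completion_ex_borel_measurable_real[of d0 lborel] by auto
 have key: "(\<integral>\<^sup>+z. ennreal (f' (phi z) * d z) * indicator (G \<inter> A) z \<partial>lborel) = (\<integral>\<^sup>+z. ennreal (f z) * indicator (G \<inter> A) z \<partial>lborel)"
  if A[measurable]: "A \<in> sets borel" for A
 proof -
  have GA: "G \<inter> A \<in> sets lebesgue" "G \<inter> A \<in> sets borel" by simp_all
  have derA: "(phi has_derivative phi' z) (at z within G \<inter> A)" if "z \<in> G \<inter> A" for z
   using der[of z] that by (auto intro: has_derivative_subset)
  have injA: "inj_on phi (G \<inter> A)" using inj by (rule inj_on_subset) auto
  define I where "I = phi ` (G \<inter> A)"
  have I: "I \<in> sets lebesgue" unfolding I_def by (rule emeasure_differentiable_image(1)[OF GA(1) derA injA])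
  \<comment> \<open>The image of a Borel set is only known to be Lebesgue measurable, while the
    measures are Borel. The main part differs from it within the null set \<open>N\<close>, whose
    preimage is null because the image measure has a density.\<close>
  define B where "B = main_part lborel I"
  have B[measurable]: "B \<in> sets borel" using main_part_sets[OF I] by (simp add: B_def)
  obtain N where N: "N \<in> null_sets lborel" "null_part lborel I \<subseteq> N" using null_part[OF I] by auto
  have IB: "I = B \<union> null_part lborel I" using main_part_null_part_Un[OF I] by (simp add: B_def)
  have N0[measurable]: "N \<in> sets borel" using N(1) by auto
  have "(\<integral>\<^sup>+z. ennreal (f' (phi z) * d z) * indicator (G \<inter> A) z \<partial>lborel) = (\<integral>\<^sup>+z. ennreal (f' (phi z) * d z) * indicator (G \<inter> A) z \<partial>lebesgue)"
   by (rule nn_integral_completion[symmetric])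
  also have "... = (\<integral>\<^sup>+z. ennreal (abs (det (matrix (phi' z)))) * ennreal (f' (phi z)) * indicator (G \<inter> A) z \<partial>lebesgue)"
   by (rule nn_integral_cong_AE, rule AE_completion, use dAE in eventually_elim)
     (auto simp: d0_def indicator_def nonneg ennreal_mult'' mult.commute split: if_splits)
  also have "... = (\<integral>\<^sup>+z. ennreal (abs (det (matrix (phi' z)))) * ennreal (f' (phi z)) \<partial>lebesgue_on (G \<inter> A))"
   using GA(1) by (subst nn_integral_restrict_space) auto
  also have "... = (\<integral>\<^sup>+y. ennreal (f' y) * indicator I y \<partial>lebesgue)"
   unfolding I_def by (rule nn_integral_differentiable_image[OF GA(1) derA injA, symmetric]) simp_all
  also have "... = (\<integral>\<^sup>+y. ennreal (f' y) * indicator B y \<partial>lebesgue)"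
  proof (rule nn_integral_cong_AE, rule AE_completion)
   have "AE y in lborel. y \<notin> N" using N(1) by (rule AE_not_in)
   then show "AE y in lborel. ennreal (f' y) * indicator I y = ennreal (f' y) * indicator B y"
    by eventually_elim (use IB N(2) in \<open>auto simp: indicator_def\<close>)
  qed
  also have "... = emeasure M' B" unfolding M'_def by (subst emeasure_density) (auto simp: nn_integral_completion)
  also have "... = emeasure M (phi -` B)" unfolding push'[symmetric] by (subst emeasure_distr) (auto simp: spM)
  also have "... = emeasure M (G \<inter> A)"
  proof (rule emeasure_eq_AE)
   have "emeasure M' N = 0" unfolding M'_def using N(1)
    by (subst emeasure_density) (auto simp: null_sets_def nn_integral_0_iff_AE intro: AE_mp[OF AE_not_in[OF N(1)]])
   then have "emeasure M (phi -` N) = 0" unfolding push'[symmetric] by (subst (asm) emeasure_distr) (auto simp: spM)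
   moreover have "phi -` N \<in> sets borel" using measurable_sets_borel[OF assms(4) N0] by simp
   ultimately have "phi -` N \<in> null_sets M" by (simp add: null_sets_def)
   then have 1: "AE z in M. phi z \<notin> N" by (auto dest: AE_not_in)
   have 2: "AE z in M. z \<in> G" unfolding M_def by (rule full)
   show "AE z in M. (z \<in> phi -` B) = (z \<in> G \<inter> A)"
    using 1 2
   proof eventually_elim
    case (elim z)
    have "z \<in> phi -` B \<longleftrightarrow> phi z \<in> I" using elim(1) N(2) IB by auto
    also have "... \<longleftrightarrow> z \<in> G \<inter> A" using inj elim(2) by (auto simp: I_def inj_on_def)
    finally show ?case .
   qed
  qed (use measurable_sets_borel[OF assms(4) B] in auto)
  also have "... = (\<integral>\<^sup>+z. ennreal (f z) * indicator (G \<inter> A) z \<partial>lborel)"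
   unfolding M_def by (subst emeasure_density) auto
  finally show ?thesis .
 qed
 have "density lborel (\<lambda>z. ennreal (f' (phi z) * d z) * indicator G z) = density lborel (\<lambda>z. ennreal (f z) * indicator G z)"
 proof (rule measure_eqI)
  fix A assume "A \<in> sets (density lborel (\<lambda>z. ennreal (f' (phi z) * d z) * indicator G z))"
  then have [measurable]: "A \<in> sets borel" by simp
  show "emeasure (density lborel (\<lambda>z. ennreal (f' (phi z) * d z) * indicator G z)) A = emeasure (density lborel (\<lambda>z. ennreal (f z) * indicator G z)) A"
   using key[of A] by (simp add: emeasure_density mult.assoc indicator_inter_arith[symmetric])
 qed simp
 then have "AE z in lborel. ennreal (f' (phi z) * d z) * indicator G z = ennreal (f z) * indicator G z"
  by (subst (asm) sigma_finite_measure.density_unique_iff[OF sigma_finite_lborel]) auto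
 then show ?thesis using dAE
 proof eventually_elim
  case (elim z)
  show ?case
  proof
   assume z: "z \<in> G"
   have dz: "d z = abs (det (matrix (phi' z)))" using elim(2) z by (simp add: d0_def)
   have "ennreal (f' (phi z) * d z) = ennreal (f z)" using elim(1) z by simp
   then show "f' (phi z) * abs (det (matrix (phi' z))) = f z" using nonneg dz by (subst (asm) ennreal_inj) auto
  qed
 qed
qed

text \<open>For \<open>f = exp (- V)\<close> the last clause is twice the midpoint inequality for
  \<open>V\<close> minus half the squared norm, whose quadratic part contributes
  \<open>(norm (x - y))^2 / 8\<close>. Midpoints are all that the transport argument uses, and the
  product form copes with zeros of \<open>f\<close>.\<close>

definition slc_dens :: "('a::euclidean_space => real) => bool" where
 "slc_dens f \<longleftrightarrow> f \<in> BM & (\<forall>x. 0 <= f x) & (\<integral>\<^sup>+x. ennreal (f x) \<partial>lborel) = 1 &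
   (\<forall>x y. f x * f y * exp ((norm (x - y))^2 / 4) <= (f ((1/2) *\<^sub>R (x + y)))^2)"

text \<open>The relation makes \<open>a\<close> an affine function of \<open>b\<close>, so an
  eigenbasis of \<open>b\<close> serves for both.\<close>

lemma joint_eigenbasis:
 fixes a b :: "real^'n => real^'n"
 assumes a: "!!h. h ~= 0 ==> 0 < a h \<bullet> h" and b: "sym_map b" "!!h. h ~= 0 ==> 0 < b h \<bullet> h"
  and rel: "!!h. (1 - t) *\<^sub>R a h + t *\<^sub>R b h = h" and t: "t < 1"
 obtains e :: "'n => real^'n" and al be where "!!i j. e i \<bullet> e j = (if i = j then 1 else 0)"
  "!!i. a (e i) = al i *\<^sub>R e i" "!!i. b (e i) = be i *\<^sub>R e i" "!!i. 0 < al i" "!!i. 0 < be i" "!!i. (1 - t) * al i + t * be i = 1"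
proof -
 obtain e :: "'n => real^'n" and be :: "'n => real"
  where e: "!!i j. e i \<bullet> e j = (if i = j then 1 else 0)" and be: "!!i. b (e i) = be i *\<^sub>R e i"
  using spectral_theorem[OF b(1)] by blast
 have e0: "e i ~= 0" for i using e[of i i] by auto
 define al where "al i = (1 - t * be i) / (1 - t)" for i
 have al: "a (e i) = al i *\<^sub>R e i" for i
 proof -
  have "(1 - t) *\<^sub>R a (e i) = (1 - t * be i) *\<^sub>R e i" using rel[of "e i"] by (simp add: be algebra_simps)
  then have "(1 / (1 - t)) *\<^sub>R (1 - t) *\<^sub>R a (e i) = (1 / (1 - t)) *\<^sub>R (1 - t * be i) *\<^sub>R e i" by simp
  then show ?thesis using t by (simp add: al_def)
 qed
 show thesis
  by (rule that[OF e al be]) (use a[OF e0] b(2)[OF e0] e t in \<open>force simp: al be al_def\<close>)+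
qed

text \<open>The derivative of a gradient composed with \<open>Y\<close> is \<open>sg\<close> after
  \<open>b\<close>, which is not symmetric. Writing \<open>a\<close> as \<open>P\<close> after
  \<open>b\<close>, with \<open>P\<close> diagonal in the joint eigenbasis, splits off the
  determinant of \<open>b\<close> on both sides and leaves the symmetric maps \<open>P\<close> and
  \<open>sg\<close>.\<close>

lemma ldet_midpoint_comm:
 fixes a b sg :: "real^'n => real^'n"
 assumes a: "sym_map a" "!!h. h ~= 0 ==> 0 < a h \<bullet> h" and b: "sym_map b" "!!h. h ~= 0 ==> 0 < b h \<bullet> h"
  and rel: "!!h. (1 - t) *\<^sub>R a h + t *\<^sub>R b h = h" and t: "t < 1"
  and sg: "sym_map sg" "!!h. 0 <= sg h \<bullet> h"
 shows "ldet a * ldet (\<lambda>x. sg (b x)) <= (ldet (\<lambda>x. (1/2) *\<^sub>R (a x + sg (b x))))^2" (is ?A)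
  and "0 < ldet (\<lambda>x. (1/2) *\<^sub>R (a x + sg (b x)))" "0 < ldet a" "0 <= ldet (\<lambda>x. sg (b x))"
proof -
 obtain e :: "'n => real^'n" and al be where e: "!!i j. e i \<bullet> e j = (if i = j then 1 else 0)"
  and al: "!!i. a (e i) = al i *\<^sub>R e i" and be: "!!i. b (e i) = be i *\<^sub>R e i" and al0: "!!i. 0 < al i" and be0: "!!i. 0 < be i"
  using joint_eigenbasis[OF a(2) b rel t] by metis
 have lin: "linear a" "linear b" "linear sg" using a b sg by (auto simp: sym_map_def)
 define P where "P = diag_map e (\<lambda>i. al i / be i)"
 have P: "sym_map P" "linear P" unfolding P_def by (auto simp: sym_diag_map linear_diag_map)
 have Ppos: "0 < P h \<bullet> h" if "h ~= 0" for h
 proof -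
  have "P h \<bullet> h = (\<Sum>i\<in>UNIV. al i / be i * (h \<bullet> e i)^2)"
   unfolding P_def diag_map_def inner_sum_left by (rule sum.cong) (simp_all add: power2_eq_square inner_commute mult_ac)
  have "\<exists>i. h \<bullet> e i ~= 0"
  proof (rule ccontr)
   assume "\<not> ?thesis"
   then show False using orthonormal_expand[OF e, of h] that by simp
  qed
  then obtain i where i: "h \<bullet> e i ~= 0" by blast
  have "0 < al i / be i * (h \<bullet> e i)^2" using al0 be0 i by simp
  also have "... <= (\<Sum>i\<in>UNIV. al i / be i * (h \<bullet> e i)^2)"
   using al0 be0 by (intro member_le_sum) (auto simp: less_imp_le)
  finally show ?thesis using \<open>P h \<bullet> h = _\<close> by simp
 qed
 have "(\<lambda>x. P (b x)) = a"
 proof (rule linear_eq_orthonormal[OF e])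
  show "linear (\<lambda>x. P (b x))" using linear_compose[OF lin(2) P(2)] by (simp add: comp_def)
  show "P (b (e i)) = a (e i)" for i
   using be0[of i] by (simp add: be al linear_scale[OF P(2)]) (simp add: P_def diag_map_eigen[OF e])
 qed (rule lin)
 then have aP: "a x = P (b x)" for x by (metis)
 note L = ldet_midpoint_ge[OF P(1) Ppos sg]
 have lm: "linear (\<lambda>x. (1/2) *\<^sub>R (P x + sg x))" using P(2) lin by (intro linear_compose_scale_right linear_compose_add)
 have da: "ldet a = ldet P * ldet b" using ldet_compose[OF P(2) lin(2)] by (simp add: aP[abs_def])
 have ds: "ldet (\<lambda>x. sg (b x)) = ldet sg * ldet b" by (rule ldet_compose[OF lin(3,2)])
 have dm: "ldet (\<lambda>x. (1/2) *\<^sub>R (a x + sg (b x))) = ldet (\<lambda>x. (1/2) *\<^sub>R (P x + sg x)) * ldet b"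
  using ldet_compose[OF lm lin(2)] by (simp add: aP)
 have db: "ldet b > 0" using ldet_eigen[OF e lin(2) be] be0 by (simp add: prod_pos)
 show "0 < ldet (\<lambda>x. (1/2) *\<^sub>R (a x + sg (b x)))" using dm L(4) db by simp
 show "0 < ldet a" using da L(2) db by simp
 show "0 <= ldet (\<lambda>x. sg (b x))" using ds L(3) db by simp
 have "(ldet P * ldet sg) * (ldet b)^2 <= (ldet (\<lambda>x. (1/2) *\<^sub>R (P x + sg x)))^2 * (ldet b)^2"
  by (rule mult_right_mono[OF L(1)]) auto
 then show ?A unfolding da ds dm by (simp add: power_mult_distrib power2_eq_square mult_ac)
qed

text \<open>One half of the transport inequality: with \<open>S = cgrad w\<close>, \<open>phi = S \<circ> Y\<close> and \<open>P\<close> the midpoint of \<open>X\<close> and \<open>phi\<close>, the map \<open>P\<close>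
 is injective because \<open>X\<close> and \<open>S\<close> are both monotone in \<open>Y\<close>; the area formula for \<open>P\<close>, midpoint strong
 log-concavity of \<open>f0\<close> and \<open>det a det (sg b) <= (det DP)^2\<close> give an exponential bound, and \<open>1 + u <= exp u\<close> concludes.\<close>

lemma half_transport:
 fixes X Y :: "real^'n => real^'n" and f0 ft rho rho' :: "real^'n => real"
 assumes slc: "slc_dens f0"
  and [measurable]: "X \<in> BM" "Y \<in> BM" "ft \<in> BM"
   "rho \<in> BM" "rho' \<in> BM" "G \<in> sets borel"
  and nonneg: "!!z. 0 <= ft z"
  and der: "!!z. z \<in> G ==> (X has_derivative a z) (at z within G)" "!!z. z \<in> G ==> (Y has_derivative b z) (at z within G)"
  and sym: "!!z. z \<in> G ==> sym_map (a z)" "!!z. z \<in> G ==> sym_map (b z)"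
  and pos: "!!z h. z \<in> G ==> h ~= 0 ==> 0 < a z h \<bullet> h" "!!z h. z \<in> G ==> h ~= 0 ==> 0 < b z h \<bullet> h"
  and ab: "!!z h. z \<in> G ==> (1 - t) *\<^sub>R a z h + t *\<^sub>R b z h = h" and t: "t < 1"
  and injX: "inj_on X G"
  and mono: "!!z1 z2. z1 \<in> G ==> z2 \<in> G ==> 0 <= (X z1 - X z2) \<bullet> (Y z1 - Y z2)"
   "!!z1 z2. z1 \<in> G ==> z2 \<in> G ==> (X z1 - X z2) \<bullet> (Y z1 - Y z2) = 0 ==> z1 = z2"
  and rel: "AE z in lborel. z \<in> G --> f0 (X z) * abs (ldet (a z)) = ft z"
  and La: "La = dens (\<lambda>z. rho z * ft z)" "prob_space La"
  and La': "La' = dens (\<lambda>z. rho' z * ft z)" "prob_space La'"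
  and c: "0 < c" and bnd: "!!z. rho z = 0 \<or> z \<in> G & c <= rho z & rho z <= C" "!!z. rho' z = 0 \<or> z \<in> G & c <= rho' z & rho' z <= C"
  and w: "convex_on UNIV w" and u: "convex_on UNIV u"
  and push: "distr (distr La borel Y) borel (cgrad w) = distr La' borel X"
  and acY: "null_sets lborel \<subseteq> null_sets (distr La borel Y)" and acX: "null_sets lborel \<subseteq> null_sets (distr La' borel X)"
  and good: "AE y in distr La borel Y. subgrad w y = {cgrad w y} & norm (cgrad w y) <= k & y \<in> subgrad u (cgrad w y)"
  and bX: "!!z. rho z ~= 0 ==> norm (X z) <= k"
 shows "(LINT z|La. (norm (X z - cgrad w (Y z)))^2) <= 4 * ((LINT z|La. ln (rho z)) + (LINT z|La'. ln (rho' z)))"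
proof -
 interpret La: prob_space La by fact
 interpret La': prob_space La' by fact
 have [simp, measurable_cong]: "sets La = sets borel" "sets La' = sets borel" by (simp_all add: La(1) La'(1))
 have [simp]: "space La = UNIV" "space La' = UNIV" by (simp_all add: La(1) La'(1))
 have [measurable]: "cgrad w \<in> BM" using w by (rule cgrad_measurable)
 have [measurable]: "f0 \<in> BM" and f0: "!!x. 0 <= f0 x" and f01: "(\<integral>\<^sup>+x. ennreal (f0 x) \<partial>lborel) = 1"
  and f0mid: "!!x y. f0 x * f0 y * exp ((norm (x - y))^2 / 4) <= (f0 ((1/2) *\<^sub>R (x + y)))^2"
  using slc by (auto simp: slc_dens_def)
 define phi where "phi z = cgrad w (Y z)" for z
 have [measurable]: "phi \<in> BM" unfolding phi_def by measurable
 have push2: "distr La borel phi = distr La' borel X"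
  using push by (subst (asm) distr_distr) (auto simp: comp_def phi_def[abs_def])
 have rho0: "0 <= rho z" "0 <= rho' z" for z using bnd(1)[of z] bnd(2)[of z] c by auto
 have AELa: "AE z in La. rho z ~= 0 & ft z ~= 0 & z \<in> G" "AE z in La'. rho' z ~= 0 & ft z ~= 0 & z \<in> G"
 proof -
  have 1: "z \<in> G" if "rho z ~= 0" for z using bnd(1)[of z] that by auto
  have 2: "z \<in> G" if "rho' z ~= 0" for z using bnd(2)[of z] that by auto
  show "AE z in La. rho z ~= 0 & ft z ~= 0 & z \<in> G" unfolding La(1) by (subst AE_density) (auto intro!: 1)
  show "AE z in La'. rho' z ~= 0 & ft z ~= 0 & z \<in> G" unfolding La'(1) by (subst AE_density) (auto intro!: 2)
 qed
 have AEl: "AE z in La. P z" "AE z in La'. P z" if "AE z in lborel. P z" for P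
  using that unfolding La(1) La'(1) by (auto simp: AE_density elim: eventually_mono)
 have cover: "\<exists>N. N \<in> sets borel & emeasure M N = 0 & (\<forall>y. y \<notin> N --> P y)" if "AE y in M. P y" "sets M = sets borel" for M :: "(real^'n) measure" and P
 proof -
  obtain N where "{y \<in> space M. \<not> P y} \<subseteq> N" "emeasure M N = 0" "N \<in> sets M" using \<open>AE y in M. P y\<close> by (rule AE_E)
  moreover have "space M = UNIV" using that(2) by (metis sets_eq_imp_space_eq space_borel)
  ultimately show ?thesis using that(2) by blast
 qed
 obtain Nw where Nw[measurable]: "Nw \<in> sets borel" and Nw0: "emeasure lborel Nw = 0" "!!y. y \<notin> Nw ==> \<exists>p sg. alexandrov_at w y p sg"
  using cover[OF alexandrov_ae[OF w]] by auto
 obtain Nu where Nu[measurable]: "Nu \<in> sets borel" and Nu0: "emeasure lborel Nu = 0" "!!y. y \<notin> Nu ==> \<exists>p sg. alexandrov_at u y p sg"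
  using cover[OF alexandrov_ae[OF u]] by auto
 obtain Nq where Nq[measurable]: "Nq \<in> sets borel" and Nq0: "emeasure (distr La borel Y) Nq = 0"
  "!!y. y \<notin> Nq ==> subgrad w y = {cgrad w y} & norm (cgrad w y) <= k & y \<in> subgrad u (cgrad w y)"
  using cover[OF good] by auto
 define G1 where "G1 = {z \<in> G. rho z ~= 0 & Y z \<notin> Nw & Y z \<notin> Nq & phi z \<notin> Nu}"
 have G1[measurable]: "G1 \<in> sets borel" unfolding G1_def by measurable
 have G1G: "G1 \<subseteq> G" by (auto simp: G1_def)
 have AEpull: "AE z in M. g z \<notin> N" if [measurable]: "g \<in> M \<rightarrow>\<^sub>M borel" "N \<in> sets borel" and "emeasure (distr M borel g) N = 0" for M and g :: "real^'n => real^'n" and N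
 proof -
  have "AE y in distr M borel g. y \<notin> N" using that(2,3) by (intro AE_not_in) (auto simp: null_sets_def)
  then show ?thesis by (subst (asm) AE_distr_iff) auto
 qed
 have full1: "AE z in La. z \<in> G1"
 proof -
  have "Nw \<in> null_sets lborel" "Nu \<in> null_sets lborel" using Nw0 Nu0 by (auto simp: null_sets_def)
  then have "Nw \<in> null_sets (distr La borel Y)" "Nu \<in> null_sets (distr La' borel X)" using acY acX by auto
  then have 1: "AE z in La. Y z \<notin> Nw" "AE z in La. phi z \<notin> Nu"
   by (auto intro!: AEpull simp: push2 null_sets_def)
  have "AE z in La. Y z \<notin> Nq" using Nq0(1) by (intro AEpull) auto
  then show ?thesis using 1 AELa(1) by eventually_elim (auto simp: G1_def)
 qed
 obtain sg where sg: "!!y. y \<notin> Nw ==> \<exists>p. alexandrov_at w y p (sg y)" using Nw0(2) by metis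
 have al: "alexandrov_at w (Y z) (phi z) (sg (Y z))" if "z \<in> G1" for z
 proof -
  have "Y z \<notin> Nw" using \<open>z \<in> G1\<close> by (simp add: G1_def)
  then obtain p where p: "alexandrov_at w (Y z) p (sg (Y z))" using sg[of "Y z"] by blast
  moreover have "cgrad w (Y z) = p" by (rule cgrad_eq[OF p w])
  ultimately show ?thesis by (simp add: phi_def)
 qed
 have sgs: "sym_map (sg (Y z))" "!!h. 0 <= sg (Y z) h \<bullet> h" if "z \<in> G1" for z
  using alexandrov_symmetric[OF al[OF that] w] alexandrov_nonneg[OF al[OF that] w] al[OF that]
  by (auto simp: sym_map_def alexandrov_at_def)
 have derphi: "(phi has_derivative (\<lambda>h. sg (Y z) (b z h))) (at z within G1)" if z: "z \<in> G1" for z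
 proof -
  have 1: "(Y has_derivative b z) (at z within G1)" using der(2) z G1G has_derivative_subset by blast
  have 2: "(cgrad w has_derivative sg (Y z)) (at (Y z) within Y ` G1)"
  proof (rule alexandrov_has_derivative[OF al[OF z]])
   fix y assume "y \<in> Y ` G1"
   then have "y \<notin> Nq" by (auto simp: G1_def)
   then show "cgrad w y \<in> subgrad w y" using Nq0(2) by blast
  qed (use z in auto)
  show ?thesis using diff_chain_within[OF 1 2] by (simp add: comp_def phi_def[abs_def])
 qed
 have subphi: "phi z \<in> subgrad w (Y z)" "Y z \<in> subgrad u (phi z)" "norm (phi z) <= k" if "z \<in> G1" for z
  using Nq0(2)[of "Y z"] that by (auto simp: G1_def phi_def)
 \<comment> \<open>Second-order differentiability of \<open>u\<close> at \<open>phi z1\<close> makes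
   its subgradient there unique, so equal values of \<open>phi\<close> give equal values of
   \<open>Y\<close>; strict monotonicity then identifies the points.\<close>
 have injphi: "inj_on phi G1"
 proof (rule inj_onI)
  fix z1 z2 assume z: "z1 \<in> G1" "z2 \<in> G1" and eq: "phi z1 = phi z2"
  obtain p s where ps: "alexandrov_at u (phi z1) p s" using Nu0(2)[of "phi z1"] z by (auto simp: G1_def)
  have "Y z1 = p" "Y z2 = p" using alexandrov_unique[OF ps] subphi(2)[OF z(1)] subphi(2)[OF z(2)] eq by auto
  then show "z1 = z2" using mono(2)[of z1 z2] z G1G by auto
 qed
 obtain n' where n'[measurable]: "n' \<in> BM" and n'0: "!!x. 0 <= n' x"
  and n'd: "distr La' borel X = dens n'"
  using real_density_exists[OF La'.finite_measure_distr _ acX] by auto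
 have R1: "AE z in lborel. z \<in> G1 --> n' (phi z) * abs (ldet (\<lambda>h. sg (Y z) (b z h))) = rho z * ft z"
 proof (rule density_relation)
  show "distr (dens (\<lambda>z. rho z * ft z)) borel phi = dens n'"
   using push2 n'd by (simp add: La(1))
  show "AE z in dens (\<lambda>z. rho z * ft z). z \<in> G1" using full1 unfolding La(1) .
 qed (use rho0 nonneg n'0 derphi injphi in auto)
 have R2: "AE z in lborel. z \<in> G --> n' (X z) * abs (ldet (a z)) = rho' z * ft z"
 proof (rule density_relation)
  show "distr (dens (\<lambda>z. rho' z * ft z)) borel X = dens n'"
   using n'd by (simp add: La'(1))
  have "AE z in La'. z \<in> G" using AELa(2) by eventually_elim auto
  then show "AE z in dens (\<lambda>z. rho' z * ft z). z \<in> G" unfolding La'(1) .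
 qed (use rho0 nonneg n'0 der injX in auto)
 \<comment> \<open>The density of the target relative to \<open>f0\<close>. Composed with
   \<open>X\<close> it equals \<open>rho'\<close>, so its logarithm integrates to the entropy of the
   second perturbation.\<close>
 define r where "r x = n' x / f0 x" for x
 have [measurable]: "r \<in> BM" unfolding r_def by measurable
 have r': "AE z in La'. r (X z) = rho' z & c <= r (X z) & r (X z) <= C"
  using AELa(2) AEl(2)[OF R2] AEl(2)[OF rel]
 proof eventually_elim
  case (elim z)
  then have "f0 (X z) * abs (ldet (a z)) = ft z" "n' (X z) * abs (ldet (a z)) = rho' z * ft z" "ft z ~= 0" "z \<in> G" by auto
  then have "f0 (X z) ~= 0" "abs (ldet (a z)) ~= 0" "n' (X z) * abs (ldet (a z)) = (rho' z * f0 (X z)) * abs (ldet (a z))" by auto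
  then have "r (X z) = rho' z" by (simp add: r_def)
  then show ?case using bnd(2)[of z] elim by auto
 qed
 have rphi: "AE z in La. c <= r (phi z) & r (phi z) <= C"
 proof -
  have "AE x in distr La' borel X. c <= r x & r x <= C" using r' by (subst AE_distr_iff) (auto elim: eventually_mono)
  then have "AE x in distr La borel phi. c <= r x & r x <= C" by (simp only: push2)
  then show ?thesis by (subst (asm) AE_distr_iff) auto
 qed
 have lnr: "(LINT z|La. ln (r (phi z))) = (LINT z|La'. ln (rho' z))"
 proof -
  have "(LINT z|La. ln (r (phi z))) = (\<integral>x. ln (r x) \<partial>distr La borel phi)" by (subst integral_distr) auto
  also have "... = (LINT z|La'. ln (r (X z)))" unfolding push2 by (subst integral_distr) auto
  also have "... = (LINT z|La'. ln (rho' z))" by (rule integral_cong_AE) (use r' in \<open>auto elim: eventually_mono\<close>)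
  finally show ?thesis .
 qed
 define P where "P z = (1/2) *\<^sub>R (X z + phi z)" for z
 define DP where "DP z h = (1/2) *\<^sub>R (a z h + sg (Y z) (b z h))" for z h
 have derP: "(P has_derivative DP z) (at z within G1)" if z: "z \<in> G1" for z
 proof -
  have 1: "(X has_derivative a z) (at z within G1)" using der(1) z G1G has_derivative_subset by blast
  show ?thesis unfolding P_def DP_def by (intro derivative_intros 1 derphi[OF z])
 qed
 have injP: "inj_on P G1"
 proof (rule inj_onI)
  fix z1 z2 assume z: "z1 \<in> G1" "z2 \<in> G1" and eq: "P z1 = P z2"
  have "X z1 + phi z1 = X z2 + phi z2" using eq by (simp add: P_def)
  then have "X z1 - X z2 = - (phi z1 - phi z2)" by (simp add: algebra_simps)
  then have "(X z1 - X z2) \<bullet> (Y z1 - Y z2) = - ((phi z1 - phi z2) \<bullet> (Y z1 - Y z2))" by (simp only: inner_minus_left)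
  moreover have "0 <= (phi z1 - phi z2) \<bullet> (Y z1 - Y z2)" using subgrad_monotone[OF subphi(1)[OF z(1)] subphi(1)[OF z(2)]] .
  ultimately show "z1 = z2" using mono[of z1 z2] z G1G by force
 qed
 \<comment> \<open>Half of the exponent that the squared midpoint inequality produces, because
   \<open>point\<close> takes the square root of that inequality.\<close>
 define uu where "uu z = (norm (X z - phi z))^2 / 8 - ln (rho z) / 2 - ln (r (phi z)) / 2" for z
 have [measurable]: "uu \<in> BM" unfolding uu_def by measurable
 have point: "AE z in La. ennreal (rho z * ft z * exp (uu z)) <= ennreal (abs (ldet (DP z))) * ennreal (f0 (P z))"
  using full1 AELa(1) AEl(1)[OF R1] AEl(1)[OF rel] rphi
 proof eventually_elim
  case (elim z)
  have z: "z \<in> G1" "z \<in> G" and rho: "rho z > 0" "ft z > 0" and rp: "r (phi z) > 0"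
   using elim rho0[of z] nonneg[of z] c G1G by (auto simp: less_le)
  have L: "ldet (a z) * ldet (\<lambda>x. sg (Y z) (b z x)) <= (ldet (DP z))^2" "0 < ldet (DP z)" "0 < ldet (a z)" "0 <= ldet (\<lambda>x. sg (Y z) (b z x))"
   using ldet_midpoint_comm[OF sym(1)[OF z(2)] pos(1)[OF z(2)] sym(2)[OF z(2)] pos(2)[OF z(2)] ab[OF z(2)] t sgs[OF z(1)]]
   unfolding DP_def by auto
  define S where "S = ldet (\<lambda>x. sg (Y z) (b z x))"
  have e1: "n' (phi z) * S = rho z * ft z" using elim(3) z L(4) by (simp add: S_def)
  have e2: "f0 (X z) * ldet (a z) = ft z" using elim(4) z L(3) by simp
  have f0phi: "f0 (phi z) > 0" using rp f0[of "phi z"] n'0[of "phi z"] by (auto simp: r_def zero_less_divide_iff)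
  have e3: "f0 (phi z) * S = rho z * ft z / r (phi z)"
  proof -
   have "n' (phi z) ~= 0" using rp by (auto simp: r_def)
   then show ?thesis using e1 f0phi by (simp add: r_def field_simps)
  qed
  have "(rho z * ft z * exp (uu z))^2 = (rho z * ft z)^2 * exp (2 * uu z)" by (simp add: power_mult_distrib exp_double)
  also have "exp (2 * uu z) = exp ((norm (X z - phi z))^2 / 4) / (rho z * r (phi z))"
  proof -
   have "2 * uu z = (norm (X z - phi z))^2 / 4 - (ln (rho z) + ln (r (phi z)))" by (simp add: uu_def field_simps)
   then show ?thesis using rho(1) rp by (simp add: exp_diff exp_add)
  qed
  also have "(rho z * ft z)^2 * (exp ((norm (X z - phi z))^2 / 4) / (rho z * r (phi z))) = ft z * (rho z * ft z / r (phi z)) * exp ((norm (X z - phi z))^2 / 4)"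
   using rho rp by (simp add: power2_eq_square field_simps)
  also have "... = (f0 (X z) * f0 (phi z) * exp ((norm (X z - phi z))^2 / 4)) * (ldet (a z) * S)"
   unfolding e3[symmetric] unfolding e2[symmetric] by (simp only: mult_ac)
  also have "... <= (f0 (P z))^2 * (ldet (DP z))^2"
   unfolding P_def using L f0mid[of "X z" "phi z"] by (intro mult_mono) (auto simp: S_def)
  also have "... = (abs (ldet (DP z)) * f0 (P z))^2" by (simp add: power_mult_distrib mult.commute)
  finally have "rho z * ft z * exp (uu z) <= abs (ldet (DP z)) * f0 (P z)"
   by (rule power2_le_imp_le) (simp add: f0)
  then show ?case by (simp add: ennreal_mult''[symmetric] f0 ennreal_leI)
 qed
 have point': "AE z in lborel. ennreal (rho z * ft z * exp (uu z)) <= ennreal (abs (ldet (DP z))) * ennreal (f0 (P z)) * indicator G1 z"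
 proof -
  have "AE z in La. ennreal (rho z * ft z * exp (uu z)) <= ennreal (abs (ldet (DP z))) * ennreal (f0 (P z)) & z \<in> G1"
   using point full1 by eventually_elim simp
  then have "AE z in lborel. 0 < ennreal (rho z * ft z) --> ennreal (rho z * ft z * exp (uu z)) <= ennreal (abs (ldet (DP z))) * ennreal (f0 (P z)) & z \<in> G1"
   unfolding La(1) by (subst (asm) AE_density) auto
  then show ?thesis
  proof eventually_elim
   case (elim z)
   show ?case
   proof (cases "rho z * ft z = 0")
    case False
    then have "0 < ennreal (rho z * ft z)" using rho0[of z] nonneg[of z] by (simp add: less_le)
    then show ?thesis using elim by simp
   next
    case True
    then have "rho z * ft z * exp (uu z) = 0" by simp
    then show ?thesis by (simp only: ennreal_0) simp
   qed
  qed
 qed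
 have "(\<integral>\<^sup>+z. ennreal (exp (uu z)) \<partial>La) = (\<integral>\<^sup>+z. ennreal (rho z * ft z * exp (uu z)) \<partial>lborel)"
  unfolding La(1) using rho0 nonneg by (subst nn_integral_density) (auto simp: ennreal_mult)
 also have "... = (\<integral>\<^sup>+z. ennreal (rho z * ft z * exp (uu z)) \<partial>lebesgue)" by (rule nn_integral_completion[symmetric])
 also have "... <= (\<integral>\<^sup>+z. ennreal (abs (ldet (DP z))) * ennreal (f0 (P z)) * indicator G1 z \<partial>lebesgue)"
  by (rule nn_integral_mono_AE) (rule AE_completion[OF point'])
 also have "... = (\<integral>\<^sup>+z. ennreal (abs (ldet (DP z))) * ennreal (f0 (P z)) \<partial>lebesgue_on G1)"
  by (subst nn_integral_restrict_space) auto
 also have "... = (\<integral>\<^sup>+y. ennreal (f0 y) * indicator (P ` G1) y \<partial>lebesgue)"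
  by (rule nn_integral_differentiable_image[symmetric]) (use derP injP in auto)
 also have "... <= (\<integral>\<^sup>+y. ennreal (f0 y) \<partial>lebesgue)" by (intro nn_integral_mono) (auto simp: indicator_def)
 also have "... = 1" using f01 by (simp add: nn_integral_completion)
 finally have exp1: "(\<integral>\<^sup>+z. ennreal (exp (uu z)) \<partial>La) <= 1" .
 have bXphi: "AE z in La. norm (X z - phi z) <= 2 * k"
  using full1 AELa(1)
 proof eventually_elim
  case (elim z)
  then show ?case using subphi(3)[of z] bX[of z] norm_triangle_ineq4[of "X z" "phi z"] by auto
 qed
 have bN: "(norm (X z - phi z))^2 <= (2 * k)^2" if "norm (X z - phi z) <= 2 * k" for z using that by (intro power_mono) auto
 have iN: "integrable La (\<lambda>z. (norm (X z - phi z))^2)"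
  by (rule La.integrable_const_bound[where B="(2 * k)^2"]) (use bXphi bN in \<open>auto elim!: eventually_mono\<close>)
 have lnb: "abs (ln x) <= abs (ln c) + abs (ln C)" if "c <= x" "x <= C" for x
 proof -
  have "ln c <= ln x" "ln x <= ln C" using that c by auto
  then show ?thesis by linarith
 qed
 have lb1: "abs (ln (rho z)) <= abs (ln c) + abs (ln C)" if "rho z ~= 0" for z using bnd(1)[of z] that lnb by auto
 have il1: "integrable La (\<lambda>z. ln (rho z))"
  by (rule La.integrable_const_bound[where B="abs (ln c) + abs (ln C)"])
    (use AELa(1) lb1 in \<open>auto elim!: eventually_mono\<close>)
 have il2: "integrable La (\<lambda>z. ln (r (phi z)))"
  by (rule La.integrable_const_bound[where B="abs (ln c) + abs (ln C)"])
    (use rphi in \<open>(force elim!: eventually_mono intro!: lnb)+\<close>)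
 have iu: "integrable La uu" unfolding uu_def using iN il1 il2 by auto
 have ie: "integrable La (\<lambda>z. exp (uu z))"
 proof (rule integrableI_bounded)
  show "(\<integral>\<^sup>+z. ennreal (norm (exp (uu z))) \<partial>La) < \<infinity>" using exp1 by (simp add: le_less_trans)
 qed measurable
 have "1 + (LINT z|La. uu z) = (LINT z|La. 1 + uu z)" using iu La.prob_space by simp
 also have "... <= (LINT z|La. exp (uu z))" using iu ie by (intro integral_mono) (auto simp: exp_ge_add_one_self)
 also have "... <= 1"
 proof -
  have "(\<integral>\<^sup>+z. ennreal (exp (uu z)) \<partial>La) = ennreal (LINT z|La. exp (uu z))" by (rule nn_integral_eq_integral[OF ie]) auto
  then show ?thesis using exp1 by simp
 qed
 finally have "(LINT z|La. uu z) <= 0" by simp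
 moreover have "(LINT z|La. uu z) = (LINT z|La. (norm (X z - phi z))^2) / 8 - (LINT z|La. ln (rho z)) / 2 - (LINT z|La. ln (r (phi z))) / 2"
  unfolding uu_def using iN il1 il2 by simp
 ultimately show ?thesis unfolding lnr by (simp add: phi_def)
qed

text \<open>On the set \<open>B\<close> where \<open>x\<close> and \<open>T x\<close> both lie in
  the ball, \<open>T\<close> may be exchanged for the Brenier map of the restricted measures without
  changing the image measure. Optimality of \<open>T\<close> then forces its Fenchel-Young gap for
  the Brenier potentials to vanish, and equality in Fenchel-Young is the subgradient inequality on
  the ball.\<close>

lemma optimal_locally_subgradient:
 fixes mu :: "(real^'n) measure" and T :: "real^'n => real^'n"
 assumes mu: "prob_space mu" "sets mu = sets borel" and ac: "null_sets lborel \<subseteq> null_sets mu"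
  and T[measurable]: "T \<in> BM"
  and m2: "integrable mu (\<lambda>x. (norm x)^2)" "integrable mu (\<lambda>x. (norm (T x))^2)"
  and opt: "!!T'. T' \<in> BM ==> distr mu borel T' = distr mu borel T ==>
   (LINT x|mu. (norm (x - T x))^2) <= (LINT x|mu. (norm (x - T' x))^2)"
  and k: "0 < k"
 shows "\<exists>w. AE x in mu. norm x <= k & norm (T x) <= k --> (\<forall>x'\<in>cball 0 k. w x + T x \<bullet> (x' - x) <= w x')"
proof -
 interpret mu: prob_space mu by fact
 have [measurable_cong, simp]: "sets mu = sets borel" by fact
 have sp[simp]: "space mu = UNIV" using mu(2) by (metis sets_eq_imp_space_eq space_borel)
 define B where "B = {x. norm x <= k & norm (T x) <= k}"
 have B[measurable]: "B \<in> sets borel" unfolding B_def by measurable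
 define al where "al = density mu (indicator B)"
 define be where "be = distr al borel T"
 have sal[measurable_cong, simp]: "sets al = sets borel" by (simp add: al_def)
 have em: "emeasure al A = emeasure mu (B \<inter> A)" if "A \<in> sets borel" for A
  unfolding al_def using that by (subst emeasure_density) (auto simp: indicator_inter_arith[symmetric])
 have "emeasure al (space al) ~= \<infinity>" using em[of UNIV] by (simp add: al_def)
 then interpret al: finite_measure al by (rule finite_measureI)
 have fbe: "finite_measure be" unfolding be_def by (rule al.finite_measure_distr) simp
 have AEal: "(AE x in al. P x) \<longleftrightarrow> (AE x in mu. x \<in> B --> P x)" for P
  unfolding al_def by (subst AE_density) (auto simp: indicator_def)
 have mass: "measure al UNIV = measure be UNIV" unfolding be_def measure_def by (subst emeasure_distr) (auto simp: al_def)
 have acal: "null_sets lborel \<subseteq> null_sets al"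
 proof
  fix N :: "(real^'n) set" assume N: "N \<in> null_sets lborel"
  then have "emeasure mu N = 0" "N \<in> sets borel" using ac by auto
  then show "N \<in> null_sets al" using em[of N] emeasure_mono[of "B \<inter> N" N mu] by auto
 qed
 obtain w u where w: "convex_on UNIV w" and u: "convex_on UNIV u" and push: "distr al borel (cgrad w) = be"
  and le: "!!x y. x \<in> cball 0 k ==> y \<in> cball 0 k ==> x \<bullet> y <= w y + u x"
  and good: "AE y in al. subgrad w y = {cgrad w y} & cgrad w y \<in> cball 0 k & y \<in> subgrad u (cgrad w y) & w y + u (cgrad w y) = cgrad w y \<bullet> y"
 proof (rule brenier_exists[OF al.finite_measure_axioms sal fbe _ mass acal k])
  show "AE y in al. y \<in> cball 0 k" unfolding AEal by (auto simp: B_def)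
  show "AE x in be. x \<in> cball 0 k" unfolding be_def by (subst AE_distr_iff) (auto simp: AEal B_def)
 qed (auto simp: be_def)
 have cu: "continuous_on UNIV u" and cw: "continuous_on UNIV w" using w u by (auto intro: convex_on_continuous)
 have [measurable]: "u \<in> BM" "w \<in> BM" using cu cw by (auto intro: borel_measurable_continuous_onI)
 have [measurable]: "cgrad w \<in> BM" using w by (rule cgrad_measurable)
 define T' where "T' x = (if x \<in> B then cgrad w x else T x)" for x
 have T'[measurable]: "T' \<in> BM" unfolding T'_def by measurable
 have push': "distr mu borel T' = distr mu borel T"
 proof (rule measure_eqI)
  fix A assume "A \<in> sets (distr mu borel T')"
  then have A[measurable]: "A \<in> sets borel" by simp
  have [measurable]: "cgrad w -` A \<in> sets borel" "T -` A \<in> sets borel" "T' -` A \<in> sets borel"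
   using measurable_sets[OF \<open>cgrad w \<in> BM\<close> A] measurable_sets[OF T A] measurable_sets[OF T' A] by auto
  have "emeasure al (cgrad w -` A) = emeasure al (T -` A)"
   using arg_cong[OF push, of "\<lambda>M. emeasure M A"] unfolding be_def by (subst (asm) (1 2) emeasure_distr) (auto simp: al_def)
  then have eq: "emeasure mu (B \<inter> cgrad w -` A) = emeasure mu (B \<inter> T -` A)" by (simp add: em)
  have "emeasure mu (T' -` A) = emeasure mu (B \<inter> cgrad w -` A) + emeasure mu (- B \<inter> T -` A)"
   by (subst plus_emeasure) (auto simp: T'_def intro!: arg_cong[where f="emeasure mu"] split: if_splits)
  also have "... = emeasure mu (T -` A)" unfolding eq
   by (subst plus_emeasure) (auto intro!: arg_cong[where f="emeasure mu"])
  finally show "emeasure (distr mu borel T') A = emeasure (distr mu borel T) A" by (simp add: emeasure_distr)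
 qed simp
 have m2': "integrable mu (\<lambda>x. (norm (T' x))^2)" "(LINT x|mu. (norm (T' x))^2) = (LINT x|mu. (norm (T x))^2)"
 proof -
  have "integrable (distr mu borel T) (\<lambda>x. (norm x)^2)" using m2(2) by (subst integrable_distr_eq) auto
  then show "integrable mu (\<lambda>x. (norm (T' x))^2)" unfolding push'[symmetric] by (subst (asm) integrable_distr_eq) auto
  have "(\<integral>x. (norm x)^2 \<partial>distr mu borel T') = (\<integral>x. (norm x)^2 \<partial>distr mu borel T)" by (simp only: push')
  then show "(LINT x|mu. (norm (T' x))^2) = (LINT x|mu. (norm (T x))^2)" by (subst (asm) (1 2) integral_distr) auto
 qed
 have ip: "integrable mu (\<lambda>x. x \<bullet> S x)" if [measurable]: "S \<in> BM" and "integrable mu (\<lambda>x. (norm (S x))^2)" for S :: "real^'n => real^'n"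
  by (rule integrable_norm_add_sq) (use m2(1) that in auto)
 have ex: "(LINT x|mu. (norm (x - S x))^2) = (LINT x|mu. (norm x)^2) + (LINT x|mu. (norm (S x))^2) - 2 * (LINT x|mu. x \<bullet> S x)"
  if [measurable]: "S \<in> BM" and "integrable mu (\<lambda>x. (norm (S x))^2)" for S :: "real^'n => real^'n"
 proof -
  have e: "(norm (x - S x))^2 = (norm x)^2 + (norm (S x))^2 - 2 * (x \<bullet> S x)" for x
   by (simp add: power2_norm_eq_inner inner_diff_left inner_diff_right inner_commute)
  show ?thesis unfolding e using m2(1) that(2) ip[OF that] by simp
 qed
 have main: "0 <= (LINT x|mu. x \<bullet> T x - x \<bullet> T' x)"
  using opt[OF T' push'] ex[OF T m2(2)] ex[OF T' m2'(1)] m2'(2) ip[OF T m2(2)] ip[OF T' m2'(1)] by simp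
 define U where "U x = (if norm x <= k then u x else 0)" for x
 \<comment> \<open>The Fenchel-Young gap, nonnegative by duality. As \<open>T\<close> and
   \<open>T'\<close> have the same image measure, the terms with \<open>u\<close> integrate to the
   same value, and optimality makes the integral of \<open>g\<close> nonpositive.\<close>
 define g where "g x = (if x \<in> B then w x + u (T x) - x \<bullet> T x else 0)" for x
 have [measurable]: "U \<in> BM" "g \<in> BM" unfolding U_def[abs_def] g_def[abs_def] by measurable
 have bu: "\<exists>b. \<forall>x\<in>cball 0 k. abs (v x) <= b" if "continuous_on UNIV v" for v :: "real^'n => real"
 proof -
  have "compact (v ` cball 0 k)" using that by (intro compact_continuous_image) (auto intro: continuous_on_subset)
  then show ?thesis using compact_imp_bounded[of "v ` cball 0 k"] unfolding bounded_iff by auto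
 qed
 obtain bu' where bu': "!!x. x \<in> cball 0 k ==> abs (u x) <= bu'" using bu[OF cu] by blast
 have bu0: "0 <= bu'" using bu'[of 0] k by auto
 have Ub: "abs (U x) <= bu'" for x using bu' bu0 by (auto simp: U_def)
 have iU: "integrable mu (\<lambda>x. U (S x))" if [measurable]: "S \<in> BM" for S
  by (rule mu.integrable_const_bound[where B=bu']) (use Ub in auto)
 have eU: "(LINT x|mu. U (T' x)) = (LINT x|mu. U (T x))"
 proof -
  have "(\<integral>x. U x \<partial>distr mu borel T') = (\<integral>x. U x \<partial>distr mu borel T)" by (simp only: push')
  then show ?thesis by (subst (asm) (1 2) integral_distr) auto
 qed
 have pt: "AE x in mu. x \<bullet> T x - x \<bullet> T' x = U (T x) - U (T' x) - g x"
  using good[unfolded AEal]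
 proof eventually_elim
  case (elim x)
  show ?case
  proof (cases "x \<in> B")
   case True
   then have "T' x = cgrad w x" "cgrad w x \<in> cball 0 k" "T x \<in> cball 0 k" "w x + u (cgrad w x) = cgrad w x \<bullet> x"
    using elim by (auto simp: T'_def B_def)
   then show ?thesis using True by (simp add: U_def g_def inner_commute)
  qed (simp add: T'_def g_def)
 qed
 have ig: "integrable mu g"
 proof -
  have "integrable mu (\<lambda>x. U (T x) - U (T' x) - (x \<bullet> T x - x \<bullet> T' x))" using iU[OF T] iU[OF T'] ip[OF T m2(2)] ip[OF T' m2'(1)] by simp
  moreover have "AE x in mu. U (T x) - U (T' x) - (x \<bullet> T x - x \<bullet> T' x) = g x" using pt by eventually_elim simp
  ultimately show ?thesis by (subst (asm) integrable_cong_AE) auto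
 qed
 have g0: "0 <= g x" for x using le[of "T x" x] by (auto simp: g_def B_def inner_commute)
 have "(LINT x|mu. x \<bullet> T x - x \<bullet> T' x) = (LINT x|mu. U (T x) - U (T' x) - g x)" by (rule integral_cong_AE) (use pt in auto)
 also have "... = - (LINT x|mu. g x)" using iU[OF T] iU[OF T'] ig eU by simp
 finally have "(LINT x|mu. g x) <= 0" using main by simp
 then have "(LINT x|mu. g x) = 0" using Bochner_Integration.integral_nonneg[of mu g] g0 by (simp add: order_antisym)
 then have "AE x in mu. g x = 0" using integral_nonneg_eq_0_iff_AE[OF ig] g0 by simp
 then have "AE x in mu. norm x <= k & norm (T x) <= k --> (\<forall>x'\<in>cball 0 k. w x + T x \<bullet> (x' - x) <= w x')"
 proof eventually_elim
  case (elim x)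
  show ?case
  proof (intro impI ballI)
   fix x' :: "real^'n" assume h: "norm x <= k & norm (T x) <= k" "x' \<in> cball 0 k"
   then have "w x + u (T x) = T x \<bullet> x" using elim by (simp add: g_def B_def inner_commute)
   moreover have "T x \<bullet> x' <= w x' + u (T x)" using le[of "T x" x'] h by auto
   ultimately show "w x + T x \<bullet> (x' - x) <= w x'" by (simp add: inner_diff_right)
  qed
 qed
 then show ?thesis by blast
qed

text \<open>Potentials on balls of different radii are unrelated. Normalised at a common point
  \<open>x0\<close>, their lower limit inherits the subgradient inequality, and comparison with
  \<open>x0\<close> in both directions keeps it finite on \<open>D\<close>.\<close>

lemma optimal_potential:
 fixes mu :: "(real^'n) measure" and T :: "real^'n => real^'n"
 assumes mu: "prob_space mu" "sets mu = sets borel" and ac: "null_sets lborel \<subseteq> null_sets mu"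
  and T[measurable]: "T \<in> BM"
  and m2: "integrable mu (\<lambda>x. (norm x)^2)" "integrable mu (\<lambda>x. (norm (T x))^2)"
  and opt: "!!T'. T' \<in> BM ==> distr mu borel T' = distr mu borel T ==>
   (LINT x|mu. (norm (x - T x))^2) <= (LINT x|mu. (norm (x - T' x))^2)"
 obtains D and Phi :: "real^'n => real" where "D \<in> sets borel" "AE x in mu. x \<in> D" "D ~= {}"
  "!!x x'. x \<in> D ==> x' \<in> D ==> Phi x + T x \<bullet> (x' - x) <= Phi x'"
proof -
 interpret mu: prob_space mu by fact
 have [simp]: "space mu = UNIV" using mu(2) by (metis sets_eq_imp_space_eq space_borel)
 define P where "P w k x \<longleftrightarrow> (norm x <= real (Suc k) & norm (T x) <= real (Suc k) -->
  (\<forall>x'\<in>cball 0 (real (Suc k)). w x + T x \<bullet> (x' - x) <= w x'))" for w and k and x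
 have "\<forall>k. \<exists>w. AE x in mu. P w k x" unfolding P_def
  by (intro allI optimal_locally_subgradient[OF mu ac T m2 opt]) auto
 then obtain w where "!!k. AE x in mu. P (w k) k x" by metis
 then have "AE x in mu. \<forall>k. P (w k) k x" by (simp add: AE_all_countable)
 then obtain N where N: "{x \<in> space mu. \<not> (\<forall>k. P (w k) k x)} \<subseteq> N" "emeasure mu N = 0" "N \<in> sets mu" by (rule AE_E)
 define D where "D = - N"
 have Db: "D \<in> sets borel" using N(3) mu(2) by (auto simp: D_def)
 have full: "AE x in mu. x \<in> D" using N by (auto simp: D_def intro!: AE_not_in simp: null_sets_def)
 have ne: "D ~= {}"
 proof
  assume "D = {}"
  then have "AE x in mu. False" using full by simp
  then show False by (simp add: mu.AE_False)
 qed
 have sub: "eventually (\<lambda>k. w k x + T x \<bullet> (x' - x) <= w k x') sequentially" if "x \<in> D" for x x'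
 proof -
  have ev: "eventually (\<lambda>k. c <= real (Suc k)) sequentially" for c :: real
   using eventually_ge_at_top[of "nat \<lceil>c\<rceil>"] by eventually_elim linarith
  show ?thesis using ev[of "norm x"] ev[of "norm (T x)"] ev[of "norm x'"]
  proof eventually_elim
   case (elim k)
   moreover have "P (w k) k x" using that N(1) by (auto simp: D_def)
   ultimately show ?case by (simp add: P_def)
  qed
 qed
 obtain x0 where x0: "x0 \<in> D" using ne by blast
 define L where "L x = liminf (\<lambda>k. ereal (w k x - w k x0))" for x
 have Lsub: "L x + ereal (T x \<bullet> (x' - x)) <= L x'" if "x \<in> D" for x x'
 proof -
  have "L x + ereal (T x \<bullet> (x' - x)) = liminf (\<lambda>k. ereal (w k x - w k x0) + ereal (T x \<bullet> (x' - x)))"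
   unfolding L_def by (rule Liminf_add_ereal_right[symmetric]) auto
  also have "... <= L x'" unfolding L_def by (rule Liminf_mono) (use sub[OF that, of x'] in eventually_elim, simp)
  finally show ?thesis .
 qed
 have L0: "L x0 = 0" by (simp add: L_def Liminf_const zero_ereal_def)
 have fin: "abs (L x) ~= \<infinity>" if "x \<in> D" for x
  using Lsub[OF x0, of x] Lsub[OF that, of x0] L0 by (cases "L x") auto
 show thesis
 proof (rule that[OF Db full ne])
  fix x x' assume "x \<in> D" "x' \<in> D"
  then show "real_of_ereal (L x) + T x \<bullet> (x' - x) <= real_of_ereal (L x')"
   using Lsub[of x x'] fin[of x] fin[of x'] by (cases "L x"; cases "L x'") auto
 qed
qed

subsection \<open>Displacement interpolation\<close>

text \<open>The sum of the two subgradients is a subgradient of a smooth quadratic function, which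
  has only its gradient; testing along the difference \<open>g\<close> shows that \<open>g\<close>
  vanishes.\<close>

lemma sandwich_subgrad:
 fixes psi th :: "'a::euclidean_space => real"
 assumes sum: "!!z. psi z + th z = (norm z)^2 / (2 * s)" and s: "0 < s"
  and p: "p \<in> subgrad psi z" and q: "q \<in> subgrad th z"
 shows "p + q = (1 / s) *\<^sub>R z"
proof -
 define g where "g = p + q - (1 / s) *\<^sub>R z"
 have "psi z + p \<bullet> (s *\<^sub>R g) <= psi (z + s *\<^sub>R g)" "th z + q \<bullet> (s *\<^sub>R g) <= th (z + s *\<^sub>R g)"
  using subgradD[OF p, of "z + s *\<^sub>R g"] subgradD[OF q, of "z + s *\<^sub>R g"] by simp_all
 then have "(norm z)^2 / (2 * s) + (p + q) \<bullet> (s *\<^sub>R g) <= (norm (z + s *\<^sub>R g))^2 / (2 * s)"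
  using sum[of z] sum[of "z + s *\<^sub>R g"] unfolding inner_add_left by linarith
 also have "... = (norm z)^2 / (2 * s) + z \<bullet> g + s * (g \<bullet> g) / 2"
  using s by (simp add: power2_norm_eq_inner inner_add_left inner_add_right inner_commute field_simps)
 finally have "s * ((p + q) \<bullet> g) - z \<bullet> g <= s * (g \<bullet> g) / 2" by simp
 moreover have "s * ((p + q) \<bullet> g) - z \<bullet> g = s * (g \<bullet> g)"
  using s by (simp add: g_def inner_add_left inner_diff_left field_simps)
 ultimately have "s * (g \<bullet> g) <= 0" by simp
 then have "g \<bullet> g <= 0" using s by (simp add: mult_le_0_iff)
 then have "g = 0" using inner_ge_zero[of g] by (metis inner_eq_zero_iff order_antisym)
 then show ?thesis by (simp add: g_def)
qed

text \<open>Convexity of \<open>th\<close> bounds \<open>psi\<close> from above by quadratics, so a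
  gradient step of length \<open>s\<close> improves the subgradient inequality by
  \<open>s / 2\<close> times the squared change of the subgradient. Symmetrising in the two points
  gives cocoercivity.\<close>

lemma sandwich_cocoercive:
 fixes psi th :: "'a::euclidean_space => real"
 assumes sum: "!!z. psi z + th z = (norm z)^2 / (2 * s)" and s: "0 < s" and cv: "convex_on UNIV th"
  and p1: "p1 \<in> subgrad psi z1" and p2: "p2 \<in> subgrad psi z2"
 shows "s * (norm (p1 - p2))^2 <= (p1 - p2) \<bullet> (z1 - z2)"
proof -
 have half: "psi z + p \<bullet> (z' - z) + s * (norm (p' - p))^2 / 2 <= psi z'"
  if p: "p \<in> subgrad psi z" and p': "p' \<in> subgrad psi z'" for z z' p p'
 proof -
  obtain q where q: "q \<in> subgrad th z'" using subgrad_nonempty[OF cv] by blast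
  have qq: "q = (1 / s) *\<^sub>R z' - p'" using sandwich_subgrad[OF sum s p' q] by (simp add: algebra_simps)
  define d where "d = p' - p"
  define y where "y = z' - s *\<^sub>R d"
  have "psi z + p \<bullet> (y - z) <= psi y" using subgradD[OF p] .
  also have "psi y = (norm y)^2 / (2 * s) - th y" using sum[of y] by simp
  also have "... <= (norm y)^2 / (2 * s) - (th z' + q \<bullet> (y - z'))" using subgradD[OF q, of y] by simp
  also have "... = psi z' + ((norm y)^2 - (norm z')^2) / (2 * s) + s * (q \<bullet> d)"
   using sum[of z'] by (simp add: y_def diff_divide_distrib)
  also have "(norm y)^2 - (norm z')^2 = s * (s * (d \<bullet> d) - 2 * (z' \<bullet> d))"
   unfolding y_def power2_norm_eq_inner by (simp add: inner_diff_left inner_diff_right inner_commute algebra_simps)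
  also have "... / (2 * s) = s * (d \<bullet> d) / 2 - z' \<bullet> d" using s by (simp add: field_simps)
  also have "s * (q \<bullet> d) = z' \<bullet> d - s * (p' \<bullet> d)" using s by (simp add: qq inner_diff_left field_simps)
  finally have "psi z + p \<bullet> (z' - z) - s * (p \<bullet> d) <= psi z' + s * (d \<bullet> d) / 2 - s * (p' \<bullet> d)"
   by (simp add: y_def inner_diff_right)
  moreover have "s * (d \<bullet> d) = s * (p' \<bullet> d) - s * (p \<bullet> d)" by (simp add: d_def inner_diff_left right_diff_distrib)
  ultimately show ?thesis unfolding power2_norm_eq_inner d_def[symmetric] by linarith
 qed
 have "p1 \<bullet> (z2 - z1) + p2 \<bullet> (z1 - z2) + s * (norm (p2 - p1))^2 <= 0" using half[OF p1 p2] half[OF p2 p1] by (simp add: norm_minus_commute)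
 moreover have "p1 \<bullet> (z2 - z1) + p2 \<bullet> (z1 - z2) = - ((p1 - p2) \<bullet> (z1 - z2))" by (simp add: inner_diff_left inner_diff_right)
 ultimately show ?thesis by (simp add: norm_minus_commute)
qed

lemma subgrad_segment:
 assumes p1: "p \<in> subgrad psi z1" and p2: "p \<in> subgrad psi z2" and cv: "convex_on UNIV psi" and r: "0 <= r" "r <= 1"
 shows "p \<in> subgrad psi (z1 + r *\<^sub>R (z2 - z1))"
proof -
 have e: "z1 + r *\<^sub>R (z2 - z1) = (1 - r) *\<^sub>R z1 + r *\<^sub>R z2" by (simp add: algebra_simps)
 have "psi (z1 + r *\<^sub>R (z2 - z1)) <= (1 - r) * psi z1 + r * psi z2"
  unfolding e by (rule convex_onD[OF cv]) (use r in auto)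
 moreover have "psi z2 = psi z1 + p \<bullet> (z2 - z1)"
  using subgradD[OF p1, of z2] subgradD[OF p2, of z1] by (simp add: inner_diff_right)
 ultimately have le: "psi (z1 + r *\<^sub>R (z2 - z1)) <= psi z1 + r * (p \<bullet> (z2 - z1))" by (simp add: algebra_simps)
 show ?thesis unfolding subgrad_def
 proof (intro CollectI allI)
  fix y
  show "psi (z1 + r *\<^sub>R (z2 - z1)) + p \<bullet> (y - (z1 + r *\<^sub>R (z2 - z1))) <= psi y"
   using subgradD[OF p1, of y] le by (simp add: inner_diff_right inner_add_right algebra_simps)
 qed
qed

text \<open>\<open>psi\<close> is the Legendre transform of \<open>s / 2\<close> times the squared
  norm plus \<open>t\<close> times the convex potential; its subgradients invert the interpolation
  map. Its complement \<open>th\<close> is a partial minimum of a jointly convex function, hence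
  convex. The last clause treats vanishing monotonicity: there \<open>T x2\<close> is a further
  subgradient of the potential at \<open>x1\<close>.\<close>

lemma interpolation_potentials:
 fixes T :: "'a::euclidean_space => 'a"
 assumes ne: "D ~= {}" and sub: "!!x x'. x \<in> D ==> x' \<in> D ==> Phi x + T x \<bullet> (x' - x) <= Phi x'"
  and t: "0 < t" "t < 1"
 obtains psi th :: "'a => real" where "convex_on UNIV psi" "convex_on UNIV th"
  "!!z. psi z + th z = (norm z)^2 / (2 * (1 - t))"
  "!!x. x \<in> D ==> x \<in> subgrad psi ((1 - t) *\<^sub>R x + t *\<^sub>R T x)"
  "!!x1 x2. x1 \<in> D ==> x2 \<in> D ==> (x1 - x2) \<bullet> (T x1 - T x2) = 0 ==>
    x1 \<in> subgrad psi ((1 - t) *\<^sub>R x1 + t *\<^sub>R T x2)"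
proof -
 define s where "s = 1 - t"
 have s: "0 < s" using t by (simp add: s_def)
 \<comment> \<open>Epigraph of the supremum of the tangent planes. The supremum may be infinite off
   \<open>D\<close>, and pairs \<open>(x, c)\<close> avoid infinite values.\<close>
 define E where "E = {(x, c). \<forall>x0\<in>D. Phi x0 + T x0 \<bullet> (x - x0) <= c}"
 define h where "h z e = z \<bullet> fst e - s * (norm (fst e))^2 / 2 - t * snd e" for z :: 'a and e :: "'a \<times> real"
 define psi where "psi z = Sup (h z ` E)" for z
 define th where "th z = (norm z)^2 / (2 * s) - psi z" for z
 have DE: "(x, Phi x) \<in> E" if "x \<in> D" for x using sub that by (auto simp: E_def)
 have E0: "E ~= {}" using ne DE by blast
 have bdd: "bdd_above (h z ` E)" for z
 proof -
  obtain x0 where x0: "x0 \<in> D" using ne by blast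
  have "h z e <= (norm (z - t *\<^sub>R T x0))^2 / (2 * s) + t * (T x0 \<bullet> x0 - Phi x0)" if e: "e \<in> E" for e
  proof -
   obtain x c where [simp]: "e = (x, c)" by (cases e)
   define y where "y = z - t *\<^sub>R T x0"
   have "Phi x0 + T x0 \<bullet> (x - x0) <= c" using e x0 by (auto simp: E_def)
   then have "t * (Phi x0 + T x0 \<bullet> (x - x0)) <= t * c" using t by simp
   then have "h z e <= z \<bullet> x - s * (norm x)^2 / 2 - t * (Phi x0 + T x0 \<bullet> (x - x0))" by (simp add: h_def)
   also have "... = y \<bullet> x - s * (norm x)^2 / 2 + t * (T x0 \<bullet> x0 - Phi x0)"
    by (simp add: y_def inner_diff_left inner_diff_right algebra_simps)
   also have "y \<bullet> x - s * (norm x)^2 / 2 <= (norm y)^2 / (2 * s)"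
   proof -
    have "0 <= (norm (y - s *\<^sub>R x))^2" by simp
    also have "... = (norm y)^2 - 2 * s * (y \<bullet> x) + s * s * (norm x)^2"
     by (simp add: power2_norm_eq_inner inner_diff_left inner_diff_right inner_commute algebra_simps)
    finally have "s * (2 * (y \<bullet> x) - s * (norm x)^2) <= (norm y)^2" by (simp add: algebra_simps)
    then have "(y \<bullet> x - s * (norm x)^2 / 2) * (2 * s) <= (norm y)^2" by (simp add: algebra_simps)
    then show ?thesis using s by (simp add: pos_le_divide_eq)
   qed
   finally show ?thesis by (simp add: y_def)
  qed
  then show ?thesis by (intro bdd_aboveI2[where M="(norm (z - t *\<^sub>R T x0))^2 / (2 * s) + t * (T x0 \<bullet> x0 - Phi x0)"])
 qed
 have up: "h z e <= psi z" if "e \<in> E" for z e unfolding psi_def using that bdd by (intro cSUP_upper)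
 have least: "psi z <= c" if "!!e. e \<in> E ==> h z e <= c" for z c unfolding psi_def using that E0 by (intro cSUP_least)
 have cvpsi: "convex_on UNIV psi"
 proof (rule convex_onI)
  fix r :: real and x y assume r: "0 < r" "r < 1"
  show "psi ((1 - r) *\<^sub>R x + r *\<^sub>R y) <= (1 - r) * psi x + r * psi y"
  proof (rule least)
   fix e assume e: "e \<in> E"
   have "h ((1 - r) *\<^sub>R x + r *\<^sub>R y) e = (1 - r) * h x e + r * h y e" unfolding h_def inner_add_left inner_scaleR_left by (simp add: field_simps)
   also have "... <= (1 - r) * psi x + r * psi y" using up[OF e] r by (intro add_mono mult_left_mono) auto
   finally show "h ((1 - r) *\<^sub>R x + r *\<^sub>R y) e <= (1 - r) * psi x + r * psi y" .
  qed
 qed simp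
 \<comment> \<open>The result of completing the square in \<open>lh\<close>: in this form the
   complement of \<open>h\<close> is visibly convex in \<open>z\<close> and \<open>e\<close>
   jointly.\<close>
 define l where "l z e = s / 2 * (norm (fst e - (1 / s) *\<^sub>R z))^2 + t * snd e" for z :: 'a and e :: "'a \<times> real"
 have lh: "(norm z)^2 / (2 * s) - h z e = l z e" for z e
 proof -
  have "(norm (fst e - (1 / s) *\<^sub>R z))^2 = (norm (fst e))^2 - 2 * (z \<bullet> fst e) / s + (norm z)^2 / s^2"
   unfolding power2_norm_eq_inner by (simp add: inner_diff_left inner_diff_right inner_commute power2_eq_square)
  then have "l z e = s / 2 * ((norm (fst e))^2 - 2 * (z \<bullet> fst e) / s + (norm z)^2 / s^2) + t * snd e" by (simp add: l_def)
  moreover have "s / 2 * (A - 2 * B / s + C / s^2) = C / (2 * s) - (B - s * A / 2)" for A B C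
   using s by (simp add: power2_eq_square field_simps)
  ultimately show ?thesis by (simp add: h_def)
 qed
 have thle: "th z <= l z e" if "e \<in> E" for z e using up[OF that, of z] lh[of z e] by (simp add: th_def)
 have cvth: "convex_on UNIV th"
 proof (rule convex_onI)
  fix r :: real and x y assume r: "0 < r" "r < 1"
  have key: "th ((1 - r) *\<^sub>R x + r *\<^sub>R y) <= (1 - r) * l x e + r * l y e'" if e: "e \<in> E" "e' \<in> E" for e e'
  proof -
   define e2 where "e2 = (1 - r) *\<^sub>R e + r *\<^sub>R e'"
   have "e2 \<in> E"
   proof -
    obtain a c a' c' where [simp]: "e = (a, c)" "e' = (a', c')" by (cases e; cases e')
    have "Phi x0 + T x0 \<bullet> ((1 - r) *\<^sub>R a + r *\<^sub>R a' - x0) <= (1 - r) * c + r * c'" if "x0 \<in> D" for x0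
    proof -
     have "Phi x0 + T x0 \<bullet> ((1 - r) *\<^sub>R a + r *\<^sub>R a' - x0) = (1 - r) * (Phi x0 + T x0 \<bullet> (a - x0)) + r * (Phi x0 + T x0 \<bullet> (a' - x0))"
      by (simp add: inner_diff_right inner_add_right algebra_simps)
     also have "... <= (1 - r) * c + r * c'" using e that r by (intro add_mono mult_left_mono) (auto simp: E_def)
     finally show ?thesis .
    qed
    then show ?thesis by (simp add: E_def e2_def)
   qed
   then have "th ((1 - r) *\<^sub>R x + r *\<^sub>R y) <= l ((1 - r) *\<^sub>R x + r *\<^sub>R y) e2" by (rule thle)
   also have "... <= (1 - r) * l x e + r * l y e'"
   proof -
    define A where "A = fst e - (1 / s) *\<^sub>R x"
    define B where "B = fst e' - (1 / s) *\<^sub>R y"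
    have a: "fst e2 - (1 / s) *\<^sub>R ((1 - r) *\<^sub>R x + r *\<^sub>R y) = (1 - r) *\<^sub>R A + r *\<^sub>R B"
     by (simp add: e2_def A_def B_def scaleR_diff_right scaleR_add_right mult.commute)
    have "(1 - r) * (norm A)^2 + r * (norm B)^2 - (norm ((1 - r) *\<^sub>R A + r *\<^sub>R B))^2 = (1 - r) * r * (norm (A - B))^2"
     unfolding power2_norm_eq_inner by (simp add: inner_add_left inner_add_right inner_diff_left inner_diff_right inner_commute algebra_simps)
    moreover have "0 <= (1 - r) * r * (norm (A - B))^2" using r by simp
    ultimately have "(norm ((1 - r) *\<^sub>R A + r *\<^sub>R B))^2 <= (1 - r) * (norm A)^2 + r * (norm B)^2" by linarith
    then have *: "s / 2 * (norm ((1 - r) *\<^sub>R A + r *\<^sub>R B))^2 <= s / 2 * ((1 - r) * (norm A)^2 + r * (norm B)^2)"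
     using s by (intro mult_left_mono) auto
    have e: "s / 2 * ((1 - r) * (norm A)^2 + r * (norm B)^2) + t * snd e2 = (1 - r) * l x e + r * l y e'"
     by (simp add: l_def A_def B_def e2_def field_simps)
    show ?thesis using * unfolding e[symmetric] unfolding l_def a by simp
   qed
   finally show ?thesis .
  qed
  have near: "\<exists>e\<in>E. l x e < th x + eps" if eps: "0 < eps" for x eps
  proof -
   have "\<exists>e\<in>E. psi x - eps < h x e" using eps less_cSUP_iff[OF E0 bdd, of "psi x - eps" x] by (simp add: psi_def)
   then show ?thesis by (force simp: th_def lh[symmetric])
  qed
  show "th ((1 - r) *\<^sub>R x + r *\<^sub>R y) <= (1 - r) * th x + r * th y"
  proof (rule field_le_epsilon)
   fix eps :: real assume "0 < eps"
   then obtain e e' where e: "e \<in> E" "l x e < th x + eps" "e' \<in> E" "l y e' < th y + eps" using near by meson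
   note key[OF e(1,3)]
   also have "(1 - r) * l x e + r * l y e' <= (1 - r) * (th x + eps) + r * (th y + eps)"
    using e r by (intro add_mono mult_left_mono) auto
   finally show "th ((1 - r) *\<^sub>R x + r *\<^sub>R y) <= (1 - r) * th x + r * th y + eps" by (simp add: algebra_simps)
  qed
 qed simp
 have ident: "x \<in> subgrad psi (s *\<^sub>R x + t *\<^sub>R p)"
  if xc: "(x, c) \<in> E" and p: "!!x' c'. (x', c') \<in> E ==> c + p \<bullet> (x' - x) <= c'" for x c p
 proof -
  define z where "z = s *\<^sub>R x + t *\<^sub>R p"
  have "psi z <= h z (x, c)"
  proof (rule least)
   fix e assume e: "e \<in> E"
   obtain x' c' where [simp]: "e = (x', c')" by (cases e)
   have "t * (c + p \<bullet> (x' - x)) <= t * c'" using p[of x' c'] e t by simp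
   then have "h z e <= z \<bullet> x' - s * (norm x')^2 / 2 - t * (c + p \<bullet> (x' - x))" by (simp add: h_def)
   also have "... = h z (x, c) - s / 2 * (norm (x' - x))^2"
    unfolding h_def z_def power2_norm_eq_inner
    by (simp add: inner_add_left inner_add_right inner_diff_left inner_diff_right inner_commute field_simps)
   also have "... <= h z (x, c)" using s by simp
   finally show "h z e <= h z (x, c)" .
  qed
  then have "psi z + x \<bullet> (z' - z) <= psi z'" for z'
   using up[OF xc, of z'] by (simp add: h_def inner_diff_right inner_diff_left inner_commute)
  then show ?thesis by (simp add: subgrad_def z_def)
 qed
 show thesis
 proof (rule that[OF cvpsi cvth, folded s_def])
  show "psi z + th z = (norm z)^2 / (2 * s)" for z by (simp add: th_def)
  show "x \<in> subgrad psi (s *\<^sub>R x + t *\<^sub>R T x)" if "x \<in> D" for x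
   by (rule ident[OF DE[OF that]]) (use that in \<open>auto simp: E_def\<close>)
  fix x1 x2 assume x: "x1 \<in> D" "x2 \<in> D" and eq: "(x1 - x2) \<bullet> (T x1 - T x2) = 0"
  have "Phi x1 = Phi x2 + T x2 \<bullet> (x1 - x2)"
  proof -
   have "Phi x1 + T x1 \<bullet> (x2 - x1) + T x2 \<bullet> (x1 - x2) = Phi x1 - (x1 - x2) \<bullet> (T x1 - T x2)"
    by (simp add: inner_diff_left inner_diff_right inner_commute)
   then have "Phi x1 + T x1 \<bullet> (x2 - x1) + T x2 \<bullet> (x1 - x2) = Phi x1" using eq by simp
   then show ?thesis using sub[OF x] sub[OF x(2) x(1)] by simp
  qed
  then have "Phi x1 + T x2 \<bullet> (x' - x1) = Phi x2 + T x2 \<bullet> (x' - x2)" for x' by (simp add: inner_diff_right)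
  then show "x1 \<in> subgrad psi (s *\<^sub>R x1 + t *\<^sub>R T x2)"
   by (intro ident[OF DE[OF x(1)]]) (use x in \<open>auto simp: E_def\<close>)
 qed
qed

lemma norm_le_norm_add:
 fixes p q :: "'a::euclidean_space"
 assumes "0 <= p \<bullet> q"
 shows "norm p <= norm (p + q)" "norm q <= norm (p + q)"
 unfolding norm_le using assms inner_ge_zero[of p] inner_ge_zero[of q] by (auto simp: inner_add_left inner_add_right inner_commute)

text \<open>Directional derivatives as limits along a fixed sequence: this form passes to
  inequalities and shows that derivatives are Borel measurable.\<close>

lemma has_derivative_sequence:
 fixes f :: "'a::real_normed_vector => 'b::real_normed_vector"
 assumes "(f has_derivative f') (at z)"
 shows "(\<lambda>k. real (Suc k) *\<^sub>R (f (z + (1 / real (Suc k)) *\<^sub>R h) - f z)) \<longlonglongrightarrow> f' h"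
proof (cases "h = 0")
 case True
 then show ?thesis using has_derivative_bounded_linear[OF assms] by (simp add: linear_simps)
next
 case False
 interpret bounded_linear f' by (rule has_derivative_bounded_linear[OF assms])
 let ?h = "\<lambda>k. (1 / real (Suc k)) *\<^sub>R h"
 have "?h \<longlonglongrightarrow> 0 *\<^sub>R h" by (intro tendsto_intros LIMSEQ_Suc[OF lim_1_over_n])
 then have "filterlim ?h (at 0) sequentially" using False by (simp add: filterlim_at)
 from filterlim_compose[OF conjunct2[OF assms[unfolded has_derivative_at]] this]
 have "(\<lambda>k. norm (f (z + ?h k) - f z - f' (?h k)) / norm (?h k) * norm h) \<longlonglongrightarrow> 0 * norm h" by (rule tendsto_mult_right)
 moreover have "norm (d - f' ((1 / r) *\<^sub>R h)) / norm ((1 / r) *\<^sub>R h) * norm h = norm (r *\<^sub>R d - f' h)" if "0 < r" for r d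
 proof -
  have "r *\<^sub>R d - f' h = r *\<^sub>R (d - f' ((1 / r) *\<^sub>R h))" using that by (simp add: scaleR_diff_right scaleR)
  then show ?thesis using that False by simp
 qed
 ultimately have "(\<lambda>k. norm (real (Suc k) *\<^sub>R (f (z + ?h k) - f z) - f' h)) \<longlonglongrightarrow> 0"
  by (simp only: of_nat_0_less_iff zero_less_Suc mult_zero_left)
 then show ?thesis by (rule LIM_zero_cancel[OF tendsto_norm_zero_cancel])
qed

lemma monotone_derivative_nonneg:
 fixes F :: "'a::euclidean_space => 'a"
 assumes F: "(F has_derivative c) (at z)" and mono: "!!y. 0 <= (F y - F z) \<bullet> (y - z)"
 shows "0 <= c h \<bullet> h"
proof (rule LIMSEQ_le_const)
 show "(\<lambda>k. (real (Suc k) *\<^sub>R (F (z + (1 / real (Suc k)) *\<^sub>R h) - F z)) \<bullet> h) \<longlonglongrightarrow> c h \<bullet> h"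
  by (intro tendsto_intros has_derivative_sequence F)
 have "0 <= (F (z + (1 / real (Suc k)) *\<^sub>R h) - F z) \<bullet> h" for k
  using mono[of "z + (1 / real (Suc k)) *\<^sub>R h"] unfolding add_diff_cancel_left' inner_scaleR_right zero_le_mult_iff by simp
 then show "\<exists>N. \<forall>k\<ge>N. 0 <= (real (Suc k) *\<^sub>R (F (z + (1 / real (Suc k)) *\<^sub>R h) - F z)) \<bullet> h"
  unfolding inner_scaleR_left by (blast intro: mult_nonneg_nonneg of_nat_0_le_iff)
qed

lemma pos_definite_if_det:
 fixes a :: "real^'n => real^'n"
 assumes a: "sym_map a" "!!h. 0 <= a h \<bullet> h" and d: "ldet a ~= 0" and h: "h ~= 0"
 shows "0 < a h \<bullet> h"
proof (rule ccontr)
 assume "\<not> 0 < a h \<bullet> h"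
 then have 0: "a h \<bullet> h = 0" using a(2)[of h] by simp
 have l: "linear a" and s: "!!h k. a h \<bullet> k = h \<bullet> a k" using a(1) by (auto simp: sym_map_def)
 have "a h \<bullet> k = 0" for k
  by (rule psd_form_kernel[OF l s subspace_UNIV]) (use a 0 in auto)
 then have "a h = 0" by (metis inner_eq_zero_iff)
 moreover have "inj a" using d l by (metis det_nz_iff_inj)
 ultimately show False using h linear_0[OF l] by (metis injD)
qed

text \<open>The geodesic seen from an interior time: \<open>ft\<close> is the density there,
  \<open>X\<close> and \<open>Y\<close> carry it to the endpoints with derivatives \<open>a\<close>
  and \<open>b\<close>, and \<open>R\<close> is the interpolation map from time \<open>0\<close>.
  Monotonicity holds everywhere, while derivatives, definiteness and strictness are asked only on
  the Borel set \<open>G\<close> of full measure.\<close>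

locale interp =
 fixes t :: real and X Y R :: "real^'n => real^'n" and G :: "(real^'n) set"
  and a b :: "real^'n => real^'n => real^'n" and f0 f1 ft :: "real^'n => real"
 assumes t: "0 < t" "t < 1"
  and XY: "!!z. (1 - t) *\<^sub>R X z + t *\<^sub>R Y z = z"
  and mono: "!!z1 z2. 0 <= (X z1 - X z2) \<bullet> (Y z1 - Y z2)"
  and strict: "!!z1 z2. z1 \<in> G ==> z2 \<in> G ==> (X z1 - X z2) \<bullet> (Y z1 - Y z2) = 0 ==> z1 = z2"
  and RX: "!!z. z \<in> G ==> R (X z) = z"
  and meas[measurable]: "X \<in> BM" "Y \<in> BM" "R \<in> BM"
   "G \<in> sets borel" "ft \<in> BM"
  and der: "!!z. z \<in> G ==> (X has_derivative a z) (at z)" "!!z. z \<in> G ==> (Y has_derivative b z) (at z)"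
  and sym: "!!z. z \<in> G ==> sym_map (a z)" "!!z. z \<in> G ==> sym_map (b z)"
  and pos: "!!z h. z \<in> G ==> h ~= 0 ==> 0 < a z h \<bullet> h" "!!z h. z \<in> G ==> h ~= 0 ==> 0 < b z h \<bullet> h"
  and ab: "!!z h. z \<in> G ==> (1 - t) *\<^sub>R a z h + t *\<^sub>R b z h = h"
  and slc: "slc_dens f0" "slc_dens f1"
  and ft0: "!!z. 0 <= ft z"
  and prob: "prob_space (dens ft)"
  and full: "AE z in dens ft. z \<in> G"
  and push: "distr (dens ft) borel X = dens f0"
   "distr (dens ft) borel Y = dens f1"
  and rel: "AE z in lborel. z \<in> G --> f0 (X z) * abs (ldet (a z)) = ft z"
   "AE z in lborel. z \<in> G --> f1 (Y z) * abs (ldet (b z)) = ft z"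

text \<open>\<open>X\<close> is the gradient of \<open>psi\<close>, single-valued and Lipschitz
  because \<open>psi\<close> and \<open>th\<close> are convex with a quadratic sum, and
  \<open>Y\<close> is determined by \<open>X\<close> and the point. The set \<open>G\<close> drops
  the points without second derivative and, by Sard's theorem, those where a derivative is
  singular.\<close>

lemma interp_exists:
 fixes T :: "real^'n => real^'n"
 assumes Db[measurable]: "D \<in> sets borel" and ne: "D ~= {}"
  and sub: "!!x x'. x \<in> D ==> x' \<in> D ==> Phi x + T x \<bullet> (x' - x) <= Phi x'"
  and t: "0 < t" "t < 1" and T[measurable]: "T \<in> BM"
  and slc: "slc_dens f0" "slc_dens f1"
  and D: "AE x in dens f0. x \<in> D"
  and push: "distr (dens f0) borel T = dens f1"
 obtains X Y G a b ft where "interp t X Y (\<lambda>x. (1 - t) *\<^sub>R x + t *\<^sub>R T x) G a b f0 f1 ft"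
  "!!z. z \<in> G ==> Y z = T (X z)"
  "distr (dens f0) borel (\<lambda>x. (1 - t) *\<^sub>R x + t *\<^sub>R T x) = dens ft"
proof -
 define R where "R x = (1 - t) *\<^sub>R x + t *\<^sub>R T x" for x
 have R[measurable]: "R \<in> BM" unfolding R_def by measurable
 define s where "s = 1 - t"
 have s: "0 < s" using t by (simp add: s_def)
 define mu0 where "mu0 = dens f0"
 define mu1 where "mu1 = dens f1"
 define mu where "mu = distr mu0 borel R"
 have [measurable]: "f0 \<in> BM" "f1 \<in> BM" using slc by (auto simp: slc_dens_def)
 have [measurable_cong, simp]: "sets mu0 = sets borel" "sets mu1 = sets borel" "sets mu = sets borel" by (auto simp: mu0_def mu1_def mu_def)
 have [simp]: "space mu0 = UNIV" "space mu1 = UNIV" "space mu = UNIV" by (auto simp: mu0_def mu1_def mu_def)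
 have "emeasure mu0 UNIV = 1" using slc(1) by (simp add: mu0_def emeasure_density slc_dens_def)
 then interpret mu0: prob_space mu0 by (intro prob_spaceI) simp
 have pmu: "prob_space mu" unfolding mu_def by (rule mu0.prob_space_distr) measurable
 obtain psi th where psi: "convex_on UNIV psi" and th: "convex_on UNIV th"
  and sum: "!!z. psi z + th z = (norm z)^2 / (2 * s)"
  and id1: "!!x. x \<in> D ==> x \<in> subgrad psi (R x)"
  and id2: "!!x1 x2. x1 \<in> D ==> x2 \<in> D ==> (x1 - x2) \<bullet> (T x1 - T x2) = 0 ==> x1 \<in> subgrad psi (s *\<^sub>R x1 + t *\<^sub>R T x2)"
  unfolding s_def R_def by (rule interpolation_potentials[OF ne sub t]) auto
 obtain X where X: "!!z. X z \<in> subgrad psi z" using subgrad_nonempty[OF psi] unfolding ex_in_conv[symmetric] by metis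
 obtain Q where Q: "!!z. Q z \<in> subgrad th z" using subgrad_nonempty[OF th] unfolding ex_in_conv[symmetric] by metis
 have XQ: "p + q = (1 / s) *\<^sub>R z" if "p \<in> subgrad psi z" "q \<in> subgrad th z" for p q z
  by (rule sandwich_subgrad[OF sum s that])
 have uX: "p = X z" if "p \<in> subgrad psi z" for p z using XQ[OF that Q] XQ[OF X Q] by (metis add_right_cancel)
 have uQ: "q = (1 / s) *\<^sub>R z - X z" if "q \<in> subgrad th z" for q z using XQ[OF X that] by (simp add: algebra_simps)
 define Y where "Y z = (1 / t) *\<^sub>R (z - s *\<^sub>R X z)" for z
 have XY: "s *\<^sub>R X z + t *\<^sub>R Y z = z" for z using t by (simp add: Y_def)
 have QY: "Q z = (t / s) *\<^sub>R Y z" for z using uQ[OF Q, of z] t s by (simp add: Y_def scaleR_diff_right)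
 have coc: "s * (norm (X z1 - X z2))^2 <= (X z1 - X z2) \<bullet> (z1 - z2)" for z1 z2
  by (rule sandwich_cocoercive[OF sum s th X X])
 have dY: "Y z1 - Y z2 = (1 / t) *\<^sub>R ((z1 - z2) - s *\<^sub>R (X z1 - X z2))" for z1 z2
  by (simp add: Y_def scaleR_diff_right)
 have mono: "0 <= (X z1 - X z2) \<bullet> (Y z1 - Y z2)" for z1 z2
  using coc[of z1 z2] t unfolding dY by (simp add: inner_diff_right power2_norm_eq_inner)
 have lipX: "norm (X z1 - X z2) <= (1 / s) * norm (z1 - z2)" for z1 z2
 proof -
  have e: "z1 - z2 = s *\<^sub>R (X z1 - X z2) + t *\<^sub>R (Y z1 - Y z2)" by (subst (1 2) XY[symmetric]) (simp add: algebra_simps)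
  have "norm (s *\<^sub>R (X z1 - X z2)) <= norm (z1 - z2)" unfolding e by (rule norm_le_norm_add(1)) (use mono[of z1 z2] s t in simp)
  then show ?thesis using s unfolding norm_scaleR by (simp add: pos_le_divide_eq mult.commute)
 qed
 have cX: "continuous_on UNIV X"
  by (rule lipschitz_on_continuous_on[of "1 / s"], rule lipschitz_onI) (use lipX s in \<open>auto simp: dist_norm\<close>)
 then have cY: "continuous_on UNIV Y" unfolding Y_def by (intro continuous_intros)
 have [measurable]: "X \<in> BM" "Y \<in> BM"
  using cX cY by (auto intro: borel_measurable_continuous_onI)
 have XR: "X (R x) = x" if "x \<in> D" for x using uX[OF id1[OF that]] by simp
 have YR: "Y (R x) = T x" if "x \<in> D" for x using XR[OF that] t by (simp add: Y_def R_def s_def)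
 define Z where "Z = {z. X z \<in> D & R (X z) = z}"
 have Z[measurable]: "Z \<in> sets borel" unfolding Z_def by measurable
 have YZ: "Y z = T (X z)" if "z \<in> Z" for z using YR[of "X z"] that by (auto simp: Z_def)
 have D': "AE x in mu0. x \<in> D" using D unfolding mu0_def .
 have AEmu: "(AE z in mu. P z) \<longleftrightarrow> (AE x in mu0. P (R x))" if "{z. P z} \<in> sets borel" for P
  unfolding mu_def using that by (intro AE_distr_iff) auto
 have fullZ: "AE z in mu. z \<in> Z"
  using D' by (subst AEmu) (auto simp: Z_def XR elim: eventually_mono)
 have pushX: "distr mu borel X = mu0"
 proof -
  have "distr mu borel X = distr mu0 borel (\<lambda>x. X (R x))" unfolding mu_def by (subst distr_distr) (auto simp: comp_def)
  also have "... = distr mu0 borel (\<lambda>x. x)" by (rule distr_cong_AE) (use D' XR in auto)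
  also have "... = mu0" by (rule distr_id2) simp
  finally show ?thesis .
 qed
 have pushY: "distr mu borel Y = mu1"
 proof -
  have "distr mu borel Y = distr mu0 borel (\<lambda>x. Y (R x))" unfolding mu_def by (subst distr_distr) (auto simp: comp_def)
  also have "... = distr mu0 borel T" by (rule distr_cong_AE) (use D' YR in auto)
  finally show ?thesis using push by (simp add: mu0_def mu1_def)
 qed
 have ac0: "null_sets lborel \<subseteq> null_sets mu0" "null_sets lborel \<subseteq> null_sets mu1"
  unfolding mu0_def mu1_def by (auto simp: null_sets_density_iff null_setsD2[of _ lborel, simplified] dest: AE_not_in elim!: eventually_mono)
 have pullX: "AE z in mu. X z \<notin> N" if "N \<in> null_sets lborel" for N
 proof -
  have "AE x in distr mu borel X. x \<notin> N" unfolding pushX using that ac0 by (intro AE_not_in) auto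
  then show ?thesis using that by (subst (asm) AE_distr_iff) (auto simp: null_sets_def)
 qed
 have pullY: "AE z in mu. Y z \<notin> N" if "N \<in> null_sets lborel" for N
 proof -
  have "AE x in distr mu borel Y. x \<notin> N" unfolding pushY using that ac0 by (intro AE_not_in) auto
  then show ?thesis using that by (subst (asm) AE_distr_iff) (auto simp: null_sets_def)
 qed
 \<comment> \<open>A Lipschitz map sends null sets to null sets, and \<open>X\<close> carries
   \<open>mu\<close> to a measure with a density; so \<open>mu\<close> charges no null set.\<close>
 have ac: "null_sets lborel \<subseteq> null_sets mu"
 proof
  fix N :: "(real^'n) set" assume N: "N \<in> null_sets lborel"
  then have "negligible N" by (metis completion.complete completion_def negligible_iff_null_sets null_sets_completionI)
  then have "negligible (X ` N)"
   by (rule negligible_locally_Lipschitz_image[rotated]) (use lipX in \<open>auto intro!: exI[of _ UNIV] exI[of _ "1 / s"]\<close>)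
  then obtain N' where N': "N' \<in> null_sets lborel" "X ` N \<subseteq> N'" by (rule null_sets_lebesgue_cover)
  have "AE z in mu. z \<notin> N" using pullX[OF N'(1)] by eventually_elim (use N'(2) in auto)
  then show "N \<in> null_sets mu" using N by (subst (asm) AE_iff_null_sets[symmetric]) (auto simp: null_sets_def)
 qed
 interpret mu: prob_space mu by fact
 obtain ft where ft[measurable]: "ft \<in> BM" and ft0: "!!z. 0 <= ft z" and muft: "mu = dens ft"
  using real_density_exists[OF mu.finite_measure_axioms _ ac] by auto
 obtain N0 where N0: "N0 \<in> null_sets lborel" "!!z. z \<notin> N0 ==> \<exists>p sg. alexandrov_at psi z p sg"
 proof -
  obtain N' where "N' \<in> null_sets lborel" "{y. \<not> (\<exists>p sg. alexandrov_at psi y p sg)} \<subseteq> N'"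
   by (rule null_sets_lebesgue_cover[OF negligible_if_AE[OF alexandrov_ae[OF psi]]])
  then show thesis by (intro that[of N']) blast+
 qed
 obtain a where a: "!!z. z \<notin> N0 ==> \<exists>p. alexandrov_at psi z p (a z)" using N0(2) by metis
 have al: "alexandrov_at psi z (X z) (a z)" if z: "z \<notin> N0" for z
 proof -
  obtain p where p: "alexandrov_at psi z p (a z)" using a[OF z] by blast
  then have "p = X z" using uX by (simp add: alexandrov_at_def)
  then show ?thesis using p by simp
 qed
 define b where "b z h = (1 / t) *\<^sub>R (h - s *\<^sub>R a z h)" for z h
 have derX: "(X has_derivative a z) (at z)" if z: "z \<notin> N0" for z
  by (rule alexandrov_has_derivative[OF al[OF z]]) (use X in auto)
 have derY: "(Y has_derivative b z) (at z)" if z: "z \<notin> N0" for z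
  unfolding Y_def b_def by (intro derivative_intros derX[OF z])
 have la: "linear (a z)" if z: "z \<notin> N0" for z using al[OF z] by (simp add: alexandrov_at_def)
 have syma: "sym_map (a z)" if z: "z \<notin> N0" for z
  using alexandrov_symmetric[OF al[OF z] psi] la[OF z] by (auto simp: sym_map_def)
 have symb: "sym_map (b z)" if z: "z \<notin> N0" for z
  unfolding sym_map_def b_def
  by (intro conjI allI linear_compose_scale_right linear_compose_sub linear_ident la[OF z])
    (use alexandrov_symmetric[OF al[OF z] psi] in \<open>auto simp: inner_diff_left inner_diff_right\<close>)
 have a0: "0 <= a z h \<bullet> h" if z: "z \<notin> N0" for z h by (rule alexandrov_nonneg[OF al[OF z] psi])
 have b0: "0 <= b z h \<bullet> h" if z: "z \<notin> N0" for z h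
 proof -
  have e: "y - z = s *\<^sub>R (X y - X z) + t *\<^sub>R (Y y - Y z)" for y by (subst (1 2) XY[symmetric]) (simp add: algebra_simps)
  have "0 <= (Y y - Y z) \<bullet> (y - z)" for y unfolding e using mono[of y z] s t by (simp add: inner_add_right inner_commute)
  then show ?thesis by (rule monotone_derivative_nonneg[OF derY[OF z]])
 qed
 define S1 where "S1 = {z. z \<notin> N0 & ldet (a z) = 0}"
 define S2 where "S2 = {z. z \<notin> N0 & ldet (b z) = 0}"
 have "negligible (X ` S1)" by (rule sard_negligible[where f'=a]) (auto simp: S1_def intro: has_derivative_at_withinI derX)
 then obtain N1 where N1: "N1 \<in> null_sets lborel" "X ` S1 \<subseteq> N1" by (rule null_sets_lebesgue_cover)
 have "negligible (Y ` S2)" by (rule sard_negligible[where f'=b]) (auto simp: S2_def intro: has_derivative_at_withinI derY)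
 then obtain N2 where N2: "N2 \<in> null_sets lborel" "Y ` S2 \<subseteq> N2" by (rule null_sets_lebesgue_cover)
 have [measurable]: "N0 \<in> sets borel" "N1 \<in> sets borel" "N2 \<in> sets borel" using N0 N1 N2 by (auto simp: null_sets_def)
 define G where "G = {z \<in> Z. z \<notin> N0 & X z \<notin> N1 & Y z \<notin> N2}"
 have [measurable]: "G \<in> sets borel" unfolding G_def by measurable
 have G: "z \<in> Z" "z \<notin> N0" "ldet (a z) ~= 0" "ldet (b z) ~= 0" if "z \<in> G" for z
  using that N1(2) N2(2) by (auto simp: G_def S1_def S2_def)
 have fullG: "AE z in mu. z \<in> G"
 proof -
  have "AE z in mu. z \<notin> N0" using N0(1) ac by (intro AE_not_in) auto
  then show ?thesis using fullZ pullX[OF N1(1)] pullY[OF N2(1)] by eventually_elim (auto simp: G_def)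
 qed
 have pa: "0 < a z h \<bullet> h" if "z \<in> G" "h ~= 0" for z h
  by (rule pos_definite_if_det) (use G[OF that(1)] syma a0 that in auto)
 have pb: "0 < b z h \<bullet> h" if "z \<in> G" "h ~= 0" for z h
  by (rule pos_definite_if_det) (use G[OF that(1)] symb b0 that in auto)
 \<comment> \<open>If \<open>X\<close> agrees at two points, it is constant on the segment between
   them, and its derivative at \<open>z1\<close> would vanish in that direction, contrary to
   definiteness; likewise for \<open>Y\<close>. Only \<open>z1\<close> has to lie in
   \<open>G\<close>, which matters for the auxiliary point in \<open>strict\<close>.\<close>
 have segment: "z1 = z2" if z1: "z1 \<in> G" and eq: "X z1 = X z2 \<or> Y z1 = Y z2" for z1 z2
 proof (rule ccontr)
  assume "z1 ~= z2"
  then have h: "z2 - z1 ~= 0" by simp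
  have z1': "z1 \<notin> N0" using G[OF z1] by simp
  have dir: "c (z2 - z1) = 0"
   if F: "(F has_derivative c) (at z1)" and const: "!!r. 0 <= r ==> r <= 1 ==> F (z1 + r *\<^sub>R (z2 - z1)) = F z1"
   for F c :: "real^'n => real^'n"
  proof -
   let ?g = "\<lambda>r::real. F (z1 + r *\<^sub>R (z2 - z1))"
   have lc: "linear c" using F by (rule has_derivative_linear)
   have "((\<lambda>r::real. z1 + r *\<^sub>R (z2 - z1)) has_derivative (\<lambda>r. r *\<^sub>R (z2 - z1))) (at 0 within {0..1})"
    by (auto intro!: derivative_eq_intros)
   from has_derivative_compose[OF this, of F c] F
   have "(?g has_derivative (\<lambda>r. c (r *\<^sub>R (z2 - z1)))) (at 0 within {0..1})" by simp
   then have 1: "(?g has_vector_derivative c (z2 - z1)) (at 0 within {0..1})"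
    unfolding has_vector_derivative_def by (simp add: linear_cmul[OF lc])
   have "((\<lambda>r::real. F z1) has_vector_derivative 0) (at 0 within {0..1})" by simp
   then have 2: "(?g has_vector_derivative 0) (at 0 within {0..1})"
    by (rule has_vector_derivative_transform[rotated 2]) (auto simp: const)
   show ?thesis
    by (rule vector_derivative_unique_within_closed_interval[of 0 1 0 ?g]) (use 1 2 in auto)
  qed
  from eq show False
  proof
   assume e: "X z1 = X z2"
   have "X (z1 + r *\<^sub>R (z2 - z1)) = X z1" if "0 <= r" "r <= 1" for r
    using subgrad_segment[OF X[of z1] _ psi that, of z2] X[of z2] e uX by metis
   then have "a z1 (z2 - z1) = 0" by (rule dir[OF derX[OF z1']])
   then show False using pa[OF z1 h] by simp
  next
   assume e: "Y z1 = Y z2"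
   then have e': "Q z1 = Q z2" by (simp add: QY)
   have "Y (z1 + r *\<^sub>R (z2 - z1)) = Y z1" if "0 <= r" "r <= 1" for r
   proof -
    have "Q z1 \<in> subgrad th (z1 + r *\<^sub>R (z2 - z1))"
     by (rule subgrad_segment[OF Q[of z1] _ th that]) (use Q[of z2] e' in simp)
    then have "Q z1 = Q (z1 + r *\<^sub>R (z2 - z1))" using uQ Q by metis
    then show ?thesis using s t by (simp add: QY)
   qed
   then have "b z1 (z2 - z1) = 0" by (rule dir[OF derY[OF z1']])
   then show False using pb[OF z1 h] by simp
  qed
 qed
 \<comment> \<open>Vanishing monotonicity gives the mixed point \<open>z'\<close> the same
   \<open>X\<close>-value as \<open>z1\<close>. Hence \<open>z' = z1\<close>, so the
   \<open>Y\<close>-values agree, and \<open>segment\<close> applies once more.\<close>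
 have strict: "z1 = z2" if z: "z1 \<in> G" "z2 \<in> G" and eq: "(X z1 - X z2) \<bullet> (Y z1 - Y z2) = 0" for z1 z2
 proof -
  have D12: "X z1 \<in> D" "X z2 \<in> D" using G[OF z(1)] G[OF z(2)] by (auto simp: Z_def)
  have Ys: "Y z1 = T (X z1)" "Y z2 = T (X z2)" using YZ G z by auto
  define z' where "z' = s *\<^sub>R X z1 + t *\<^sub>R T (X z2)"
  have "X z1 \<in> subgrad psi z'" unfolding z'_def by (rule id2[OF D12]) (use eq Ys in simp)
  then have "X z1 = X z'" by (rule uX)
  then have "z1 = z'" using segment[OF z(1)] by blast
  then have "s *\<^sub>R X z1 + t *\<^sub>R Y z1 = s *\<^sub>R X z1 + t *\<^sub>R Y z2" using XY[of z1] Ys by (simp add: z'_def)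
  then have "Y z1 = Y z2" using t by simp
  then show ?thesis using segment[OF z(1)] by blast
 qed
 have injX: "inj_on X G" and injY: "inj_on Y G" using segment by (auto intro!: inj_onI)
 have RX: "R (X z) = z" if "z \<in> G" for z using G(1)[OF that] by (simp add: Z_def)
 have dGX: "(X has_derivative a z) (at z within G)" "(Y has_derivative b z) (at z within G)" if "z \<in> G" for z
  using derX derY G(2)[OF that] by (auto intro: has_derivative_at_withinI)
 have slc0: "!!x. 0 <= f0 x" "!!x. 0 <= f1 x" using slc by (auto simp: slc_dens_def)
 have "interp t X Y R G a b f0 f1 ft"
 proof (rule interp.intro)
  show "(1 - t) *\<^sub>R X z + t *\<^sub>R Y z = z" for z using XY[of z] by (simp add: s_def)
  show "(1 - t) *\<^sub>R a z h + t *\<^sub>R b z h = h" for z h using t by (simp add: b_def s_def)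
  show "prob_space (dens ft)" using pmu muft by simp
  show "AE z in dens ft. z \<in> G" using fullG unfolding muft .
  show p1: "distr (dens ft) borel X = dens f0"
   using pushX muft by (simp add: mu0_def)
  show p2: "distr (dens ft) borel Y = dens f1"
   using pushY muft by (simp add: mu1_def)
  show "AE z in lborel. z \<in> G --> f0 (X z) * abs (ldet (a z)) = ft z"
   by (rule density_relation[OF _ _ _ _ ft0 slc0(1) p1 _ dGX(1) injX]) (use fullG muft in auto)
  show "AE z in lborel. z \<in> G --> f1 (Y z) * abs (ldet (b z)) = ft z"
   by (rule density_relation[OF _ _ _ _ ft0 slc0(2) p2 _ dGX(2) injY]) (use fullG muft in auto)
 qed (use t mono strict RX derX derY syma symb pa pb slc ft0 G in auto)
 then have I: "interp t X Y (\<lambda>x. (1 - t) *\<^sub>R x + t *\<^sub>R T x) G a b f0 f1 ft" by (simp add: R_def[abs_def])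
 show thesis
 proof (rule that[OF I])
  show "Y z = T (X z)" if "z \<in> G" for z using YZ G(1)[OF that] by simp
  show "distr (dens f0) borel (\<lambda>x. (1 - t) *\<^sub>R x + t *\<^sub>R T x) = dens ft"
   using muft by (simp add: mu_def mu0_def R_def[abs_def])
 qed
qed

subsection \<open>A Poincare inequality along the geodesic\<close>

context interp
begin

abbreviation "M \<equiv> dens ft"

text \<open>Brenier's theorem is applied between the \<open>Y\<close>-image of \<open>La\<close> and
  the \<open>X\<close>-image of \<open>La'\<close>. Its gradient \<open>cgrad w\<close> yields the
  cost at the first endpoint and the inverse \<open>cgrad u\<close> the cost at the second, each by
  \<open>half_transport\<close>, and both are costs of the single map \<open>tau\<close>.\<close>

lemma transport_bound:
 assumes rho[measurable]: "rho \<in> BM" "rho' \<in> BM"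
  and c: "0 < c" and k: "0 < k"
  and bnd: "!!z. rho z = 0 \<or> z \<in> G & c <= rho z & rho z <= C & norm (X z) <= k & norm (Y z) <= k"
   "!!z. rho' z = 0 \<or> z \<in> G & c <= rho' z & rho' z <= C & norm (X z) <= k & norm (Y z) <= k"
  and La: "La = dens (\<lambda>z. rho z * ft z)" "prob_space La"
  and La': "La' = dens (\<lambda>z. rho' z * ft z)" "prob_space La'"
 obtains tau where "tau \<in> BM" "distr La borel tau = La'"
  "(LINT z|La. (1 - t) * (norm (X z - X (tau z)))^2 + t * (norm (Y z - Y (tau z)))^2) <= 4 * ((LINT z|La. ln (rho z)) + (LINT z|La'. ln (rho' z)))"
proof -
 interpret La: prob_space La by fact
 interpret La': prob_space La' by fact
 have [simp, measurable_cong]: "sets La = sets borel" "sets La' = sets borel" by (simp_all add: La(1) La'(1))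
 have [simp]: "space La = UNIV" "space La' = UNIV" by (simp_all add: La(1) La'(1))
 have rho0: "0 <= rho z" "0 <= rho' z" for z using bnd(1)[of z] bnd(2)[of z] c by auto
 define al where "al = distr La borel Y"
 define be where "be = distr La' borel X"
 have [simp, measurable_cong]: "sets al = sets borel" "sets be = sets borel" by (simp_all add: al_def be_def)
 have [simp]: "space al = UNIV" "space be = UNIV" by (simp_all add: al_def be_def)
 interpret al: prob_space al unfolding al_def by (rule La.prob_space_distr) simp
 interpret be: prob_space be unfolding be_def by (rule La'.prob_space_distr) simp
 have bd: "AE z in La. rho z ~= 0" "AE z in La'. rho' z ~= 0"
  unfolding La(1) La'(1) by (auto simp: AE_density)
 have bd1: "z \<in> G" "norm (X z) <= k" "norm (Y z) <= k" if "rho z ~= 0" for z using bnd(1)[of z] that by auto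
 have bd2: "z \<in> G" "norm (X z) <= k" "norm (Y z) <= k" if "rho' z ~= 0" for z using bnd(2)[of z] that by auto
 have ac: "null_sets lborel \<subseteq> null_sets (distr La'' borel g)"
  if g: "g \<in> BM" "distr M borel g = dens f" "f \<in> BM"
   and L: "La'' = dens (\<lambda>z. r z * ft z)" "r \<in> BM" for La'' and g :: "real^'n => real^'n" and f r :: "real^'n => real"
 proof
  fix N :: "(real^'n) set" assume N: "N \<in> null_sets lborel"
  have [measurable]: "g \<in> BM" "N \<in> sets borel" "r \<in> BM" "f \<in> BM"
   using g L N by (auto simp: null_sets_def)
  have "AE x in dens f. x \<notin> N"
   using AE_not_in[OF N] by (subst AE_density) (auto elim: eventually_mono)
  then have "AE z in M. g z \<notin> N" unfolding g(2)[symmetric] by (subst (asm) AE_distr_iff) auto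
  then have "AE z in lborel. 0 < ennreal (ft z) --> g z \<notin> N" by (subst (asm) AE_density) auto
  then have "AE z in La''. g z \<notin> N" unfolding L(1) by (subst AE_density) (auto simp: ft0 less_le elim!: eventually_mono)
  then have "AE x in distr La'' borel g. x \<notin> N" by (subst AE_distr_iff) (auto simp: L(1))
  then show "N \<in> null_sets (distr La'' borel g)" by (subst (asm) AE_iff_null_sets[symmetric]) auto
 qed
 have f01[measurable]: "f0 \<in> BM" "f1 \<in> BM" using slc by (auto simp: slc_dens_def)
 have acal: "null_sets lborel \<subseteq> null_sets al" unfolding al_def by (rule ac[OF _ push(2) _ La(1)]) auto
 have acbe: "null_sets lborel \<subseteq> null_sets be" unfolding be_def by (rule ac[OF _ push(1) _ La'(1)]) auto
 obtain w u where w: "convex_on UNIV w" and u: "convex_on UNIV u" and pw: "distr al borel (cgrad w) = be"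
  and good: "AE y in al. subgrad w y = {cgrad w y} & cgrad w y \<in> cball 0 k & y \<in> subgrad u (cgrad w y) & w y + u (cgrad w y) = cgrad w y \<bullet> y"
 proof (rule brenier_exists[OF al.finite_measure_axioms _ be.finite_measure_axioms _ _ acal k])
  show "measure al UNIV = measure be UNIV" using al.prob_space be.prob_space by simp
  show "AE y in al. y \<in> cball 0 k" unfolding al_def using bd(1) by (subst AE_distr_iff) (auto elim!: eventually_mono dest: bd1)
  show "AE y in be. y \<in> cball 0 k" unfolding be_def using bd(2) by (subst AE_distr_iff) (auto elim!: eventually_mono dest: bd2)
 qed auto
 have [measurable]: "cgrad w \<in> BM" "cgrad u \<in> BM" using w u by (auto intro: cgrad_measurable)
 have cw: "continuous_on UNIV w" using w by (auto intro: convex_on_continuous)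
 have cbe: "AE x in be. subgrad u x = {cgrad u x}"
 proof -
  obtain N where N: "{x \<in> space lborel. subgrad u x ~= {cgrad u x}} \<subseteq> N" "emeasure lborel N = 0" "N \<in> sets lborel"
   using cgrad_ae[OF u] by (rule AE_E)
  then have "N \<in> null_sets be" using acbe by (auto simp: null_sets_def)
  then show ?thesis by (rule AE_I'[where N=N]) (use N in auto)
 qed
 have AEbe: "AE y in al. P (cgrad w y)" if "AE x in be. P x" for P
  using that unfolding pw[symmetric] by (rule AE_distrD[rotated]) simp
 have inv: "AE y in al. cgrad u (cgrad w y) = y & cgrad w y \<in> subgrad w y & norm y <= k"
 proof -
  have "AE y in al. norm y <= k" unfolding al_def using bd(1) by (subst AE_distr_iff) (auto elim!: eventually_mono dest: bd1)
  then show ?thesis using AEbe[OF cbe] good by eventually_elim auto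
 qed
 have pu: "distr be borel (cgrad u) = al"
 proof -
  have "distr be borel (cgrad u) = distr al borel (\<lambda>y. cgrad u (cgrad w y))" unfolding pw[symmetric] by (subst distr_distr) (auto simp: comp_def)
  also have "... = distr al borel (\<lambda>y. y)" by (rule distr_cong_AE) (use inv in \<open>auto elim: eventually_mono\<close>)
  finally show ?thesis by (simp add: distr_id2)
 qed
 have good': "AE x in be. subgrad u x = {cgrad u x} & norm (cgrad u x) <= k & x \<in> subgrad w (cgrad u x)"
 proof -
  have "closed {z. w (snd z) + fst z \<bullet> (y' - snd z) <= w y'}" for y'
   by (intro closed_Collect_le continuous_intros continuous_on_compose2[OF cw]) auto
  then have "closed (\<Inter>y'. {z. w (snd z) + fst z \<bullet> (y' - snd z) <= w y'})" by (intro closed_INT ballI)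
  also have "(\<Inter>y'. {z. w (snd z) + fst z \<bullet> (y' - snd z) <= w y'}) = {(x, p). x \<in> subgrad w p}" by (auto simp: subgrad_def)
  finally have "{(x, p). x \<in> subgrad w p} \<in> sets borel" by (rule borel_closed)
  then have "(\<lambda>x. (x, cgrad u x)) -` {(x, p). x \<in> subgrad w p} \<inter> space borel \<in> sets borel"
   by (rule measurable_sets[rotated]) (simp add: borel_prod[symmetric])
  then have m: "{x. x \<in> subgrad w (cgrad u x)} \<in> sets borel" by (simp add: vimage_def)
  have "AE x in be. norm (cgrad u x) <= k & x \<in> subgrad w (cgrad u x)"
   unfolding pw[symmetric]
   by (subst AE_distr_iff) (use m inv in \<open>force simp: Collect_conj_eq elim!: eventually_mono intro!: sets.Int\<close>)+
  then show ?thesis using cbe by eventually_elim auto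
 qed
 have derG: "(X has_derivative a z) (at z within G)" "(Y has_derivative b z) (at z within G)" if "z \<in> G" for z
  using der[OF that] by (auto intro: has_derivative_at_withinI)
 have rel': "AE z in lborel. z \<in> G --> f0 (X z) * abs (ldet (a z)) = ft z" "AE z in lborel. z \<in> G --> f1 (Y z) * abs (ldet (b z)) = ft z" by (rule rel)+
 have injX: "inj_on X G" and injY: "inj_on Y G" using strict by (auto intro!: inj_onI)
 have bn: "rho z = 0 \<or> z \<in> G & c <= rho z & rho z <= C" "rho' z = 0 \<or> z \<in> G & c <= rho' z & rho' z <= C" for z
  using bnd(1)[of z] bnd(2)[of z] by auto
 have h1: "(LINT z|La. (norm (X z - cgrad w (Y z)))^2) <= 4 * ((LINT z|La. ln (rho z)) + (LINT z|La'. ln (rho' z)))"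
 proof (rule half_transport[OF slc(1) _ _ _ _ _ _ ft0 derG sym pos ab t(2) injX mono _ rel'(1) La La' c bn w u])
  show "distr (distr La borel Y) borel (cgrad w) = distr La' borel X" using pw by (simp add: al_def be_def)
  show "AE y in distr La borel Y. subgrad w y = {cgrad w y} & norm (cgrad w y) <= k & y \<in> subgrad u (cgrad w y)"
   using good unfolding al_def by eventually_elim auto
 qed (use acal acbe strict bd1 in \<open>auto simp: al_def be_def\<close>)
 have h2: "(LINT z|La'. (norm (Y z - cgrad u (X z)))^2) <= 4 * ((LINT z|La'. ln (rho' z)) + (LINT z|La. ln (rho z)))"
 proof (rule half_transport[OF slc(2) _ _ _ _ _ _ ft0 derG(2,1) sym(2,1) pos(2,1) _ _ injY _ _ rel'(2) La' La c bn(2,1) u w])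
  show "1 - t < 1" using t by simp
  show "(1 - (1 - t)) *\<^sub>R b z h + (1 - t) *\<^sub>R a z h = h" if "z \<in> G" for z h
   using t ab[OF that, of h] by (auto simp: add.commute)
  show "distr (distr La' borel X) borel (cgrad u) = distr La borel Y" using pu by (simp add: al_def be_def)
  show "AE x in distr La' borel X. subgrad u x = {cgrad u x} & norm (cgrad u x) <= k & x \<in> subgrad w (cgrad u x)"
   using good' unfolding be_def .
 qed (use acal acbe strict mono bd2 t in \<open>auto simp: al_def be_def inner_commute\<close>)
 \<comment> \<open>Almost everywhere \<open>X (tau z) = cgrad w (Y z)\<close> and, equivalently,
   \<open>cgrad u (X (tau z)) = Y z\<close>. The first form reads \<open>h1\<close> and the second
   reads \<open>h2\<close> as a cost of \<open>tau\<close>.\<close>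
 define tau where "tau z = R (cgrad w (Y z))" for z
 have tau[measurable]: "tau \<in> BM" unfolding tau_def by measurable
 have pphi: "distr La borel (\<lambda>z. cgrad w (Y z)) = distr La' borel X"
  using pw unfolding al_def be_def by (subst (asm) distr_distr) (auto simp: comp_def)
 have ptau: "distr La borel tau = La'"
 proof -
  have "distr La borel tau = distr (distr La borel (\<lambda>z. cgrad w (Y z))) borel R" by (subst distr_distr) (auto simp: comp_def tau_def[abs_def])
  also have "... = distr La' borel (\<lambda>z. R (X z))" unfolding pphi by (subst distr_distr) (auto simp: comp_def)
  also have "... = distr La' borel (\<lambda>z. z)" by (rule distr_cong_AE) (use bd(2) RX bd2 in \<open>auto elim!: eventually_mono\<close>)
  finally show ?thesis by (simp add: distr_id2)
 qed
 have Xtau: "AE z in La. X (tau z) = cgrad w (Y z)"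
 proof -
  have "AE x in distr La' borel X. X (R x) = x" using bd(2) by (subst AE_distr_iff) (auto elim!: eventually_mono simp: RX bd2)
  then show ?thesis unfolding pphi[symmetric] by (subst (asm) AE_distr_iff) (auto simp: tau_def)
 qed
 have utau: "AE z in La. cgrad u (X (tau z)) = Y z"
 proof -
  have "AE y in distr La borel Y. cgrad u (cgrad w y) = y" using inv unfolding al_def by eventually_elim simp
  then have "AE z in La. cgrad u (cgrad w (Y z)) = Y z" by (subst (asm) AE_distr_iff) auto
  then show ?thesis using Xtau by eventually_elim simp
 qed
 have bt: "AE z in La. norm (X (tau z)) <= k & norm (Y (tau z)) <= k"
 proof -
  have "AE z in distr La borel tau. norm (X z) <= k & norm (Y z) <= k" unfolding ptau using bd(2) by eventually_elim (use bd2 in auto)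
  then show ?thesis by (subst (asm) AE_distr_iff) auto
 qed
 have sq: "(norm (p - q))^2 <= (2 * k)^2" if "norm p <= k" "norm q <= k" for p q :: "real^'n"
  using that norm_triangle_ineq4[of p q] by (intro power_mono) auto
 have i1: "integrable La (\<lambda>z. (norm (X z - X (tau z)))^2)"
 proof (rule La.integrable_const_bound[where B="(2 * k)^2"])
  show "AE z in La. norm ((norm (X z - X (tau z)))^2) <= (2 * k)^2" using bd(1) bt by eventually_elim (use sq bd1 in auto)
 qed simp
 have i2: "integrable La (\<lambda>z. (norm (Y z - Y (tau z)))^2)"
 proof (rule La.integrable_const_bound[where B="(2 * k)^2"])
  show "AE z in La. norm ((norm (Y z - Y (tau z)))^2) <= (2 * k)^2" using bd(1) bt by eventually_elim (use sq bd1 in auto)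
 qed simp
 have e1: "(LINT z|La. (norm (X z - cgrad w (Y z)))^2) = (LINT z|La. (norm (X z - X (tau z)))^2)"
  by (rule integral_cong_AE) (use Xtau in \<open>auto elim!: eventually_mono\<close>)
 have "(LINT z|La'. (norm (Y z - cgrad u (X z)))^2) = (LINT z|La. (norm (Y (tau z) - cgrad u (X (tau z))))^2)"
  unfolding ptau[symmetric] by (subst integral_distr) auto
 also have "... = (LINT z|La. (norm (Y z - Y (tau z)))^2)"
  by (rule integral_cong_AE) (use utau in \<open>auto elim!: eventually_mono simp: norm_minus_commute\<close>)
 finally have e2: "(LINT z|La'. (norm (Y z - cgrad u (X z)))^2) = (LINT z|La. (norm (Y z - Y (tau z)))^2)" .
 define K where "K = 4 * ((LINT z|La. ln (rho z)) + (LINT z|La'. ln (rho' z)))"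
 have "(LINT z|La. (1 - t) * (norm (X z - X (tau z)))^2 + t * (norm (Y z - Y (tau z)))^2)
   = (1 - t) * (LINT z|La. (norm (X z - X (tau z)))^2) + t * (LINT z|La. (norm (Y z - Y (tau z)))^2)"
  using i1 i2 by simp
 also have "... <= (1 - t) * K + t * K"
  using h1 h2 t unfolding e1 e2 K_def by (intro add_mono mult_left_mono) auto
 also have "... = K" by (simp add: algebra_simps)
 finally show thesis using that[OF tau ptau] by (simp add: K_def)
qed

end

text \<open>The difference of the two sides has derivative \<open>x ^ 3 / (1 + x)\<close>, which has
  the sign of \<open>x\<close>, so it is smallest at \<open>0\<close>.\<close>

lemma ln_one_plus_le_cubic:
 fixes u :: real
 assumes "-1 < u"
 shows "ln (1 + u) <= u - u^2 / 2 + u ^ 3 / 3"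
proof -
 define h where "h x = x - x^2 / 2 + x ^ 3 / 3 - ln (1 + x)" for x :: real
 have d: "(h has_real_derivative x ^ 3 / (1 + x)) (at x)" if "-1 < x" for x
 proof -
  have "1 - x + x^2 - 1 / (1 + x) = x ^ 3 / (1 + x)" using that by (simp add: field_simps power2_eq_square power3_eq_cube)
  then show ?thesis unfolding h_def using that by (auto intro!: derivative_eq_intros simp: power2_eq_square)
 qed
 have "h 0 <= h u"
 proof (cases "0 <= u")
  case True
  show ?thesis
  proof (rule DERIV_nonneg_imp_nondecreasing[OF True])
   fix x assume "0 <= x" "x <= u"
   then show "\<exists>y. (h has_real_derivative y) (at x) & 0 <= y" using d[of x] by (intro exI[of _ "x ^ 3 / (1 + x)"]) auto
  qed
 next
  case False
  then have "u <= 0" by simp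
  then show ?thesis
  proof (rule DERIV_nonpos_imp_nonincreasing)
   fix x assume x: "u <= x" "x <= 0"
   then have "x ^ 3 / (1 + x) <= 0" using assms by (intro divide_nonpos_pos) (auto simp: power3_eq_cube mult_nonneg_nonpos zero_le_mult_iff mult_le_0_iff)
   then show "\<exists>y. (h has_real_derivative y) (at x) & y <= 0" using d[of x] x assms by (intro exI[of _ "x ^ 3 / (1 + x)"]) auto
  qed
 qed
 then show ?thesis by (simp add: h_def)
qed

text \<open>Odd powers cancel between \<open>u\<close> and \<open>- u\<close>, which leaves
  \<open>u^2\<close> up to fourth order: the leading term of the two entropies in
  \<open>poincare_step\<close>.\<close>

lemma entropy_quadratic_le:
 fixes u :: real
 assumes "abs u < 1"
 shows "(1 + u) * ln (1 + u) + (1 - u) * ln (1 - u) <= u^2 + u ^ 4"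
proof -
 have "(1 + u) * ln (1 + u) <= (1 + u) * (u - u^2 / 2 + u ^ 3 / 3)"
  using assms by (intro mult_left_mono ln_one_plus_le_cubic) auto
 moreover have "(1 - u) * ln (1 - u) <= (1 - u) * (- u - u^2 / 2 - u ^ 3 / 3)"
  using assms ln_one_plus_le_cubic[of "- u"] by (intro mult_left_mono) auto
 moreover have "(1 + u) * (u - u^2 / 2 + u ^ 3 / 3) + (1 - u) * (- u - u^2 / 2 - u ^ 3 / 3) = u^2 + 2 / 3 * u ^ 4"
  by (simp add: power2_eq_square power3_eq_cube power4_eq_xxxx field_simps)
 moreover have "2 / 3 * u ^ 4 <= u ^ 4" by simp
 ultimately show ?thesis by linarith
qed

context interp
begin

text \<open>Transport between the perturbations with factors \<open>1 + s * (F z - m)\<close> and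
  \<open>1 - s * (F z - m)\<close> of the measure restricted to \<open>B\<close>. The two means of
  \<open>F\<close> differ by exactly \<open>2 * s * V\<close>, and the entropies add up to
  \<open>s^2 * V\<close> with errors of higher order. Restriction to \<open>B\<close> supplies the
  bounds for \<open>transport_bound\<close>; the lost mass is of order \<open>s ^ 3\<close>,
  invisible after division by \<open>s^2\<close>.\<close>

lemma poincare_step:
 assumes B[measurable]: "B \<in> sets borel" and BG: "!!z. z \<in> B ==> z \<in> G & norm (X z) <= r & norm (Y z) <= r" and r: "0 < r"
  and F[measurable]: "F \<in> BM" and Fb: "!!z. abs (F z) <= K"
  and s: "0 < s" "4 * s * K <= 1" and c_def: "c = measure M B" and c: "1/2 <= c" "1 - c <= s ^ 3"
  and m_def: "m = (LINT z|M. indicator B z * F z) / c" and V_def: "V = (LINT z|M. indicator B z * (F z)^2) / c - m^2"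
  and rho_def: "!!z. rho z = indicator B z * (1 + s * (F z - m)) / c"
 obtains tau where "tau \<in> BM" "AE z in M. z \<in> B --> tau z \<in> B"
  "(LINT z|M. rho z * (F z - F (tau z))) = 2 * s * V"
  "(LINT z|M. rho z * ((1 - t) * (norm (X z - X (tau z)))^2 + t * (norm (Y z - Y (tau z)))^2)) <= 4 * (s^2 * V + 16 * s ^ 4 * K ^ 4 + 4 * s ^ 3)"
  "(LINT z|M. rho z) = 1" "\<forall>z\<in>B. 1 / 2 <= rho z & rho z <= 3"
proof -
 interpret M: prob_space M by (rule prob)
 have K: "0 <= K" using Fb[of 0] by linarith
 have c1: "c <= 1" "0 < c" using c_def c M.prob_le_1 by auto
 have iB: "integrable M (\<lambda>z. indicator B z * h z)" if [measurable]: "h \<in> BM" and "!!z. z \<in> B ==> abs (h z) <= b" "0 <= b" for h :: "_ => real" and b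
  by (rule M.integrable_const_bound[where B=b]) (use that in \<open>auto simp: indicator_def\<close>)
 have IB: "measure M B = c" by (simp add: c_def)
 have F2b: "abs ((F z)^2) <= K^2" for z using Fb[of z] by (simp add: abs_le_square_iff[symmetric] K)
 have iF: "integrable M (\<lambda>z. indicator B z * F z)" by (rule iB[OF F Fb K])
 have iF2: "integrable M (\<lambda>z. indicator B z * (F z)^2)" by (rule iB[OF _ F2b]) auto
 have i1: "integrable M (\<lambda>z. indicator B z * 1 :: real)" by (rule iB[of _ 1]) auto
 have mc: "(LINT z|M. indicator B z * F z) = m * c" using c1 by (simp add: m_def)
 have Vc: "(LINT z|M. indicator B z * (F z)^2) = (V + m^2) * c" using c1 by (simp add: V_def)
 have mK: "abs m <= K"
 proof -
  have "abs (\<integral>z. indicator B z * F z \<partial>M) <= (LINT z|M. abs (indicator B z * F z))" by (rule integral_abs_bound)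
  also have "... <= (LINT z|M. K * (indicator B z * 1))"
   using iF i1 Fb by (intro integral_mono) (auto simp: indicator_def)
  also have "... = K * c" by (simp add: IB)
  finally show ?thesis using c1 unfolding mc by (simp add: abs_mult)
 qed
 define U where "U z = F z - m" for z
 have [measurable]: "U \<in> BM" unfolding U_def by measurable
 have Ub: "abs (U z) <= 2 * K" for z using Fb[of z] mK by (auto simp: U_def)
 have sU: "abs (s * U z) <= 1/2" for z
 proof -
  have "abs (s * U z) <= s * (2 * K)" using Ub[of z] s(1) by (simp add: abs_mult)
  then show ?thesis using s(2) by simp
 qed
 have iU: "(LINT z|M. indicator B z * U z) = 0"
  using iF i1 by (simp add: U_def right_diff_distrib mc IB)
 have iiU: "integrable M (\<lambda>z. indicator B z * U z)" by (rule iB[OF _ Ub]) (use K in auto)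
 have iU2: "(LINT z|M. indicator B z * (U z)^2) = V * c"
 proof -
  have "(\<lambda>z. indicator B z * (U z)^2) = (\<lambda>z. indicator B z * (F z)^2 - 2 * m * (indicator B z * F z) + m^2 * (indicator B z * 1))"
   by (simp add: U_def power2_eq_square algebra_simps)
  then have "(LINT z|M. indicator B z * (U z)^2) = (V + m^2) * c - 2 * m * (m * c) + m^2 * c"
   using iF iF2 i1 by (simp add: mc Vc IB)
  then show ?thesis by (simp add: power2_eq_square algebra_simps)
 qed
 have iUU: "integrable M (\<lambda>z. indicator B z * (U z)^2)"
 proof (rule iB)
  show "abs ((U z)^2) <= (2 * K)^2" for z using power_mono[OF Ub[of z], of 2] by simp
 qed auto
 \<comment> \<open>\<open>e = 1\<close> and \<open>e = -1\<close> give the two perturbed densities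
   relative to \<open>M\<close>.\<close>
 define q where "q e z = indicator B z * (1 + e * (s * U z)) / c" for e z :: "_" 
 have q[measurable]: "q e \<in> BM" for e :: real unfolding q_def by measurable
 have rhoq: "rho z = q 1 z" for z by (simp add: rho_def q_def U_def)
 have eU: "abs (e * (s * U z)) <= 1/2" if "abs e = 1" for e z using sU[of z] that by (simp add: abs_mult)
 \<comment> \<open>The numerator lies between \<open>1/2\<close> and \<open>3/2\<close>, and
   \<open>c\<close> between \<open>1/2\<close> and \<open>1\<close>.\<close>
 have qb: "1/2 <= q e z & q e z <= 3" if e: "abs e = 1" and z: "z \<in> B" for e z
 proof -
  have "1/2 <= 1 + e * (s * U z)" "1 + e * (s * U z) <= 3/2" using eU[OF e, of z] by linarith+
  moreover have "1/2 * c <= 1/2 * 1" "3 * (1/2) <= 3 * c" using c c1 by auto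
  ultimately show ?thesis using z c1 by (auto simp: q_def pos_le_divide_eq pos_divide_le_eq)
 qed
 have qB: "q e z = 0" if "z \<notin> B" for e z using that by (simp add: q_def)
 have q0: "0 <= q e z" if "abs e = 1" for e z using qb[OF that, of z] qB[of z e] by (cases "z \<in> B") linarith+
 have qbd: "abs (q e z) <= 3" if "abs e = 1" for e z using qb[OF that, of z] qB[of z e] by (cases "z \<in> B") linarith+
 define L where "L e = dens (\<lambda>z. q e z * ft z)" for e
 have LM: "L e = density M (\<lambda>z. ennreal (q e z))" if "abs e = 1" for e
  unfolding L_def by (subst density_density_eq) (auto simp: ennreal_mult q0[OF that] ft0 mult.commute)
 have Lint: "(\<integral>z. h z \<partial>L e) = (LINT z|M. q e z * h z)" if "abs e = 1" "h \<in> BM" for e and h :: "_ => real"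
  unfolding LM[OF that(1)] using that q0[OF that(1)] by (subst integral_real_density) auto
 have iq: "integrable M (q e)" "(LINT z|M. q e z) = 1" if e: "abs e = 1" for e
 proof -
  show "integrable M (q e)" by (rule M.integrable_const_bound[where B=3]) (use qbd[OF e] in auto)
  have "(LINT z|M. q e z) = (LINT z|M. (1 / c) * (indicator B z * 1) + (e * s / c) * (indicator B z * U z))"
   by (rule Bochner_Integration.integral_cong) (auto simp: q_def algebra_simps add_divide_distrib)
  also have "... = 1" using i1 iiU c1 by (simp add: iU IB)
  finally show "(LINT z|M. q e z) = 1" .
 qed
 have pL: "prob_space (L e)" if e: "abs e = 1" for e
 proof
  have "emeasure (L e) (space (L e)) = (\<integral>\<^sup>+z. ennreal (q e z) \<partial>M)" unfolding LM[OF e] by (subst emeasure_density) auto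
  also have "... = 1" using iq[OF e] q0[OF e] by (subst nn_integral_eq_integral) auto
  finally show "emeasure (L e) (space (L e)) = 1" .
 qed
 have e1: "abs (1::real) = 1" "abs (-1::real) = 1" by auto
 have bnd: "q e z = 0 \<or> z \<in> G & 1/2 <= q e z & q e z <= 3 & norm (X z) <= r & norm (Y z) <= r" if "abs e = 1" for e z
  using qb[OF that, of z] BG[of z] by (cases "z \<in> B") (auto simp: q_def)
 obtain tau where tau[measurable]: "tau \<in> BM" and ptau: "distr (L 1) borel tau = L (-1)"
  and le: "(\<integral>z. (1 - t) * (norm (X z - X (tau z)))^2 + t * (norm (Y z - Y (tau z)))^2 \<partial>L 1) <= 4 * ((\<integral>z. ln (q 1 z) \<partial>L 1) + (\<integral>z. ln (q (-1) z) \<partial>L (-1)))"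
  by (rule transport_bound[OF q q _ r bnd[OF e1(1)] bnd[OF e1(2)] L_def pL[OF e1(1)] L_def pL[OF e1(2)]]) auto
 have [measurable_cong, simp]: "sets (L e) = sets borel" for e by (simp add: L_def)
 have tauB: "AE z in M. z \<in> B --> tau z \<in> B"
 proof -
  have "AE z in L (-1). z \<in> B" unfolding LM[OF e1(2)] by (subst AE_density) (auto simp: q_def indicator_def)
  then have "AE z in L 1. tau z \<in> B" unfolding ptau[symmetric] by (subst (asm) AE_distr_iff) auto
  then have "AE z in M. 0 < ennreal (q 1 z) --> tau z \<in> B" unfolding LM[OF e1(1)] by (subst (asm) AE_density) auto
  then show ?thesis
  proof eventually_elim
   case (elim z)
   then show ?case using qb[OF e1(1), of z] by auto
  qed
 qed
 have iLF: "integrable (L e) (\<lambda>z. F (g z))" if "abs e = 1" and [measurable]: "g \<in> BM" for e g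
 proof -
  interpret L: prob_space "L e" by (rule pL[OF that(1)])
  show ?thesis by (rule L.integrable_const_bound[where B=K]) (use Fb in auto)
 qed
 have mean: "(\<integral>z. F z \<partial>L e) = m + e * s * V" if e: "abs e = 1" for e
 proof -
  have "(\<integral>z. F z \<partial>L e) = (LINT z|M. q e z * F z)" by (rule Lint[OF e F])
  also have "... = (LINT z|M. (1 / c) * (indicator B z * F z) + (e * s / c) * (indicator B z * (U z)^2) + (e * s * m / c) * (indicator B z * U z))"
   by (rule Bochner_Integration.integral_cong) (auto simp: q_def U_def power2_eq_square algebra_simps add_divide_distrib diff_divide_distrib)
  also have "... = m + e * s * V"
  proof -
   show ?thesis using iUU iF iiU c1 by (simp add: mc iU iU2)
  qed
  finally show ?thesis .
 qed
 have I: "(LINT z|M. rho z * (F z - F (tau z))) = 2 * s * V"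
 proof -
  have "(\<integral>z. F z \<partial>L (-1)) = (\<integral>z. F (tau z) \<partial>L 1)" unfolding ptau[symmetric] by (subst integral_distr) auto
  then have "(\<integral>z. F z - F (tau z) \<partial>L 1) = (\<integral>z. F z \<partial>L 1) - (\<integral>z. F z \<partial>L (-1))"
   using iLF[OF e1(1), of "\<lambda>z. z"] iLF[OF e1(1) tau] by simp
  also have "... = 2 * s * V" using mean[OF e1(1)] mean[OF e1(2)] by simp
  finally show ?thesis unfolding rhoq by (subst (asm) Lint) auto
 qed
 have ent: "(\<integral>z. ln (q 1 z) \<partial>L 1) + (\<integral>z. ln (q (-1) z) \<partial>L (-1)) <= s^2 * V + 16 * s ^ 4 * K ^ 4 + 4 * s ^ 3"
 proof -
  define H where "H z = q 1 z * ln (q 1 z) + q (-1) z * ln (q (-1) z)" for z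
  have lnb: "abs (q e z * ln (q e z)) <= 3 * (ln 2 + ln 3)" if e: "abs e = 1" for e z
  proof (cases "z \<in> B")
   case True
   then have qq: "1/2 <= q e z" "q e z <= 3" using qb[OF e] by auto
   then have "ln (1/2) <= ln (q e z)" "ln (q e z) <= ln 3" by auto
   moreover have "0 <= ln (2::real)" "0 <= ln (3::real)" by auto
   moreover have "ln (1/2::real) = - ln 2" by (simp add: ln_div)
   ultimately have "abs (ln (q e z)) <= ln 2 + ln 3" by linarith
   then show ?thesis using qq unfolding abs_mult by (intro mult_mono) auto
  qed (simp add: q_def)
  have il: "integrable M (\<lambda>z. q e z * ln (q e z))" if e: "abs e = 1" for e
   by (rule M.integrable_const_bound[where B="3 * (ln 2 + ln 3)"]) (use lnb[OF e] in auto)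
  have "(\<integral>z. ln (q 1 z) \<partial>L 1) + (\<integral>z. ln (q (-1) z) \<partial>L (-1)) = (LINT z|M. H z)"
   using il[OF e1(1)] il[OF e1(2)] by (simp add: Lint H_def)
  also have "... <= (LINT z|M. (s^2 / c) * (indicator B z * (U z)^2) + (16 * s ^ 4 * K ^ 4 - 2 * ln c) / c * (indicator B z * 1))"
  proof (rule integral_mono)
   show "integrable M H" unfolding H_def using il[OF e1(1)] il[OF e1(2)] by simp
   show "integrable M (\<lambda>z. (s^2 / c) * (indicator B z * (U z)^2) + (16 * s ^ 4 * K ^ 4 - 2 * ln c) / c * (indicator B z * 1))"
    using i1 iUU by simp
   fix z
   show "H z <= (s^2 / c) * (indicator B z * (U z)^2) + (16 * s ^ 4 * K ^ 4 - 2 * ln c) / c * (indicator B z * 1)"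
   proof (cases "z \<in> B")
    case True
    define u where "u = s * U z"
    have u: "abs u <= 1/2" using sU[of z] by (simp add: u_def)
    then have u1: "0 < 1 + u" "0 < 1 - u" by linarith+
    have "c * H z = (1 + u) * (ln (1 + u) - ln c) + (1 - u) * (ln (1 - u) - ln c)"
     using True u1 c1 by (simp add: H_def q_def u_def[symmetric] ln_div distrib_left)
    also have "... = ((1 + u) * ln (1 + u) + (1 - u) * ln (1 - u)) - 2 * ln c" by (simp add: algebra_simps)
    also have "... <= u^2 + u ^ 4 - 2 * ln c" using entropy_quadratic_le[of u] u by simp
    also have "u ^ 4 <= 16 * s ^ 4 * K ^ 4"
    proof -
     have "u ^ 4 = abs u ^ 4" by simp
     also have "... <= (s * (2 * K)) ^ 4" using Ub[of z] s(1) by (intro power_mono) (auto simp: u_def abs_mult)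
     finally show ?thesis by (simp add: power_mult_distrib)
    qed
    finally have "c * H z <= s^2 * (U z)^2 + 16 * s ^ 4 * K ^ 4 - 2 * ln c" by (simp add: u_def power_mult_distrib)
    then have "H z <= (s^2 * (U z)^2 + 16 * s ^ 4 * K ^ 4 - 2 * ln c) / c" using c1 by (simp add: pos_le_divide_eq mult.commute)
    then show ?thesis using True by (simp add: add_divide_distrib diff_divide_distrib)
   qed (simp add: H_def q_def)
  qed
  also have "... = s^2 * V + 16 * s ^ 4 * K ^ 4 - 2 * ln c"
  proof -
   show ?thesis using iUU i1 c1 by (simp add: iU2 IB)
  qed
  finally have *: "(\<integral>z. ln (q 1 z) \<partial>L 1) + (\<integral>z. ln (q (-1) z) \<partial>L (-1)) <= s^2 * V + 16 * s ^ 4 * K ^ 4 - 2 * ln c" .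
  \<comment> \<open>Normalising the two densities by \<open>c\<close> costs \<open>- ln c\<close>
    each, which is at most \<open>(1 - c) / c\<close> and hence at most
    \<open>2 * s ^ 3\<close>.\<close>
  have "- 2 * ln c <= 4 * s ^ 3"
  proof -
   have "ln (1 / c) <= 1 / c - 1" using ln_le_minus_one[of "1 / c"] c1 by simp
   also have "1 / c - 1 = (1 - c) / c" using c1 by (simp add: field_simps)
   also have "... <= s ^ 3 / (1/2)" using c c1 s by (intro frac_le) auto
   finally show ?thesis using c1 by (simp add: ln_div)
  qed
  then have **: "(\<integral>z. ln (q 1 z) \<partial>L 1) + (\<integral>z. ln (q (-1) z) \<partial>L (-1)) <= s^2 * V + 16 * s ^ 4 * K ^ 4 + 4 * s ^ 3" using * by simp
  show ?thesis using ** .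
 qed
 have II: "(LINT z|M. rho z * ((1 - t) * (norm (X z - X (tau z)))^2 + t * (norm (Y z - Y (tau z)))^2)) <= 4 * (s^2 * V + 16 * s ^ 4 * K ^ 4 + 4 * s ^ 3)"
 proof -
  have "(\<integral>z. (1 - t) * (norm (X z - X (tau z)))^2 + t * (norm (Y z - Y (tau z)))^2 \<partial>L 1) <= 4 * (s^2 * V + 16 * s ^ 4 * K ^ 4 + 4 * s ^ 3)"
   by (rule order_trans[OF le mult_left_mono[OF ent]]) simp
  then show ?thesis unfolding rhoq by (subst (asm) (1) Lint) auto
 qed
 show thesis using that[OF tau tauB I II] iq(2)[OF e1(1)] qb[OF e1(1)] by (simp add: rhoq)
qed

end

context interp
begin

text \<open>The variance identity for a two-point average, applied to \<open>x - x'\<close> and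
  \<open>y - y'\<close>: the endpoint costs exceed the cost at time \<open>t\<close> by the spread
  of the velocities.\<close>

lemma norm_convex_comb_diff:
 assumes "z = (1 - t) *\<^sub>R x + t *\<^sub>R y" "z' = (1 - t) *\<^sub>R x' + t *\<^sub>R (y' :: real^'n)"
 shows "(1 - t) * (norm (x - x'))^2 + t * (norm (y - y'))^2 = (norm (z - z'))^2 + t * (1 - t) * (norm (y - x - (y' - x')))^2"
proof -
 define p where "p = x - x'"
 define q where "q = y - y'"
 have e: "z - z' = (1 - t) *\<^sub>R p + t *\<^sub>R q" "y - x - (y' - x') = q - p"
  by (simp_all add: assms p_def q_def algebra_simps)
 show ?thesis unfolding e p_def[symmetric] q_def[symmetric] power2_norm_eq_inner
  by (simp add: inner_add_left inner_add_right inner_diff_left inner_diff_right inner_commute algebra_simps)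
qed

text \<open>Let \<open>s\<close> tend to \<open>0\<close> in \<open>poincare_step\<close>.
  Cauchy-Schwarz bounds the change of the mean by the cost times the mean square of difference
  quotients, which tends to the integral of \<open>(norm (q z))^2\<close>; a second use, with
  \<open>g\<close>, bounds the velocity part of the cost from below. The increments of
  \<open>F\<close> are merely dominated by those of the differentiable \<open>H\<close>, which
  admits truncations.\<close>

lemma poincare_bounded:
 assumes F[measurable]: "F \<in> BM" and Fb: "!!z. abs (F z) <= K"
  and FH: "!!z z'. abs (F z - F z') <= abs (H z - H z')"
  and lip: "!!z z'. abs (H z - H z') <= L * norm (z - z')" and qL: "!!z. norm (q z) <= L"
  and q[measurable]: "q \<in> BM" and derH: "!!z. z \<in> G ==> (H has_derivative (\<lambda>h. q z \<bullet> h)) (at z)"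
  and g: "0 <= g" "!!z z'. g * (F z - F z')^2 <= (norm (Y z - X z - (Y z' - X z')))^2"
  and V: "V = (LINT z|M. (F z)^2) - (LINT z|M. F z)^2"
 shows "V^2 <= (LINT z|M. (norm (q z))^2) * (V - t * (1 - t) * g * V^2)"
proof -
 interpret M: prob_space M by (rule prob)
 have K: "0 <= K" using Fb[of 0] by linarith
 have L: "0 <= L" using qL[of 0] norm_ge_zero[of "q 0"] by linarith
 obtain k0 :: nat where k0: "1 <= k0" "4 * (1/2) ^ k0 * K <= 1"
 proof -
  have "(\<lambda>k. 4 * (1/2::real) ^ k * K) \<longlonglongrightarrow> 4 * 0 * K" by (intro tendsto_intros LIMSEQ_realpow_zero) auto
  then have "eventually (\<lambda>k. 4 * (1/2::real) ^ k * K < 1) sequentially" by (intro order_tendstoD) auto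
  then show thesis using that eventually_ge_at_top[of "1::nat"]
   by (metis (mono_tags, lifting) eventually_conj eventually_happens less_imp_le sequentially_bot)
 qed
 \<comment> \<open>With a geometric sequence the transport costs are summable, which forces
   \<open>tau k z\<close> to converge to \<open>z\<close> almost everywhere. The offset
   \<open>k0\<close> secures \<open>4 * s k * K <= 1\<close>.\<close>
 define s where "s k = (1/2::real) ^ (k + k0)" for k
 have s0: "0 < s k" for k by (simp add: s_def)
 have sk0: "s k <= (1/2) ^ k0" for k unfolding s_def by (intro power_decreasing) auto
 have sh: "s k <= 1/2" for k using sk0[of k] power_decreasing[of 1 k0 "1/2::real"] k0(1) by simp
 have sK: "4 * s k * K <= 1" for k
 proof -
  have "4 * s k * K <= 4 * (1/2) ^ k0 * K" using sk0[of k] K by (intro mult_right_mono mult_left_mono) auto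
  then show ?thesis using k0(2) by simp
 qed
 have sl: "s \<longlonglongrightarrow> 0"
  unfolding s_def by (rule LIMSEQ_ignore_initial_segment) (auto intro!: LIMSEQ_realpow_zero)
 define B where "B r = {z \<in> G. norm (X z) <= r & norm (Y z) <= r}" for r
 have B[measurable]: "B r \<in> sets borel" for r unfolding B_def by measurable
 \<comment> \<open>The radii grow without bound, so every point of \<open>G\<close> is eventually
   included, and the mass left out is at most \<open>s k ^ 3\<close>, as
   \<open>poincare_step\<close> asks.\<close>
 have "\<exists>r\<ge>real (Suc k). 1 - measure M (B r) <= s k ^ 3" for k
 proof -
  have "(\<lambda>i. measure M (B (real i))) \<longlonglongrightarrow> measure M (\<Union>i. B (real i))"
  proof (rule M.finite_Lim_measure_incseq)
   show "incseq (\<lambda>i. B (real i))" by (force simp: incseq_def B_def)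
  qed auto
  moreover have "measure M (\<Union>i. B (real i)) = 1"
  proof -
   have "z \<in> (\<Union>i. B (real i))" if "z \<in> G" for z
   proof -
    obtain i :: nat where "max (norm (X z)) (norm (Y z)) <= real i" using real_arch_simple by blast
    then show ?thesis using that by (auto simp: B_def)
   qed
   then have "AE z in M. z \<in> (\<Union>i. B (real i))" using full by (auto elim!: eventually_mono)
   then show ?thesis by (subst M.prob_eq_1) auto
  qed
  ultimately have "(\<lambda>i. measure M (B (real i))) \<longlonglongrightarrow> 1" by simp
  then have "eventually (\<lambda>i. 1 - s k ^ 3 < measure M (B (real i))) sequentially" using s0[of k] by (intro order_tendstoD) auto
  then obtain i where "Suc k <= i" "1 - s k ^ 3 < measure M (B (real i))"
   using eventually_ge_at_top[of "Suc k"] by (metis (mono_tags, lifting) eventually_conj eventually_happens sequentially_bot)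
  then show ?thesis by (intro exI[of _ "real i"]) auto
 qed
 then obtain r where r: "!!k. real (Suc k) <= r k" "!!k. 1 - measure M (B (r k)) <= s k ^ 3" by metis
 define c where "c k = measure M (B (r k))" for k
 define m where "m k = (LINT z|M. indicator (B (r k)) z * F z) / c k" for k
 define v where "v k = (LINT z|M. indicator (B (r k)) z * (F z)^2) / c k - (m k)^2" for k
 define rho where "rho k z = indicator (B (r k)) z * (1 + s k * (F z - m k)) / c k" for k z
 have s3: "s k ^ 3 <= 1/2" for k
 proof -
  have "s k ^ 3 <= s k ^ 1" using s0[of k] sh[of k] by (intro power_decreasing) auto
  then show ?thesis using sh[of k] by simp
 qed
 have c: "1/2 <= c k" "c k <= 1" "1 - c k <= s k ^ 3" for k using r(2)[of k] s3[of k] M.prob_le_1[of "B (r k)"] by (auto simp: c_def)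
 have rpos: "0 < r k" for k using r(1)[of k] by simp
 have "\<exists>tau. tau \<in> BM & (AE z in M. z \<in> B (r k) --> tau z \<in> B (r k)) &
  (LINT z|M. rho k z * (F z - F (tau z))) = 2 * s k * v k &
  (LINT z|M. rho k z * ((1 - t) * (norm (X z - X (tau z)))^2 + t * (norm (Y z - Y (tau z)))^2)) <= 4 * ((s k)^2 * v k + 16 * s k ^ 4 * K ^ 4 + 4 * s k ^ 3) &
  (LINT z|M. rho k z) = 1 & (\<forall>z \<in> B (r k). 1 / 2 <= rho k z & rho k z <= 3)" for k
 proof -
  have BG: "z \<in> G & norm (X z) <= r k & norm (Y z) <= r k" if "z \<in> B (r k)" for z using that by (simp add: B_def)
  obtain tau where "tau \<in> BM" "AE z in M. z \<in> B (r k) --> tau z \<in> B (r k)"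
   "(LINT z|M. rho k z * (F z - F (tau z))) = 2 * s k * v k"
   "(LINT z|M. rho k z * ((1 - t) * (norm (X z - X (tau z)))^2 + t * (norm (Y z - Y (tau z)))^2)) <= 4 * ((s k)^2 * v k + 16 * s k ^ 4 * K ^ 4 + 4 * s k ^ 3)"
   "(LINT z|M. rho k z) = 1" "\<forall>z\<in>B (r k). 1 / 2 <= rho k z & rho k z <= 3"
   by (rule poincare_step[where B="B (r k)" and r="r k" and F=F and K=K and s="s k" and c="c k" and m="m k" and V="v k" and rho="rho k",
    OF B BG rpos F Fb s0 sK c_def c(1) c(3) m_def v_def rho_def])
  then show ?thesis by blast
 qed
 then obtain tau where all: "\<forall>k. tau k \<in> BM & (AE z in M. z \<in> B (r k) --> tau k z \<in> B (r k)) &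
  (LINT z|M. rho k z * (F z - F (tau k z))) = 2 * s k * v k &
  (LINT z|M. rho k z * ((1 - t) * (norm (X z - X (tau k z)))^2 + t * (norm (Y z - Y (tau k z)))^2)) <= 4 * ((s k)^2 * v k + 16 * s k ^ 4 * K ^ 4 + 4 * s k ^ 3) &
  (LINT z|M. rho k z) = 1 & (\<forall>z \<in> B (r k). 1 / 2 <= rho k z & rho k z <= 3)" by (rule choice[OF allI, THEN exE])
 have tau[measurable]: "!!k. tau k \<in> BM" and tauB: "!!k. AE z in M. z \<in> B (r k) --> tau k z \<in> B (r k)"
  and I: "!!k. (LINT z|M. rho k z * (F z - F (tau k z))) = 2 * s k * v k"
  and II: "!!k. (LINT z|M. rho k z * ((1 - t) * (norm (X z - X (tau k z)))^2 + t * (norm (Y z - Y (tau k z)))^2)) <= 4 * ((s k)^2 * v k + 16 * s k ^ 4 * K ^ 4 + 4 * s k ^ 3)"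
  and rho1: "!!k. (LINT z|M. rho k z) = 1" and rhob: "!!k z. z \<in> B (r k) ==> 1 / 2 <= rho k z & rho k z <= 3" using all by blast+
 have rhoz: "rho k z = 0" if "z \<notin> B (r k)" for k z using that by (simp add: rho_def)
 have rho0: "0 <= rho k z" "rho k z <= 3" for k z using rhob[of z k] rhoz[of z k] by (cases "z \<in> B (r k)"; force)+
 have [measurable]: "rho k \<in> BM" for k unfolding rho_def by measurable
 define d where "d k z = norm (z - tau k z)" for k z
 \<comment> \<open>A slope that controls the increment of \<open>F\<close> along
   \<open>tau k\<close> and stays below \<open>L\<close>. Differentiability of \<open>H\<close>
   gives only an upper estimate of the quotient; the maximum with \<open>norm (q z)\<close> supplies
   the lower one, so that \<open>n k z\<close> converges.\<close>
 define n where "n k z = max (norm (q z)) (abs (F z - F (tau k z)) / d k z)" for k z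
 define w where "w k z = norm (Y z - X z - (Y (tau k z) - X (tau k z)))" for k z
 have [measurable]: "d k \<in> BM" "n k \<in> BM" "w k \<in> BM" for k
  unfolding d_def n_def w_def by measurable
 have nq: "norm (q z) <= n k z" "0 <= n k z" for k z by (auto simp: n_def le_max_iff_disj)
 have nL: "n k z <= L" for k z
  using order_trans[OF FH lip, of z "tau k z"] qL[of z] L by (cases "d k z = 0") (auto simp: n_def d_def pos_divide_le_eq)
 have Fn: "abs (F z - F (tau k z)) <= n k z * d k z" for k z
 proof (cases "d k z = 0")
  case True
  then show ?thesis using order_trans[OF FH lip, of z "tau k z"] by (simp add: d_def)
 next
  case False
  then have "0 < d k z" by (simp add: d_def)
  moreover have "abs (F z - F (tau k z)) / d k z <= n k z" by (simp add: n_def)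
  ultimately show ?thesis by (simp add: pos_divide_le_eq)
 qed
 have bdz: "norm z <= r k" if "z \<in> B (r k)" for k z
 proof -
  have "norm z <= norm ((1 - t) *\<^sub>R X z) + norm (t *\<^sub>R Y z)" by (subst XY[of z, symmetric]) (rule norm_triangle_ineq)
  also have "... <= (1 - t) * r k + t * r k" using that t by (auto simp: B_def intro!: add_mono mult_left_mono)
  finally show ?thesis by (simp add: algebra_simps)
 qed
 have ib: "integrable M h" if "h \<in> BM" "AE z in M. abs (h z) <= be" for h and be :: real
  by (rule M.integrable_const_bound[where B=be]) (use that in auto)
 have irho: "integrable M (rho k)" for k by (rule ib[of _ 3]) (use rho0 in \<open>auto simp: abs_le_iff intro: order_trans[OF _ rho0(1)]\<close>)
 have id: "integrable M (\<lambda>z. rho k z * (d k z)^2)" for k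
 proof (rule ib[of _ "3 * (2 * r k)^2"])
  show "AE z in M. abs (rho k z * (d k z)^2) <= 3 * (2 * r k)^2" using tauB[of k]
  proof eventually_elim
   case (elim z)
   show ?case
   proof (cases "z \<in> B (r k)")
    case True
    then have "d k z <= 2 * r k" using bdz[of z k] bdz[of "tau k z" k] elim norm_triangle_ineq4[of z "tau k z"] by (simp add: d_def)
    then have "(d k z)^2 <= (2 * r k)^2" by (intro power_mono) (auto simp: d_def)
    then show ?thesis using rho0[of k z] unfolding abs_mult by (intro mult_mono) auto
   qed (simp add: rhoz)
  qed
 qed measurable
 have iw: "integrable M (\<lambda>z. rho k z * (w k z)^2)" for k
 proof (rule ib[of _ "3 * (4 * r k)^2"])
  show "AE z in M. abs (rho k z * (w k z)^2) <= 3 * (4 * r k)^2" using tauB[of k]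
  proof eventually_elim
   case (elim z)
   show ?case
   proof (cases "z \<in> B (r k)")
    case True
    then have "norm (Y z) <= r k" "norm (X z) <= r k" "norm (Y (tau k z)) <= r k" "norm (X (tau k z)) <= r k"
     using elim by (auto simp: B_def)
    then have "w k z <= 4 * r k" unfolding w_def by norm
    then have "(w k z)^2 <= (4 * r k)^2" by (intro power_mono) (auto simp: w_def)
    then show ?thesis using rho0[of k z] unfolding abs_mult by (intro mult_mono) auto
   qed (simp add: rhoz)
  qed
 qed measurable
 have n2: "rho k z * (n k z)^2 <= 3 * L^2" for k z
  using nL[of k z] nq(2)[of k z] rho0[of k z] by (intro mult_mono power_mono) auto
 have in2: "integrable M (\<lambda>z. rho k z * (n k z)^2)" for k
  by (rule ib[of _ "3 * L^2"]) (use n2 rho0 in auto)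
 have dF: "(F z - F (tau k z))^2 <= (2 * K)^2" for k z
  using power_mono[of "abs (F z - F (tau k z))" "2 * K" 2] Fb[of z] Fb[of "tau k z"] by simp
 have iF2: "integrable M (\<lambda>z. rho k z * (F z - F (tau k z))^2)" for k
 proof (rule ib[of _ "3 * (2 * K)^2"])
  have "abs (rho k z * (F z - F (tau k z))^2) <= 3 * (2 * K)^2" for z
   using dF[of z k] rho0[of k z] unfolding abs_mult by (intro mult_mono) auto
  then show "AE z in M. abs (rho k z * (F z - F (tau k z))^2) <= 3 * (2 * K)^2" by simp
 qed measurable
 define N where "N k = (LINT z|M. rho k z * (n k z)^2)" for k
 have N0: "0 <= N k" for k unfolding N_def by (rule Bochner_Integration.integral_nonneg) (use rho0 in auto)
 have D: "(LINT z|M. rho k z * (d k z)^2) + t * (1 - t) * (LINT z|M. rho k z * (w k z)^2) <= 4 * ((s k)^2 * v k + 16 * s k ^ 4 * K ^ 4 + 4 * s k ^ 3)" for k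
 proof -
  have "(LINT z|M. rho k z * (d k z)^2) + t * (1 - t) * (LINT z|M. rho k z * (w k z)^2) = (LINT z|M. rho k z * (d k z)^2 + t * (1 - t) * (rho k z * (w k z)^2))"
   using id iw by simp
  also have "... = (LINT z|M. rho k z * ((1 - t) * (norm (X z - X (tau k z)))^2 + t * (norm (Y z - Y (tau k z)))^2))"
   unfolding norm_convex_comb_diff[OF XY[symmetric] XY[symmetric]]
   by (rule Bochner_Integration.integral_cong) (auto simp: d_def w_def distrib_left mult_ac)
  finally show ?thesis using II[of k] by simp
 qed
 have sq: "sqrt (rho k z) * sqrt (rho k z) = rho k z" for k z using rho0 by simp
 have CS1: "(2 * s k * v k)^2 <= N k * (LINT z|M. rho k z * (d k z)^2)" for k
 proof -
  have e: "(\<lambda>z. (sqrt (rho k z) * n k z)^2) = (\<lambda>z. rho k z * (n k z)^2)" "(\<lambda>z. (sqrt (rho k z) * d k z)^2) = (\<lambda>z. rho k z * (d k z)^2)"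
   "(\<lambda>z. (sqrt (rho k z) * n k z) * (sqrt (rho k z) * d k z)) = (\<lambda>z. rho k z * (n k z * d k z))"
   using rho0 sq by (auto simp: power_mult_distrib fun_eq_iff mult_ac)
  have i: "integrable M (\<lambda>z. rho k z * (n k z * d k z))" "(LINT z|M. rho k z * (n k z * d k z))^2 <= N k * (LINT z|M. rho k z * (d k z)^2)"
   using integral_Cauchy_Schwarz[of "\<lambda>z. sqrt (rho k z) * n k z" M "\<lambda>z. sqrt (rho k z) * d k z"] id in2 unfolding e N_def by auto
  have "abs (2 * s k * v k) <= (LINT z|M. abs (rho k z * (F z - F (tau k z))))" unfolding I[symmetric] by (rule integral_abs_bound)
  also have "... <= (LINT z|M. rho k z * (n k z * d k z))"
   by (rule integral_mono_AE') (use i(1) Fn rho0 nq in \<open>auto simp: abs_mult d_def intro!: mult_left_mono mult_nonneg_nonneg\<close>)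
  finally have "(2 * s k * v k)^2 <= (LINT z|M. rho k z * (n k z * d k z))^2" by (metis abs_ge_zero power2_abs power_mono)
  then show ?thesis using i(2) by simp
 qed
 have CS2: "g * (2 * s k * v k)^2 <= (LINT z|M. rho k z * (w k z)^2)" for k
 proof -
  have e: "(\<lambda>z. (sqrt (rho k z))^2) = rho k" "(\<lambda>z. (sqrt (rho k z) * (F z - F (tau k z)))^2) = (\<lambda>z. rho k z * (F z - F (tau k z))^2)"
   "(\<lambda>z. sqrt (rho k z) * (sqrt (rho k z) * (F z - F (tau k z)))) = (\<lambda>z. rho k z * (F z - F (tau k z)))"
   using rho0 sq by (auto simp: power_mult_distrib fun_eq_iff mult.assoc[symmetric])
  have "(2 * s k * v k)^2 <= 1 * (LINT z|M. rho k z * (F z - F (tau k z))^2)"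
   using integral_Cauchy_Schwarz(2)[of "\<lambda>z. sqrt (rho k z)" M "\<lambda>z. sqrt (rho k z) * (F z - F (tau k z))"] iF2 irho unfolding e I rho1 by auto
  then have "g * (2 * s k * v k)^2 <= g * (LINT z|M. rho k z * (F z - F (tau k z))^2)" using g by (intro mult_left_mono) auto
  also have "... = (LINT z|M. rho k z * (g * (F z - F (tau k z))^2))" by (simp add: mult.left_commute flip: integral_mult_right_zero)
  also have "... <= (LINT z|M. rho k z * (w k z)^2)"
   by (rule integral_mono_AE') (use iw g rho0 in \<open>auto simp: w_def intro!: mult_left_mono\<close>)
  finally show ?thesis .
 qed
 have main: "(v k)^2 <= N k * (v k + 16 * (s k)^2 * K ^ 4 + 4 * s k - t * (1 - t) * g * (v k)^2)" for k
 proof -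
  have "t * (1 - t) * (g * (2 * s k * v k)^2) <= t * (1 - t) * (LINT z|M. rho k z * (w k z)^2)"
   using CS2[of k] t by (intro mult_left_mono) auto
  then have "(LINT z|M. rho k z * (d k z)^2) <= 4 * ((s k)^2 * v k + 16 * s k ^ 4 * K ^ 4 + 4 * s k ^ 3) - t * (1 - t) * (g * (2 * s k * v k)^2)"
   using D[of k] by linarith
  also have "... = 4 * (s k)^2 * (v k + 16 * (s k)^2 * K ^ 4 + 4 * s k - t * (1 - t) * g * (v k)^2)"
   by (simp add: power2_eq_square power3_eq_cube power4_eq_xxxx algebra_simps)
  finally have "(2 * s k * v k)^2 <= N k * (4 * (s k)^2 * (v k + 16 * (s k)^2 * K ^ 4 + 4 * s k - t * (1 - t) * g * (v k)^2))"
   using CS1[of k] N0[of k] by (meson mult_left_mono order_trans)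
  then have "4 * (s k)^2 * (v k)^2 <= 4 * (s k)^2 * (N k * (v k + 16 * (s k)^2 * K ^ 4 + 4 * s k - t * (1 - t) * g * (v k)^2))"
   by (simp add: power_mult_distrib mult_ac)
  moreover have "0 < 4 * (s k)^2" using s0[of k] by simp
  ultimately show ?thesis by (meson mult_le_cancel_left_pos)
 qed
 have evB: "eventually (\<lambda>k. z \<in> B (r k)) sequentially" if "z \<in> G" for z
 proof -
  obtain i :: nat where i: "max (norm (X z)) (norm (Y z)) <= real i" using real_arch_simple by blast
  show ?thesis using eventually_ge_at_top[of i]
  proof eventually_elim
   case (elim k)
   then have "real i <= r k" using r(1)[of k] by linarith
   then show ?case using that i by (auto simp: B_def)
  qed
 qed
 have cl: "c \<longlonglongrightarrow> 1"
 proof (rule tendsto_sandwich[of "\<lambda>k. 1 - s k ^ 3" _ _ "\<lambda>_. 1"])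
  show "(\<lambda>k. 1 - s k ^ 3) \<longlonglongrightarrow> 1" using tendsto_diff[OF tendsto_const[of 1] tendsto_power[OF sl, of 3]] by simp
 qed (use c in \<open>auto simp: algebra_simps\<close>)
 have lim: "(\<lambda>k. \<integral>z. indicator (B (r k)) z * h z \<partial>M) \<longlonglongrightarrow> (LINT z|M. h z)" if [measurable]: "h \<in> BM" and "!!z. abs (h z) <= be" for h :: "_ => real" and be
 proof (rule integral_dominated_convergence[where w="\<lambda>_. be"])
  show "AE z in M. (\<lambda>k. indicator (B (r k)) z * h z) \<longlonglongrightarrow> h z" using full
  proof eventually_elim
   case (elim z)
   show ?case by (rule tendsto_eventually) (use evB[OF elim] in eventually_elim, simp)
  qed
  show "AE z in M. norm (indicator (B (r k)) z * h z) <= be" for k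
   using that(2) by (auto simp: indicator_def intro: order_trans[OF abs_ge_zero])
 qed auto
 have F2b: "abs ((F z)^2) <= K^2" for z using power_mono[OF Fb[of z], of 2] by simp
 have ml: "m \<longlonglongrightarrow> (LINT z|M. F z)" unfolding m_def using tendsto_divide[OF lim[OF F Fb] cl] by simp
 have vl: "v \<longlonglongrightarrow> V"
 proof -
  have "(\<lambda>k. (LINT z|M. indicator (B (r k)) z * (F z)^2) / c k) \<longlonglongrightarrow> (LINT z|M. (F z)^2)"
   using tendsto_divide[OF lim[OF _ F2b] cl] by simp
  then show ?thesis unfolding v_def V by (intro tendsto_diff tendsto_power ml)
 qed
 have vK: "v k <= 2 * K^2" for k
 proof -
  have "(LINT z|M. indicator (B (r k)) z * (F z)^2) <= (LINT z|M. K^2)"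
   by (rule integral_mono_AE') (use F2b in \<open>auto simp: indicator_def\<close>)
  also have "... = K^2" using M.prob_space by simp
  finally have "(LINT z|M. indicator (B (r k)) z * (F z)^2) / c k <= K^2 / (1/2)"
   using c(1)[of k] by (intro frac_le) auto
  then show ?thesis by (simp add: v_def) (smt (verit) zero_le_power2)
 qed
 \<comment> \<open>The integrals of \<open>rho k z * (d k z)^2\<close> are dominated by a geometric
   series, so the terms tend to \<open>0\<close> at almost every point; the bound
   \<open>1/2 <= rho k z\<close> on \<open>B (r k)\<close> removes the weight.\<close>
 have d0: "AE z in M. (\<lambda>k. d k z) \<longlonglongrightarrow> 0"
 proof -
  define C where "C = 4 * (2 * K^2 + 16 * K ^ 4 + 4)"
  have Dk: "(LINT z|M. rho k z * (d k z)^2) <= C * (1/4) ^ k" for k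
  proof -
   have "0 <= t * (1 - t) * (LINT z|M. rho k z * (w k z)^2)" using t rho0 by (intro mult_nonneg_nonneg Bochner_Integration.integral_nonneg) auto
   then have "(LINT z|M. rho k z * (d k z)^2) <= 4 * ((s k)^2 * v k + 16 * s k ^ 4 * K ^ 4 + 4 * s k ^ 3)" using D[of k] by linarith
   also have "... = (s k)^2 * (4 * (v k + 16 * ((s k)^2 * K ^ 4) + 4 * s k))" by (simp add: power2_eq_square power3_eq_cube power4_eq_xxxx algebra_simps)
   also have "... <= (s k)^2 * C"
   proof (rule mult_left_mono)
    have "(s k)^2 * K ^ 4 <= 1 * K ^ 4" using s0[of k] sh[of k] by (intro mult_right_mono power_le_one) auto
    then show "4 * (v k + 16 * ((s k)^2 * K ^ 4) + 4 * s k) <= C" using vK[of k] sh[of k] unfolding C_def by (intro mult_left_mono add_mono) auto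
   qed simp
   also have "... <= (1/4) ^ k * C"
   proof (rule mult_right_mono)
    have "(s k)^2 = (1/4) ^ (k + k0)" by (simp add: s_def power2_eq_square power_mult_distrib[symmetric])
    also have "... <= (1/4) ^ k" by (intro power_decreasing) auto
    finally show "(s k)^2 <= (1/4) ^ k" .
   qed (simp add: C_def)
   finally show ?thesis by (simp add: mult.commute)
  qed
  have C0: "0 <= C" by (simp add: C_def)
  have "(\<integral>\<^sup>+z. (\<Sum>k. ennreal (rho k z * (d k z)^2)) \<partial>M) = (\<Sum>k. \<integral>\<^sup>+z. ennreal (rho k z * (d k z)^2) \<partial>M)"
   by (rule nn_integral_suminf) simp
  also have "... = (\<Sum>k. ennreal (LINT z|M. rho k z * (d k z)^2))"
   using id rho0 by (intro suminf_cong nn_integral_eq_integral) auto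
  also have "... <= (\<Sum>k. ennreal (C * (1/4) ^ k))" using Dk by (intro suminf_le ennreal_leI) auto
  also have "... = ennreal (\<Sum>k. C * (1/4) ^ k)"
   using C0 by (intro suminf_ennreal2 summable_mult summable_geometric) auto
  also have "... < \<infinity>" by simp
  finally have "AE z in M. (\<Sum>k. ennreal (rho k z * (d k z)^2)) ~= \<infinity>" by (intro nn_integral_noteq_infinite) auto
  then show ?thesis using full
  proof eventually_elim
   case (elim z)
   have "summable (\<lambda>k. rho k z * (d k z)^2)" using elim(1) rho0 by (intro summable_suminf_not_top) auto
   then have u0: "(\<lambda>k. 2 * (rho k z * (d k z)^2)) \<longlonglongrightarrow> 0" using tendsto_mult[OF tendsto_const[of 2] summable_LIMSEQ_zero] by fastforce
   have ev: "eventually (\<lambda>k. (d k z)^2 <= 2 * (rho k z * (d k z)^2)) sequentially" using evB[OF elim(2)]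
   proof eventually_elim
    case (elim k)
    then have "1 * (d k z)^2 <= (2 * rho k z) * (d k z)^2" using rhob[of z k] by (intro mult_right_mono) auto
    then show ?case by simp
   qed
   have "(\<lambda>k. (d k z)^2) \<longlonglongrightarrow> 0"
    by (rule tendsto_sandwich[OF _ ev tendsto_const u0]) simp
   then show ?case by (simp add: power_tendsto_0_iff)
  qed
 qed
 have nl: "AE z in M. (\<lambda>k. n k z) \<longlonglongrightarrow> norm (q z)"
  using d0 full
 proof eventually_elim
  case (elim z)
  show ?case
  proof (rule tendstoI)
   fix e :: real assume e: "0 < e"
   obtain de where de: "0 < de" "!!y. norm (y - z) < de ==> norm (H y - H z - q z \<bullet> (y - z)) <= e / 2 * norm (y - z)"
    using derH[OF elim(2)] e unfolding has_derivative_at_alt by (meson half_gt_zero)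
   have "eventually (\<lambda>k. d k z < de) sequentially" using elim(1) de(1) by (rule order_tendstoD)
   then show "eventually (\<lambda>k. dist (n k z) (norm (q z)) < e) sequentially"
   proof eventually_elim
    case (elim k)
    have "abs (F z - F (tau k z)) <= (norm (q z) + e / 2) * d k z"
    proof -
     have "norm (H (tau k z) - H z - q z \<bullet> (tau k z - z)) <= e / 2 * d k z" using de(2)[of "tau k z"] elim by (simp add: d_def norm_minus_commute)
     moreover have "abs (q z \<bullet> (tau k z - z)) <= norm (q z) * d k z" using Cauchy_Schwarz_ineq2[of "q z" "tau k z - z"] by (simp add: d_def norm_minus_commute)
     ultimately show ?thesis using FH[of z "tau k z"] unfolding distrib_right real_norm_def by linarith
    qed
    then have "abs (F z - F (tau k z)) / d k z <= norm (q z) + e / 2"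
     using e by (cases "d k z = 0") (auto simp: pos_divide_le_eq d_def)
    then have "n k z <= norm (q z) + e / 2" using e by (simp add: n_def)
    then show ?case using nq(1)[of z k] e by (simp add: dist_real_def)
   qed
  qed
 qed
 have Nl: "N \<longlonglongrightarrow> (LINT z|M. (norm (q z))^2)"
  unfolding N_def
 proof (rule integral_dominated_convergence[where w="\<lambda>_. 3 * L^2"])
  show "AE z in M. (\<lambda>k. rho k z * (n k z)^2) \<longlonglongrightarrow> (norm (q z))^2" using nl full
  proof eventually_elim
   case (elim z)
   have "(\<lambda>k. (1 + s k * (F z - m k)) / c k) \<longlonglongrightarrow> (1 + 0 * (F z - (LINT z|M. F z))) / 1"
    by (intro tendsto_intros sl ml cl) simp
   then have "(\<lambda>k. (1 + s k * (F z - m k)) / c k) \<longlonglongrightarrow> 1" by simp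
   then have "(\<lambda>k. rho k z) \<longlonglongrightarrow> 1"
    by (rule Lim_transform_eventually) (use evB[OF elim(2)] in eventually_elim, simp add: rho_def)
   from tendsto_mult[OF this tendsto_power[OF elim(1), of 2]] show ?case by simp
  qed
  show "AE z in M. norm (rho k z * (n k z)^2) <= 3 * L^2" for k using n2 rho0 by auto
 qed auto
 have r1: "(\<lambda>k. N k * (v k + 16 * (s k)^2 * K ^ 4 + 4 * s k - t * (1 - t) * g * (v k)^2)) \<longlonglongrightarrow>
   (LINT z|M. (norm (q z))^2) * (V + 16 * 0^2 * K ^ 4 + 4 * 0 - t * (1 - t) * g * V^2)"
  by (intro tendsto_intros Nl vl sl)
 have r2: "(\<lambda>k. (v k)^2) \<longlonglongrightarrow> V^2" by (intro tendsto_intros vl)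
 have "V^2 <= (LINT z|M. (norm (q z))^2) * (V + 16 * 0^2 * K ^ 4 + 4 * 0 - t * (1 - t) * g * V^2)"
  by (rule LIMSEQ_le[OF r2 r1]) (use main in auto)
 then show ?thesis by simp
qed

end

lemma lipschitz_gradient_le:
 fixes F :: "'a::euclidean_space => real"
 assumes F: "(F has_derivative (\<lambda>h. q \<bullet> h)) (at z)" and lip: "!!y. abs (F y - F z) <= L * norm (y - z)"
 shows "norm q <= L"
proof (rule ccontr)
 assume c: "\<not> norm q <= L"
 define e where "e = norm q - L"
 have e: "0 < e" using c by (simp add: e_def)
 obtain de where de: "0 < de" "!!y. norm (y - z) < de ==> norm (F y - F z - q \<bullet> (y - z)) <= e / 2 * norm (y - z)"
  using F e unfolding has_derivative_at_alt by (meson half_gt_zero)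
 have L: "0 <= L"
 proof -
  obtain b :: 'a where "b \<in> Basis" using nonempty_Basis by blast
  then have "0 <= L * 1" using lip[of "z + b"] by (metis abs_ge_zero add_diff_cancel_left' norm_Basis order_trans)
  then show ?thesis by simp
 qed
 have q0: "norm q > 0" using c L by linarith
 define r where "r = de / 2 / norm q"
 have r: "0 < r" "r * norm q = de / 2" using de(1) q0 by (auto simp: r_def)
 have n: "norm (r *\<^sub>R q) = r * norm q" using r by simp
 have "norm (F (z + r *\<^sub>R q) - F z - q \<bullet> (r *\<^sub>R q)) <= e / 2 * (r * norm q)"
  using de(2)[of "z + r *\<^sub>R q"] n r(2) de(1) by simp
 moreover have "abs (F (z + r *\<^sub>R q) - F z) <= L * (r * norm q)" using lip[of "z + r *\<^sub>R q"] unfolding add_diff_cancel_left' n .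
 moreover have "q \<bullet> (r *\<^sub>R q) = norm q * (r * norm q)" by (simp add: power2_norm_eq_inner[symmetric] power2_eq_square)
 ultimately have "norm q * (r * norm q) <= L * (r * norm q) + e / 2 * (r * norm q)" unfolding real_norm_def by linarith
 then have "norm q * (r * norm q) <= (L + e / 2) * (r * norm q)" by (simp add: distrib_right)
 moreover have "0 < r * norm q" using r de(1) by simp
 ultimately have "norm q <= L + e / 2" by (simp only: mult_le_cancel_right_pos)
 moreover have "x <= L" if "x <= L + (x - L) / 2" for x :: real using that by (simp add: field_simps)
 ultimately have "norm q <= L" unfolding e_def by blast
 then show False using c by simp
qed

context interp
begin

text \<open>Cutting \<open>F\<close> off at the levels \<open>- k\<close> and \<open>k\<close>
  destroys differentiability, but the increments remain dominated by those of \<open>F\<close>,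
  which is the form \<open>poincare_bounded\<close> accepts. Dominated convergence removes the
  cutoff.\<close>

lemma poincare_lipschitz:
 assumes F[measurable]: "F \<in> BM" and F2: "integrable M (\<lambda>z. (F z)^2)"
  and lip: "!!z z'. abs (F z - F z') <= L * norm (z - z')"
  and q[measurable]: "q \<in> BM" and q0: "!!z. z \<notin> G ==> q z = 0"
  and derF: "!!z. z \<in> G ==> (F has_derivative (\<lambda>h. q z \<bullet> h)) (at z)"
  and g: "0 <= g" "!!z z'. g * (F z - F z')^2 <= (norm (Y z - X z - (Y z' - X z')))^2"
  and V: "V = (LINT z|M. (F z)^2) - (LINT z|M. F z)^2"
 shows "V^2 <= (LINT z|M. (norm (q z))^2) * (V - t * (1 - t) * g * V^2)"
proof -
 interpret M: prob_space M by (rule prob)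
 have L: "0 <= L"
 proof -
  have "norm (axis undefined (1::real) :: real^'n) = 1" by simp
  then show ?thesis using lip[of "axis undefined 1" 0] by (metis abs_ge_zero diff_zero mult.right_neutral order_trans)
 qed
 have qL: "norm (q z) <= L" for z
  by (cases "z \<in> G") (use lipschitz_gradient_le[OF derF lip] q0 L in auto)
 have F1: "integrable M F" using M.square_integrable_imp_integrable[OF _ F2] by simp
 define N where "N = (LINT z|M. (norm (q z))^2)"
 define f where "f k z = max (- real k) (min (real k) (F z))" for k z
 have fm[measurable]: "f k \<in> BM" for k unfolding f_def by measurable
 have fd: "abs (f k z - f k z') <= abs (F z - F z')" and fF: "abs (f k z) <= abs (F z)" for k z z' by (auto simp: f_def)
 define v where "v k = (LINT z|M. (f k z)^2) - (LINT z|M. f k z)^2" for k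
 have step: "(v k)^2 <= N * (v k - t * (1 - t) * g * (v k)^2)" for k
  unfolding N_def
 proof (rule poincare_bounded[OF fm _ fd lip qL q derF g(1) _ v_def])
  show "abs (f k z) <= real k" for z by (auto simp: f_def)
  fix z z'
  have "(f k z - f k z')^2 <= (F z - F z')^2" using power_mono[OF fd[of k z z'], of 2] by simp
  then show "g * (f k z - f k z')^2 <= (norm (Y z - X z - (Y z' - X z')))^2" using g by (meson mult_left_mono order_trans)
 qed
 have fl: "(\<lambda>k. f k z) \<longlonglongrightarrow> F z" for z
 proof (rule tendsto_eventually)
  show "eventually (\<lambda>k. f k z = F z) sequentially"
   using eventually_ge_at_top[of "nat \<lceil>abs (F z)\<rceil>"] by eventually_elim (auto simp: f_def nat_le_iff ceiling_le_iff)
 qed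
 have vl: "v \<longlonglongrightarrow> V" unfolding v_def V
 proof (intro tendsto_diff tendsto_power)
  show "(\<lambda>k. \<integral>z. (f k z)^2 \<partial>M) \<longlonglongrightarrow> (LINT z|M. (F z)^2)"
  proof (rule integral_dominated_convergence[OF _ _ F2])
   show "AE z in M. norm ((f k z)^2) <= (F z)^2" for k using power_mono[OF fF, of _ _ 2] by (intro AE_I2) auto
  qed (use fl in \<open>auto intro!: tendsto_power\<close>)
  show "(\<lambda>k. \<integral>z. f k z \<partial>M) \<longlonglongrightarrow> (LINT z|M. F z)"
   by (rule integral_dominated_convergence[where w="\<lambda>z. abs (F z)"]) (use fl fF F1 in auto)
 qed
 show ?thesis unfolding N_def[symmetric]
 proof (rule LIMSEQ_le)
  show "(\<lambda>k. (v k)^2) \<longlonglongrightarrow> V^2" "(\<lambda>k. N * (v k - t * (1 - t) * g * (v k)^2)) \<longlonglongrightarrow> N * (V - t * (1 - t) * g * V^2)"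
   by (intro tendsto_intros vl)+
 qed (use step in auto)
qed

end

lemma norm_sq_sum_Basis: "(norm (x::'a::euclidean_space))^2 = (\<Sum>e\<in>Basis. (x \<bullet> e)^2)"
 unfolding power2_norm_eq_inner by (subst euclidean_inner) (simp add: power2_eq_square)

context interp
begin

lemma lipschitz_XY: "norm (X z - X z') <= 1 / (1 - t) * norm (z - z')" "norm (Y z - Y z') <= 1 / t * norm (z - z')"
proof -
 have e: "z - z' = (1 - t) *\<^sub>R (X z - X z') + t *\<^sub>R (Y z - Y z')"
  by (subst (1 2) XY[symmetric]) (simp add: algebra_simps)
 have "norm ((1 - t) *\<^sub>R (X z - X z')) <= norm (z - z')" "norm (t *\<^sub>R (Y z - Y z')) <= norm (z - z')"
  unfolding e by (rule norm_le_norm_add; use mono[of z z'] t in simp)+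
 then show "norm (X z - X z') <= 1 / (1 - t) * norm (z - z')" "norm (Y z - Y z') <= 1 / t * norm (z - z')"
  using t unfolding norm_scaleR by (simp_all add: pos_le_divide_eq mult.commute)
qed

definition "v z = Y z - X z"

text \<open>The derivative of \<open>v\<close>; the value \<open>0\<close> off \<open>G\<close>
  makes it Borel in \<open>z\<close> and bounded everywhere.\<close>

definition "A z h = (if z \<in> G then b z h - a z h else 0)"

abbreviation "tr_A z \<equiv> \<Sum>e\<in>Basis. A z e \<bullet> e"

abbreviation "hs_A z \<equiv> \<Sum>e\<in>Basis. (norm (A z e))^2"

lemma v_measurable[measurable]: "v \<in> BM" unfolding v_def by measurable

lemma v_derivative: "z \<in> G ==> (v has_derivative A z) (at z)"
 unfolding v_def A_def using der by (auto intro!: derivative_eq_intros)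

lemma sym_A: "z \<in> G ==> sym_map (A z)"
 unfolding sym_map_def A_def using sym[of z] by (auto simp: sym_map_def inner_diff_left inner_diff_right intro!: linear_compose_sub)

lemma A_measurable[measurable]: "(\<lambda>z. A z h) \<in> BM"
proof -
 have "A z h = (if z \<in> G then lim (\<lambda>k. real (Suc k) *\<^sub>R (v (z + (1 / real (Suc k)) *\<^sub>R h) - v z)) else 0)" for z
  using limI[OF has_derivative_sequence[OF v_derivative], of z h] by (simp add: A_def)
 then show ?thesis by (subst fun_cong[OF ext]) measurable
qed

lemma lipschitz_v: "norm (v z - v z') <= (1 / (1 - t) + 1 / t) * norm (z - z')"
proof -
 have "norm (v z - v z') <= norm (Y z - Y z') + norm (X z - X z')"
  unfolding v_def using norm_triangle_ineq4[of "Y z - Y z'" "X z - X z'"] by (simp add: algebra_simps)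
 then show ?thesis using lipschitz_XY[of z z'] by (simp add: distrib_right)
qed

text \<open>Symmetry of \<open>A z\<close> makes \<open>A z e + l *\<^sub>R e\<close> the gradient
  of the test function, so the sum over the basis is a polynomial in \<open>l\<close> that is
  nonnegative for all \<open>l\<close>: its discriminant is the second claim, its leading
  coefficient the last. At \<open>l = 0\<close> the surplus term excludes equality in each component
  of positive variance, since it would give \<open>t * (1 - t) * Ve e ^ 3 <= 0\<close>. Finally
  \<open>Z\<close> is positive because a measure with a density is not a point mass.\<close>

lemma poincare_sums:
 assumes mom: "integrable M (\<lambda>z. (norm (X z))^2)" "integrable M (\<lambda>z. (norm (Y z))^2)"
 defines "W \<equiv> (LINT z|M. (norm (v z))^2) - (norm (LINT z|M. v z))^2"
  and "C \<equiv> (LINT z|M. z \<bullet> v z) - (LINT z|M. z) \<bullet> (LINT z|M. v z)"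
  and "Z \<equiv> (LINT z|M. (norm z)^2) - (norm (LINT z|M. z))^2"
  and "Q \<equiv> (LINT z|M. hs_A z)" and "S \<equiv> (LINT z|M. tr_A z)"
 shows "0 < W ==> W < Q" and "(S - C)^2 <= (Q - W) * (real CARD('n) - Z)" and "0 < Z"
  and "integrable M (\<lambda>z. hs_A z)" and "integrable M (\<lambda>z. tr_A z)"
  and "integrable M (\<lambda>z. (norm (v z))^2)" "integrable M (\<lambda>z. (norm z)^2)" "integrable M (\<lambda>z. z \<bullet> v z)"
  and "integrable M v" "integrable M (\<lambda>z. z)" and "Z <= real CARD('n)"
proof -
 interpret M: prob_space M by (rule prob)
 define L where "L = 1 / (1 - t) + 1 / t"
 have L: "0 < L" using t by (simp add: L_def add_pos_pos)
 have iv2: "integrable M (\<lambda>z. (norm (v z))^2)" unfolding v_def by (rule integrable_norm_add_sq) (use mom in auto)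
 have "z = X z + t *\<^sub>R v z" for z using XY[of z] by (simp add: v_def algebra_simps)
 moreover have "integrable M (\<lambda>z. (norm (X z + t *\<^sub>R v z))^2)"
  by (rule integrable_norm_add_sq) (use mom iv2 in \<open>auto simp: power_mult_distrib\<close>)
 ultimately have iz2: "integrable M (\<lambda>z. (norm z)^2)" by simp
 have iv: "integrable M v" and iz: "integrable M (\<lambda>z. z)"
  by (rule integrable_square_imp(1)[OF prob]; use iv2 iz2 in simp)+
 define ev where "ev e = (LINT z|M. v z) \<bullet> e" for e
 define ez where "ez e = (LINT z|M. z) \<bullet> e" for e :: "real^'n"
 have Ee: "(LINT z|M. v z \<bullet> e) = ev e" "(LINT z|M. z \<bullet> e) = ez e" for e
  unfolding ev_def ez_def using iv iz by (auto intro: integral_inner_left)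
 have ivv: "integrable M (\<lambda>z. (v z \<bullet> e)^2)" "integrable M (\<lambda>z. (z \<bullet> e)^2)" if "e \<in> Basis" for e
 proof -
  have *: "(x \<bullet> e)^2 <= (norm x)^2" for x :: "real^'n"
   using Basis_le_norm[OF that, of x] by (metis abs_ge_zero power2_abs power_mono)
  show "integrable M (\<lambda>z. (v z \<bullet> e)^2)" by (rule Bochner_Integration.integrable_bound[OF iv2]) (use * in auto)
  show "integrable M (\<lambda>z. (z \<bullet> e)^2)" by (rule Bochner_Integration.integrable_bound[OF iz2]) (use * in auto)
 qed
 have izv: "integrable M (\<lambda>z. (z \<bullet> e) * (v z \<bullet> e))" if "e \<in> Basis" for e
  by (rule integral_Cauchy_Schwarz(1)) (use ivv[OF that] in auto)
 have ip: "z \<bullet> v z = (\<Sum>e\<in>Basis. (z \<bullet> e) * (v z \<bullet> e))" for z by (rule euclidean_inner)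
 have izvs: "integrable M (\<lambda>z. z \<bullet> v z)" unfolding ip using izv by auto
 define Ve where "Ve e = (LINT z|M. (v z \<bullet> e)^2) - (ev e)^2" for e
 define Ce where "Ce e = (LINT z|M. (z \<bullet> e) * (v z \<bullet> e)) - ez e * ev e" for e
 define Ze where "Ze e = (LINT z|M. (z \<bullet> e)^2) - (ez e)^2" for e
 have Ws: "W = (\<Sum>e\<in>Basis. Ve e)"
  unfolding W_def norm_sq_sum_Basis Ve_def sum_subtractf ev_def using ivv by simp
 have Zs: "Z = (\<Sum>e\<in>Basis. Ze e)"
  unfolding Z_def norm_sq_sum_Basis Ze_def sum_subtractf ez_def using ivv by simp
 have Cs: "C = (\<Sum>e\<in>Basis. Ce e)"
 proof -
  have "(LINT z|M. z) \<bullet> (LINT z|M. v z) = (\<Sum>e\<in>Basis. ez e * ev e)" unfolding ez_def ev_def by (rule euclidean_inner)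
  then show ?thesis unfolding C_def ip Ce_def sum_subtractf using izv by simp
 qed
 have P: "Ve e + 2 * l * Ce e + l^2 * Ze e <= (LINT z|M. (norm (if z \<in> G then A z e + l *\<^sub>R e else 0))^2)"
  "l = 0 ==> (Ve e)^2 <= (LINT z|M. (norm (A z e))^2) * (Ve e - t * (1 - t) * (Ve e)^2)"
  if e: "e \<in> Basis" for e l
 proof -
  define F where "F z = v z \<bullet> e + l * (z \<bullet> e)" for z
  define q where "q z = (if z \<in> G then A z e + l *\<^sub>R e else 0)" for z
  define V where "V = (LINT z|M. (F z)^2) - (LINT z|M. F z)^2"
  have [measurable]: "F \<in> BM" "q \<in> BM" unfolding F_def q_def by measurable
  have F2: "(F z)^2 = (v z \<bullet> e)^2 + 2 * l * ((z \<bullet> e) * (v z \<bullet> e)) + l^2 * (z \<bullet> e)^2" for z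
   by (simp add: F_def power2_eq_square algebra_simps)
  have iF2: "integrable M (\<lambda>z. (F z)^2)" unfolding F2 using ivv[OF e] izv[OF e] by simp
  have "(LINT z|M. F z) = ev e + l * ez e" unfolding F_def using iv iz by (simp add: Ee)
  then have VV: "V = Ve e + 2 * l * Ce e + l^2 * Ze e"
  proof -
   assume *: "(LINT z|M. F z) = ev e + l * ez e"
   have "(LINT z|M. (F z)^2) = (LINT z|M. (v z \<bullet> e)^2) + 2 * l * (LINT z|M. (z \<bullet> e) * (v z \<bullet> e)) + l^2 * (LINT z|M. (z \<bullet> e)^2)"
    unfolding F2 using ivv[OF e] izv[OF e] by simp
   then show ?thesis unfolding V_def * Ve_def Ce_def Ze_def by (simp add: power2_eq_square algebra_simps)
  qed
  have lip: "abs (F z - F z') <= (L + abs l) * norm (z - z')" for z z'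
  proof -
   have "abs (F z - F z') <= abs ((v z - v z') \<bullet> e) + abs l * abs ((z - z') \<bullet> e)"
    unfolding F_def abs_mult[symmetric] by (simp add: inner_diff_left algebra_simps)
   also have "... <= norm (v z - v z') + abs l * norm (z - z')" using Basis_le_norm[OF e] by (intro add_mono mult_left_mono) auto
   also have "... <= L * norm (z - z') + abs l * norm (z - z')" using lipschitz_v[of z z'] by (simp add: L_def)
   finally show ?thesis by (simp add: distrib_right)
  qed
  have derF: "(F has_derivative (\<lambda>h. q z \<bullet> h)) (at z)" if z: "z \<in> G" for z
  proof -
   have "(F has_derivative (\<lambda>h. A z h \<bullet> e + l * (h \<bullet> e))) (at z)"
    unfolding F_def by (auto intro!: derivative_eq_intros v_derivative[OF z])
   moreover have "A z h \<bullet> e + l * (h \<bullet> e) = q z \<bullet> h" for h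
    using sym_A[OF z] z by (simp add: q_def sym_map_def inner_add_left inner_commute[of e])
   ultimately show ?thesis by simp
  qed
  \<comment> \<open>The velocity difference dominates each of its components, so the constant
    \<open>1\<close> is admissible for \<open>l = 0\<close>; for other \<open>l\<close> the surplus
    is given up.\<close>
  have gap: "(if l = 0 then 1 else 0) * (F z - F z')^2 <= (norm (Y z - X z - (Y z' - X z')))^2" for z z'
  proof (cases "l = 0")
   case True
   then have "F z - F z' = (v z - v z') \<bullet> e" by (simp add: F_def inner_diff_left)
   then have "abs (F z - F z') <= norm (v z - v z')" using Basis_le_norm[OF e] by metis
   then show ?thesis using True power_mono[of "abs (F z - F z')" _ 2] by (simp add: v_def)
  qed simp
  have PL: "V^2 <= (LINT z|M. (norm (q z))^2) * (V - t * (1 - t) * (if l = 0 then 1 else 0) * V^2)"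
   by (rule poincare_lipschitz[OF _ iF2 lip _ _ derF _ gap V_def]) (auto simp: q_def)
  have N0: "0 <= (LINT z|M. (norm (q z))^2)" by (rule Bochner_Integration.integral_nonneg) simp
  have "0 <= t * (1 - t) * (if l = 0 then 1 else 0) * V^2" using t by simp
  then have "V^2 <= (LINT z|M. (norm (q z))^2) * V" using PL N0 by (smt (verit) mult_left_mono)
  then have "V <= (LINT z|M. (norm (q z))^2)"
  proof (cases "0 < V")
   case False
   then show ?thesis using N0 by linarith
  qed (simp add: power2_eq_square)
  then show "Ve e + 2 * l * Ce e + l^2 * Ze e <= (LINT z|M. (norm (if z \<in> G then A z e + l *\<^sub>R e else 0))^2)"
   by (simp add: VV q_def)
  show "(Ve e)^2 <= (LINT z|M. (norm (A z e))^2) * (Ve e - t * (1 - t) * (Ve e)^2)" if "l = 0"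
  proof -
   have "norm (q z) = norm (A z e)" for z using that by (simp add: q_def A_def)
   then show ?thesis using PL that VV by simp
  qed
 qed
 have Ab: "norm (A z e) <= L" if e: "e \<in> Basis" for z e
 proof (cases "z \<in> G")
  case True
  show ?thesis
  proof (rule lipschitz_gradient_le)
   have "((\<lambda>z. v z \<bullet> e) has_derivative (\<lambda>h. A z h \<bullet> e)) (at z)" by (auto intro!: derivative_eq_intros v_derivative[OF True])
   then show "((\<lambda>z. v z \<bullet> e) has_derivative (\<lambda>h. A z e \<bullet> h)) (at z)" using sym_A[OF True] by (simp add: sym_map_def inner_commute)
   show "abs (v y \<bullet> e - v z \<bullet> e) <= L * norm (y - z)" for y
    using Basis_le_norm[OF e, of "v y - v z"] lipschitz_v[of y z] by (simp add: inner_diff_left L_def)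
  qed
 qed (use L in \<open>simp add: A_def\<close>)
 have iA: "integrable M (\<lambda>z. (norm (A z e))^2)" if "e \<in> Basis" for e
  by (rule M.integrable_const_bound[where B="L^2"]) (use Ab[OF that] in \<open>auto intro!: power_mono\<close>)
 have iAe: "integrable M (\<lambda>z. A z e \<bullet> e)" if "e \<in> Basis" for e
  by (rule M.integrable_const_bound[where B=L])
    (use Ab[OF that] Basis_le_norm[OF that] in \<open>auto intro: order_trans\<close>)
 show "integrable M (\<lambda>z. hs_A z)" "integrable M (\<lambda>z. tr_A z)" using iA iAe by auto
 show "integrable M (\<lambda>z. (norm (v z))^2)" "integrable M (\<lambda>z. (norm z)^2)" "integrable M (\<lambda>z. z \<bullet> v z)" "integrable M v" "integrable M (\<lambda>z. z)"
  by fact+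
 have Qs: "Q = (\<Sum>e\<in>Basis. \<integral>z. (norm (A z e))^2 \<partial>M)" unfolding Q_def using iA by simp
 have Ss: "S = (\<Sum>e\<in>Basis. \<integral>z. A z e \<bullet> e \<partial>M)" unfolding S_def using iAe by simp
 have Ne: "(LINT z|M. (norm (if z \<in> G then A z e + l *\<^sub>R e else 0))^2) = (LINT z|M. (norm (A z e))^2) + 2 * l * (LINT z|M. A z e \<bullet> e) + l^2"
  if e: "e \<in> Basis" for e l
 proof -
  have "(LINT z|M. (norm (if z \<in> G then A z e + l *\<^sub>R e else 0))^2) = (LINT z|M. (norm (A z e))^2 + 2 * l * (A z e \<bullet> e) + l^2)"
  proof (rule integral_cong_AE)
   show "AE z in M. (norm (if z \<in> G then A z e + l *\<^sub>R e else 0))^2 = (norm (A z e))^2 + 2 * l * (A z e \<bullet> e) + l^2"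
    using full
   proof eventually_elim
    case (elim z)
    have "(norm (A z e + l *\<^sub>R e))^2 = (norm (A z e))^2 + 2 * l * (A z e \<bullet> e) + l^2 * (e \<bullet> e)"
     unfolding power2_norm_eq_inner by (simp add: inner_add_left inner_add_right inner_commute power2_eq_square algebra_simps)
    then show ?case using elim e by simp
   qed
  qed measurable
  also have "... = (LINT z|M. (norm (A z e))^2) + 2 * l * (LINT z|M. A z e \<bullet> e) + l^2"
   using iA[OF e] iAe[OF e] M.prob_space by simp
  finally show ?thesis .
 qed
 have quad: "0 <= Q - W + 2 * l * (S - C) + l^2 * (real CARD('n) - Z)" for l :: real
 proof -
  have "(\<Sum>e\<in>Basis. Ve e + 2 * l * Ce e + l^2 * Ze e) <= (\<Sum>e\<in>Basis. (LINT z|M. (norm (A z e))^2) + 2 * l * (LINT z|M. A z e \<bullet> e) + l^2)"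
   using P(1)[of _ l] Ne[of _ l] by (intro sum_mono) simp
  then have "W + 2 * l * C + l^2 * Z <= Q + 2 * l * S + l^2 * real CARD('n)"
   by (simp add: sum.distrib sum_distrib_left[symmetric] Ws Zs Cs Qs Ss mult.commute[of "real CARD('n)"])
  then show ?thesis by (simp add: algebra_simps)
 qed
 show "(S - C)^2 <= (Q - W) * (real CARD('n) - Z)" "Z <= real CARD('n)"
  using quadratic_discriminant_le[OF quad] by simp_all
 show "W < Q" if W: "0 < W"
 proof -
  have le: "Ve e <= (LINT z|M. (norm (A z e))^2)" if "e \<in> Basis" for e using P(1)[OF that, of 0] Ne[OF that, of 0] by simp
  have "\<exists>e\<in>Basis. 0 < Ve e" using W unfolding Ws by (meson not_less sum_nonpos)
  then obtain e where e: "e \<in> Basis" "0 < Ve e" by blast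
  have "Ve e < (LINT z|M. (norm (A z e))^2)"
  proof (rule ccontr)
   assume "\<not> ?thesis"
   then have eq: "(LINT z|M. (norm (A z e))^2) = Ve e" using le[OF e(1)] by simp
   have "Ve e * (Ve e - t * (1 - t) * (Ve e)^2) = (Ve e)^2 - t * (1 - t) * Ve e ^ 3" by (simp add: power2_eq_square power3_eq_cube algebra_simps)
   then have "t * (1 - t) * Ve e ^ 3 <= 0" using P(2)[OF e(1), of 0] eq by simp
   moreover have "0 < t * (1 - t) * Ve e ^ 3" using e t by simp
   ultimately show False by simp
  qed
  then show ?thesis unfolding Ws Qs using le e by (intro sum_strict_mono_ex1) auto
 qed
 show "0 < Z"
 proof -
  define m where "m = (LINT z|M. z)"
  have "0 <= Z" using integrable_square_imp(2)[OF prob _ iz2] by (simp add: Z_def)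
  moreover have "Z ~= 0"
  proof
   assume "Z = 0"
   then have "AE z in M. z = m" unfolding m_def by (intro variance_zero_AE[OF prob _ iz2]) (simp_all add: Z_def)
   moreover have "AE z in M. z ~= m"
   proof -
    have "AE z in lborel. z ~= m" by (rule AE_lborel_singleton)
    then show ?thesis by (subst AE_density) (auto elim: eventually_mono)
   qed
   ultimately have "AE z in M. False" by eventually_elim simp
   then show False by (simp add: M.AE_False)
  qed
  ultimately show ?thesis by simp
 qed
qed

end

subsection \<open>Entropy along the geodesic\<close>

text \<open>\<open>f\<close> solves the equation of the harmonic oscillator with frequency
  \<open>w\<close>, and \<open>g\<close> is its derivative divided by \<open>w\<close>; this is the
  addition theorem for such a solution.\<close>

lemma sine_interpolation_shift:
 fixes w x y :: real
 defines "f \<equiv> \<lambda>tau. sin ((1 - tau) * w) / sin w * x + sin (tau * w) / sin w * y"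
  and "g \<equiv> \<lambda>tau. (cos (tau * w) * y - cos ((1 - tau) * w) * x) / sin w"
 shows "f (t + d) = f t * cos (d * w) + g t * sin (d * w)"
proof -
 have "sin ((1 - (t + d)) * w) = sin ((1 - t) * w) * cos (d * w) - cos ((1 - t) * w) * sin (d * w)"
 proof -
  have "(1 - (t + d)) * w = (1 - t) * w - d * w" by (simp add: algebra_simps)
  then show ?thesis by (simp only: sin_diff)
 qed
 moreover have "sin ((t + d) * w) = sin (t * w) * cos (d * w) + cos (t * w) * sin (d * w)"
  by (simp add: distrib_right sin_add)
 ultimately show ?thesis unfolding f_def g_def by (simp only:) (simp add: divide_inverse algebra_simps)
qed

text \<open>If the inequality failed at \<open>t0\<close>, the function \<open>Psi\<close> would
  have a maximum at some interior time. First-order bounds there give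
  \<open>n * (u * w) = S - C\<close>, and symmetric second differences give
  \<open>Q + W <= n * (1 + u^2) * w^2\<close>. With \<open>n * w^2 = 2 * W\<close> and the bound for
  \<open>(S - C)^2\<close> this yields \<open>(Q - W) * Z <= 0\<close>. The majorant
  \<open>h\<close> stands in for continuity of \<open>D\<close> at the two ends.\<close>

lemma sine_comparison_strict:
 fixes D h :: "real => real" and W n w :: real
 assumes n: "0 < n" and w: "0 < w" "w < pi" "n * w^2 = 2 * W" and W: "0 < W"
  and h: "continuous_on {0..1} h" "h 0 = D 0" "h 1 = D 1" "!!tau. 0 < tau ==> tau < 1 ==> D tau <= h tau"
  and loc: "!!t. 0 < t ==> t < 1 ==> \<exists>S C Q Z J e. 0 < e & W < Q & 0 < Z & (S - C)^2 <= (Q - W) * (n - Z) &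
   (\<forall>d. abs d < e --> 0 < t + d & t + d < 1 & D (t + d) = D t - J d + d * C + d^2 * W / 2 &
    abs (J d - d * S) <= 2 * d^2 * Q & J d + J (- d) <= - d\<^sup>2 * Q)"
  and t0: "0 < t0" "t0 < 1"
 shows "sin ((1 - t0) * w) / sin w * exp (- D 0 / n) + sin (t0 * w) / sin w * exp (- D 1 / n) < exp (- D t0 / n)"
proof (rule ccontr)
 define c where "c tau = sin ((1 - tau) * w) / sin w * exp (- D 0 / n) + sin (tau * w) / sin w * exp (- D 1 / n)" for tau
 define g where "g tau = (cos (tau * w) * exp (- D 1 / n) - cos ((1 - tau) * w) * exp (- D 0 / n)) / sin w" for tau
 assume neg: "\<not> ?thesis"
 have sw: "0 < sin w" using w by (intro sin_gt_zero) auto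
 have s0: "0 <= sin (tau * w)" "tau ~= 0 ==> 0 < sin (tau * w)" if "0 <= tau" "tau <= 1" for tau
 proof -
  have "tau * w <= 1 * w" using that w by (intro mult_right_mono) auto
  then have "tau * w < pi" using w(2) by linarith
  moreover have "0 <= tau * w" using w(1) that(1) by simp
  ultimately
  show "0 <= sin (tau * w)" "tau ~= 0 ==> 0 < sin (tau * w)" using that w by (auto intro!: sin_ge_zero sin_gt_zero)
 qed
 have cpos: "0 < c tau" if "0 <= tau" "tau <= 1" for tau
 proof (cases "tau = 0")
  case True
  then show ?thesis using sw by (simp add: c_def)
 next
  case False
  then have "0 < sin (tau * w) / sin w * exp (- D 1 / n)" using s0(2)[OF that] sw by simp
  moreover have "0 <= sin ((1 - tau) * w) / sin w * exp (- D 0 / n)" using s0(1)[of "1 - tau"] that sw by simp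
  ultimately show ?thesis unfolding c_def by linarith
 qed
 have c01: "c 0 = exp (- D 0 / n)" "c 1 = exp (- D 1 / n)" using sw by (simp_all add: c_def)
 have shift: "c (t + d) = c t * cos (d * w) + g t * sin (d * w)" for t d
  unfolding c_def g_def by (rule sine_interpolation_shift)
 define Psi where "Psi tau = D tau + n * ln (c tau)" for tau
 define H where "H tau = h tau + n * ln (c tau)" for tau
 have cc: "continuous_on UNIV c" unfolding c_def by (intro continuous_intros) (use sw in auto)
 have cH: "continuous_on {0..1} H"
  unfolding H_def by (intro continuous_intros h(1) continuous_on_subset[OF cc]) (use cpos in \<open>auto simp: less_imp_neq[symmetric]\<close>)
 have H01: "H 0 = 0" "H 1 = 0" using n h by (simp_all add: H_def c01)
 have PsiH: "Psi tau <= H tau" if "0 < tau" "tau < 1" for tau using h(4)[OF that] by (simp add: Psi_def H_def)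
 have Psi0: "0 <= Psi t0"
 proof -
  have "exp (- D t0 / n) <= c t0" using neg by (simp add: c_def)
  then have "ln (exp (- D t0 / n)) <= ln (c t0)" by (subst ln_le_cancel_iff) (use cpos[of t0] t0 in auto)
  then have "n * (- D t0 / n) <= n * ln (c t0)" using n by (intro mult_left_mono) auto
  moreover have "n * (- D t0 / n) = - D t0" using n by simp
  ultimately show ?thesis by (simp add: Psi_def)
 qed
 have contD: "isCont D t" if t: "0 < t" "t < 1" for t
 proof -
  obtain S C Q J e where e: "0 < e"
   "!!d. abs d < e ==> D (t + d) = D t - J d + d * C + d^2 * W / 2 & abs (J d - d * S) <= 2 * d^2 * Q" using loc[OF t] by blast
  have "((\<lambda>d. D (t + d)) \<longlongrightarrow> D t) (at 0)"
  proof (rule tendsto_sandwich)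
   have ev: "eventually (\<lambda>d. abs d < e) (at (0::real))" using e(1) by (auto simp: eventually_at dist_real_def intro!: exI[of _ e])
   show "eventually (\<lambda>d. D t - d * S - 2 * d^2 * Q + d * C + d^2 * W / 2 <= D (t + d)) (at 0)"
    using ev by eventually_elim (use e(2) in force)
   show "eventually (\<lambda>d. D (t + d) <= D t - d * S + 2 * d^2 * Q + d * C + d^2 * W / 2) (at 0)"
    using ev by eventually_elim (use e(2) in force)
   have "((\<lambda>d. D t - d * S - 2 * d^2 * Q + d * C + d^2 * W / 2) \<longlongrightarrow> D t - 0 * S - 2 * 0^2 * Q + 0 * C + 0^2 * W / 2) (at 0)" by (intro tendsto_intros) auto
   then show "((\<lambda>d. D t - d * S - 2 * d^2 * Q + d * C + d^2 * W / 2) \<longlongrightarrow> D t) (at 0)" by simp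
   have "((\<lambda>d. D t - d * S + 2 * d^2 * Q + d * C + d^2 * W / 2) \<longlongrightarrow> D t - 0 * S + 2 * 0^2 * Q + 0 * C + 0^2 * W / 2) (at 0)" by (intro tendsto_intros) auto
   then show "((\<lambda>d. D t - d * S + 2 * d^2 * Q + d * C + d^2 * W / 2) \<longlongrightarrow> D t) (at 0)" by simp
  qed
  then show ?thesis by (simp add: isCont_iff)
 qed
 \<comment> \<open>If \<open>Psi\<close> is nowhere positive, \<open>t0\<close> is a maximum because
   \<open>Psi t0\<close> is nonnegative. Otherwise a positive value beats all values near the ends,
   where \<open>Psi\<close> lies below \<open>H\<close> and \<open>H\<close> tends to
   \<open>0\<close>.\<close>
 obtain t where t: "0 < t" "t < 1" and tmax: "!!tau. 0 < tau ==> tau < 1 ==> Psi tau <= Psi t"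
 proof (cases "\<exists>tau. 0 < tau & tau < 1 & 0 < Psi tau")
  case False
  then show thesis using that[of t0] t0 Psi0 by force
 next
  case True
  then obtain t2 where t2: "0 < t2" "t2 < 1" "0 < Psi t2" by blast
  have "((H \<longlongrightarrow> H 0) (at 0 within {0..1}))" "((H \<longlongrightarrow> H 1) (at 1 within {0..1}))" using cH by (auto simp: continuous_on_def)
  then have "eventually (\<lambda>tau. H tau < Psi t2) (at 0 within {0..1})" "eventually (\<lambda>tau. H tau < Psi t2) (at 1 within {0..1})"
   using t2 H01 by (auto intro: order_tendstoD)
  then obtain d1 d2 where d: "0 < d1" "!!tau. tau \<in> {0..1} ==> tau ~= 0 ==> abs tau < d1 ==> H tau < Psi t2"
   "0 < d2" "!!tau. tau \<in> {0..1} ==> tau ~= 1 ==> abs (tau - 1) < d2 ==> H tau < Psi t2"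
   unfolding eventually_at dist_real_def by (metis diff_zero)
  define I where "I = {min d1 t2 .. max (1 - d2) t2}"
  have I01: "0 < tau & tau < 1" if "tau \<in> I" for tau using that d(1,3) t2 by (auto simp: I_def)
  have "continuous_on I Psi"
   unfolding Psi_def
  proof (intro continuous_on_add continuous_on_mult_left continuous_on_ln)
   show "continuous_on I D" using I01 contD by (intro continuous_at_imp_continuous_on) auto
   show "continuous_on I c" using cc by (rule continuous_on_subset) simp
   show "\<forall>x\<in>I. c x ~= 0" using cpos I01 by (metis less_imp_le less_irrefl)
  qed
  moreover have "compact I" "I ~= {}" using t2 by (auto simp: I_def)
  ultimately obtain t where ti: "t \<in> I" "!!tau. tau \<in> I ==> Psi tau <= Psi t" using continuous_attains_sup[of I Psi] by metis
  have t2I: "t2 \<in> I" by (simp add: I_def)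
  show thesis
  proof (rule that[of t])
   show "0 < t" "t < 1" using I01[OF ti(1)] by auto
   fix tau :: real assume tau: "0 < tau" "tau < 1"
   show "Psi tau <= Psi t"
   proof (cases "tau \<in> I")
    case False
    then have "abs tau < d1 \<or> abs (tau - 1) < d2" using tau by (auto simp: I_def)
    then have "H tau < Psi t2" using d(2)[of tau] d(4)[of tau] tau by auto
    then show ?thesis using PsiH[OF tau] ti(2)[OF t2I] by simp
   qed (use ti in auto)
  qed
 qed
 obtain S C Q Z J e where e: "0 < e" and WQ: "W < Q" and Z: "0 < Z" and SC: "(S - C)^2 <= (Q - W) * (n - Z)"
  and J: "!!d. abs d < e ==> 0 < t + d & t + d < 1 & D (t + d) = D t - J d + d * C + d^2 * W / 2 &
    abs (J d - d * S) <= 2 * d^2 * Q & J d + J (- d) <= - d\<^sup>2 * Q" using loc[OF t] by blast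
 define u where "u = g t / c t"
 have ct: "0 < c t" using cpos[of t] t by simp
 \<comment> \<open>The ratio of \<open>c (t + d)\<close> to \<open>c t\<close>; the logarithmic
   derivative of \<open>c\<close> at \<open>t\<close> is \<open>u * w\<close>.\<close>
 define r where "r d = cos (d * w) + u * sin (d * w)" for d
 have r: "c (t + d) = c t * r d" for d unfolding shift r_def u_def using ct by (simp add: field_simps)
 have rp: "0 < r d" if "abs d < e" for d
 proof -
  have "0 < c (t + d)" using cpos[of "t + d"] J[OF that] by simp
  then show ?thesis using ct by (simp add: r zero_less_mult_iff)
 qed
 have key: "n * ln (r d) <= J d - d * C - d^2 * W / 2" if d: "abs d < e" for d
 proof -
  have "Psi (t + d) <= Psi t" using tmax J[OF d] by blast
  moreover have "ln (c (t + d)) = ln (c t) + ln (r d)" unfolding r using ct rp[OF d] by (rule ln_mult_pos)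
  ultimately show ?thesis using J[OF d] by (simp add: Psi_def distrib_left)
 qed
 have first: "n * (u * w) = S - C"
 proof -
  \<comment> \<open>\<open>J d\<close> is known only up to an error quadratic in \<open>d\<close>.
    Subtracting that error gives a differentiable function with a local maximum at \<open>0\<close>,
    whose derivative must vanish.\<close>
  define F where "F d = n * ln (r d) - d * (S - C) - 2 * d^2 * Q" for d
  have "(r has_real_derivative u * w) (at 0)" unfolding r_def by (auto intro!: derivative_eq_intros)
  moreover have r0: "r 0 = 1" by (simp add: r_def)
  ultimately have dF: "(F has_real_derivative n * (u * w) - (S - C)) (at 0)"
   unfolding F_def by (auto intro!: derivative_eq_intros)
  have "F d <= F 0" if "abs (0 - d) < e" for d
  proof -
   have d: "abs d < e" using that by simp
   have "0 <= d^2 * W / 2" using W by simp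
   then have "n * ln (r d) <= d * S + 2 * d^2 * Q - d * C" using key[OF d] J[OF d] by linarith
   then show ?thesis using r0 by (simp add: F_def algebra_simps)
  qed
  then have "n * (u * w) - (S - C) = 0" by (intro DERIV_local_max[OF dF e]) auto
  then show ?thesis by simp
 qed
 define k where "k = (1 + u^2) * w^2"
 have k0: "0 <= k" by (simp add: k_def)
 \<comment> \<open>Summing over \<open>d\<close> and \<open>- d\<close> cancels the linear terms,
   and the product \<open>r d * r (- d)\<close> is \<open>1\<close> minus a square.\<close>
 have second: "Q + W <= n * (k + 2 * k^2 * d^2)" if d: "0 < d" "d < e" "k * d^2 <= 1/2" for d
 proof -
  have d': "abs d < e" "abs (- d) < e" using d by auto
  have rr: "r d * r (- d) = 1 - (1 + u^2) * (sin (d * w))^2"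
  proof -
   have "r d * r (- d) = (cos (d * w))^2 - u^2 * (sin (d * w))^2" by (simp add: r_def power2_eq_square algebra_simps)
   then show ?thesis by (simp add: cos_squared_eq algebra_simps)
  qed
  have "(sin (d * w))^2 <= (d * w)^2" using abs_sin_x_le_abs_x[of "d * w"] by (simp add: abs_le_square_iff)
  then have "(1 + u^2) * (sin (d * w))^2 <= (1 + u^2) * (d * w)^2" by (intro mult_left_mono) auto
  then have y: "(1 + u^2) * (sin (d * w))^2 <= k * d^2" by (simp add: k_def power_mult_distrib mult_ac)
  have "- (k * d^2) - 2 * (k * d^2)^2 <= ln (1 - k * d^2)"
   using ln_one_minus_pos_lower_bound[of "k * d^2"] d(3) k0 by simp
  also have "... <= ln (r d * r (- d))" unfolding rr using y d(3) by (subst ln_le_cancel_iff) auto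
  also have "... = ln (r d) + ln (r (- d))" using rp[OF d'(1)] rp[OF d'(2)] by (rule ln_mult_pos)
  finally have "n * (- (k * d^2) - 2 * (k * d^2)^2) <= n * (ln (r d) + ln (r (- d)))" using n by (intro mult_left_mono) auto
  also have "... <= (J d - d * C - d^2 * W / 2) + (J (- d) - (- d) * C - (- d)^2 * W / 2)"
   unfolding distrib_left using key[OF d'(1)] key[OF d'(2)] by (rule add_mono)
  also have "... = J d + J (- d) - d^2 * W" by simp
  also have "... <= - d\<^sup>2 * (Q + W)" using J[OF d'(1)] by (simp add: algebra_simps)
  finally have "d^2 * (Q + W) <= d^2 * (n * (k + 2 * k^2 * d^2))" by (simp add: power2_eq_square algebra_simps)
  moreover have "0 < d^2" using d by simp
  ultimately show ?thesis by (simp only: mult_le_cancel_left_pos)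
 qed
 have "Q + W <= n * k"
 proof (rule tendsto_lowerbound)
  have "((\<lambda>d. n * (k + 2 * k^2 * d^2)) \<longlongrightarrow> n * (k + 2 * k^2 * 0^2)) (at_right 0)" by (intro tendsto_intros)
  then show "((\<lambda>d. n * (k + 2 * k^2 * d^2)) \<longlongrightarrow> n * k) (at_right 0)" by simp
  have "((\<lambda>d. k * d^2) \<longlongrightarrow> k * 0^2) (at_right 0)" by (intro tendsto_intros)
  then have "eventually (\<lambda>d. k * d^2 < 1/2) (at_right 0)" by (intro order_tendstoD(2)[of _ "k * 0^2"]) auto
  moreover have "eventually (\<lambda>d. d \<in> {0<..<e}) (at_right 0)" using e by (rule eventually_at_right_real)
  ultimately show "eventually (\<lambda>d. Q + W <= n * (k + 2 * k^2 * d^2)) (at_right 0)"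
   by eventually_elim (use second in auto)
 qed auto
 also have "n * k = 2 * W + n * (u * w)^2" using w(3) by (simp add: k_def power_mult_distrib algebra_simps)
 finally have 1: "Q - W <= n * (u * w)^2" by simp
 have "(S - C)^2 = n * (n * (u * w)^2)" unfolding first[symmetric] by (simp add: power2_eq_square mult_ac)
 then have "n * (n * (u * w)^2) <= (Q - W) * n - (Q - W) * Z" using SC by (simp add: right_diff_distrib)
 moreover have "n * (Q - W) <= n * (n * (u * w)^2)" using 1 n by (intro mult_left_mono) auto
 ultimately have "(Q - W) * Z <= 0" by (simp add: mult.commute)
 moreover have "0 < (Q - W) * Z" using WQ Z by simp
 ultimately show False by simp
qed

section \<open>Finiteness of the entropy and its expansion in time\<close>

lemma gaussian_nn_integral_finite: "(\<integral>\<^sup>+x. ennreal (exp (- (norm (x::'a::euclidean_space))\<^sup>2 / 2)) \<partial>lborel) < \<infinity>"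
proof -
 have one: "(\<integral>\<^sup>+x. ennreal (exp (- x\<^sup>2 / 2)) \<partial>lborel) < \<infinity>"
 proof -
  interpret prob_space "density lborel std_normal_density" by (rule prob_space_normal_density) simp
  have "(\<integral>\<^sup>+x. ennreal (std_normal_density x) \<partial>lborel) = 1" using emeasure_space_1 by (simp add: emeasure_density)
  moreover have "ennreal (exp (- x\<^sup>2 / 2)) = ennreal (sqrt (2 * pi)) * ennreal (std_normal_density x)" for x
   by (simp add: std_normal_density_def ennreal_mult[symmetric])
  ultimately show ?thesis by (simp add: nn_integral_cmult ennreal_mult_less_top)
 qed
 have "ennreal (exp (- (norm x)\<^sup>2 / 2)) = (\<Prod>b\<in>Basis. ennreal (exp (- (x \<bullet> b)\<^sup>2 / 2)))" for x :: 'a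
  unfolding norm_sq_sum_Basis by (subst prod_ennreal) (auto simp: exp_sum[symmetric] sum_divide_distrib sum_negf)
 then have "(\<integral>\<^sup>+x. ennreal (exp (- (norm (x::'a))\<^sup>2 / 2)) \<partial>lborel) = (\<Prod>b\<in>(Basis::'a set). (\<integral>\<^sup>+x. ennreal (exp (- x\<^sup>2 / 2)) \<partial>lborel))"
  by (simp only:) (rule nn_integral_lborel_prod; simp)
 also have "... < \<infinity>" using one by (induction rule: finite_induct[OF finite_Basis]) (auto simp: ennreal_mult_less_top)
 finally show ?thesis .
qed

text \<open>The positive part is controlled by \<open>h\<close>. For the negative part,
  \<open>f\<close> is compared with a Gaussian through \<open>ln y <= y - 1\<close>, which bounds
  \<open>- ln (f x)\<close> times \<open>f x\<close> by the second-moment density plus the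
  Gaussian.\<close>

lemma ln_density_integrable:
 fixes f :: "'a::euclidean_space => real"
 assumes [measurable]: "f \<in> BM" and f0: "!!x. 0 <= f x"
  and m2: "integrable (dens f) (\<lambda>x. (norm x)^2)"
  and h: "integrable (dens f) h" "AE x in dens f. ln (f x) <= h x"
 shows "integrable (dens f) (\<lambda>x. ln (f x))"
proof (rule integrableI_bounded)
 let ?M = "dens f"
 have pos: "(\<integral>\<^sup>+x. ennreal (ln (f x)) \<partial>?M) < \<infinity>"
 proof -
  have "(\<integral>\<^sup>+x. ennreal (ln (f x)) \<partial>?M) <= (\<integral>\<^sup>+x. ennreal (norm (h x)) \<partial>?M)"
   by (rule nn_integral_mono_AE) (use h(2) in eventually_elim, auto intro!: ennreal_leI)
  also have "... < \<infinity>" using h(1) by (simp add: integrable_iff_bounded)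
  finally show ?thesis .
 qed
 have pt: "f x * (- ln (f x)) <= f x * (norm x)^2 + exp (- (norm x)\<^sup>2 / 2)" for x
 proof (cases "f x = 0")
  case False
  then have fx: "0 < f x" using f0[of x] by simp
  define y where "y = exp (- (norm x)\<^sup>2 / 2) / f x"
  have "- ln (f x) = (norm x)^2 / 2 + ln y" using fx by (simp add: y_def ln_div)
  moreover have "0 < y" using fx by (simp add: y_def)
  then have "(norm x)^2 / 2 + ln y <= (norm x)^2 + y" using ln_le_minus_one[of y] zero_le_power2[of "norm x"] by linarith
  ultimately have "f x * (- ln (f x)) <= f x * ((norm x)^2 + y)" using fx by (intro mult_left_mono) auto
  then show ?thesis using fx by (simp add: y_def distrib_left)
 qed simp
 have neg: "(\<integral>\<^sup>+x. ennreal (- ln (f x)) \<partial>?M) < \<infinity>"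
 proof -
  have "(\<integral>\<^sup>+x. ennreal (- ln (f x)) \<partial>?M) = (\<integral>\<^sup>+x. ennreal (f x * (- ln (f x))) \<partial>lborel)"
   by (subst nn_integral_density) (auto simp: ennreal_mult'[OF f0, symmetric])
  also have "... <= (\<integral>\<^sup>+x. ennreal (f x) * ennreal ((norm x)^2) + ennreal (exp (- (norm x)\<^sup>2 / 2)) \<partial>lborel)"
  proof (rule nn_integral_mono)
   fix x :: 'a
   have "ennreal (f x * (- ln (f x))) <= ennreal (f x * (norm x)^2 + exp (- (norm x)\<^sup>2 / 2))" by (rule ennreal_leI[OF pt])
   also have "... = ennreal (f x) * ennreal ((norm x)^2) + ennreal (exp (- (norm x)\<^sup>2 / 2))"
    using f0 by (simp add: ennreal_plus ennreal_mult)
   finally show "ennreal (f x * (- ln (f x))) <= ennreal (f x) * ennreal ((norm x)^2) + ennreal (exp (- (norm x)\<^sup>2 / 2))" .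
  qed
  also have "... = (\<integral>\<^sup>+x. ennreal ((norm x)^2) \<partial>?M) + (\<integral>\<^sup>+x. ennreal (exp (- (norm (x::'a))\<^sup>2 / 2)) \<partial>lborel)"
   by (subst nn_integral_add) (auto simp: nn_integral_density nn_integral_cmult)
  also have "... < \<infinity>" using m2 gaussian_nn_integral_finite[where 'a='a] by (simp add: integrable_iff_bounded ennreal_mult_less_top)
  finally show ?thesis .
 qed
 have "(\<integral>\<^sup>+x. ennreal (norm (ln (f x))) \<partial>?M) = (\<integral>\<^sup>+x. ennreal (ln (f x)) + ennreal (- ln (f x)) \<partial>?M)"
 proof (rule nn_integral_cong)
  fix x show "ennreal (norm (ln (f x))) = ennreal (ln (f x)) + ennreal (- ln (f x))"
   by (cases "0 <= ln (f x)") (auto simp: ennreal_neg)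
 qed
 also have "... < \<infinity>" using pos neg by (subst nn_integral_add) auto
 finally show "(\<integral>\<^sup>+x. ennreal (norm (ln (f x))) \<partial>?M) < \<infinity>" .
qed simp

text \<open>Under the hypotheses both parts of the integral in \<open>rel_entropy\<close> are
  finite, so their difference is an ordinary integral of \<open>ln (rho x)\<close> against
  \<open>mu\<close>; the Gaussian factor contributes the second moment and the constant.\<close>

lemma Ent_density:
 fixes f :: "'a::euclidean_space => real"
 assumes [measurable]: "f \<in> BM" and f0: "!!x. 0 <= f x"
  and mu: "mu = dens f" "prob_space mu"
  and m2: "integrable mu (\<lambda>x. (norm x)^2)" and lnf: "integrable mu (\<lambda>x. ln (f x))"
 shows "Ent mu = ereal ((LINT x|mu. ln (f x)) + (LINT x|mu. (norm x)^2) / 2 + real DIM('a) / 2 * ln (2 * pi))"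
proof -
 interpret mu: prob_space mu by fact
 define g where "g x = (2 * pi) powr (- real DIM('a) / 2) * exp (- (norm x)\<^sup>2 / 2)" for x :: 'a
 define ga where "ga = (std_gaussian :: 'a measure)"
 have gag: "ga = dens g" by (simp add: ga_def std_gaussian_def g_def)
 have g0: "0 < g x" for x by (simp add: g_def)
 have [measurable]: "g \<in> BM" unfolding g_def by measurable
 have [simp, measurable_cong]: "sets ga = sets borel" by (simp add: gag)
 have "emeasure ga (space ga) = ennreal ((2 * pi) powr (- real DIM('a) / 2)) * (\<integral>\<^sup>+x. ennreal (exp (- (norm (x::'a))\<^sup>2 / 2)) \<partial>lborel)"
  by (simp add: gag emeasure_density g_def ennreal_mult nn_integral_cmult)
 also have "... ~= \<infinity>" using gaussian_nn_integral_finite[where 'a='a] by (simp add: ennreal_mult_eq_top_iff less_top)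
 finally interpret ga: finite_measure ga by (rule finite_measureI)
 define rho where "rho x = f x / g x" for x
 have rho0: "0 <= rho x" for x using f0 g0[of x] by (simp add: rho_def)
 have [measurable]: "rho \<in> BM" unfolding rho_def by measurable
 have murho: "mu = density ga (\<lambda>x. ennreal (rho x))"
 proof -
  have "ennreal (g x) * ennreal (rho x) = ennreal (f x)" for x
   using g0[of x] rho0[of x] by (subst ennreal_mult[symmetric]) (auto simp: rho_def less_imp_le)
  then show ?thesis unfolding mu(1) gag by (subst density_density_eq) auto
 qed
 have RN: "AE x in ga. ennreal (rho x) = RN_deriv ga mu x"
  by (rule ga.RN_deriv_unique) (auto simp: murho[symmetric] mu.sigma_finite_measure_axioms)
 have RN': "AE x in ga. enn2real (RN_deriv ga mu x) = rho x" using RN by eventually_elim (metis rho0 enn2real_ennreal)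
 have lnr: "AE x in mu. ln (rho x) = ln (f x) + (norm x)^2 / 2 + real DIM('a) / 2 * ln (2 * pi)"
  unfolding mu(1)
 proof (subst AE_density, simp, rule AE_I2, rule impI)
  fix x assume "0 < ennreal (f x)"
  then have "0 < f x" by (simp add: ennreal_less_zero_iff)
  then show "ln (rho x) = ln (f x) + (norm x)^2 / 2 + real DIM('a) / 2 * ln (2 * pi)"
   using g0[of x] unfolding rho_def by (simp add: ln_div) (simp add: g_def ln_mult ln_powr)
 qed
 have il: "integrable mu (\<lambda>x. ln (rho x))"
 proof -
  have "integrable mu (\<lambda>x. ln (f x) + (norm x)^2 / 2 + real DIM('a) / 2 * ln (2 * pi))" using m2 lnf by simp
  moreover have "AE x in mu. ln (f x) + (norm x)^2 / 2 + real DIM('a) / 2 * ln (2 * pi) = ln (rho x)" using lnr by eventually_elim simp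
  ultimately show ?thesis by (subst (asm) integrable_cong_AE) (auto simp: mu(1))
 qed
 have part: "(\<integral>\<^sup>+x. ennreal (s * (enn2real (RN_deriv ga mu x) * ln (enn2real (RN_deriv ga mu x)))) \<partial>ga) = (\<integral>\<^sup>+x. ennreal (s * ln (rho x)) \<partial>mu)" for s
 proof -
  have "(\<integral>\<^sup>+x. ennreal (s * (enn2real (RN_deriv ga mu x) * ln (enn2real (RN_deriv ga mu x)))) \<partial>ga) = (\<integral>\<^sup>+x. ennreal (rho x) * ennreal (s * ln (rho x)) \<partial>ga)"
  proof (rule nn_integral_cong_AE)
   show "AE x in ga. ennreal (s * (enn2real (RN_deriv ga mu x) * ln (enn2real (RN_deriv ga mu x)))) = ennreal (rho x) * ennreal (s * ln (rho x))"
    using RN' by eventually_elim (simp add: ennreal_mult'[OF rho0, symmetric] mult.left_commute)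
  qed
  also have "... = (\<integral>\<^sup>+x. ennreal (s * ln (rho x)) \<partial>mu)" unfolding murho by (subst nn_integral_density) auto
  finally show ?thesis .
 qed
 have fin: "(\<integral>\<^sup>+x. ennreal (ln (rho x)) \<partial>mu) < \<infinity>" "(\<integral>\<^sup>+x. ennreal (- ln (rho x)) \<partial>mu) < \<infinity>"
  using il unfolding real_integrable_def by (auto simp: less_top)
 have "Ent mu = enn2ereal (\<integral>\<^sup>+x. ennreal (ln (rho x)) \<partial>mu) - enn2ereal (\<integral>\<^sup>+x. ennreal (- ln (rho x)) \<partial>mu)"
 proof -
  have "\<exists>r\<in>borel_measurable ga. mu = density ga r" using murho by (intro bexI[of _ "\<lambda>x. ennreal (rho x)"]) auto
  then show ?thesis using part[of 1] part[of "-1"] unfolding rel_entropy_def ga_def[symmetric] by (simp add: Let_def)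
 qed
 also have "... = ereal (enn2real (\<integral>\<^sup>+x. ennreal (ln (rho x)) \<partial>mu) - enn2real (\<integral>\<^sup>+x. ennreal (- ln (rho x)) \<partial>mu))"
  using fin by (cases "\<integral>\<^sup>+x. ennreal (ln (rho x)) \<partial>mu"; cases "\<integral>\<^sup>+x. ennreal (- ln (rho x)) \<partial>mu") (auto simp: enn2ereal_ennreal)
 also have "... = ereal (LINT x|mu. ln (rho x))" using real_lebesgue_integral_def[OF il] by simp
 also have "(LINT x|mu. ln (rho x)) = (LINT x|mu. ln (f x) + (norm x)^2 / 2 + real DIM('a) / 2 * ln (2 * pi))"
  by (rule integral_cong_AE) (use lnr in \<open>auto simp: mu(1)\<close>)
 also have "... = (LINT x|mu. ln (f x)) + (LINT x|mu. (norm x)^2) / 2 + real DIM('a) / 2 * ln (2 * pi)"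
  using m2 lnf mu.prob_space by simp
 finally show ?thesis .
qed

context interp
begin

text \<open>In the joint eigenbasis of \<open>a z\<close> and \<open>b z\<close> the eigenvalues of
  \<open>A z\<close> are the differences \<open>be i - al i\<close>. The averages
  \<open>(1 - t) * al i + t * be i\<close> equal \<open>1\<close>, which bounds them, and
  \<open>1 + d * l z i\<close> is the same average taken at time \<open>t + d\<close>, hence
  positive.\<close>

lemma eigenvalues:
 "\<exists>l :: real^'n => 'n => real. \<forall>z\<in>G. (\<forall>i. abs (l z i) <= 1 / t + 1 / (1 - t)) & (\<Sum>i\<in>UNIV. l z i) = tr_A z &
   (\<Sum>i\<in>UNIV. (l z i)^2) = hs_A z &
   (\<forall>d. ldet (\<lambda>h. h + d *\<^sub>R A z h) = (\<Prod>i\<in>UNIV. 1 + d * l z i)) &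
   (\<forall>i d. 0 < t + d --> t + d < 1 --> 0 < 1 + d * l z i)"
proof (rule bchoice, rule ballI)
 fix z assume z: "z \<in> G"
 show "\<exists>l :: 'n => real. (\<forall>i. abs (l i) <= 1 / t + 1 / (1 - t)) & (\<Sum>i\<in>UNIV. l i) = tr_A z &
   (\<Sum>i\<in>UNIV. (l i)^2) = hs_A z &
   (\<forall>d. ldet (\<lambda>h. h + d *\<^sub>R A z h) = (\<Prod>i\<in>UNIV. 1 + d * l i)) &
   (\<forall>i d. 0 < t + d --> t + d < 1 --> 0 < 1 + d * l i)"
 proof -
  obtain e :: "'n => real^'n" and al be where e: "!!i j. e i \<bullet> e j = (if i = j then 1 else 0)"
   and ev: "!!i. a z (e i) = al i *\<^sub>R e i" "!!i. b z (e i) = be i *\<^sub>R e i"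
   and p: "!!i. 0 < al i" "!!i. 0 < be i" and s: "!!i. (1 - t) * al i + t * be i = 1" 
  using joint_eigenbasis[OF pos(1)[OF z] sym(2)[OF z] pos(2)[OF z] ab[OF z] t(2)] by blast
  define l where "l i = be i - al i" for i
  have Ae: "A z (e i) = l i *\<^sub>R e i" for i using z by (simp add: A_def ev l_def scaleR_diff_left)
  have lin: "linear (A z)" using sym_A[OF z] by (simp add: sym_map_def)
  have bd: "al i <= 1 / (1 - t)" "be i <= 1 / t" for i
  proof -
   have "0 < (1 - t) * al i" "0 < t * be i" using p t by simp_all
   then have "(1 - t) * al i <= 1" "t * be i <= 1" using s[of i] by linarith+
   then show "al i <= 1 / (1 - t)" "be i <= 1 / t" using t by (simp_all add: pos_le_divide_eq mult.commute)
  qed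
  show ?thesis
  proof (intro exI[of _ l] conjI allI impI)
   show "abs (l i) <= 1 / t + 1 / (1 - t)" for i using bd[of i] p[of i] by (simp add: l_def abs_le_iff)
   show "(\<Sum>i\<in>UNIV. l i) = tr_A z" using trace_orthonormal[OF e lin] by (simp add: Ae e)
   have "(\<Sum>b\<in>Basis. A z (A z b) \<bullet> b) = (\<Sum>i\<in>UNIV. A z (A z (e i)) \<bullet> e i)"
    by (rule trace_orthonormal[OF e]) (use linear_compose[OF lin lin] in \<open>simp add: comp_def\<close>)
   moreover have "A z (A z b) \<bullet> b = (norm (A z b))^2" for b using sym_A[OF z] by (simp add: sym_map_def power2_norm_eq_inner)
   ultimately show "(\<Sum>i\<in>UNIV. (l i)^2) = hs_A z"
    by (simp add: Ae e linear_cmul[OF lin] power2_eq_square)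
   show "ldet (\<lambda>h. h + d *\<^sub>R A z h) = (\<Prod>i\<in>UNIV. 1 + d * l i)" for d
    by (rule ldet_eigen[OF e]) (auto intro!: linear_compose_add linear_ident linear_compose_scale_right lin simp: Ae algebra_simps)
   show "0 < 1 + d * l i" if d: "0 < t + d" "t + d < 1" for i d
   proof -
    have "1 + d * l i = (1 - (t + d)) * al i + (t + d) * be i" using s[of i] unfolding l_def by (simp add: algebra_simps)
    also have "... > 0" using d p by (intro add_pos_pos[OF mult_pos_pos mult_pos_pos]) auto
    finally show ?thesis .
   qed
  qed
 qed
qed

lemma AE_M_lborel: "AE z in lborel. P z ==> AE z in M. P z"
 by (subst AE_density) (auto elim: eventually_mono)

lemma AE_ft_pos: "AE z in M. 0 < ft z"
 by (subst AE_density) (auto simp: ennreal_less_zero_iff)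

text \<open>\<open>ln (ft z)\<close> is the logarithm of an endpoint density plus the logarithms of
  the eigenvalues of its Jacobian. As \<open>al i\<close> and \<open>be i\<close> have weighted mean
  \<open>1\<close>, concavity of the logarithm makes the weighted sum of these terms nonpositive.
  Integrated, this is displacement convexity; it provides integrability and the majorant near the
  ends of the geodesic.\<close>

lemma log_density_convex: "AE z in M. ln (ft z) <= (1 - t) * ln (f0 (X z)) + t * ln (f1 (Y z))"
 using full AE_ft_pos AE_M_lborel[OF rel(1)] AE_M_lborel[OF rel(2)]
proof eventually_elim
 case (elim z)
 have z: "z \<in> G" by fact
 obtain e :: "'n => real^'n" and al be where e: "!!i j. e i \<bullet> e j = (if i = j then 1 else 0)"
  and ev: "!!i. a z (e i) = al i *\<^sub>R e i" "!!i. b z (e i) = be i *\<^sub>R e i"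
  and p: "!!i. 0 < al i" "!!i. 0 < be i" and s: "!!i. (1 - t) * al i + t * be i = 1" 
  using joint_eigenbasis[OF pos(1)[OF z] sym(2)[OF z] pos(2)[OF z] ab[OF z] t(2)] by blast
 have d: "ldet (a z) = (\<Prod>i\<in>UNIV. al i)" "ldet (b z) = (\<Prod>i\<in>UNIV. be i)"
  using sym[OF z] ev by (auto intro!: ldet_eigen[OF e] simp: sym_map_def)
 have dp: "0 < (\<Prod>i\<in>UNIV. al i)" "0 < (\<Prod>i\<in>UNIV. be i)" using p by (auto intro: prod_pos)
 have r: "f0 (X z) * (\<Prod>i\<in>UNIV. al i) = ft z" "f1 (Y z) * (\<Prod>i\<in>UNIV. be i) = ft z" using elim(3,4) z d dp by auto
 then have fp: "0 < f0 (X z)" "0 < f1 (Y z)" using elim(2) dp by (metis zero_less_mult_pos2)+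
 have lp: "ln (\<Prod>i\<in>UNIV. al i) = (\<Sum>i\<in>UNIV. ln (al i))" "ln (\<Prod>i\<in>UNIV. be i) = (\<Sum>i\<in>UNIV. ln (be i))"
  using p by (auto intro!: ln_prod simp: less_imp_neq[symmetric])
 have l0: "ln (ft z) = ln (f0 (X z)) + (\<Sum>i\<in>UNIV. ln (al i))"
  unfolding r(1)[symmetric] lp(1)[symmetric] using fp(1) dp(1) by (rule ln_mult_pos)
 have l1: "ln (ft z) = ln (f1 (Y z)) + (\<Sum>i\<in>UNIV. ln (be i))"
  unfolding r(2)[symmetric] lp(2)[symmetric] using fp(2) dp(2) by (rule ln_mult_pos)
 have "(1 - t) * (\<Sum>i\<in>UNIV. ln (al i)) + t * (\<Sum>i\<in>UNIV. ln (be i)) = (\<Sum>i\<in>UNIV. (1 - t) * ln (al i) + t * ln (be i))"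
  by (simp add: sum_distrib_left sum.distrib)
 also have "... <= (\<Sum>i\<in>(UNIV::'n set). 0)"
 proof (rule sum_mono)
  fix i
  have "(1 - t) * ln (al i) + t * ln (be i) <= (1 - t) * (al i - 1) + t * (be i - 1)"
   using p t by (intro add_mono mult_left_mono ln_le_minus_one) auto
  also have "... = 0" using s[of i] by (simp add: algebra_simps)
  finally show "(1 - t) * ln (al i) + t * ln (be i) <= 0" .
 qed
 finally have "(1 - t) * (\<Sum>i\<in>UNIV. ln (al i)) + t * (\<Sum>i\<in>UNIV. ln (be i)) <= 0" by simp
 moreover have "ln (ft z) = (1 - t) * ln (ft z) + t * ln (ft z)" by (simp add: algebra_simps)
 ultimately show ?case using l0 l1 by (simp add: distrib_left) (smt (verit) l0 l1 distrib_left)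
qed

text \<open>The map \<open>z + d *\<^sub>R v z\<close> is the interpolation of \<open>X z\<close>
  and \<open>Y z\<close> at time \<open>t + d\<close>, and strict monotonicity makes it injective on
  \<open>G\<close>.\<close>

lemma interpolant_density_relation:
 assumes d: "0 < t + d" "t + d < 1" and f'[measurable]: "f' \<in> BM" and f'0: "!!z. 0 <= f' z"
  and push': "distr M borel (\<lambda>z. z + d *\<^sub>R v z) = dens f'"
 shows "AE z in M. z \<in> G & 0 < ft z & f' (z + d *\<^sub>R v z) * abs (ldet (\<lambda>h. h + d *\<^sub>R A z h)) = ft z"
proof -
 have inj: "inj_on (\<lambda>z. z + d *\<^sub>R v z) G"
 proof (rule inj_onI)
  fix z1 z2 assume z: "z1 \<in> G" "z2 \<in> G" and eq: "z1 + d *\<^sub>R v z1 = z2 + d *\<^sub>R v z2"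
  define p where "p = X z1 - X z2"
  define q where "q = Y z1 - Y z2"
  have zz: "z + d *\<^sub>R v z = (1 - (t + d)) *\<^sub>R X z + (t + d) *\<^sub>R Y z" for z
   by (subst XY[of z, symmetric]) (simp add: v_def algebra_simps)
  have pq: "(1 - (t + d)) *\<^sub>R p + (t + d) *\<^sub>R q = 0" using eq unfolding zz p_def q_def by (simp add: algebra_simps)
  have "(1 - (t + d)) * (p \<bullet> p) + (t + d) * (p \<bullet> q) = p \<bullet> ((1 - (t + d)) *\<^sub>R p + (t + d) *\<^sub>R q)" by (simp add: inner_add_right)
  then have "(1 - (t + d)) * (p \<bullet> p) + (t + d) * (p \<bullet> q) = 0" unfolding pq by simp
  moreover have "0 <= (t + d) * (p \<bullet> q)" "0 <= (1 - (t + d)) * (p \<bullet> p)" using mono[of z1 z2] d by (simp_all add: p_def q_def)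
  ultimately have "(t + d) * (p \<bullet> q) = 0" by linarith
  then have "p \<bullet> q = 0" using d by simp
  then show "z1 = z2" using strict[OF z] by (simp add: p_def q_def)
 qed
 have "AE z in lborel. z \<in> G --> f' (z + d *\<^sub>R v z) * abs (ldet (\<lambda>h. h + d *\<^sub>R A z h)) = ft z"
 proof (rule density_relation[OF _ f' _ _ ft0 f'0 push' full _ inj])
  show "((\<lambda>z. z + d *\<^sub>R v z) has_derivative (\<lambda>h. h + d *\<^sub>R A z h)) (at z within G)" if "z \<in> G" for z
   using has_derivative_at_withinI[OF v_derivative[OF that]] by (auto intro!: derivative_eq_intros)
 qed auto
 from AE_M_lborel[OF this] full AE_ft_pos show ?thesis by eventually_elim auto
qed

text \<open>\<open>J d\<close> is the integral of the logarithm of the determinant of the identity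
  plus \<open>d\<close> times \<open>A z\<close>. For each eigenvalue, \<open>ln (1 + x)\<close>
  differs from \<open>x\<close> by at most \<open>2 * x^2\<close> when \<open>abs x <= 1/2\<close>,
  and the terms for \<open>d\<close> and \<open>- d\<close> add up to \<open>ln (1 - x^2)\<close>,
  which is at most minus \<open>x^2\<close>.\<close>

lemma entropy_expansion:
 assumes lnf: "integrable M (\<lambda>z. ln (ft z))"
  and mom: "integrable M (\<lambda>z. (norm (X z))^2)" "integrable M (\<lambda>z. (norm (Y z))^2)"
  and g[measurable]: "!!d. g d \<in> BM" and g0: "!!d z. 0 <= g d z"
  and push': "!!d. 0 < t + d ==> t + d < 1 ==> distr M borel (\<lambda>z. z + d *\<^sub>R v z) = dens (g d)"
 defines "Q \<equiv> (LINT z|M. hs_A z)" and "S \<equiv> (LINT z|M. tr_A z)"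
 shows "\<exists>J e. 0 < e & (\<forall>d. abs d < e --> 0 < t + d & t + d < 1 &
  (LINT z|M. ln (g d (z + d *\<^sub>R v z))) = (LINT z|M. ln (ft z)) - J d & abs (J d - d * S) <= 2 * d^2 * Q & J d + J (- d) <= - d\<^sup>2 * Q)"
proof -
 interpret M: prob_space M by (rule prob)
 define L where "L = 1 / t + 1 / (1 - t)"
 have L: "0 < L" using t by (simp add: L_def add_pos_pos)
 obtain l :: "real^'n => 'n => real" where l0: "\<forall>z\<in>G. (\<forall>i. abs (l z i) <= L) & (\<Sum>i\<in>UNIV. l z i) = tr_A z &
   (\<Sum>i\<in>UNIV. (l z i)^2) = hs_A z &
   (\<forall>d. ldet (\<lambda>h. h + d *\<^sub>R A z h) = (\<Prod>i\<in>UNIV. 1 + d * l z i)) &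
   (\<forall>i d. 0 < t + d --> t + d < 1 --> 0 < 1 + d * l z i)"
  using eigenvalues unfolding L_def by blast
 have l: "!!z i. z \<in> G ==> abs (l z i) <= L"
  "!!z. z \<in> G ==> (\<Sum>i\<in>UNIV. l z i) = tr_A z"
  "!!z. z \<in> G ==> (\<Sum>i\<in>UNIV. (l z i)^2) = hs_A z"
  "!!z d. z \<in> G ==> ldet (\<lambda>h. h + d *\<^sub>R A z h) = (\<Prod>i\<in>UNIV. 1 + d * l z i)"
  "!!z i d. z \<in> G ==> 0 < t + d ==> t + d < 1 ==> 0 < 1 + d * l z i"
  using l0 by blast+
 note iQ = poincare_sums(4)[OF mom] and iS = poincare_sums(5)[OF mom]
 \<comment> \<open>Small enough for \<open>t + d\<close> to stay interior and for every
   \<open>d * l z i\<close> to be at most \<open>1/2\<close> in modulus.\<close>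
 define e where "e = min (min t (1 - t)) (1 / (2 * L))"
 have e: "0 < e" using t L by (simp add: e_def)
 have ed: "0 < t + d & t + d < 1 & abs d * L <= 1/2" if "abs d < e" for d
 proof -
  have "abs d < t" "abs d < 1 - t" "abs d <= 1 / (2 * L)" using that by (auto simp: e_def)
  moreover have "abs d * (2 * L) <= 1" using \<open>\<bar>d\<bar> <= 1 / (2 * L)\<close> L by (simp add: pos_le_divide_eq)
  ultimately show ?thesis by auto
 qed
 define F where "F d z = ln (ft z) - ln (g d (z + d *\<^sub>R v z))" for d z
 have [measurable]: "F d \<in> BM" for d unfolding F_def by measurable
 have Fl: "AE z in M. z \<in> G & F d z = (\<Sum>i\<in>UNIV. ln (1 + d * l z i))" if d: "abs d < e" for d
  using interpolant_density_relation[OF ed[OF d, THEN conjunct1] ed[OF d, THEN conjunct2, THEN conjunct1] g g0 push'[OF ed[OF d, THEN conjunct1] ed[OF d, THEN conjunct2, THEN conjunct1]]]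
 proof eventually_elim
  case (elim z)
  have p: "0 < 1 + d * l z i" for i using l(5)[of z d i] ed[OF d] elim by blast
  have P: "0 < (\<Prod>i\<in>UNIV. 1 + d * l z i)" using p by (intro prod_pos) auto
  have r: "g d (z + d *\<^sub>R v z) * (\<Prod>i\<in>UNIV. 1 + d * l z i) = ft z" using elim l(4)[of z d] P by simp
  then have gp: "0 < g d (z + d *\<^sub>R v z)" using elim P by (metis zero_less_mult_pos2)
  have "ln (ft z) = ln (g d (z + d *\<^sub>R v z)) + (\<Sum>i\<in>UNIV. ln (1 + d * l z i))"
  proof -
   have "ln (\<Prod>i\<in>UNIV. 1 + d * l z i) = (\<Sum>i\<in>UNIV. ln (1 + d * l z i))"
    using p by (auto intro!: ln_prod simp: less_imp_neq[symmetric])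
   then show ?thesis using ln_mult_pos[OF gp P] unfolding r by simp
  qed
  then show ?case using elim by (simp add: F_def)
 qed
 have Fb: "AE z in M. abs (F d z - d * tr_A z) <= 2 * d^2 * hs_A z" if d: "abs d < e" for d
  using Fl[OF d]
 proof eventually_elim
  case (elim z)
  have "F d z - d * tr_A z = (\<Sum>i\<in>UNIV. ln (1 + d * l z i) - d * l z i)"
   using elim l(2)[of z] by (simp add: sum_subtractf flip: sum_distrib_left)
  also have "abs (...) <= (\<Sum>i\<in>UNIV. abs (ln (1 + d * l z i) - d * l z i))" by (rule sum_abs)
  also have "... <= (\<Sum>i\<in>UNIV. 2 * (d * l z i)^2)"
  proof (rule sum_mono, rule abs_ln_one_plus_x_minus_x_bound)
   fix i
   have "abs (d * l z i) <= abs d * L" unfolding abs_mult using l(1)[of z i] elim by (intro mult_left_mono) auto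
   then show "abs (d * l z i) <= 1/2" using ed[OF d] by linarith
  qed
  also have "... = 2 * d^2 * (\<Sum>i\<in>UNIV. (l z i)^2)" by (simp add: sum_distrib_left power_mult_distrib mult.assoc)
  finally show ?case using l(3)[of z] elim by simp
 qed
 have iF: "integrable M (F d)" if d: "abs d < e" for d
 proof (rule Bochner_Integration.integrable_bound)
  show "integrable M (\<lambda>z. abs (d * tr_A z) + 2 * d^2 * hs_A z)" using iQ iS by simp
  show "AE z in M. norm (F d z) <= norm (abs (d * tr_A z) + 2 * d^2 * hs_A z)"
   using Fb[OF d]
  proof eventually_elim
   case (elim z)
   then have "abs (F d z) <= abs (d * tr_A z) + 2 * d^2 * hs_A z" by linarith
   then show ?case unfolding real_norm_def by (rule order_trans[OF _ abs_ge_self])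
  qed
 qed measurable
 define J where "J d = (LINT z|M. F d z)" for d
 show ?thesis
 proof (intro exI[of _ J] exI[of _ e] conjI allI impI)
  fix d assume d: "abs d < e"
  show "0 < t + d" "t + d < 1" using ed[OF d] by auto
  have "(LINT z|M. ln (g d (z + d *\<^sub>R v z))) = (LINT z|M. ln (ft z) - F d z)" by (simp add: F_def)
  also have "... = (LINT z|M. ln (ft z)) - J d" using lnf iF[OF d] by (simp add: J_def)
  finally show "(LINT z|M. ln (g d (z + d *\<^sub>R v z))) = (LINT z|M. ln (ft z)) - J d" .
  have "J d - d * S = (LINT z|M. F d z - d * tr_A z)" using iF[OF d] iS by (simp add: J_def S_def)
  also have "abs (...) <= (LINT z|M. abs (F d z - d * tr_A z))" by (rule integral_abs_bound)
  also have "... <= (LINT z|M. 2 * d^2 * hs_A z)"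
   by (rule integral_mono_AE) (use iF[OF d] iS iQ Fb[OF d] in auto)
  also have "... = 2 * d^2 * Q" by (simp add: Q_def)
  finally show "abs (J d - d * S) <= 2 * d^2 * Q" .
  have d': "abs (- d) < e" using d by simp
  have "J d + J (- d) = (LINT z|M. F d z + F (- d) z)" using iF[OF d] iF[OF d'] by (simp add: J_def)
  also have "... <= (LINT z|M. - d\<^sup>2 * hs_A z)"
  proof (rule integral_mono_AE)
   show "AE z in M. F d z + F (- d) z <= - d\<^sup>2 * hs_A z"
    using Fl[OF d] Fl[OF d']
   proof eventually_elim
    case (elim z)
    have "F d z + F (- d) z = (\<Sum>i\<in>UNIV. ln (1 + d * l z i) + ln (1 + (- d) * l z i))" using elim by (simp add: sum.distrib)
    also have "... <= (\<Sum>i\<in>UNIV. - (d * l z i)\<^sup>2)"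
    proof (rule sum_mono)
     fix i
     have p: "0 < 1 + d * l z i" "0 < 1 + (- d) * l z i" using l(5)[of z d i] l(5)[of z "- d" i] ed[OF d] ed[OF d'] elim by auto
     have "ln (1 + d * l z i) + ln (1 + (- d) * l z i) = ln ((1 + d * l z i) * (1 + (- d) * l z i))" using ln_mult_pos[OF p] by simp
     also have "... <= (1 + d * l z i) * (1 + (- d) * l z i) - 1" using p by (intro ln_le_minus_one mult_pos_pos)
     also have "... = - (d * l z i)\<^sup>2" by (simp add: power2_eq_square algebra_simps)
     finally show "ln (1 + d * l z i) + ln (1 + (- d) * l z i) <= - (d * l z i)\<^sup>2" .
    qed
    also have "... = - d\<^sup>2 * (\<Sum>i\<in>UNIV. (l z i)^2)" by (simp add: sum_distrib_left power_mult_distrib sum_negf)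
    finally show ?case using l(3)[of z] elim by simp
   qed
  qed (use iF[OF d] iF[OF d'] iQ in auto)
  also have "... = - d\<^sup>2 * Q" by (simp add: Q_def)
  finally show "J d + J (- d) <= - d\<^sup>2 * Q" .
 qed (rule e)
qed

end

context interp
begin

text \<open>\<open>X\<close> carries \<open>M\<close> to the first endpoint and
  \<open>Y z = T (X z)\<close> on \<open>G\<close>. Integrals over \<open>(x, T x)\<close> at time
  \<open>0\<close> thus reappear, unchanged, at every interior time.\<close>

lemma transfer:
 assumes YT: "!!z. z \<in> G ==> Y z = T (X z)" and [measurable]: "T \<in> BM"
  and h[measurable]: "case_prod h \<in> borel_measurable (borel \<Otimes>\<^sub>M borel)"
 shows "integrable (dens f0) (\<lambda>x. h x (T x)) \<longleftrightarrow> integrable M (\<lambda>z. h (X z) (Y z) :: 'b::{banach, second_countable_topology})"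
  and "(\<integral>x. h x (T x) \<partial>dens f0) = (LINT z|M. h (X z) (Y z))"
proof -
 have hm: "(\<lambda>x. h (p x) (q x)) \<in> BM" if [measurable]: "p \<in> BM" "q \<in> BM" for p q :: "real^'n => real^'n"
  using measurable_compose[OF measurable_Pair[OF that] h] by simp
 have ae: "AE z in M. h (X z) (T (X z)) = h (X z) (Y z)" using full by eventually_elim (simp add: YT)
 have [measurable]: "(\<lambda>x. h x (T x)) \<in> BM" "(\<lambda>z. h (X z) (Y z)) \<in> BM" "(\<lambda>z. h (X z) (T (X z))) \<in> BM"
  by (rule hm; simp)+
 show "integrable (dens f0) (\<lambda>x. h x (T x)) \<longleftrightarrow> integrable M (\<lambda>z. h (X z) (Y z))"
  unfolding push(1)[symmetric] using integrable_cong_AE[OF _ _ ae] by (subst integrable_distr_eq) auto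
 show "(\<integral>x. h x (T x) \<partial>dens f0) = (LINT z|M. h (X z) (Y z))"
  unfolding push(1)[symmetric] by (subst integral_distr) (auto intro!: integral_cong_AE ae)
qed

lemma distr_interpolate:
 assumes YT: "!!z. z \<in> G ==> Y z = T (X z)" and [measurable]: "T \<in> BM"
 shows "distr (dens f0) borel (\<lambda>x. (1 - (t + d)) *\<^sub>R x + (t + d) *\<^sub>R T x) = distr M borel (\<lambda>z. z + d *\<^sub>R v z)"
proof -
 have "distr (distr M borel X) borel (\<lambda>x. (1 - (t + d)) *\<^sub>R x + (t + d) *\<^sub>R T x) = distr M borel (\<lambda>z. (1 - (t + d)) *\<^sub>R X z + (t + d) *\<^sub>R T (X z))"
  by (subst distr_distr) (auto simp: comp_def)
 also have "... = distr M borel (\<lambda>z. z + d *\<^sub>R v z)"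
 proof (rule distr_cong_AE)
  show "AE z in M. (1 - (t + d)) *\<^sub>R X z + (t + d) *\<^sub>R T (X z) = z + d *\<^sub>R v z" using full
  proof eventually_elim
   case (elim z)
   have "z + d *\<^sub>R v z = (1 - (t + d)) *\<^sub>R X z + (t + d) *\<^sub>R Y z"
    by (subst XY[of z, symmetric]) (simp add: v_def algebra_simps)
   then show ?case using YT[OF elim] by simp
  qed
 qed auto
 finally show ?thesis by (simp add: push(1))
qed

end

lemma prob_space_slc: "slc_dens f ==> prob_space (dens f)"
 by (auto intro!: prob_spaceI simp: slc_dens_def emeasure_density)

lemma centered_Ent_density:
 fixes f :: "'a::euclidean_space => real"
 assumes "f \<in> BM" "!!x. 0 <= f x" "mu = dens f" "prob_space mu"
  "integrable mu (\<lambda>x. (norm x)^2)" "integrable mu (\<lambda>x. ln (f x))"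
 shows "centered_Ent mu = ereal ((LINT x|mu. ln (f x)) + ((LINT x|mu. (norm x)^2) - (norm (LINT x|mu. x))^2) / 2 + real DIM('a) / 2 * ln (2 * pi))"
 using Ent_density[OF assms] by (simp add: centered_Ent_def barycenter_def diff_divide_distrib)

text \<open>The centred entropy splits into the integral \<open>U\<close> of the logarithm of the
  density and half the variance \<open>Va\<close>. The variance is exactly quadratic in time with
  leading coefficient \<open>W\<close>, while \<open>U\<close> is expanded around each interior time
  with the \<open>interp\<close> data of that time. Moments are computed at time \<open>0\<close>
  and carried over by \<open>transfer\<close>, so the same \<open>W\<close> serves at all
  times.\<close>

theorem displacement_strict:
 fixes f0 f1 :: "real^'n => real" and T :: "real^'n => real^'n"
 defines "mu0 \<equiv> dens f0" and "mu1 \<equiv> dens f1"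
 defines "mu \<equiv> \<lambda>tau. distr mu0 borel (\<lambda>x. (1 - tau) *\<^sub>R x + tau *\<^sub>R T x)"
 assumes slc: "slc_dens f0" "slc_dens f1"
  and m2: "integrable mu0 (\<lambda>x. (norm x)^2)" "integrable mu1 (\<lambda>x. (norm x)^2)"
  and lnf: "integrable mu0 (\<lambda>x. ln (f0 x))" "integrable mu1 (\<lambda>x. ln (f1 x))"
  and T[measurable]: "T \<in> BM" and push: "distr mu0 borel T = mu1"
  and opt: "!!T'. T' \<in> BM ==> distr mu0 borel T' = mu1 ==>
   (LINT x|mu0. (norm (x - T x))^2) <= (LINT x|mu0. (norm (x - T' x))^2)"
  and W: "W = (LINT x|mu0. (norm (T x - x))^2) - (norm (LINT x|mu0. T x - x))^2" "0 < W"
  and w: "0 < w" "w < pi" "real CARD('n) * w^2 = 2 * W"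
 shows "\<exists>D. (\<forall>tau\<in>{0..1}. centered_Ent (mu tau) = ereal (D tau)) &
  (\<forall>t\<in>{0<..<1}. sin ((1 - t) * w) / sin w * exp (- D 0 / real CARD('n)) + sin (t * w) / sin w * exp (- D 1 / real CARD('n)) < exp (- D t / real CARD('n)))"
proof -
 have f[measurable]: "f0 \<in> BM" "f1 \<in> BM" and fn: "!!x. 0 <= f0 x" "!!x. 0 <= f1 x"
  using slc by (auto simp: slc_dens_def)
 have [simp, measurable_cong]: "sets mu0 = sets borel" "sets mu1 = sets borel" by (auto simp: mu0_def mu1_def)
 interpret mu0: prob_space mu0 unfolding mu0_def by (rule prob_space_slc[OF slc(1)])
 interpret mu1: prob_space mu1 unfolding mu1_def by (rule prob_space_slc[OF slc(2)])
 have mT: "integrable mu0 (\<lambda>x. (norm (T x))^2)" using m2(2) unfolding push[symmetric] by (subst (asm) integrable_distr_eq) auto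
 have ac: "null_sets lborel \<subseteq> null_sets mu0"
  unfolding mu0_def by (auto simp: null_sets_density_iff null_setsD2[of _ lborel, simplified] dest: AE_not_in elim!: eventually_mono)
 obtain E and Phi :: "real^'n => real" where E: "E \<in> sets borel" "AE x in mu0. x \<in> E" "E ~= {}"
  "!!x x'. x \<in> E ==> x' \<in> E ==> Phi x + T x \<bullet> (x' - x) <= Phi x'"
  using optimal_potential[OF mu0.prob_space_axioms _ ac T m2(1) mT, unfolded push] opt by auto
 have "\<exists>F. \<exists>X Y G a b. interp t X Y (\<lambda>x. (1 - t) *\<^sub>R x + t *\<^sub>R T x) G a b f0 f1 F & (\<forall>z\<in>G. Y z = T (X z)) & mu t = dens F"
  if t: "0 < t" "t < 1" for t
 proof -
  show ?thesis
  proof (rule interp_exists[OF E(1) E(3) E(4) t T slc E(2)[unfolded mu0_def] push[unfolded mu0_def mu1_def]])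
   fix X Y G a b F
   assume "interp t X Y (\<lambda>x. (1 - t) *\<^sub>R x + t *\<^sub>R T x) G a b f0 f1 F" "!!z. z \<in> G ==> Y z = T (X z)"
    "distr (dens f0) borel (\<lambda>x. (1 - t) *\<^sub>R x + t *\<^sub>R T x) = dens F"
   then show ?thesis unfolding mu_def mu0_def by blast
  qed
 qed
 then have "\<forall>t. \<exists>F. 0 < t --> t < 1 --> (\<exists>X Y G a b. interp t X Y (\<lambda>x. (1 - t) *\<^sub>R x + t *\<^sub>R T x) G a b f0 f1 F & (\<forall>z\<in>G. Y z = T (X z)) & mu t = dens F)"
  by blast
 then obtain F where F: "!!t. 0 < t ==> t < 1 ==> (\<exists>X Y G a b. interp t X Y (\<lambda>x. (1 - t) *\<^sub>R x + t *\<^sub>R T x) G a b f0 f1 (F t) & (\<forall>z\<in>G. Y z = T (X z)) & mu t = dens (F t))"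
  by (rule choice[THEN exE]) blast
 have Fm: "F t \<in> BM" "!!z. 0 <= F t z" "mu t = dens (F t)" if "0 < t" "t < 1" for t
  using F[OF that] by (auto simp: interp_def)
 define P where "P h = (LINT x|mu0. h x (T x))" for h :: "real^'n => real^'n => real"
 define Va where "Va tau = (\<integral>x. (norm x)^2 \<partial>mu tau) - (norm (\<integral>x. x \<partial>mu tau))^2" for tau
 define U where "U tau = (if tau = 0 then \<integral>x. ln (f0 x) \<partial>mu0 else if tau = 1 then \<integral>x. ln (f1 x) \<partial>mu1 else \<integral>x. ln (F tau x) \<partial>mu tau)" for tau
 define D where "D tau = U tau + Va tau / 2 + real CARD('n) / 2 * ln (2 * pi)" for tau
 have mu01: "mu 0 = mu0" "mu 1 = mu1" by (simp_all add: mu_def distr_id2 push)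
 have iv2: "integrable mu0 (\<lambda>x. (norm (T x - x))^2)" by (rule integrable_norm_add_sq) (use m2(1) mT in auto)
 have iv: "integrable mu0 (\<lambda>x. T x - x)" and ix: "integrable mu0 (\<lambda>x. x)"
  by (rule integrable_square_imp(1)[OF mu0.prob_space_axioms]; use iv2 m2(1) in simp)+
 have ixv: "integrable mu0 (\<lambda>x. x \<bullet> (T x - x))" by (rule integrable_norm_add_sq) (use m2(1) iv2 in auto)
 define C0 where "C0 = (LINT x|mu0. x \<bullet> (T x - x)) - (LINT x|mu0. x) \<bullet> (LINT x|mu0. T x - x)"
 have pt: "(1 - tau) *\<^sub>R x + tau *\<^sub>R T x = x + tau *\<^sub>R (T x - x)" for tau x by (simp add: algebra_simps)
 have im: "integrable (mu tau) (\<lambda>x. (norm x)^2)" and mean: "(\<integral>x. x \<partial>mu tau) = (LINT x|mu0. x) + tau *\<^sub>R (LINT x|mu0. T x - x)"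
  and VaQ: "Va tau = Va 0 + 2 * tau * C0 + tau^2 * W" for tau
 proof -
  have n: "(norm (x + tau *\<^sub>R (T x - x)))^2 = (norm x)^2 + 2 * tau * (x \<bullet> (T x - x)) + tau^2 * (norm (T x - x))^2" for x
   unfolding power2_norm_eq_inner by (simp add: inner_add_left inner_add_right inner_diff_left inner_diff_right inner_commute power2_eq_square algebra_simps)
  have iR: "integrable mu0 (\<lambda>x. (norm (x + tau *\<^sub>R (T x - x)))^2)" unfolding n using m2(1) iv2 ixv by simp
  then show "integrable (mu tau) (\<lambda>x. (norm x)^2)" unfolding mu_def pt by (subst integrable_distr_eq) auto
  have "(\<integral>x. x \<partial>mu tau) = (LINT x|mu0. x + tau *\<^sub>R (T x - x))" unfolding mu_def pt by (subst integral_distr) auto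
  also have "... = (LINT x|mu0. x) + tau *\<^sub>R (LINT x|mu0. T x - x)" using ix iv by (simp del: integral_diff)
  finally show mean: "(\<integral>x. x \<partial>mu tau) = (LINT x|mu0. x) + tau *\<^sub>R (LINT x|mu0. T x - x)" .
  have "(\<integral>x. (norm x)^2 \<partial>mu tau) = (LINT x|mu0. (norm (x + tau *\<^sub>R (T x - x)))^2)" unfolding mu_def pt by (subst integral_distr) auto
  also have "... = (LINT x|mu0. (norm x)^2) + 2 * tau * (LINT x|mu0. x \<bullet> (T x - x)) + tau^2 * (LINT x|mu0. (norm (T x - x))^2)"
   unfolding n using m2(1) iv2 ixv by simp
  finally have sq: "(\<integral>x. (norm x)^2 \<partial>mu tau) = (LINT x|mu0. (norm x)^2) + 2 * tau * (LINT x|mu0. x \<bullet> (T x - x)) + tau^2 * (LINT x|mu0. (norm (T x - x))^2)" .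
  have n2: "(norm (p + tau *\<^sub>R q))^2 = (norm p)^2 + 2 * tau * (p \<bullet> q) + tau^2 * (norm q)^2" for p q :: "real^'n"
   unfolding power2_norm_eq_inner by (simp add: inner_add_left inner_add_right inner_commute power2_eq_square algebra_simps)
  show "Va tau = Va 0 + 2 * tau * C0 + tau^2 * W" unfolding Va_def sq mean n2 mu01 W C0_def by (simp add: algebra_simps)
 qed
 have mid: "integrable (mu t) (\<lambda>x. ln (F t x)) & U t <= (1 - t) * U 0 + t * U 1 &
   (\<exists>S C Q Z J e. 0 < e & W < Q & 0 < Z & (S - C)^2 <= (Q - W) * (real CARD('n) - Z) &
   (\<forall>d. abs d < e --> 0 < t + d & t + d < 1 & D (t + d) = D t - J d + d * C + d^2 * W / 2 &
    abs (J d - d * S) <= 2 * d^2 * Q & J d + J (- d) <= - d\<^sup>2 * Q))" if t: "0 < t" "t < 1" for t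
 proof -
  obtain X Y G a b where I: "interp t X Y (\<lambda>x. (1 - t) *\<^sub>R x + t *\<^sub>R T x) G a b f0 f1 (F t)" and YT: "!!z. z \<in> G ==> Y z = T (X z)"
   and mut: "mu t = dens (F t)" using F[OF t] by blast
  interpret interp t X Y "\<lambda>x. (1 - t) *\<^sub>R x + t *\<^sub>R T x" G a b f0 f1 "F t" by (rule I)
  have M: "M = mu t" by (simp add: mut)
  have pd: "mu (t + d) = distr M borel (\<lambda>z. z + d *\<^sub>R v z)" for d
   unfolding mu_def mu0_def by (rule distr_interpolate[OF YT T])
  have mom: "integrable M (\<lambda>z. (norm (X z))^2)" "integrable M (\<lambda>z. (norm (Y z))^2)"
  proof -
   have "integrable mu0 (\<lambda>x. (norm x)^2) \<longleftrightarrow> integrable M (\<lambda>z. (norm (X z))^2)"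
    unfolding mu0_def using transfer(1)[OF YT T, of "\<lambda>x y. (norm x)^2"] by simp
   then show "integrable M (\<lambda>z. (norm (X z))^2)" using m2(1) by simp
   have "integrable mu0 (\<lambda>x. (norm (T x))^2) \<longleftrightarrow> integrable M (\<lambda>z. (norm (Y z))^2)"
    unfolding mu0_def using transfer(1)[OF YT T, of "\<lambda>x y. (norm y)^2"] by simp
   then show "integrable M (\<lambda>z. (norm (Y z))^2)" using mT by simp
  qed
  have l0: "integrable M (\<lambda>z. ln (f0 (X z)))" "(LINT z|M. ln (f0 (X z))) = U 0"
   using lnf(1) unfolding U_def mu0_def push(1)[symmetric] by (simp_all add: integrable_distr_eq integral_distr)
  have l1: "integrable M (\<lambda>z. ln (f1 (Y z)))" "(LINT z|M. ln (f1 (Y z))) = U 1"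
   using lnf(2) unfolding U_def mu1_def push(2)[symmetric] by (simp_all add: integrable_distr_eq integral_distr)
  have lnt: "integrable M (\<lambda>z. ln (F t z))"
   by (rule ln_density_integrable[OF meas(5) ft0 poincare_sums(7)[OF mom] _ log_density_convex]) (use l0 l1 in simp)
  have Ut: "U t = (LINT z|M. ln (F t z))" using t by (simp add: U_def mut)
  have conv: "U t <= (1 - t) * U 0 + t * U 1"
  proof -
   have "U t <= (LINT z|M. (1 - t) * ln (f0 (X z)) + t * ln (f1 (Y z)))"
    unfolding Ut by (rule integral_mono_AE) (use lnt l0 l1 log_density_convex in auto)
   also have "... = (1 - t) * U 0 + t * U 1" using l0 l1 by simp
   finally show ?thesis .
  qed
  \<comment> \<open>The densities around time \<open>t\<close>; the value \<open>0\<close> at times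
    outside the open interval only makes the family total.\<close>
  define g where "g d = (if 0 < t + d & t + d < 1 then F (t + d) else (\<lambda>_. 0))" for d
  have gm: "g d \<in> BM" "0 <= g d z" for d z using Fm[of "t + d"] by (auto simp: g_def)
  have gp: "distr M borel (\<lambda>z. z + d *\<^sub>R v z) = dens (g d)" if "0 < t + d" "t + d < 1" for d
   using Fm(3)[OF that] that unfolding pd by (simp add: g_def)
  define Q where "Q = (LINT z|M. (\<Sum>e\<in>Basis. (norm (A z e))^2))"
  define S where "S = (LINT z|M. (\<Sum>e\<in>Basis. A z e \<bullet> e))"
  define C where "C = (LINT z|M. z \<bullet> v z) - (LINT z|M. z) \<bullet> (LINT z|M. v z)"
  define Z where "Z = (LINT z|M. (norm z)^2) - (norm (LINT z|M. z))^2"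
  obtain J e where J: "0 < e" "!!d. abs d < e ==> 0 < t + d & t + d < 1 &
    (LINT z|M. ln (g d (z + d *\<^sub>R v z))) = (LINT z|M. ln (F t z)) - J d & abs (J d - d * S) <= 2 * d^2 * Q & J d + J (- d) <= - d\<^sup>2 * Q"
   using entropy_expansion[OF lnt mom gm gp] unfolding Q_def S_def by blast
  have vv: "(LINT z|M. (norm (v z))^2) = (LINT x|mu0. (norm (T x - x))^2)" "(LINT z|M. v z) = (LINT x|mu0. T x - x)"
   unfolding mu0_def v_def using transfer(2)[OF YT T, of "\<lambda>x y. (norm (y - x))^2"] transfer(2)[OF YT T, of "\<lambda>x y. y - x"] by simp_all
  have WM: "W = (LINT z|M. (norm (v z))^2) - (norm (LINT z|M. v z))^2" unfolding vv by (rule W(1))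
  \<comment> \<open>The covariance at time \<open>t\<close> is half the derivative of
    \<open>Va\<close> there, so the quadratic formula for \<open>Va\<close>, stated at time
    \<open>0\<close>, can be re-expanded at \<open>t\<close>.\<close>
  have Cc: "C = C0 + t * W"
  proof -
   have "z \<bullet> v z = X z \<bullet> (Y z - X z) + t * (norm (Y z - X z))^2" for z
    by (subst XY[of z, symmetric]) (simp add: v_def power2_norm_eq_inner inner_add_left inner_diff_left inner_diff_right inner_commute algebra_simps)
   then have "(LINT z|M. z \<bullet> v z) = (LINT x|mu0. x \<bullet> (T x - x) + t * (norm (T x - x))^2)"
    unfolding mu0_def using transfer(2)[OF YT T, of "\<lambda>x y. x \<bullet> (y - x) + t * (norm (y - x))^2"] by simp
   also have "... = (LINT x|mu0. x \<bullet> (T x - x)) + t * (LINT x|mu0. (norm (T x - x))^2)" using ixv iv2 by simp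
   finally have 1: "(LINT z|M. z \<bullet> v z) = (LINT x|mu0. x \<bullet> (T x - x)) + t * (LINT x|mu0. (norm (T x - x))^2)" .
   have 2: "(LINT z|M. z) = (LINT x|mu0. x) + t *\<^sub>R (LINT x|mu0. T x - x)" using mean[of t] unfolding M .
   show ?thesis unfolding C_def 1 2 vv(2) C0_def W(1)
    by (simp only: inner_add_left inner_scaleR_left power2_norm_eq_inner[of "\<integral>x. T x - x \<partial>mu0"]) (simp only: algebra_simps)
  qed
  have "W < Q" using poincare_sums(1)[OF mom] W(2) unfolding WM Q_def by blast
  moreover have "(S - C)^2 <= (Q - W) * (real CARD('n) - Z)" using poincare_sums(2)[OF mom] unfolding WM Q_def S_def C_def Z_def .
  moreover have "0 < Z" using poincare_sums(3)[OF mom] unfolding Z_def .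
  moreover have "D (t + d) = D t - J d + d * C + d^2 * W / 2" if d: "abs d < e" for d
  proof -
   have td: "0 < t + d" "t + d < 1" using J(2)[OF d] by auto
   have "U (t + d) = (\<integral>z. ln (g d z) \<partial>mu (t + d))" using td by (simp add: U_def g_def)
   also have "... = (LINT z|M. ln (g d (z + d *\<^sub>R v z)))" unfolding pd using gm(1)[of d] by (subst integral_distr) auto
   also have "... = U t - J d" using J(2)[OF d] Ut by simp
   finally have "U (t + d) = U t - J d" .
   moreover have "Va (t + d) = Va t + 2 * d * C + d^2 * W"
    unfolding VaQ[of "t + d"] VaQ[of t] Cc by (simp add: power2_eq_square algebra_simps)
   ultimately show ?thesis by (simp add: D_def add_divide_distrib)
  qed
  ultimately have "\<exists>S C Q Z J e. 0 < e & W < Q & 0 < Z & (S - C)^2 <= (Q - W) * (real CARD('n) - Z) &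
   (\<forall>d. abs d < e --> 0 < t + d & t + d < 1 & D (t + d) = D t - J d + d * C + d^2 * W / 2 &
    abs (J d - d * S) <= 2 * d^2 * Q & J d + J (- d) <= - d\<^sup>2 * Q)"
   using J(1) J(2) by (intro exI[of _ S] exI[of _ C] exI[of _ Q] exI[of _ Z] exI[of _ J] exI[of _ e] conjI allI impI) blast+
  then show ?thesis using lnt conv unfolding M by blast
 qed
 have pm: "prob_space (mu tau)" for tau unfolding mu_def by (rule mu0.prob_space_distr) measurable
 have Ent: "centered_Ent (mu tau) = ereal (D tau)" if tau: "tau \<in> {0..1}" for tau
 proof -
  have *: "centered_Ent (mu tau) = ereal ((\<integral>x. ln (k x) \<partial>mu tau) + Va tau / 2 + real CARD('n) / 2 * ln (2 * pi))"
   if "k \<in> BM" "!!x. 0 <= k x" "mu tau = dens k" "integrable (mu tau) (\<lambda>x. ln (k x))" for k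
   using centered_Ent_density[OF that(1-3) pm im that(4)] by (simp add: Va_def)
  consider "tau = 0" | "tau = 1" | "0 < tau" "tau < 1" using tau by force
  then show ?thesis
  proof cases
   case 1
   then show ?thesis using *[of f0] fn f lnf mu01 by (simp add: D_def U_def mu0_def)
  next
   case 2
   then show ?thesis using *[of f1] fn f lnf mu01 by (simp add: D_def U_def mu1_def)
  next
   case 3
   then show ?thesis using *[of "F tau"] Fm[OF 3] mid[OF 3] by (simp add: D_def U_def)
  qed
 qed
 \<comment> \<open>The chord of \<open>U\<close>, an upper bound by convexity, plus the explicit
   quadratic \<open>Va\<close>: a continuous majorant of \<open>D\<close> with the right end
   values.\<close>
 define h where "h tau = (1 - tau) * U 0 + tau * U 1 + (Va 0 + 2 * tau * C0 + tau^2 * W) / 2 + real CARD('n) / 2 * ln (2 * pi)" for tau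
 have "sin ((1 - t) * w) / sin w * exp (- D 0 / real CARD('n)) + sin (t * w) / sin w * exp (- D 1 / real CARD('n)) < exp (- D t / real CARD('n))"
  if t: "t \<in> {0<..<1}" for t
 proof (rule sine_comparison_strict[where W=W and h=h])
  show "continuous_on {0..1} h" unfolding h_def by (intro continuous_intros) auto
  show "h 0 = D 0" by (simp add: h_def D_def)
  show "h 1 = D 1" using VaQ[of 1] by (simp add: h_def D_def)
  show "D tau <= h tau" if "0 < tau" "tau < 1" for tau using mid[OF that] VaQ[of tau] by (simp add: h_def D_def)
 qed (use t w W mid in auto)
 then show ?thesis using Ent by (intro exI[of _ D]) auto
qed

subsection \<open>The main theorem\<close>

lemma gaussian_shift_nn_integral_finite:
 "(\<integral>\<^sup>+x. ennreal (exp (- (norm (x - x0 :: 'a::euclidean_space))\<^sup>2 / 8)) \<partial>lborel) < \<infinity>"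
proof -
 have "(\<integral>\<^sup>+x. ennreal (exp (- (norm (x - x0))\<^sup>2 / 8)) \<partial>lborel)
   = (\<integral>\<^sup>+x. ennreal (exp (- (norm (x - x0))\<^sup>2 / 8)) \<partial>density (distr lborel borel (\<lambda>x::'a. x0 + 2 *\<^sub>R x)) (\<lambda>_. ennreal (abs 2 ^ DIM('a))))"
  by (subst lborel_affine[of 2 x0]) simp_all
 also have "... = (\<integral>\<^sup>+x. ennreal (2 ^ DIM('a)) * ennreal (exp (- (norm (x::'a))\<^sup>2 / 2)) \<partial>lborel)"
  by (subst nn_integral_density) (auto simp: nn_integral_distr power_mult_distrib)
 also have "... < \<infinity>" using gaussian_nn_integral_finite[where 'a='a] by (subst nn_integral_cmult) (auto simp: ennreal_mult_less_top)
 finally show ?thesis .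
qed

text \<open>Lower semicontinuity bounds \<open>V\<close> from below near one point, and strong
  convexity along rays from there makes it grow quadratically. The resulting Gaussian bound for the
  density gives second moments and bounds \<open>ln (f x)\<close> from above.\<close>

lemma strongly_log_concave_density:
 fixes mu :: "'a::euclidean_space measure"
 assumes "strongly_log_concave mu"
 obtains f where "slc_dens f" "mu = dens f" "integrable mu (\<lambda>x. (norm x)^2)" "integrable mu (\<lambda>x. ln (f x))"
proof -
 obtain V where p: "prob_space mu" and V: "proper_fun V" "lower_semicont V" "ereal_convex (\<lambda>x. V x - ereal ((norm x)^2 / 2))"
  and muV: "mu = density lborel (\<lambda>x. e2ennreal (eexp (- V x)))"
  using assms by (auto simp: strongly_log_concave_def)
 interpret mu: prob_space mu by fact
 define U where "U x = real_of_ereal (V x)" for x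
 have Vm: "V x ~= -\<infinity>" for x using V(1) by (simp add: proper_fun_def)
 have VU: "V x = ereal (U x)" if "V x ~= \<infinity>" for x using Vm[of x] that by (cases "V x") (auto simp: U_def)
 have conv: "V ((1 - u) *\<^sub>R x + u *\<^sub>R y) ~= \<infinity> & U ((1 - u) *\<^sub>R x + u *\<^sub>R y) <= (1 - u) * U x + u * U y - u * (1 - u) / 2 * (norm (x - y))^2"
  if xy: "V x ~= \<infinity>" "V y ~= \<infinity>" and u: "0 <= u" "u <= 1" for x y u
 proof -
  define m where "m = (1 - u) *\<^sub>R x + u *\<^sub>R y"
  have "V m - ereal ((norm m)^2 / 2) <= ereal (1 - u) * (V x - ereal ((norm x)^2 / 2)) + ereal u * (V y - ereal ((norm y)^2 / 2))"
   using V(3) u unfolding ereal_convex_def m_def by auto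
  also have "... = ereal ((1 - u) * (U x - (norm x)^2 / 2) + u * (U y - (norm y)^2 / 2))" using VU[OF xy(1)] VU[OF xy(2)] by simp
  finally have le: "V m - ereal ((norm m)^2 / 2) <= ereal ((1 - u) * (U x - (norm x)^2 / 2) + u * (U y - (norm y)^2 / 2))" .
  then have fin: "V m ~= \<infinity>" by auto
  have "U m <= (1 - u) * (U x - (norm x)^2 / 2) + u * (U y - (norm y)^2 / 2) + (norm m)^2 / 2" using le VU[OF fin] by simp
  moreover have "(norm m)^2 = (1 - u) * (norm x)^2 + u * (norm y)^2 - u * (1 - u) * (norm (x - y))^2"
   unfolding m_def power2_norm_eq_inner
   by (simp add: inner_add_left inner_add_right inner_diff_left inner_diff_right inner_commute algebra_simps)
  ultimately have "U m <= (1 - u) * U x + u * U y - u * (1 - u) / 2 * (norm (x - y))^2" by (simp add: field_simps)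
  then show ?thesis using fin by (simp add: m_def)
 qed
 have V_meas[measurable]: "V \<in> BM"
  by (rule borel_measurableI_greater) (use V(2) in \<open>auto simp: lower_semicont_def\<close>)
 define f where "f x = (if V x = \<infinity> then 0 else exp (- U x))" for x
 have f[measurable]: "f \<in> BM" unfolding f_def U_def by measurable
 have f0: "0 <= f x" for x by (simp add: f_def)
 have "e2ennreal (eexp (- V x)) = ennreal (f x)" for x
  using Vm[of x] by (cases "V x") (auto simp: f_def U_def eexp_def)
 then have muf: "mu = dens f" by (simp add: muV)
 have slc: "slc_dens f"
  unfolding slc_dens_def
 proof (intro conjI allI f f0)
  show "(\<integral>\<^sup>+x. ennreal (f x) \<partial>lborel) = 1" using mu.emeasure_space_1 by (simp add: muf emeasure_density)
  fix x y
  show "f x * f y * exp ((norm (x - y))^2 / 4) <= (f ((1/2) *\<^sub>R (x + y)))^2"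
  proof (cases "V x = \<infinity> \<or> V y = \<infinity>")
   case False
   have c: "V ((1/2) *\<^sub>R (x + y)) ~= \<infinity>" "2 * U ((1/2) *\<^sub>R (x + y)) <= U x + U y - (norm (x - y))^2 / 4"
    using conv[of x y "1/2"] False by (auto simp: scaleR_add_right)
   have "f x * f y * exp ((norm (x - y))^2 / 4) = exp (- (U x + U y - (norm (x - y))^2 / 4))"
    using False by (simp add: f_def exp_add[symmetric] exp_diff)
   also have "... <= exp (- (2 * U ((1/2) *\<^sub>R (x + y))))" using c(2) by simp
   also have "... = (f ((1/2) *\<^sub>R (x + y)))^2" using c(1) by (simp add: f_def power2_eq_square exp_add[symmetric])
   finally show ?thesis .
  qed (auto simp: f_def)
 qed
 obtain x0 where x0: "V x0 ~= \<infinity>" using V(1) by (auto simp: proper_fun_def)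
 have "open {y. ereal (U x0 - 1) < V y}" using V(2) by (simp add: lower_semicont_def)
 moreover have "x0 \<in> {y. ereal (U x0 - 1) < V y}" using VU[OF x0] by simp
 ultimately obtain r where r: "0 < r" "!!y. norm (y - x0) < r ==> ereal (U x0 - 1) < V y"
  unfolding open_dist by (auto simp: dist_norm)
 have rU: "U x0 - 1 <= U y" if "norm (y - x0) < r" "V y ~= \<infinity>" for y using r(2)[OF that(1)] VU[OF that(2)] by simp
 \<comment> \<open>On rays the growth is \<open>rho^2 / 2 - c * rho\<close> up to a constant; half
   of the quadratic term absorbs the linear one at the price of \<open>c^2\<close>.\<close>
 define c where "c = 2 / r + r / 4"
 define K where "K = exp (- U x0) * (exp (1 + r^2 / 4) + exp (c^2))"
 have K: "0 < K" by (simp add: K_def add_pos_pos)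
 have bound: "f x <= K * exp (- (norm (x - x0))\<^sup>2 / 4)" for x
 proof (cases "V x = \<infinity>")
  case True
  then show ?thesis using K by (simp add: f_def)
 next
  case False
  define rho where "rho = norm (x - x0)"
  have "\<exists>k\<in>{1 + r^2 / 4, c^2}. U x0 + rho^2 / 4 - k <= U x"
  proof (cases "rho < r")
   case True
   then have "rho^2 <= r^2" by (intro power_mono) (auto simp: rho_def)
   then show ?thesis using rU[of x] True False by (auto simp: rho_def)
  next
   case F: False
   \<comment> \<open>Places \<open>y\<close> at distance \<open>r / 2\<close> from
     \<open>x0\<close>, where lower semicontinuity bounds \<open>U\<close> from below.\<close>
   define u where "u = r / (2 * rho)"
   have rho: "0 < rho" "r <= rho" using F r by auto
   have u: "0 < u" "u <= 1" "u * rho = r / 2" using r rho by (auto simp: u_def field_simps)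
   define y where "y = (1 - u) *\<^sub>R x0 + u *\<^sub>R x"
   have y: "V y ~= \<infinity>" "U y <= (1 - u) * U x0 + u * U x - u * (1 - u) / 2 * rho^2"
    using conv[OF x0 False, of u] u by (auto simp: y_def rho_def norm_minus_commute)
   have "y - x0 = u *\<^sub>R (x - x0)" by (simp add: y_def algebra_simps)
   then have "norm (y - x0) = r / 2" using u by (simp add: rho_def[symmetric])
   then have "U x0 - 1 <= U y" using rU[OF _ y(1)] r by simp
   then have "u * (U x0 + (1 - u) / 2 * rho^2) - 1 <= u * U x" using y(2) by (simp add: algebra_simps)
   then have "(u * (U x0 + (1 - u) / 2 * rho^2) - 1) / u <= U x" using u by (simp add: pos_divide_le_eq mult.commute)
   then have le: "U x0 + (1 - u) / 2 * rho^2 - 1 / u <= U x" using u by (simp add: diff_divide_distrib)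
   define p where "p = 2 / r * rho"
   define q where "q = r / 4 * rho"
   have eu: "1 / u = p" by (simp add: u_def p_def)
   have eq: "(1 - u) / 2 * rho^2 = rho^2 / 2 - q"
   proof -
    have "(1 - u) / 2 * rho^2 = rho^2 / 2 - (u * rho) * rho / 2" by (simp add: power2_eq_square field_simps)
    then show ?thesis unfolding u(3) q_def by simp
   qed
   have "p + q <= rho^2 / 4 + c^2"
   proof -
    have "0 <= (rho / 2 - c)^2" by simp
    also have "... = rho^2 / 4 + c^2 - c * rho" by (simp add: power2_eq_square algebra_simps)
    finally show ?thesis by (simp add: c_def p_def q_def distrib_right)
   qed
   then have "U x0 + rho^2 / 4 - c^2 <= U x" using le[unfolded eu eq] by linarith
   then show ?thesis by blast
  qed
  then obtain k where k: "k \<in> {1 + r^2 / 4, c^2}" "U x0 + rho^2 / 4 - k <= U x" by blast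
  have "f x <= exp (- (U x0 + rho^2 / 4 - k))" using False k(2) by (simp add: f_def)
  also have "... = exp (- U x0) * exp k * exp (- rho\<^sup>2 / 4)" by (simp add: exp_add[symmetric])
  also have "... <= K * exp (- rho\<^sup>2 / 4)" unfolding K_def using k(1) by (intro mult_right_mono mult_left_mono) auto
  finally show ?thesis by (simp add: rho_def)
 qed
 \<comment> \<open>Half of the Gaussian exponent pays for the factor \<open>(norm x)^2\<close>, by
   \<open>s * exp (- s / 8) <= 8\<close>.\<close>
 define K' where "K' = 16 * K + 2 * K * (norm x0)^2"
 have K': "0 <= K'" using K by (simp add: K'_def)
 have pt: "f x * (norm x)^2 <= K' * exp (- (norm (x - x0))\<^sup>2 / 8)" for x
 proof -
  define s where "s = (norm (x - x0))^2"
  have s: "0 <= s" by (simp add: s_def)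
  have "(norm x)^2 <= 2 * s + 2 * (norm x0)^2"
  proof -
   have "0 <= (norm ((x - x0) - x0))^2" by simp
   then show ?thesis unfolding s_def by (simp add: power2_norm_eq_inner inner_diff_left inner_diff_right inner_commute)
  qed
  then have "f x * (norm x)^2 <= (K * exp (- s / 4)) * (2 * s + 2 * (norm x0)^2)"
   using bound[of x] f0 K by (intro mult_mono) (auto simp: s_def)
  also have "exp (- s / 4) = exp (- s / 8) * exp (- s / 8)" by (simp add: exp_add[symmetric])
  also have "K * (exp (- s / 8) * exp (- s / 8)) * (2 * s + 2 * (norm x0)^2) = K * exp (- s / 8) * (2 * (exp (- s / 8) * s) + 2 * (norm x0)^2 * exp (- s / 8))"
   by (simp add: algebra_simps)
  also have "... <= K * exp (- s / 8) * (2 * 8 + 2 * (norm x0)^2 * 1)"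
  proof (intro mult_left_mono add_mono)
   have "s / 8 <= exp (s / 8)" using exp_ge_add_one_self[of "s / 8"] by linarith
   then have "exp (- s / 8) * (s / 8) <= exp (- s / 8) * exp (s / 8)" by (intro mult_left_mono) auto
   also have "... = 1" by (simp add: exp_add[symmetric])
   finally show "exp (- s / 8) * s <= 8" by simp
  qed (use s K in auto)
  also have "... = K' * exp (- s / 8)" by (simp add: K'_def algebra_simps)
  finally show ?thesis by (simp add: s_def)
 qed
 have m2: "integrable mu (\<lambda>x. (norm x)^2)"
 proof (rule integrableI_bounded)
  have "(\<integral>\<^sup>+x. ennreal (norm ((norm x)^2)) \<partial>mu) = (\<integral>\<^sup>+x. ennreal (f x * (norm x)^2) \<partial>lborel)"
   unfolding muf by (subst nn_integral_density) (auto simp: ennreal_mult f0)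
  also have "... <= (\<integral>\<^sup>+x. ennreal K' * ennreal (exp (- (norm (x - x0))\<^sup>2 / 8)) \<partial>lborel)"
   using pt K' by (intro nn_integral_mono) (auto simp: ennreal_mult[symmetric] intro!: ennreal_leI)
  also have "... < \<infinity>" using gaussian_shift_nn_integral_finite[of x0] by (subst nn_integral_cmult) (auto simp: ennreal_mult_less_top)
  finally show "(\<integral>\<^sup>+x. ennreal (norm ((norm x)^2)) \<partial>mu) < \<infinity>" .
 qed (simp add: muf)
 have "integrable mu (\<lambda>x. ln (f x))"
  unfolding muf
 proof (rule ln_density_integrable[OF f f0 m2[unfolded muf]])
  show "integrable (dens f) (\<lambda>_. ln K)" using mu.integrable_const by (simp add: muf)
  show "AE x in dens f. ln (f x) <= ln K"
  proof (subst AE_density, simp, rule AE_I2, rule impI)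
   fix x assume "0 < ennreal (f x)"
   then have "0 < f x" by (simp add: ennreal_less_zero_iff)
   moreover have "f x <= K" using bound[of x] K by (smt (verit) exp_le_one_iff mult_left_le zero_le_power2 divide_nonneg_nonneg minus_divide_left)
   ultimately show "ln (f x) <= ln K" using K by simp
  qed
 qed
 then show thesis using that[OF slc muf m2] by blast
qed

text \<open>With the identity as transport map the geodesic is constant, and the Poincare inequality
  at time \<open>1/2\<close> for the coordinate functions bounds the variance by the
  dimension.\<close>

lemma variance_le_dim:
 fixes f :: "real^'n => real"
 assumes slc: "slc_dens f" and mu: "mu = dens f" and m2: "integrable mu (\<lambda>x. (norm x)^2)"
 shows "(LINT x|mu. (norm x)^2) - (norm (LINT x|mu. x))^2 <= real CARD('n)"
proof -
 have half: "(1 - 1/2) *\<^sub>R x + (1/2) *\<^sub>R x = x" for x :: "real^'n" by (simp flip: scaleR_add_left)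
 have Db: "(UNIV :: (real^'n) set) \<in> sets borel" "(UNIV :: (real^'n) set) ~= {}" by auto
 have sub: "(norm x)^2 / 2 + x \<bullet> (x' - x) <= (norm x')^2 / 2" for x x' :: "real^'n"
 proof -
  have "0 <= (norm (x' - x))^2" by simp
  then show ?thesis by (simp add: power2_norm_eq_inner inner_diff_left inner_diff_right inner_commute)
 qed
 show ?thesis
 proof (rule interp_exists[where T="\<lambda>x. x" and t="1/2" and Phi="\<lambda>x. (norm x)^2 / 2" and D=UNIV and ?f0.0=f and ?f1.0=f, unfolded half])
  fix X Y G a b ft assume I: "interp (1/2) X Y (\<lambda>x. x) G a b f f ft"
   and d: "distr (dens f) borel (\<lambda>x. x) = dens ft"
  interpret interp "1/2" X Y "\<lambda>x. x" G a b f f ft by (rule I)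
  have M: "M = mu" using d by (simp add: distr_id2 mu)
  have mX: "integrable M (\<lambda>z. (norm (X z))^2)" using m2 unfolding mu push(1)[symmetric] by (subst (asm) integrable_distr_eq) auto
  have mY: "integrable M (\<lambda>z. (norm (Y z))^2)" using m2 unfolding mu push(2)[symmetric] by (subst (asm) integrable_distr_eq) auto
  from poincare_sums(11)[OF mX mY] show ?thesis unfolding M .
 qed (use slc sub in \<open>auto simp: distr_id2\<close>)
qed

section \<open>Bounds for the Wasserstein distance\<close>

lemma W2_sq_map_le:
 assumes mu: "sets mu = sets borel" and T[measurable]: "T \<in> BM"
 shows "W2_sq mu (distr mu borel T) <= (\<integral>\<^sup>+x. ennreal ((dist x (T x))^2) \<partial>mu)"
proof -
 have [measurable_cong]: "sets mu = sets borel" by fact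
 define \<pi> where "\<pi> = distr mu borel (\<lambda>x. (x, T x))"
 have m[measurable]: "(\<lambda>x. (x, T x)) \<in> mu \<rightarrow>\<^sub>M borel" unfolding borel_prod[symmetric] by measurable
 have [measurable]: "fst \<in> borel_measurable (borel :: ('a \<times> 'a) measure)" "snd \<in> borel_measurable (borel :: ('a \<times> 'a) measure)"
  unfolding borel_prod[symmetric] by measurable
 have "distr \<pi> borel fst = mu" unfolding \<pi>_def by (subst distr_distr) (auto simp: comp_def mu intro!: distr_id2)
 moreover have "distr \<pi> borel snd = distr mu borel T" unfolding \<pi>_def by (subst distr_distr) (auto simp: comp_def)
 ultimately have "\<pi> \<in> couplings mu (distr mu borel T)" by (simp add: couplings_def \<pi>_def)
 then have "W2_sq mu (distr mu borel T) <= (\<integral>\<^sup>+z. ennreal ((dist (fst z) (snd z))^2) \<partial>\<pi>)" unfolding W2_sq_def by (rule INF_lower)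
 also have "... = (\<integral>\<^sup>+x. ennreal ((dist x (T x))^2) \<partial>mu)" unfolding \<pi>_def by (subst nn_integral_distr) auto
 finally show ?thesis .
qed

text \<open>Jensen's inequality for the displacement under an arbitrary coupling.\<close>

lemma W2_sq_ge:
 fixes mu nu :: "'a::euclidean_space measure"
 assumes mu: "prob_space mu" "sets mu = sets borel" "integrable mu (\<lambda>x. x)" and nu: "sets nu = sets borel" "integrable nu (\<lambda>x. x)"
 shows "ennreal ((norm (barycenter nu - barycenter mu))^2) <= W2_sq mu nu"
 unfolding W2_sq_def
proof (rule INF_greatest)
 fix \<pi> assume "\<pi> \<in> couplings mu nu"
 then have \<pi>: "sets \<pi> = sets borel" "distr \<pi> borel fst = mu" "distr \<pi> borel snd = nu" by (auto simp: couplings_def)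
 have [measurable_cong]: "sets \<pi> = sets borel" by fact
 have [measurable]: "fst \<in> borel_measurable (borel :: ('a \<times> 'a) measure)" "snd \<in> borel_measurable (borel :: ('a \<times> 'a) measure)"
  unfolding borel_prod[symmetric] by measurable
 have pp: "prob_space \<pi>" by (rule prob_space_distrD[of fst \<pi> borel]) (use mu(1) \<pi>(2) in auto)
 have fs: "fst \<in> \<pi> \<rightarrow>\<^sub>M borel" "snd \<in> \<pi> \<rightarrow>\<^sub>M borel" by measurable
 have i: "integrable \<pi> fst" "integrable \<pi> snd"
  using integrable_distr[OF fs(1), of "\<lambda>x. x", unfolded \<pi>(2), OF mu(3)] integrable_distr[OF fs(2), of "\<lambda>x. x", unfolded \<pi>(3), OF nu(2)] .
 have b: "barycenter mu = (LINT z|\<pi>. fst z)" "barycenter nu = (LINT z|\<pi>. snd z)"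
  unfolding barycenter_def \<pi>(2,3)[symmetric] by (auto simp: integral_distr)
 show "ennreal ((norm (barycenter nu - barycenter mu))^2) <= (\<integral>\<^sup>+z. ennreal ((dist (fst z) (snd z))^2) \<partial>\<pi>)"
 proof (cases "(\<integral>\<^sup>+z. ennreal ((dist (fst z) (snd z))^2) \<partial>\<pi>) = \<infinity>")
  case False
  have sq: "integrable \<pi> (\<lambda>z. (norm (snd z - fst z))^2)"
   by (rule integrableI_bounded) (use False in \<open>auto simp: dist_norm norm_minus_commute less_top\<close>)
  have "(norm (LINT z|\<pi>. snd z - fst z))^2 <= (LINT z|\<pi>. (norm (snd z - fst z))^2)"
   by (rule integrable_square_imp(2)[OF pp _ sq]) measurable
  moreover have "(LINT z|\<pi>. snd z - fst z) = barycenter nu - barycenter mu" using i by (simp add: b)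
  ultimately have "ennreal ((norm (barycenter nu - barycenter mu))^2) <= ennreal (LINT z|\<pi>. (norm (snd z - fst z))^2)" by (simp add: ennreal_leI)
  also have "... = (\<integral>\<^sup>+z. ennreal ((dist (fst z) (snd z))^2) \<partial>\<pi>)"
   using nn_integral_eq_integral[OF sq] by (simp add: dist_norm norm_minus_commute)
  finally show ?thesis .
 qed simp
qed

text \<open>The right side is the cost of the product coupling: the two variances plus the squared
  distance of the barycentres. As each variance is at most the dimension, this is the origin of the
  bound \<open>2 * n\<close> for the centred distance.\<close>

lemma W2_sq_le_independent:
 fixes mu nu :: "'a::euclidean_space measure"
 assumes mu: "prob_space mu" "sets mu = sets borel" "integrable mu (\<lambda>x. (norm x)^2)"
  and nu: "prob_space nu" "sets nu = sets borel" "integrable nu (\<lambda>x. (norm x)^2)"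
 shows "W2_sq mu nu <= ennreal ((LINT x|mu. (norm x)^2) + (LINT x|nu. (norm x)^2) - 2 * (barycenter mu \<bullet> barycenter nu))"
proof -
 interpret mu: prob_space mu by fact
 interpret nu: prob_space nu by fact
 interpret pair_prob_space mu nu ..
 have [measurable_cong]: "sets mu = sets borel" "sets nu = sets borel" by fact+
 define \<pi> where "\<pi> = mu \<Otimes>\<^sub>M nu"
 have s\<pi>[measurable_cong]: "sets \<pi> = sets borel" unfolding \<pi>_def borel_prod[symmetric] using mu(2) nu(2) by (rule sets_pair_measure_cong)
 have [measurable]: "fst \<in> borel_measurable (borel :: ('a \<times> 'a) measure)" "snd \<in> borel_measurable (borel :: ('a \<times> 'a) measure)"
  unfolding borel_prod[symmetric] by measurable
 have [simp]: "space mu = UNIV" "space nu = UNIV" using mu(2) nu(2) by (metis sets_eq_imp_space_eq space_borel)+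
 have d1: "distr \<pi> borel fst = mu"
  unfolding \<pi>_def by (rule trans[OF distr_cong nu.distr_pair_fst]) (simp_all add: mu)
 have d2: "distr \<pi> borel snd = nu"
 proof (rule measure_eqI)
  fix A assume "A \<in> sets (distr \<pi> borel snd)"
  then have A: "A \<in> sets borel" by simp
  have "emeasure (distr \<pi> borel snd) A = emeasure \<pi> (UNIV \<times> A)"
   using A by (subst emeasure_distr) (auto simp: \<pi>_def space_pair_measure vimage_def intro!: arg_cong[where f="emeasure _"])
  also have "... = emeasure nu A" unfolding \<pi>_def using A mu.emeasure_space_1 by (subst nu.emeasure_pair_measure_Times) auto
  finally show "emeasure (distr \<pi> borel snd) A = emeasure nu A" .
 qed (simp add: nu)
 have i2: "integrable \<pi> (\<lambda>z. (norm (fst z))^2)" "integrable \<pi> (\<lambda>z. (norm (snd z))^2)"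
  using mu(3) nu(3) unfolding d1[symmetric] d2[symmetric] by (auto simp: integrable_distr_eq)
 have e2: "(LINT z|\<pi>. (norm (fst z))^2) = (LINT x|mu. (norm x)^2)" "(LINT z|\<pi>. (norm (snd z))^2) = (LINT x|nu. (norm x)^2)"
  unfolding d1[symmetric] d2[symmetric] by (auto simp: integral_distr)
 have ip: "integrable \<pi> (\<lambda>z. fst z \<bullet> snd z)" by (rule integrable_norm_add_sq(3)[OF _ _ i2]) measurable
 have imu: "integrable mu (\<lambda>x. x)" "integrable nu (\<lambda>x. x)"     by (rule integrable_square_imp(1)[OF mu(1) _ mu(3)], simp) (rule integrable_square_imp(1)[OF nu(1) _ nu(3)], simp)
 have ep: "(LINT z|\<pi>. fst z \<bullet> snd z) = barycenter mu \<bullet> barycenter nu"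
 proof -
  have "(LINT z|\<pi>. fst z \<bullet> snd z) = (LINT x|mu. \<integral>y. x \<bullet> y \<partial>nu)"
   using integral_fst'[of "\<lambda>z. fst z \<bullet> snd z"] ip by (simp add: \<pi>_def)
  also have "... = (LINT x|mu. x \<bullet> barycenter nu)" unfolding barycenter_def using imu(2) by (simp add: integral_inner_right)
  also have "... = barycenter mu \<bullet> barycenter nu" unfolding barycenter_def[of mu] using imu(1) by (simp add: integral_inner_left)
  finally show ?thesis .
 qed
 have n: "(dist (fst z) (snd z))^2 = (norm (fst z))^2 + (norm (snd z))^2 - 2 * (fst z \<bullet> snd z)" for z :: "'a \<times> 'a"
  by (simp add: dist_norm power2_norm_eq_inner inner_diff_left inner_diff_right inner_commute)
 have id: "integrable \<pi> (\<lambda>z. (dist (fst z) (snd z))^2)" unfolding n using i2 ip by simp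
 have "W2_sq mu nu <= (\<integral>\<^sup>+z. ennreal ((dist (fst z) (snd z))^2) \<partial>\<pi>)"
  unfolding W2_sq_def by (rule INF_lower) (simp add: couplings_def d1 d2 s\<pi>)
 also have "... = ennreal (LINT z|\<pi>. (dist (fst z) (snd z))^2)" by (rule nn_integral_eq_integral[OF id]) simp
 also have "(LINT z|\<pi>. (dist (fst z) (snd z))^2) = (LINT x|mu. (norm x)^2) + (LINT x|nu. (norm x)^2) - 2 * (barycenter mu \<bullet> barycenter nu)"
  unfolding n using i2 ip by (simp add: e2 ep)
 finally show ?thesis .
qed

lemma barycenter_translate:
 fixes mu :: "'a::euclidean_space measure"
 assumes "prob_space mu" and [measurable_cong]: "sets mu = sets borel" and i: "integrable mu (\<lambda>x. x)"
 shows "barycenter (distr mu borel (\<lambda>x. x + c)) = barycenter mu + c"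
proof -
 interpret prob_space mu by fact
 have "barycenter (distr mu borel (\<lambda>x. x + c)) = (LINT x|mu. x + c)" unfolding barycenter_def by (subst integral_distr) auto
 also have "... = (LINT x|mu. x) + (LINT x|mu. c)" by (rule Bochner_Integration.integral_add[OF i]) simp
 finally show ?thesis by (simp add: barycenter_def prob_space)
qed

text \<open>A translation changes neither the integral of the logarithm of the density nor the
  variance, and these two determine the centred entropy.\<close>

lemma centered_Ent_translate:
 fixes f :: "'a::euclidean_space => real"
 assumes f[measurable]: "f \<in> BM" and f0: "!!x. 0 <= f x" and mu: "mu = dens f" "prob_space mu"
  and m2: "integrable mu (\<lambda>x. (norm x)^2)" and lnf: "integrable mu (\<lambda>x. ln (f x))"
 shows "centered_Ent (distr mu borel (\<lambda>x. x + c)) = centered_Ent mu"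
proof -
 interpret prob_space mu by fact
 define k where "k x = f (x - c)" for x
 define nu where "nu = distr mu borel (\<lambda>x. x + c)"
 have [measurable]: "k \<in> BM" unfolding k_def by measurable
 have [measurable_cong]: "sets mu = sets borel" by (simp add: mu)
 have "density (distr lborel borel ((+) c)) (\<lambda>x. ennreal (k x)) = distr (dens (\<lambda>x. k (c + x))) borel ((+) c)"
  by (rule density_distr) simp_all
 then have nuk: "nu = dens k"
  by (simp add: lborel_distr_plus k_def nu_def mu(1) add.commute[of _ c] cong: distr_cong)
 have k0: "0 <= k x" for x by (simp add: k_def f0)
 have pnu: "prob_space nu" unfolding nu_def by (rule prob_space_distr) simp
 have ix: "integrable mu (\<lambda>x. x)" by (rule integrable_square_imp(1)[OF mu(2) _ m2]) simp
 have n: "(norm (x + c))^2 = (norm x)^2 + 2 * (x \<bullet> c) + (norm c)^2" for x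
  by (simp add: power2_norm_eq_inner inner_add_left inner_add_right inner_commute)
 have m2': "integrable nu (\<lambda>x. (norm x)^2)" 
  unfolding nu_def by (subst integrable_distr_eq, simp, simp, unfold n) (use m2 ix in simp)
 have ln': "integrable nu (\<lambda>x. ln (k x))" unfolding nu_def k_def using lnf by (subst integrable_distr_eq) auto
 have a: "(LINT x|nu. ln (k x)) = (LINT x|mu. ln (f x))" unfolding nu_def k_def by (subst integral_distr) auto
 have b: "(LINT x|nu. x) = (LINT x|mu. x) + c"
  using barycenter_translate[OF mu(2) _ ix] by (simp add: barycenter_def nu_def mu(1))
 have d: "(LINT x|nu. (norm x)^2) = (LINT x|mu. (norm x)^2) + 2 * ((LINT x|mu. x) \<bullet> c) + (norm c)^2"
 proof -
  have "(LINT x|nu. (norm x)^2) = (LINT x|mu. (norm x)^2 + 2 * (x \<bullet> c) + (norm c)^2)" unfolding nu_def by (subst integral_distr) (auto simp: n)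
  also have "... = (LINT x|mu. (norm x)^2) + 2 * (LINT x|mu. x \<bullet> c) + (norm c)^2"
   using m2 integrable_inner_left[OF ix, of c] by (simp add: prob_space)
  finally show ?thesis using integral_inner_left[OF ix, of c] by simp
 qed
 show ?thesis unfolding nu_def[symmetric]
  using centered_Ent_density[OF _ _ nuk pnu m2' ln'] centered_Ent_density[OF f f0 mu m2 lnf] k0
  by (simp add: a b d n)
qed

definition strict_profile :: "real => real => (real => real) => bool" where
 "strict_profile n w D \<longleftrightarrow> (\<forall>t\<in>{0<..<1}. sin ((1 - t) * w) / sin w * exp (- D 0 / n) + sin (t * w) / sin w * exp (- D 1 / n) < exp (- D t / n))"

text \<open>\<open>W = 0\<close> is the equality case, in which the geodesic consists of translates.
  It is kept apart because the angle vanishes there and \<open>strict_profile\<close> would divide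
  by \<open>sin 0\<close>.\<close>

definition entropy_profile :: "(real^'n) measure => (real^'n) measure => real => (real => (real^'n) measure) => (real => real) => bool" where
 "entropy_profile mu0 mu1 W mu D \<longleftrightarrow>
  (\<forall>tau\<in>{0..1}. centered_Ent (mu tau) = ereal (D tau) & barycenter (mu tau) = barycenter mu0 + tau *\<^sub>R (barycenter mu1 - barycenter mu0)) &
  (if W = 0 then translate_of mu1 mu0 & (\<forall>tau\<in>{0..1}. D tau = D 0) else strict_profile (real CARD('n)) (sqrt (2 / real CARD('n)) * sqrt W) D)"

text \<open>\<open>w^2 = 2 * W / n\<close> is at most \<open>4\<close>, so
  \<open>w <= 2 < pi\<close> and the sines in the comparison are positive.\<close>

lemma angle_bounds:
 assumes n: "0 < n" and W: "0 < W" "W <= 2 * n" and w: "w = sqrt (2 / n) * sqrt W"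
 shows "0 < w" "w < pi" "n * w^2 = 2 * W"
proof -
 show w2: "n * w^2 = 2 * W" using n W unfolding w by (simp add: power_mult_distrib)
 show "0 < w" using n W unfolding w by simp
 have "n * w^2 <= n * 2^2" using w2 W by simp
 then have "w^2 <= 2^2" using n by (simp only: mult_le_cancel_left_pos)
 then have "w <= 2" by (rule power2_le_imp_le) simp
 then show "w < pi" using pi_gt3 by linarith
qed

text \<open>\<open>W\<close> is the variance of the displacement \<open>T x - x\<close>. If it
  vanishes, \<open>T\<close> is a translation almost everywhere; otherwise
  \<open>displacement_strict\<close> applies. The optimality it asks for holds because every
  competing map induces a coupling.\<close>

lemma geodesic_entropy:
 fixes mu0 mu1 :: "(real^'n) measure"
 assumes slc: "strongly_log_concave mu0" "strongly_log_concave mu1"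
 obtains W where "W2_sq mu0 mu1 = ennreal (W + (norm (barycenter mu1 - barycenter mu0))^2)" "0 <= W" "W <= 2 * real CARD('n)"
  "translate_of mu1 mu0 ==> W = 0"
  "!!mu. W2_geodesic mu0 mu1 mu ==> \<exists>D. entropy_profile mu0 mu1 W mu D"
proof -
 obtain f0 where f0: "slc_dens f0" and mu0: "mu0 = dens f0" and m0: "integrable mu0 (\<lambda>x. (norm x)^2)" and l0: "integrable mu0 (\<lambda>x. ln (f0 x))"
  by (rule strongly_log_concave_density[OF slc(1)])
 obtain f1 where f1: "slc_dens f1" and mu1: "mu1 = dens f1" and m1: "integrable mu1 (\<lambda>x. (norm x)^2)" and l1: "integrable mu1 (\<lambda>x. ln (f1 x))"
  by (rule strongly_log_concave_density[OF slc(2)])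
 have p: "prob_space mu0" "prob_space mu1" using prob_space_slc[OF f0] prob_space_slc[OF f1] by (simp_all add: mu0 mu1)
 interpret mu0: prob_space mu0 by (rule p)
 have s[simp, measurable_cong]: "sets mu0 = sets borel" "sets mu1 = sets borel" by (simp_all add: mu0 mu1)
 have i0: "integrable mu0 (\<lambda>x. x)" by (rule integrable_square_imp(1)[OF p(1) _ m0]) simp
 have i1: "integrable mu1 (\<lambda>x. x)" by (rule integrable_square_imp(1)[OF p(2) _ m1]) simp
 define b where "b = barycenter mu1 - barycenter mu0"
 define k where "k = (LINT x|mu0. (norm x)^2) + (LINT x|mu1. (norm x)^2) - 2 * (barycenter mu0 \<bullet> barycenter mu1)"
 have up: "W2_sq mu0 mu1 <= ennreal k" unfolding k_def by (rule W2_sq_le_independent[OF p(1) s(1) m0 p(2) s(2) m1])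
 have lo: "ennreal ((norm b)^2) <= W2_sq mu0 mu1" unfolding b_def by (rule W2_sq_ge[OF p(1) s(1) i0 s(2) i1])
 have kb: "k <= 2 * real CARD('n) + (norm b)^2"
 proof -
  have "(norm b)^2 = (norm (barycenter mu0))^2 + (norm (barycenter mu1))^2 - 2 * (barycenter mu0 \<bullet> barycenter mu1)"
   by (simp add: b_def power2_norm_eq_inner inner_diff_left inner_diff_right inner_commute)
  then show ?thesis using variance_le_dim[OF f0 mu0 m0] variance_le_dim[OF f1 mu1 m1] by (simp add: k_def barycenter_def)
 qed
 have fin: "W2_sq mu0 mu1 < \<infinity>" using up by (simp add: le_less_trans)
 define w2 where "w2 = enn2real (W2_sq mu0 mu1)"
 have w2: "W2_sq mu0 mu1 = ennreal w2" "0 <= w2" using fin by (simp_all add: w2_def)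
 define W where "W = w2 - (norm b)^2"
 have W0: "0 <= W" using lo w2 by (simp add: W_def)
 have W2n: "W <= 2 * real CARD('n)"
 proof -
  \<comment> \<open>\<open>ennreal\<close> sends negative numbers to \<open>0\<close>, so the sign
    of \<open>k\<close> has to be settled before the bound can be read in the reals.\<close>
  have "0 <= k"
  proof (rule ccontr)
   assume "\<not> 0 <= k"
   then have "W2_sq mu0 mu1 = 0" using up by (simp add: ennreal_neg)
   then have "b = 0" using lo by simp
   then have "(norm (barycenter mu0))^2 <= (LINT x|mu0. (norm x)^2)" "(norm (barycenter mu0))^2 <= (LINT x|mu1. (norm x)^2)" "barycenter mu1 = barycenter mu0"
    using integrable_square_imp(2)[OF p(1) _ m0] integrable_square_imp(2)[OF p(2) _ m1] by (simp_all add: barycenter_def b_def)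
   then have "0 <= k" by (simp add: k_def power2_norm_eq_inner)
   then show False using \<open>\<not> 0 <= k\<close> by simp
  qed
  then have "w2 <= k" using up w2 by simp
  then show ?thesis using kb by (simp add: W_def)
 qed
 have tr0: "W = 0" if "translate_of mu1 mu0"
 proof -
  obtain c where c: "mu1 = distr mu0 borel (\<lambda>x. x + c)" using \<open>translate_of mu1 mu0\<close> by (auto simp: translate_of_def)
  have "W2_sq mu0 mu1 <= (\<integral>\<^sup>+x. ennreal ((dist x (x + c))^2) \<partial>mu0)" unfolding c by (rule W2_sq_map_le) auto
  also have "... = ennreal ((norm c)^2)" using mu0.emeasure_space_1 by (simp add: dist_norm)
  finally have "w2 <= (norm c)^2" using w2 by simp
  moreover have "b = c" unfolding b_def c barycenter_translate[OF p(1) s(1) i0] by simp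
  ultimately show ?thesis using W0 by (simp add: W_def)
 qed
 show thesis
 proof (rule that[OF _ W0 W2n tr0])
  show "W2_sq mu0 mu1 = ennreal (W + (norm (barycenter mu1 - barycenter mu0))^2)" using w2 by (simp add: W_def b_def)
  fix mu assume "W2_geodesic mu0 mu1 mu"
  then obtain T where T[measurable]: "T \<in> BM" and pT: "distr mu0 borel T = mu1"
   and oT: "(\<integral>\<^sup>+x. ennreal ((dist x (T x))^2) \<partial>mu0) = W2_sq mu0 mu1"
   and mu: "!!t. t \<in> {0..1} ==> mu t = distr mu0 borel (\<lambda>x. (1 - t) *\<^sub>R x + t *\<^sub>R T x)"
   by (auto simp: W2_geodesic_def optimal_map_def)
  have iT2: "integrable mu0 (\<lambda>x. (norm (T x))^2)" using m1 unfolding pT[symmetric] by (subst (asm) integrable_distr_eq) auto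
  have iT: "integrable mu0 T" by (rule integrable_square_imp(1)[OF p(1) _ iT2]) simp
  have iD: "integrable mu0 (\<lambda>x. (norm (x - S x))^2)" if [measurable]: "S \<in> BM" and S: "distr mu0 borel S = mu1" for S
   using m1 unfolding S[symmetric] by (intro integrable_norm_add_sq(2) m0) (auto simp: integrable_distr_eq)
  have e: "(\<integral>\<^sup>+x. ennreal ((dist x (S x))^2) \<partial>mu0) = ennreal (LINT x|mu0. (norm (x - S x))^2)"
   if "S \<in> BM" "distr mu0 borel S = mu1" for S
   using nn_integral_eq_integral[OF iD[OF that]] by (simp add: dist_norm)
  have cost: "(LINT x|mu0. (norm (x - T x))^2) = w2" using oT unfolding e[OF T pT] w2(1) by (simp add: w2)
  have opt: "(LINT x|mu0. (norm (x - T x))^2) <= (LINT x|mu0. (norm (x - T' x))^2)"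
   if T': "T' \<in> BM" "distr mu0 borel T' = mu1" for T'
  proof -
   have "ennreal w2 <= ennreal (LINT x|mu0. (norm (x - T' x))^2)"
    using W2_sq_map_le[OF s(1) T'(1)] unfolding T'(2) e[OF T'] w2(1) .
   then show ?thesis unfolding cost by simp
  qed
  have bT: "(LINT x|mu0. T x - x) = b"
  proof -
   have "barycenter mu1 = (LINT x|mu0. T x)" unfolding barycenter_def pT[symmetric] by (subst integral_distr) auto
   then show ?thesis using Bochner_Integration.integral_diff[OF iT i0] by (simp add: b_def barycenter_def)
  qed
  have Wv: "W = (LINT x|mu0. (norm (T x - x))^2) - (norm (LINT x|mu0. T x - x))^2"
   unfolding bT W_def cost[symmetric] by (simp add: norm_minus_commute)
  have bary: "barycenter (mu tau) = barycenter mu0 + tau *\<^sub>R (barycenter mu1 - barycenter mu0)" if "tau \<in> {0..1}" for tau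
  proof -
   have "barycenter (mu tau) = (LINT x|mu0. x + tau *\<^sub>R (T x - x))"
    unfolding barycenter_def mu[OF that] by (subst integral_distr) (auto simp: algebra_simps)
   also have "... = (LINT x|mu0. x) + (LINT x|mu0. tau *\<^sub>R (T x - x))"
    by (rule Bochner_Integration.integral_add[OF i0 integrable_scaleR_right]) (rule Bochner_Integration.integrable_diff[OF iT i0])
   also have "(LINT x|mu0. tau *\<^sub>R (T x - x)) = tau *\<^sub>R b" unfolding bT[symmetric] by (rule integral_scaleR_right)
   finally show ?thesis by (simp add: b_def barycenter_def)
  qed
  show "\<exists>D. entropy_profile mu0 mu1 W mu D"
  proof (cases "W = 0")
   case True
   have iDT: "integrable mu0 (\<lambda>x. (norm (T x - x))^2)" using iD[OF T pT] by (simp add: norm_minus_commute)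
   have "AE x in mu0. T x - x = b" unfolding bT[symmetric]
    by (rule variance_zero_AE[OF p(1) _ iDT]) (use Wv True in auto)
   then have ae: "AE x in mu0. T x = x + b" by eventually_elim (simp add: algebra_simps)
   have mu': "mu tau = distr mu0 borel (\<lambda>x. x + tau *\<^sub>R b)" if "tau \<in> {0..1}" for tau
    unfolding mu[OF that] by (rule distr_cong_AE) (use ae in \<open>auto elim!: eventually_mono simp: algebra_simps\<close>)
   have tr: "translate_of mu1 mu0"
   proof -
    have "mu1 = distr mu0 borel (\<lambda>x. x + b)" unfolding pT[symmetric] by (rule distr_cong_AE) (use ae in auto)
    then show ?thesis by (auto simp: translate_of_def)
   qed
   have fm: "f0 \<in> BM" "!!x. 0 <= f0 x" using f0 by (auto simp: slc_dens_def)
   obtain d where d: "centered_Ent mu0 = ereal d" using centered_Ent_density[OF fm mu0 p(1) m0 l0] by blast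
   have cE: "centered_Ent (mu tau) = ereal d" if "tau \<in> {0..1}" for tau
    unfolding mu'[OF that] d[symmetric] by (rule centered_Ent_translate[OF fm mu0 p(1) m0 l0])
   show ?thesis unfolding entropy_profile_def using cE bary tr True by (intro exI[of _ "\<lambda>_. d"]) auto
  next
   case False
   then have Wp: "0 < W" using W0 by simp
   obtain D where D: "\<forall>tau\<in>{0..1}. centered_Ent (distr mu0 borel (\<lambda>x. (1 - tau) *\<^sub>R x + tau *\<^sub>R T x)) = ereal (D tau)"
    "strict_profile (real CARD('n)) (sqrt (2 / real CARD('n)) * sqrt W) D"
    using displacement_strict[OF f0 f1 m0[unfolded mu0] m1[unfolded mu1] l0[unfolded mu0] l1[unfolded mu1] T pT[unfolded mu0 mu1] opt[unfolded mu0 mu1]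
     Wv[unfolded mu0] Wp angle_bounds[OF _ Wp W2n refl]]
    unfolding mu0[symmetric] mu1[symmetric] strict_profile_def[symmetric] by auto
   then show ?thesis unfolding entropy_profile_def using mu bary False by (intro exI[of _ D]) auto
  qed
 qed
qed

abbreviation sin_compare :: "real => (real => ereal) => bool => bool" where
 "sin_compare w e P \<equiv> (\<forall>t\<in>{0..1}. e t \<ge> sin_interp w t (e 0) (e 1)) &
  ((\<exists>t\<in>{0<..<1}. e t = sin_interp w t (e 0) (e 1)) \<longleftrightarrow> P) & (P --> (\<forall>t\<in>{0..1}. e t = sin_interp w t (e 0) (e 1)))"

text \<open>For \<open>W = 0\<close> the profile is constant and the interpolation affine, so
  equality holds throughout. For positive \<open>W\<close> the strict profile excludes equality
  inside, and \<open>P\<close> fails because it would force \<open>W = 0\<close>. The factor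
  \<open>k\<close> covers entropies that differ from the centred one by a constant.\<close>

lemma sin_interp_comparison:
 fixes D :: "real => real" and e :: "real => ereal"
 assumes n: "0 < n" and k: "0 < k" and W: "0 <= W" "W <= 2 * n" and w: "w = sqrt (2 / n) * sqrt W"
  and e: "!!tau. tau \<in> {0..1} ==> e tau = ereal (k * exp (- D tau / n))"
  and D: "if W = 0 then P & (\<forall>tau\<in>{0..1}. D tau = D 0) else strict_profile n w D" and P: "P ==> W = 0"
 shows "sin_compare w e P"
proof (cases "W = 0")
 case True
 have D: P "!!tau. tau \<in> {0..1} ==> D tau = D 0" using D unfolding if_P[OF True] by blast+
 have eq: "e t = sin_interp w t (e 0) (e 1)" if t: "t \<in> {0..1}" for t
 proof -
  have "w = 0" using True w by simp
  then have "sin_interp w t (e 0) (e 1) = ereal ((1 - t) * (k * exp (- D 0 / n)) + t * (k * exp (- D 0 / n)))"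
   using e[of 0] e[of 1] D(2)[of 1] by (simp add: sin_interp_def sin_quotient_def)
  then show ?thesis using e[OF t] D(2)[OF t] by (simp add: algebra_simps)
 qed
 have "\<exists>t\<in>{0<..<1::real}. e t = sin_interp w t (e 0) (e 1)" by (rule bexI[of _ "1/2"], rule eq) auto
 moreover have "\<forall>t\<in>{0..1}. sin_interp w t (e 0) (e 1) <= e t" using eq by (metis order_refl)
 ultimately show ?thesis using eq D(1) by blast
next
 case False
 then have Wp: "0 < W" using W by simp
 note ang = angle_bounds[OF n Wp W(2) w]
 have sw: "0 < sin w" using ang by (intro sin_gt_zero)
 have si: "sin_interp w t (e 0) (e 1) = ereal (k * (sin ((1 - t) * w) / sin w * exp (- D 0 / n) + sin (t * w) / sin w * exp (- D 1 / n)))" for t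
  using e[of 0] e[of 1] ang by (simp add: sin_interp_def sin_quotient_def algebra_simps)
 have lt: "sin_interp w t (e 0) (e 1) < e t" if t: "t \<in> {0<..<1}" for t
  using D False e[of t] t k unfolding si strict_profile_def by simp
 have ends: "sin_interp w t (e 0) (e 1) = e t" if "t = 0 \<or> t = 1" for t
  using that sw e[of t] unfolding si by auto
 have "sin_interp w t (e 0) (e 1) <= e t" if "t \<in> {0..1}" for t
  using that lt[of t] ends[of t] by (cases "t = 0 \<or> t = 1") (auto simp: less_imp_le)
 moreover have "\<not> P" using P False by blast
 ultimately show ?thesis using lt by force
qed

lemma eexp_scaled:
 assumes "0 < n" "x = ereal d"
 shows "eexp (- (x + ereal c) / ereal n) = ereal (exp (- c / n) * exp (- d / n))"
 using assms by (simp add: eexp_def exp_add[symmetric] add_divide_distrib diff_divide_distrib)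

theorem theorem1p5:
  fixes \<mu>\<^sub>0 \<mu>\<^sub>1 :: "(real ^ 'n) measure"
  assumes "strongly_log_concave \<mu>\<^sub>0" and "strongly_log_concave \<mu>\<^sub>1"
  shows
    "(let n = real CARD('n);
          \<omega> = sqrt (2 / n) * sqrt (real_of_ereal (centered_W2_sq \<mu>\<^sub>0 \<mu>\<^sub>1));
          E = (\<lambda>\<nu> :: (real ^ 'n) measure. eexp (- centered_Ent \<nu> / ereal n))
      in 0 \<le> centered_W2_sq \<mu>\<^sub>0 \<mu>\<^sub>1 \<and> centered_W2_sq \<mu>\<^sub>0 \<mu>\<^sub>1 \<le> ereal (2 * n) \<and>
         (\<forall>\<mu>. W2_geodesic \<mu>\<^sub>0 \<mu>\<^sub>1 \<mu> \<longrightarrow>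
            (\<forall>t\<in>{0..1}. E (\<mu> t) \<ge> sin_interp \<omega> t (E (\<mu> 0)) (E (\<mu> 1))) \<and>
            ((\<exists>t\<in>{0<..<1}. E (\<mu> t) = sin_interp \<omega> t (E (\<mu> 0)) (E (\<mu> 1)))
               \<longleftrightarrow> translate_of \<mu>\<^sub>1 \<mu>\<^sub>0) \<and>
            (translate_of \<mu>\<^sub>1 \<mu>\<^sub>0 \<longrightarrow>
               (\<forall>t\<in>{0..1}. E (\<mu> t) = sin_interp \<omega> t (E (\<mu> 0)) (E (\<mu> 1)))))) \<and>
     (barycenter \<mu>\<^sub>0 = barycenter \<mu>\<^sub>1 \<longrightarrow>
      (let n = real CARD('n);
           \<omega> = sqrt (2 / n) * W2 \<mu>\<^sub>0 \<mu>\<^sub>1;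
           E = (\<lambda>\<nu> :: (real ^ 'n) measure. eexp (- Ent \<nu> / ereal n))
       in 0 \<le> W2_sq \<mu>\<^sub>0 \<mu>\<^sub>1 \<and> W2_sq \<mu>\<^sub>0 \<mu>\<^sub>1 \<le> ennreal (2 * n) \<and>
          (\<forall>\<mu>. W2_geodesic \<mu>\<^sub>0 \<mu>\<^sub>1 \<mu> \<longrightarrow>
             (\<forall>t\<in>{0..1}. E (\<mu> t) \<ge> sin_interp \<omega> t (E (\<mu> 0)) (E (\<mu> 1))) \<and>
             ((\<exists>t\<in>{0<..<1}. E (\<mu> t) = sin_interp \<omega> t (E (\<mu> 0)) (E (\<mu> 1)))
                \<longleftrightarrow> translate_of \<mu>\<^sub>1 \<mu>\<^sub>0) \<and>
             (translate_of \<mu>\<^sub>1 \<mu>\<^sub>0 \<longrightarrow>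
                (\<forall>t\<in>{0..1}. E (\<mu> t) = sin_interp \<omega> t (E (\<mu> 0)) (E (\<mu> 1)))) \<and>
             ((\<exists>t\<in>{0<..<1}. E (\<mu> t) = sin_interp \<omega> t (E (\<mu> 0)) (E (\<mu> 1)))
                \<longleftrightarrow> \<mu>\<^sub>0 = \<mu>\<^sub>1))))"
proof -
 define n where "n = real CARD('n)"
 have n: "0 < n" by (simp add: n_def)
 obtain W where W2: "W2_sq \<mu>\<^sub>0 \<mu>\<^sub>1 = ennreal (W + (norm (barycenter \<mu>\<^sub>1 - barycenter \<mu>\<^sub>0))^2)" and W: "0 <= W" "W <= 2 * n"
  and tr0: "translate_of \<mu>\<^sub>1 \<mu>\<^sub>0 ==> W = 0"
  and geo: "!!\<mu>. W2_geodesic \<mu>\<^sub>0 \<mu>\<^sub>1 \<mu> ==> \<exists>D. entropy_profile \<mu>\<^sub>0 \<mu>\<^sub>1 W \<mu> D"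
  unfolding n_def by (rule geodesic_entropy[OF assms]) blast
 have "enn2ereal (W2_sq \<mu>\<^sub>0 \<mu>\<^sub>1) = ereal (W + (norm (barycenter \<mu>\<^sub>1 - barycenter \<mu>\<^sub>0))^2)"
  unfolding W2 using W by (intro enn2ereal_ennreal) simp
 then have cW: "centered_W2_sq \<mu>\<^sub>0 \<mu>\<^sub>1 = ereal W" by (simp add: centered_W2_sq_def)
 \<comment> \<open>\<open>c\<close> is the difference between the entropy inside \<open>E\<close>
   and the centred one: \<open>0\<close> in the first part, and in the second half the squared norm
   of the barycentre, which is constant along the geodesic when its endpoints share it.\<close>
 have main: "sin_compare (sqrt (2 / n) * sqrt W) (\<lambda>t. E (\<mu> t)) (translate_of \<mu>\<^sub>1 \<mu>\<^sub>0)"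
  if \<mu>: "W2_geodesic \<mu>\<^sub>0 \<mu>\<^sub>1 \<mu>"
   and E: "!!t d. t \<in> {0..1} ==> centered_Ent (\<mu> t) = ereal d ==>
    barycenter (\<mu> t) = barycenter \<mu>\<^sub>0 + t *\<^sub>R (barycenter \<mu>\<^sub>1 - barycenter \<mu>\<^sub>0) ==> E (\<mu> t) = ereal (exp (- c / n) * exp (- d / n))"
  for \<mu> c and E :: "(real ^ 'n) measure => ereal"
 proof -
  obtain D where D: "entropy_profile \<mu>\<^sub>0 \<mu>\<^sub>1 W \<mu> D" using geo[OF \<mu>] by blast
  note D = D[unfolded entropy_profile_def, folded n_def]
  show ?thesis
   by (rule sin_interp_comparison[where D=D and k="exp (- c / n)" and W=W, OF n _ W refl _ conjunct2[OF D] tr0])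
    (use E D in auto)
 qed
 have c1: "eexp (- centered_Ent \<nu> / ereal n) = ereal (exp (- 0 / n) * exp (- d / n))" if "centered_Ent \<nu> = ereal d" for \<nu> :: "(real ^ 'n) measure" and d
  using eexp_scaled[OF n that, of 0] by simp
 have part1: "sin_compare (sqrt (2 / n) * sqrt W) (\<lambda>t. eexp (- centered_Ent (\<mu> t) / ereal n)) (translate_of \<mu>\<^sub>1 \<mu>\<^sub>0)"
  if "W2_geodesic \<mu>\<^sub>0 \<mu>\<^sub>1 \<mu>" for \<mu>
  by (rule main[OF that, where c=0 and E="\<lambda>\<nu>. eexp (- centered_Ent \<nu> / ereal n)"]) (rule c1)
 have part2: "W2_sq \<mu>\<^sub>0 \<mu>\<^sub>1 = ennreal W" "W2 \<mu>\<^sub>0 \<mu>\<^sub>1 = sqrt W" "translate_of \<mu>\<^sub>1 \<mu>\<^sub>0 \<longleftrightarrow> \<mu>\<^sub>0 = \<mu>\<^sub>1"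
  "!!\<mu>. W2_geodesic \<mu>\<^sub>0 \<mu>\<^sub>1 \<mu> ==> sin_compare (sqrt (2 / n) * sqrt W) (\<lambda>t. eexp (- Ent (\<mu> t) / ereal n)) (translate_of \<mu>\<^sub>1 \<mu>\<^sub>0)"
  if bb: "barycenter \<mu>\<^sub>0 = barycenter \<mu>\<^sub>1"
 proof -
  define c where "c = (norm (barycenter \<mu>\<^sub>0))^2 / 2"
  show W2': "W2_sq \<mu>\<^sub>0 \<mu>\<^sub>1 = ennreal W" using W2 bb by simp
  show "W2 \<mu>\<^sub>0 \<mu>\<^sub>1 = sqrt W" using W by (simp add: W2_def W2')
  have Ent: "eexp (- Ent \<nu> / ereal n) = ereal (exp (- c / n) * exp (- d / n))"
   if "centered_Ent \<nu> = ereal d" "barycenter \<nu> = barycenter \<mu>\<^sub>0" for \<nu> :: "(real ^ 'n) measure" and d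
  proof -
   have "Ent \<nu> = ereal d + ereal c" using that by (cases "Ent \<nu>") (auto simp: centered_Ent_def c_def)
   then show ?thesis using eexp_scaled[OF n refl, of d c] by simp
  qed
  show "translate_of \<mu>\<^sub>1 \<mu>\<^sub>0 \<longleftrightarrow> \<mu>\<^sub>0 = \<mu>\<^sub>1"
  proof
   assume "\<mu>\<^sub>0 = \<mu>\<^sub>1"
   moreover have "sets \<mu>\<^sub>0 = sets borel" using assms(1) by (auto simp: strongly_log_concave_def)
   ultimately show "translate_of \<mu>\<^sub>1 \<mu>\<^sub>0" unfolding translate_of_def by (intro exI[of _ 0]) (simp add: distr_id2)
  next
   \<comment> \<open>A nonzero shift would move the barycentre.\<close>
   assume "translate_of \<mu>\<^sub>1 \<mu>\<^sub>0"
   then obtain a where a: "\<mu>\<^sub>1 = distr \<mu>\<^sub>0 borel (\<lambda>x. x + a)" by (auto simp: translate_of_def)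
   obtain f where f: "slc_dens f" "\<mu>\<^sub>0 = dens f" "integrable \<mu>\<^sub>0 (\<lambda>x. (norm x)^2)"
    by (rule strongly_log_concave_density[OF assms(1)])
   have p: "prob_space \<mu>\<^sub>0" unfolding f(2) by (rule prob_space_slc[OF f(1)])
   have s[measurable_cong]: "sets \<mu>\<^sub>0 = sets borel" by (simp add: f(2))
   have "integrable \<mu>\<^sub>0 (\<lambda>x. x)" by (rule integrable_square_imp(1)[OF p _ f(3)]) simp
   from barycenter_translate[OF p s this, of a] have "a = 0" using bb a by simp
   then show "\<mu>\<^sub>0 = \<mu>\<^sub>1" unfolding a by (simp add: distr_id2 s)
  qed
  show "sin_compare (sqrt (2 / n) * sqrt W) (\<lambda>t. eexp (- Ent (\<mu> t) / ereal n)) (translate_of \<mu>\<^sub>1 \<mu>\<^sub>0)" if "W2_geodesic \<mu>\<^sub>0 \<mu>\<^sub>1 \<mu>" for \<mu>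
   by (rule main[OF that, where c=c and E="\<lambda>\<nu>. eexp (- Ent \<nu> / ereal n)"]; rule Ent; simp add: bb)
 qed
 show ?thesis
  unfolding Let_def n_def[symmetric]
 proof (intro conjI impI, goal_cases)
  case 3 show ?case unfolding cW real_of_ereal.simps using part1 by blast
 next
  case 6 show ?case unfolding part2(2)[OF 6] using part2(4)[OF 6] unfolding part2(3)[OF 6] by blast
 qed (use W part2(1) in \<open>simp_all add: cW ennreal_leI\<close>)
qed

end
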